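(* Let $\mathfrak M\in\mathfrak S$ be parameters, $\xi$ random drifts, $t_0\in\mathbb R$ and $\mathfrak C$ an initial condition at time $t_0$. Suppose that $\Phi^m$ is Lipschitz for all $m\in\mathbf M$ and that for all $m\in\mathbf M$, $p,p'\in\mathbf P$, $\alpha\in\mathbf M\cup\mathbf P$ one has $h^\alpha_m,\,h^m_p,\,b^m_p\in L^1$ and $h^{p'}_p,\,b^{p'}_p\in L^{1,n_p}_\infty$. Suppose also that $\mathfrak C$ is integrable. Then there exists a unique (up to modification) HAR process with parameters $\mathfrak M$, random drifts $\xi$, started at $t_0$ with initial condition $\mathfrak C$, among non-explosive processes.
   Context: Labels and domains. $\mathbf M$ and $\mathbf P$ are disjoint nonempty finite label sets. Each $p\in\mathbf P$ has a frequency $n_p\in\mathbb N^*=\{1,2,\dots\}$ and a phase $0\le\phi_p<1/n_p$, and $\mathcal D_p=\frac1{n_p}\mathbb Z+\phi_p$; $\mathcal Q=\{(p,k):p\in\mathbf P,\ k\in\mathcal D_p\}$. Standing assumption: $\gcd(n_p,\ p\in\mathbf P)=1$. $\mathscr D^p$ is the counting measure on $\mathcal D_p$. In integrals against $\mathscr D^p$ or point processes, $\int_a^b$ is over $[a,b]$ and $\int_a^{b-}$ is over $[a,b)$ ($a=-\infty$ allowed). Norms. Functions on $(0,\infty)$ are extended by $0$ to $\mathbb R$. $L^1$ is the usual Lebesgue space; for $\alpha>0$, $\|f\|^\infty_{1,\alpha}=\sup_{x\in\mathbb R}\sum_{k\in\mathbb Z}|f(x+k/\alpha)|$, and $f\in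 L^{1,\alpha}_\infty$ means $\|f\|^\infty_{1,\alpha}<\infty$. Parameters. $\mathfrak S$ is the set of all $\mathfrak M=\big((h^\alpha_m)_{\alpha,m},(J^\alpha_p,h^\alpha_p,b^\alpha_p)_{\alpha,p},(\Phi^m)_m,(\Phi^p)_p\big)$ (with $\alpha\in\mathbf M\cup\mathbf P$, $m\in\mathbf M$, $p\in\mathbf P$) of (measurable) functions such that: $h^\alpha_m:(0,\infty)\to\mathbb R$; $J^\alpha_p:(0,\infty)\times\mathbb R\to\mathbb R$ and $h^\alpha_p,b^\alpha_p:(0,\infty)\to[0,\infty)$ satisfy $|J^\alpha_p(s,w)|\le h^\alpha_p(s)|w|+b^\alpha_p(s)$ and $|J^\alpha_p(s,w)-J^\alpha_p(s,w')|\le h^\alpha_p(s)|w-w'|$ for all $s>0$, $w,w'\in\mathbb R$; $\Phi^m:\mathbb R\to[0,\infty)$ is Lipschitz; $\Phi^p:\mathbb R\to\mathbb R$ is Lipschitz with $\Phi^p(0)=0$. Probabilistic setting. On $(\Omega,\mathcal F,\mathbb P)$, $(\pi^m)_{m\in\mathbf M}$ are independent Poisson random measures on $\mathbb R\times[0,\infty)$ with intensity $dt\,dx$, whose atoms all have distinct time coordinates. Random drifts $\xi=(\xi^p_k)_{(p,k)\in\mathcal Q}$ are independent real random variables, independent of the $\pi^m$, with $\xi^p_k\sim\xi^p_{k+n}$ in law for all $(p,k)\in\mathcal Q$, $n\in\mathbb Z$. $\mathcal F_t=\sigma\big(\pi^m\cap((-\infty,t]\times[0,\infty)),\,m\in\mathbf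 M;\ \xi^p_k,\,(p,k)\in\mathcal Q,\,k\le t\big)$. Processes. An $(\mathbf M,\mathbf P)$-process is $X=((N^m)_{m\in\mathbf M},(W^p)_{p\in\mathbf P})$ where $(N^m)_m$ is a multivariate point process on $\mathbb R$ (pairwise disjoint random sets of points, $dN^m$ being the counting measure) and $W^p=(W^p_k)_{k\in\mathcal D_p}$ is a time series. Two processes are modifications of each other if almost surely $N^m=\tilde N^m$ for all $m$ and almost surely $W^p_k=\tilde W^p_k$ for all $(p,k)\in\mathcal Q$. For $B\subset\mathbb R$ Borel, $\mathscr M_B(X)=\sum_m N^m(B)+\sum_p\int_B|W^p_k|\,d\mathscr D^p_k$ (with $|\varnothing|=0$). $X$ is non-explosive if $\mathscr M_B(X)<\infty$ for all bounded $B$ (almost surely). Initial conditions. An initial condition at time $t_0$ is an $\mathcal F_{t_0-}$-measurable $\mathfrak C=\big((\mathfrak C^m)_{m\in\mathbf M},(\mathfrak C^p_k)_{(p,k)\in\mathcal Q,\,k<t_0}\big)$, where the $\mathfrak C^m$ are (pairwise disjoint) random sets of points of $(-\infty,t_0)$ and $\mathfrak C^p_k\in\mathbb R\cup\{\varnothing\}$. By convention $J^\alpha_p(s,\varnothing)=0$, and $x+\varnothing=\varnothing+x=x$ for $x\in\mathbb R\cup\{\varnothing\}$. Let $\psi_1(x)=1+|x|$ for $x\in\mathbb R$, $\psi_1(\varnothing)=0$. Set $\mathscr M^{\mathrm{ic}}_B(\mathfrak C^m)=\operatorname{Card}(\mathfrak C^m\cap B)$, $\mathscr M^{\mathrm{ic}}_B(\mathfrak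 C^p)=\int_B\psi_1(\mathfrak C^p_k)\,d\mathscr D^p_k$ (over $k<t_0$), and $\mathscr M^{\mathrm{ic}}_B(\mathfrak C)=\sum_m\mathscr M^{\mathrm{ic}}_B(\mathfrak C^m)+\sum_p\mathscr M^{\mathrm{ic}}_B(\mathfrak C^p)$. $\mathfrak C$ is integrable if there are a constant $K<\infty$ and decompositions $\mathfrak C^m=\mathfrak C^m_{reg}\cup\mathfrak C^m_{disc}$ ($m\in\mathbf M$), $\mathfrak C^p=\mathfrak C^p_{reg}+\mathfrak C^p_{disc}$ ($p\in\mathbf P$) such that $\mathscr M^{\mathrm{ic}}_{(-\infty,t_0)}(\mathfrak C_{disc})<\infty$ a.s. and, for every Borel $B\subset\mathbb R$, $\mathbb E[\mathscr M^{\mathrm{ic}}_B(\mathfrak C^m_{reg})]\le K|B|$ ($|B|$ = Lebesgue measure) and $\mathbb E[\mathscr M^{\mathrm{ic}}_B(\mathfrak C^p_{reg})]\le K\sum_{q\in\mathbf P}\mathscr D^q(B)$. HAR process with parameters $\mathfrak M$, drifts $\xi$, started at $t_0$ with initial condition $\mathfrak C$: a process $X$ adapted to $(\mathcal F_t)_t$ such that (1) $N^m\cap(-\infty,t_0)=\mathfrak C^m$ for all $m$ and $W^p_k=\mathfrak C^p_k$ for all $(p,k)\in\mathcal Q$ with $k<t_0$; (2) with $\lambda^m$ given $\mathbb P(d\omega)\otimes dt$-a.e. on $\Omega\times[t_0,\infty)$ by $$\lambda^m_t=\Phi^m\Big(\sum_{m'}\int_{-\infty}^{t-}h^m_{m'}(t-s)\,dN^{m'}_s+\sum_p\int_{-\infty}^{t-}J^m_p(t-k,W^p_k)\,d\mathscr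 D^p_k\Big),$$ one has almost surely $N^m(C)=\int_{C\times[0,\infty)}\mathbf 1_{x\le\lambda^m_s}\,d\pi^m(s,x)$ for all $C\subset[t_0,\infty)$, and almost surely, for all $(p,k)\in\mathcal Q$ with $k\ge t_0$, $$W^p_k=\xi^p_k+\Phi^p\Big(\sum_m\int_{-\infty}^{k-}h^p_m(k-s)\,dN^m_s+\sum_{p'}\int_{-\infty}^{k-}J^p_{p'}(k-k',W^{p'}_{k'})\,d\mathscr D^{p'}_{k'}\Big).$$
   Formalization: Adaptedness of the HAR process is required only for times t ≥ t_0, since an F_{t_0-}-measurable initial condition need not be adapted before t_0; λ^m is the displayed formula at every (ω,t), with divergent sums read as 0 on the exceptional null set. *)

theory Defs
  imports "HOL-Probability.Probability"
begin

text \<open>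
  The disjoint nonempty finite label sets are finite types 'm (event labels) and 'p (time series
  labels); an index ranging over their union has the type 'm + 'p.  The missing value
  \<open>\<emptyset>\<close> of a time series is \<open>None\<close>.
\<close>

definition ar_setting :: "('p::finite \<Rightarrow> nat) \<Rightarrow> ('p \<Rightarrow> real) \<Rightarrow> bool" where
  "ar_setting n \<phi> \<longleftrightarrow>
     (\<forall>p. 1 \<le> n p \<and> 0 \<le> \<phi> p \<and> \<phi> p < 1 / real (n p)) \<and> Gcd (range n) = 1"

definition ar_times :: "('p \<Rightarrow> nat) \<Rightarrow> ('p \<Rightarrow> real) \<Rightarrow> 'p \<Rightarrow> real set" where
  "ar_times n \<phi> p = range (\<lambda>j::int. of_int j / real (n p) + \<phi> p)"

definition ar_index :: "('p \<Rightarrow> nat) \<Rightarrow> ('p \<Rightarrow> real) \<Rightarrow> ('p \<times> real) set" where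
  "ar_index n \<phi> = (SIGMA p:UNIV. ar_times n \<phi> p)"

text \<open>
  Functions on \<open>(0,\<infinity>)\<close> are total functions on the reals of which only the values at positive
  arguments are ever used.
\<close>

definition ext0 :: "(real \<Rightarrow> real) \<Rightarrow> real \<Rightarrow> real" where
  "ext0 f x = (if 0 < x then f x else 0)"

definition in_L1 :: "(real \<Rightarrow> real) \<Rightarrow> bool" where
  "in_L1 f \<longleftrightarrow> integrable lborel (ext0 f)"

definition norm_L1inf :: "real \<Rightarrow> (real \<Rightarrow> real) \<Rightarrow> ennreal" where
  "norm_L1inf a f = (SUP x::real. \<integral>\<^sup>+ k. ennreal \<bar>ext0 f (x + of_int k / a)\<bar> \<partial>count_space (UNIV :: int set))"

definition in_L1inf :: "real \<Rightarrow> (real \<Rightarrow> real) \<Rightarrow> bool" where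
  "in_L1inf a f \<longleftrightarrow> norm_L1inf a f < \<infinity>"

record ('m, 'p) har_params =
  hM :: "'m + 'p \<Rightarrow> 'm \<Rightarrow> real \<Rightarrow> real"
  J :: "'m + 'p \<Rightarrow> 'p \<Rightarrow> real \<Rightarrow> real \<Rightarrow> real"
  hP :: "'m + 'p \<Rightarrow> 'p \<Rightarrow> real \<Rightarrow> real"
  bP :: "'m + 'p \<Rightarrow> 'p \<Rightarrow> real \<Rightarrow> real"
  PhiM :: "'m \<Rightarrow> real \<Rightarrow> real"
  PhiP :: "'p \<Rightarrow> real \<Rightarrow> real"

definition lipschitz_fun :: "(real \<Rightarrow> real) \<Rightarrow> bool" where
  "lipschitz_fun f \<longleftrightarrow> (\<exists>L. L-lipschitz_on UNIV f)"

definition parameters :: "('m::finite, 'p::finite) har_params \<Rightarrow> bool" where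
  "parameters \<MM> \<longleftrightarrow>
     (\<forall>\<alpha> m. hM \<MM> \<alpha> m \<in> borel_measurable (restrict_space borel {0<..})) \<and>
     (\<forall>\<alpha> p. (\<lambda>(s, w). J \<MM> \<alpha> p s w) \<in> borel_measurable (restrict_space borel ({0<..} \<times> UNIV)) \<and>
            hP \<MM> \<alpha> p \<in> borel_measurable (restrict_space borel {0<..}) \<and>
            bP \<MM> \<alpha> p \<in> borel_measurable (restrict_space borel {0<..})) \<and>
     (\<forall>\<alpha> p. \<forall>s>0. 0 \<le> hP \<MM> \<alpha> p s \<and> 0 \<le> bP \<MM> \<alpha> p s \<and>
        (\<forall>w. \<bar>J \<MM> \<alpha> p s w\<bar> \<le> hP \<MM> \<alpha> p s * \<bar>w\<bar> + bP \<MM> \<alpha> p s) \<and>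
        (\<forall>w w'. \<bar>J \<MM> \<alpha> p s w - J \<MM> \<alpha> p s w'\<bar> \<le> hP \<MM> \<alpha> p s * \<bar>w - w'\<bar>)) \<and>
     (\<forall>m. lipschitz_fun (PhiM \<MM> m) \<and> (\<forall>x. 0 \<le> PhiM \<MM> m x)) \<and>
     (\<forall>p. lipschitz_fun (PhiP \<MM> p) \<and> PhiP \<MM> p 0 = 0)"

abbreviation npoints :: "'a set \<Rightarrow> ennreal" where
  "npoints A \<equiv> emeasure (count_space UNIV) A"

text \<open>A random set of points is a measurable map into \<open>point_sets\<close>, whose \<open>\<sigma>\<close>-algebra is generated
  by the numbers of points in Borel sets.\<close>

definition point_sets :: "('a::topological_space) set measure" where
  "point_sets = sigma UNIV {{A. npoints (A \<inter> B) \<in> S} | B S. B \<in> sets borel \<and> S \<in> sets borel}"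

definition opt_borel :: "real option measure" where
  "opt_borel = sigma UNIV (insert {None} {Some ` B | B. B \<in> sets borel})"

fun opt_add :: "real option \<Rightarrow> real option \<Rightarrow> real option" where
  "opt_add None y = y"
| "opt_add x None = x"
| "opt_add (Some x) (Some y) = Some (x + y)"

fun opt_abs :: "real option \<Rightarrow> real" where
  "opt_abs None = 0"
| "opt_abs (Some x) = \<bar>x\<bar>"

fun psi1 :: "real option \<Rightarrow> real" where
  "psi1 None = 0"
| "psi1 (Some x) = 1 + \<bar>x\<bar>"

fun opt_app :: "(real \<Rightarrow> real) \<Rightarrow> real option \<Rightarrow> real" where
  "opt_app f None = 0"
| "opt_app f (Some w) = f w"

text \<open>A Poisson random measure with intensity \<open>\<nu>\<close>, given by its random set of atoms (the setting
  below only concerns Poisson random measures without multiple atoms).\<close>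

definition poisson_random_measure ::
    "'w measure \<Rightarrow> ('a::topological_space) measure \<Rightarrow> ('w \<Rightarrow> 'a set) \<Rightarrow> bool" where
  "poisson_random_measure M \<nu> \<pi> \<longleftrightarrow>
     \<pi> \<in> measurable M point_sets \<and>
     (\<forall>\<omega>\<in>space M. \<pi> \<omega> \<subseteq> space \<nu>) \<and>
     (\<forall>A\<in>sets \<nu>. emeasure \<nu> A < \<infinity> \<longrightarrow>
        (\<forall>j::nat. measure M {\<omega>\<in>space M. npoints (\<pi> \<omega> \<inter> A) = of_nat j} =
                  exp (- measure \<nu> A) * measure \<nu> A ^ j / fact j)) \<and>
     (\<forall>A\<in>sets \<nu>. emeasure \<nu> A = \<infinity> \<longrightarrow> (AE \<omega> in M. npoints (\<pi> \<omega> \<inter> A) = \<infinity>)) \<and>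
     (\<forall>\<A>. finite \<A> \<and> \<A> \<subseteq> sets \<nu> \<and> disjoint \<A> \<longrightarrow>
        prob_space.indep_vars M (\<lambda>_. borel) (\<lambda>A \<omega>. npoints (\<pi> \<omega> \<inter> A)) \<A>)"

definition events_points :: "'w measure \<Rightarrow> ('m \<Rightarrow> 'w \<Rightarrow> (real \<times> real) set) \<Rightarrow> 'm set \<Rightarrow> real set \<Rightarrow> 'w set set" where
  "events_points M \<pi> I T =
     {(\<lambda>\<omega>. \<pi> m \<omega> \<inter> (T \<times> {0..})) -` S \<inter> space M | m S. m \<in> I \<and> S \<in> sets point_sets}"

definition events_drifts ::
    "'w measure \<Rightarrow> ('p \<Rightarrow> nat) \<Rightarrow> ('p \<Rightarrow> real) \<Rightarrow> ('p \<Rightarrow> real \<Rightarrow> 'w \<Rightarrow> real) \<Rightarrow> real set \<Rightarrow> 'w set set" where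
  "events_drifts M n \<phi> \<xi> T =
     {\<xi> p k -` S \<inter> space M | p k S. (p, k) \<in> ar_index n \<phi> \<and> k \<in> T \<and> S \<in> sets borel}"

definition random_points :: "'w measure \<Rightarrow> ('m::finite \<Rightarrow> 'w \<Rightarrow> (real \<times> real) set) \<Rightarrow> bool" where
  "random_points M \<pi> \<longleftrightarrow>
     (\<forall>m. poisson_random_measure M (restrict_space lborel (UNIV \<times> {0..})) (\<pi> m)) \<and>
     prob_space.indep_sets M (\<lambda>m. sigma_sets (space M) (events_points M \<pi> {m} UNIV)) UNIV \<and>
     (\<forall>\<omega>\<in>space M. \<forall>m m' s x x'.
        (s, x) \<in> \<pi> m \<omega> \<and> (s, x') \<in> \<pi> m' \<omega> \<longrightarrow> m = m' \<and> x = x')"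

definition random_drifts ::
    "'w measure \<Rightarrow> ('p::finite \<Rightarrow> nat) \<Rightarrow> ('p \<Rightarrow> real) \<Rightarrow> ('m::finite \<Rightarrow> 'w \<Rightarrow> (real \<times> real) set) \<Rightarrow>
     ('p \<Rightarrow> real \<Rightarrow> 'w \<Rightarrow> real) \<Rightarrow> bool" where
  "random_drifts M n \<phi> \<pi> \<xi> \<longleftrightarrow>
     prob_space.indep_vars M (\<lambda>_. borel) (\<lambda>(p, k). \<xi> p k) (ar_index n \<phi>) \<and>
     prob_space.indep_set M (sigma_sets (space M) (events_drifts M n \<phi> \<xi> UNIV))
                            (sigma_sets (space M) (events_points M \<pi> UNIV UNIV)) \<and>
     (\<forall>(p, k)\<in>ar_index n \<phi>. \<forall>j::int. distr M borel (\<xi> p (k + of_int j)) = distr M borel (\<xi> p k))"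

definition filt ::
    "'w measure \<Rightarrow> ('p \<Rightarrow> nat) \<Rightarrow> ('p \<Rightarrow> real) \<Rightarrow> ('m \<Rightarrow> 'w \<Rightarrow> (real \<times> real) set) \<Rightarrow>
     ('p \<Rightarrow> real \<Rightarrow> 'w \<Rightarrow> real) \<Rightarrow> real \<Rightarrow> 'w measure" where
  "filt M n \<phi> \<pi> \<xi> t =
     sigma (space M) (events_points M \<pi> UNIV {..t} \<union> events_drifts M n \<phi> \<xi> {..t})"

definition filt_left ::
    "'w measure \<Rightarrow> ('p \<Rightarrow> nat) \<Rightarrow> ('p \<Rightarrow> real) \<Rightarrow> ('m \<Rightarrow> 'w \<Rightarrow> (real \<times> real) set) \<Rightarrow>
     ('p \<Rightarrow> real \<Rightarrow> 'w \<Rightarrow> real) \<Rightarrow> real \<Rightarrow> 'w measure" where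
  "filt_left M n \<phi> \<pi> \<xi> t = sigma (space M) (\<Union>s\<in>{..<t}. sets (filt M n \<phi> \<pi> \<xi> s))"

text \<open>Only the values \<open>W p k\<close> with \<open>k \<in> ar_times n \<phi> p\<close> are meaningful.\<close>

type_synonym ('m, 'p, 'w) proc = "('m \<Rightarrow> 'w \<Rightarrow> real set) \<times> ('p \<Rightarrow> real \<Rightarrow> 'w \<Rightarrow> real option)"

definition mp_process ::
    "'w measure \<Rightarrow> ('p::finite \<Rightarrow> nat) \<Rightarrow> ('p \<Rightarrow> real) \<Rightarrow> ('m::finite, 'p, 'w) proc \<Rightarrow> bool" where
  "mp_process M n \<phi> = (\<lambda>(N, W).
     (\<forall>m. N m \<in> measurable M point_sets) \<and>
     (\<forall>\<omega>\<in>space M. disjoint_family (\<lambda>m. N m \<omega>)) \<and>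
     (\<forall>(p, k)\<in>ar_index n \<phi>. W p k \<in> measurable M opt_borel))"

definition modification ::
    "'w measure \<Rightarrow> ('p::finite \<Rightarrow> nat) \<Rightarrow> ('p \<Rightarrow> real) \<Rightarrow> ('m::finite, 'p, 'w) proc \<Rightarrow> ('m, 'p, 'w) proc \<Rightarrow> bool" where
  "modification M n \<phi> = (\<lambda>(N, W) (N', W').
     (AE \<omega> in M. \<forall>m. N m \<omega> = N' m \<omega>) \<and>
     (AE \<omega> in M. \<forall>(p, k)\<in>ar_index n \<phi>. W p k \<omega> = W' p k \<omega>))"

definition proc_mass ::
    "('p::finite \<Rightarrow> nat) \<Rightarrow> ('p \<Rightarrow> real) \<Rightarrow> ('m::finite, 'p, 'w) proc \<Rightarrow> real set \<Rightarrow> 'w \<Rightarrow> ennreal" where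
  "proc_mass n \<phi> = (\<lambda>(N, W) B \<omega>.
     (\<Sum>m\<in>UNIV. npoints (N m \<omega> \<inter> B)) +
     (\<Sum>p\<in>UNIV. \<integral>\<^sup>+ k. ennreal (opt_abs (W p k \<omega>)) \<partial>count_space (ar_times n \<phi> p \<inter> B)))"

definition non_explosive ::
    "'w measure \<Rightarrow> ('p::finite \<Rightarrow> nat) \<Rightarrow> ('p \<Rightarrow> real) \<Rightarrow> ('m::finite, 'p, 'w) proc \<Rightarrow> bool" where
  "non_explosive M n \<phi> X \<longleftrightarrow>
     (AE \<omega> in M. \<forall>B\<in>sets borel. bounded B \<longrightarrow> proc_mass n \<phi> X B \<omega> < \<infinity>)"

text \<open>
  The condition is imposed for \<open>t \<ge> t0\<close> only: the part of the process before \<open>t0\<close> is an initial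
  condition, which is known at time \<open>t0\<close> but need not be adapted before.
\<close>

definition adapted_from ::
    "'w measure \<Rightarrow> ('p::finite \<Rightarrow> nat) \<Rightarrow> ('p \<Rightarrow> real) \<Rightarrow> ('m::finite \<Rightarrow> 'w \<Rightarrow> (real \<times> real) set) \<Rightarrow>
     ('p \<Rightarrow> real \<Rightarrow> 'w \<Rightarrow> real) \<Rightarrow> real \<Rightarrow> ('m, 'p, 'w) proc \<Rightarrow> bool" where
  "adapted_from M n \<phi> \<pi> \<xi> t0 = (\<lambda>(N, W). \<forall>t\<ge>t0.
     (\<forall>m. (\<lambda>\<omega>. N m \<omega> \<inter> {..t}) \<in> measurable (filt M n \<phi> \<pi> \<xi> t) point_sets) \<and>
     (\<forall>(p, k)\<in>ar_index n \<phi>. k \<le> t \<longrightarrow> W p k \<in> measurable (filt M n \<phi> \<pi> \<xi> t) opt_borel))"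

definition initial_condition ::
    "'w measure \<Rightarrow> ('p::finite \<Rightarrow> nat) \<Rightarrow> ('p \<Rightarrow> real) \<Rightarrow> ('m::finite \<Rightarrow> 'w \<Rightarrow> (real \<times> real) set) \<Rightarrow>
     ('p \<Rightarrow> real \<Rightarrow> 'w \<Rightarrow> real) \<Rightarrow> real \<Rightarrow> ('m, 'p, 'w) proc \<Rightarrow> bool" where
  "initial_condition M n \<phi> \<pi> \<xi> t0 = (\<lambda>(CM, CP).
     (\<forall>m. CM m \<in> measurable (filt_left M n \<phi> \<pi> \<xi> t0) point_sets) \<and>
     (\<forall>\<omega>\<in>space M. (\<forall>m. CM m \<omega> \<subseteq> {..<t0}) \<and> disjoint_family (\<lambda>m. CM m \<omega>)) \<and>
     (\<forall>(p, k)\<in>ar_index n \<phi>. k < t0 \<longrightarrow> CP p k \<in> measurable (filt_left M n \<phi> \<pi> \<xi> t0) opt_borel))"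

definition ic_mass ::
    "('p \<Rightarrow> nat) \<Rightarrow> ('p \<Rightarrow> real) \<Rightarrow> real \<Rightarrow> 'p \<Rightarrow> (real \<Rightarrow> 'w \<Rightarrow> real option) \<Rightarrow> real set \<Rightarrow> 'w \<Rightarrow> ennreal" where
  "ic_mass n \<phi> t0 p C B \<omega> =
     (\<integral>\<^sup>+ k. ennreal (psi1 (C k \<omega>)) \<partial>count_space (ar_times n \<phi> p \<inter> {..<t0} \<inter> B))"

definition ic_integrable ::
    "'w measure \<Rightarrow> ('p::finite \<Rightarrow> nat) \<Rightarrow> ('p \<Rightarrow> real) \<Rightarrow> real \<Rightarrow> ('m::finite, 'p, 'w) proc \<Rightarrow> bool" where
  "ic_integrable M n \<phi> t0 = (\<lambda>(CM, CP).
     \<exists>(K::real) RM DM RP DP.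
       (\<forall>m. RM m \<in> measurable M point_sets \<and> DM m \<in> measurable M point_sets) \<and>
       (\<forall>(p, k)\<in>ar_index n \<phi>. k < t0 \<longrightarrow>
          RP p k \<in> measurable M opt_borel \<and> DP p k \<in> measurable M opt_borel) \<and>
       (\<forall>\<omega>\<in>space M. \<forall>m. CM m \<omega> = RM m \<omega> \<union> DM m \<omega>) \<and>
       (\<forall>\<omega>\<in>space M. \<forall>(p, k)\<in>ar_index n \<phi>. k < t0 \<longrightarrow> CP p k \<omega> = opt_add (RP p k \<omega>) (DP p k \<omega>)) \<and>
       (AE \<omega> in M. (\<Sum>m\<in>UNIV. npoints (DM m \<omega> \<inter> {..<t0})) +
                   (\<Sum>p\<in>UNIV. ic_mass n \<phi> t0 p (DP p) {..<t0} \<omega>) < \<infinity>) \<and>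
       (\<forall>B\<in>sets borel.
          (\<forall>m. (\<integral>\<^sup>+ \<omega>. npoints (RM m \<omega> \<inter> B) \<partial>M) \<le> ennreal K * emeasure lborel B) \<and>
          (\<forall>p. (\<integral>\<^sup>+ \<omega>. ic_mass n \<phi> t0 p (RP p) B \<omega> \<partial>M) \<le>
               ennreal K * (\<Sum>q\<in>UNIV. npoints (ar_times n \<phi> q \<inter> B)))))"

text \<open>
  The argument of \<open>\<Phi>\<close> at time \<open>t\<close>.  The integrals against the counting measures are
  sums over the points; for real summands \<open>summable_on\<close> is absolute convergence and a
  divergent \<open>infsum\<close> is \<open>0\<close>.
\<close>

definition drive ::
    "('p::finite \<Rightarrow> nat) \<Rightarrow> ('p \<Rightarrow> real) \<Rightarrow> ('m::finite, 'p) har_params \<Rightarrow> 'm + 'p \<Rightarrow>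
     ('m, 'p, 'w) proc \<Rightarrow> real \<Rightarrow> 'w \<Rightarrow> real" where
  "drive n \<phi> \<MM> \<alpha> = (\<lambda>(N, W) t \<omega>.
     (\<Sum>m\<in>UNIV. \<Sum>\<^sub>\<infinity>s\<in>N m \<omega> \<inter> {..<t}. hM \<MM> \<alpha> m (t - s)) +
     (\<Sum>p\<in>UNIV. \<Sum>\<^sub>\<infinity>k\<in>ar_times n \<phi> p \<inter> {..<t}. opt_app (J \<MM> \<alpha> p (t - k)) (W p k \<omega>)))"

definition drive_converges ::
    "('p::finite \<Rightarrow> nat) \<Rightarrow> ('p \<Rightarrow> real) \<Rightarrow> ('m::finite, 'p) har_params \<Rightarrow> 'm + 'p \<Rightarrow>
     ('m, 'p, 'w) proc \<Rightarrow> real \<Rightarrow> 'w \<Rightarrow> bool" where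
  "drive_converges n \<phi> \<MM> \<alpha> = (\<lambda>(N, W) t \<omega>.
     (\<forall>m. (\<lambda>s. hM \<MM> \<alpha> m (t - s)) summable_on (N m \<omega> \<inter> {..<t})) \<and>
     (\<forall>p. (\<lambda>k. opt_app (J \<MM> \<alpha> p (t - k)) (W p k \<omega>)) summable_on (ar_times n \<phi> p \<inter> {..<t})))"

definition intensity ::
    "('p::finite \<Rightarrow> nat) \<Rightarrow> ('p \<Rightarrow> real) \<Rightarrow> ('m::finite, 'p) har_params \<Rightarrow>
     ('m, 'p, 'w) proc \<Rightarrow> 'm \<Rightarrow> 'w \<Rightarrow> real \<Rightarrow> real" where
  "intensity n \<phi> \<MM> X m \<omega> t = PhiM \<MM> m (drive n \<phi> \<MM> (Inl m) X t \<omega>)"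

text \<open>
  The integrals in the intensity have to converge for almost every \<open>(\<omega>, t)\<close> only.  The value of
  the intensity on the exceptional null set does not matter as long as it is
  determined by the strict past (it is, by the convention for \<open>infsum\<close>): almost surely
  no atom of the Poisson random measures has its time coordinate there.
\<close>

definition har_process ::
    "'w measure \<Rightarrow> ('p::finite \<Rightarrow> nat) \<Rightarrow> ('p \<Rightarrow> real) \<Rightarrow> ('m::finite \<Rightarrow> 'w \<Rightarrow> (real \<times> real) set) \<Rightarrow>
     ('m, 'p) har_params \<Rightarrow> ('p \<Rightarrow> real \<Rightarrow> 'w \<Rightarrow> real) \<Rightarrow> real \<Rightarrow> ('m, 'p, 'w) proc \<Rightarrow>
     ('m, 'p, 'w) proc \<Rightarrow> bool" where
  "har_process M n \<phi> \<pi> \<MM> \<xi> t0 = (\<lambda>(CM, CP) (N, W).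
     mp_process M n \<phi> (N, W) \<and>
     adapted_from M n \<phi> \<pi> \<xi> t0 (N, W) \<and>
     (\<forall>\<omega>\<in>space M. (\<forall>m. N m \<omega> \<inter> {..<t0} = CM m \<omega>) \<and>
                  (\<forall>(p, k)\<in>ar_index n \<phi>. k < t0 \<longrightarrow> W p k \<omega> = CP p k \<omega>)) \<and>
     (\<forall>m. AE (\<omega>, t) in M \<Otimes>\<^sub>M lborel. t0 \<le> t \<longrightarrow> drive_converges n \<phi> \<MM> (Inl m) (N, W) t \<omega>) \<and>
     (\<forall>m. AE \<omega> in M. \<forall>C\<in>sets borel. C \<subseteq> {t0..} \<longrightarrow>
        npoints (N m \<omega> \<inter> C) =
        (\<integral>\<^sup>+ (s, x). indicator {..intensity n \<phi> \<MM> (N, W) m \<omega> s} x \<partial>count_space (\<pi> m \<omega> \<inter> (C \<times> {0..})))) \<and>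
     (AE \<omega> in M. \<forall>(p, k)\<in>ar_index n \<phi>. t0 \<le> k \<longrightarrow>
        drive_converges n \<phi> \<MM> (Inr p) (N, W) k \<omega> \<and>
        W p k \<omega> = Some (\<xi> p k \<omega> + PhiP \<MM> p (drive n \<phi> \<MM> (Inr p) (N, W) k \<omega>))))"

end

theory Submission
  imports Defs
begin

text \<open>
  Uniqueness is pathwise: non-explosive solutions have finitely many points in bounded time, so if two
  of them differ there is a first time of difference; there they have the same strict past and hence
  the same drives, and so they cannot differ.

  For existence, time is cut at all the autoregressive times, and further into pieces so short that
  the Lipschitz constant times the integrals of the kernels between point processes over one piece is
  at most 1/2.  Inside a piece only the point processes evolve.  Their Picard iterates are dominated
  by a monotone linear system, whose mean number of points is finite by Campbell's formula, after
  localisation to an event on which the contribution of the past is bounded.  Hence almost surely all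
  iterates take their points from one finite set, and they become stationary after finitely many
  steps.  At the end of a piece the new terms of the time series are read off the equation.

  This is done for the filtration augmented by null sets.  The thinned sets of atoms and the terms of
  the series are then replaced by versions for the given filtration.
\<close>

section \<open>Random sets of points\<close>

text \<open>No mean of the past is available: the discrete part of the initial condition is finite
  only almost surely, and the drifts carry no moment condition, so the terms of the series need not
  be integrable. From the dominating system only the finiteness of the set of candidate points is
  therefore extracted. Convergence comes from causality instead of a contraction: acceptance of a
  point depends on strictly earlier points, so every iterate settles at least one more candidate.
  The autoregressive times are cut points because a term of the series is an arbitrary finite random
  number; frozen into the past, it adds a function of time that is integrable on almost every path,
  and it leaves the smallness condition alone. Adaptedness is required for a filtration that need
  not contain the null sets, while localisation and limits determine sets only almost surely. This
  is why acceptance is encoded by predictable sets of outcomes, times and marks: such a set has a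
  version whose exceptional null set is one of outcomes, common to all times.\<close>

lemma npoints_finite: "finite A \<Longrightarrow> npoints A = of_nat (card A)"
  by (simp add: emeasure_count_space)

lemma npoints_less_top_iff: "npoints A < \<infinity> \<longleftrightarrow> finite A"
  by (cases "finite A") (simp_all add: emeasure_count_space less_top[symmetric])

lemma npoints_mono: "A \<subseteq> B \<Longrightarrow> npoints A \<le> npoints B"
  by (intro emeasure_mono) auto

lemma npoints_Un_disjoint: "A \<inter> B = {} \<Longrightarrow> npoints (A \<union> B) = npoints A + npoints B"
  by (intro plus_emeasure[symmetric]) auto

lemma SUP_npoints: "incseq F \<Longrightarrow> (SUP i. npoints (F i)) = npoints (\<Union>i. F i)"
  by (intro SUP_emeasure_incseq) auto

lemma npoints_image: "inj_on f A \<Longrightarrow> npoints (f ` A) = npoints A"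
  by (cases "finite A") (simp_all add: emeasure_count_space card_image finite_image_iff)

lemma space_point_sets [simp]: "space point_sets = UNIV"
  by (simp add: point_sets_def space_measure_of_conv)

text \<open>The generators of \<open>point_sets\<close> are the preimages under the counts
  \<open>npoints (A \<inter> B)\<close>, so a random set can be handled throughout by its counts in
  Borel sets.\<close>

lemma measurable_point_sets_iff:
  "A \<in> measurable H point_sets \<longleftrightarrow> (\<forall>B\<in>sets borel. (\<lambda>\<omega>. npoints (A \<omega> \<inter> B)) \<in> borel_measurable H)"
proof safe
  fix B :: "'b set" assume A: "A \<in> measurable H point_sets" and B: "B \<in> sets borel"
  show "(\<lambda>\<omega>. npoints (A \<omega> \<inter> B)) \<in> borel_measurable H"
  proof (rule measurableI)
    fix S :: "ennreal set" assume S: "S \<in> sets borel"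
    have "{A. npoints (A \<inter> B) \<in> S} \<in> sets point_sets"
      unfolding point_sets_def using B S by (intro in_measure_of) auto
    from measurable_sets[OF A this]
    show "(\<lambda>\<omega>. npoints (A \<omega> \<inter> B)) -` S \<inter> space H \<in> sets H"
      by (simp add: vimage_def)
  qed simp
next
  assume *: "\<forall>B\<in>sets borel. (\<lambda>\<omega>. npoints (A \<omega> \<inter> B)) \<in> borel_measurable H"
  show "A \<in> measurable H point_sets"
    unfolding point_sets_def
  proof (rule measurable_measure_of)
    fix y assume "y \<in> {{A :: 'b set. npoints (A \<inter> B) \<in> S} | B S. B \<in> sets borel \<and> S \<in> sets borel}"
    then obtain B S where y: "y = {A. npoints (A \<inter> B) \<in> S}" and BS: "B \<in> sets borel" "S \<in> sets borel"
      by auto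
    have "(\<lambda>\<omega>. npoints (A \<omega> \<inter> B)) -` S \<inter> space H \<in> sets H"
      using * BS by (auto intro: measurable_sets)
    then show "A -` y \<inter> space H \<in> sets H"
      by (simp add: y vimage_def)
  qed auto
qed

lemma measurable_npoints:
  "A \<in> measurable H point_sets \<Longrightarrow> B \<in> sets borel \<Longrightarrow> (\<lambda>\<omega>. npoints (A \<omega> \<inter> B)) \<in> borel_measurable H"
  by (simp add: measurable_point_sets_iff)

lemma measurable_point_sets_Int:
  assumes "A \<in> measurable H point_sets" "T \<in> sets borel"
  shows "(\<lambda>\<omega>. A \<omega> \<inter> T) \<in> measurable H point_sets"
  using assms unfolding measurable_point_sets_iff by (auto simp: Int_assoc)

lemma measurable_point_sets_Un:
  assumes "A \<in> measurable H point_sets" "A' \<in> measurable H point_sets"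
    and "\<And>\<omega>. \<omega> \<in> space H \<Longrightarrow> A \<omega> \<inter> A' \<omega> = {}"
  shows "(\<lambda>\<omega>. A \<omega> \<union> A' \<omega>) \<in> measurable H point_sets"
  unfolding measurable_point_sets_iff
proof
  fix B :: "'b set" assume B: "B \<in> sets borel"
  have "(\<lambda>\<omega>. npoints (A \<omega> \<inter> B) + npoints (A' \<omega> \<inter> B)) \<in> borel_measurable H"
    using assms(1,2) B by (intro borel_measurable_add measurable_npoints)
  also have "?this \<longleftrightarrow> (\<lambda>\<omega>. npoints ((A \<omega> \<union> A' \<omega>) \<inter> B)) \<in> borel_measurable H"
  proof (rule measurable_cong)
    fix \<omega> assume "\<omega> \<in> space H"
    then show "npoints (A \<omega> \<inter> B) + npoints (A' \<omega> \<inter> B) = npoints ((A \<omega> \<union> A' \<omega>) \<inter> B)"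
      unfolding Int_Un_distrib2 by (intro npoints_Un_disjoint[symmetric]) (use assms(3) in blast)
  qed
  finally show "(\<lambda>\<omega>. npoints ((A \<omega> \<union> A' \<omega>) \<inter> B)) \<in> borel_measurable H" .
qed

text \<open>A Dynkin argument from the rectangles \<open>G \<times> B\<close>. Finiteness of
  \<open>F \<omega>\<close> makes the complement step a legitimate subtraction of extended
  numbers.\<close>

lemma npoints_section_measurable:
  fixes F :: "'w \<Rightarrow> ('a::topological_space) set"
  assumes F: "F \<in> measurable H point_sets" and fin: "\<And>\<omega>. \<omega> \<in> space H \<Longrightarrow> finite (F \<omega>)"
    and C: "C \<in> sets (H \<Otimes>\<^sub>M borel)"
  shows "(\<lambda>\<omega>. npoints (F \<omega> \<inter> Pair \<omega> -` C)) \<in> borel_measurable H"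
  using Int_stable_pair_measure_generator pair_measure_closed C
  unfolding sets_pair_measure
proof (induct rule: sigma_sets_induct_disjoint)
  case (basic A)
  then obtain G B where A: "A = G \<times> B" and G: "G \<in> sets H" and B: "B \<in> sets borel" by auto
  have "(\<lambda>\<omega>. npoints (F \<omega> \<inter> B) * indicator G \<omega>) \<in> borel_measurable H"
    using F B G by (auto intro!: borel_measurable_times_ennreal measurable_npoints)
  moreover have "npoints (F \<omega> \<inter> Pair \<omega> -` A) = npoints (F \<omega> \<inter> B) * indicator G \<omega>" for \<omega>
    by (auto simp: A indicator_def vimage_def)
  ultimately show ?case by simp
next
  case empty then show ?case by simp
next
  case (compl A)
  have "(\<lambda>\<omega>. npoints (F \<omega> \<inter> UNIV) - npoints (F \<omega> \<inter> Pair \<omega> -` A)) \<in> borel_measurable H"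
    using compl F by (intro borel_measurable_minus_ennreal measurable_npoints) auto
  also have "?this \<longleftrightarrow> ?case"
  proof (rule measurable_cong)
    fix \<omega> assume w: "\<omega> \<in> space H"
    have "F \<omega> \<inter> Pair \<omega> -` (space H \<times> space borel - A) = F \<omega> - (F \<omega> \<inter> Pair \<omega> -` A)"
      using w by auto
    then show "npoints (F \<omega> \<inter> UNIV) - npoints (F \<omega> \<inter> Pair \<omega> -` A) =
        npoints (F \<omega> \<inter> Pair \<omega> -` (space H \<times> space borel - A))"
      using fin[OF w] by (subst emeasure_Diff[symmetric]) (auto simp: npoints_finite)
  qed
  finally show ?case .
next
  case (union A)
  have "(\<lambda>\<omega>. \<Sum>i. npoints (F \<omega> \<inter> Pair \<omega> -` A i)) \<in> borel_measurable H"
    using union by auto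
  moreover have "(\<Sum>i. npoints (F \<omega> \<inter> Pair \<omega> -` A i)) = npoints (F \<omega> \<inter> Pair \<omega> -` \<Union> (range A))" for \<omega>
  proof -
    have "disjoint_family (\<lambda>i. F \<omega> \<inter> Pair \<omega> -` A i)"
      using union(1) unfolding disjoint_family_on_def by fastforce
    then show ?thesis
      by (subst suminf_emeasure) (auto simp: vimage_UN)
  qed
  ultimately show ?case by simp
qed

text \<open>
  Measurability into \<open>point_sets\<close> gives the numbers of points in deterministic sets only; an
  exhaustion by finite random sets also gives the numbers of points in random sections, and with them
  sums over the points of jointly measurable functions.
\<close>

definition sfin_rset :: "'w measure \<Rightarrow> ('w \<Rightarrow> ('a::topological_space) set) \<Rightarrow> bool" where
  "sfin_rset H A \<longleftrightarrow> (\<exists>F. (\<forall>i::nat. F i \<in> measurable H point_sets \<and> (\<forall>\<omega>\<in>space H. finite (F i \<omega>))) \<and>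
     (\<forall>\<omega>\<in>space H. incseq (\<lambda>i. F i \<omega>) \<and> A \<omega> = (\<Union>i. F i \<omega>)))"

lemma sfin_rsetE:
  assumes "sfin_rset H A"
  obtains F where "\<And>i::nat. F i \<in> measurable H point_sets"
    "\<And>i \<omega>. \<omega> \<in> space H \<Longrightarrow> finite (F i \<omega>)" "\<And>\<omega>. \<omega> \<in> space H \<Longrightarrow> incseq (\<lambda>i. F i \<omega>)"
    "\<And>\<omega>. \<omega> \<in> space H \<Longrightarrow> A \<omega> = (\<Union>i. F i \<omega>)"
  using assms unfolding sfin_rset_def by (elim exE conjE) (rule that; simp)

lemma sfin_rset_npoints_section:
  assumes A: "sfin_rset H A" and C: "C \<in> sets (H \<Otimes>\<^sub>M borel)"
  shows "(\<lambda>\<omega>. npoints (A \<omega> \<inter> Pair \<omega> -` C)) \<in> borel_measurable H"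
proof -
  obtain F where F: "\<And>i::nat. F i \<in> measurable H point_sets"
    "\<And>i \<omega>. \<omega> \<in> space H \<Longrightarrow> finite (F i \<omega>)" "\<And>\<omega>. \<omega> \<in> space H \<Longrightarrow> incseq (\<lambda>i. F i \<omega>)"
    "\<And>\<omega>. \<omega> \<in> space H \<Longrightarrow> A \<omega> = (\<Union>i. F i \<omega>)" using A by (elim sfin_rsetE) (rule that; simp)
  have "(\<lambda>\<omega>. SUP i. npoints (F i \<omega> \<inter> Pair \<omega> -` C)) \<in> borel_measurable H"
    by (intro borel_measurable_SUP npoints_section_measurable F C) auto
  also have "?this \<longleftrightarrow> ?thesis"
  proof (rule measurable_cong)
    fix \<omega> assume w: "\<omega> \<in> space H"
    have "incseq (\<lambda>i. F i \<omega> \<inter> Pair \<omega> -` C)"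
      using F(3)[OF w] unfolding incseq_def by blast
    then show "(SUP i. npoints (F i \<omega> \<inter> Pair \<omega> -` C)) = npoints (A \<omega> \<inter> Pair \<omega> -` C)"
      by (subst SUP_npoints) (auto simp: F(4)[OF w])
  qed
  finally show ?thesis .
qed

lemma sfin_rset_section:
  assumes A: "sfin_rset H A" and C: "C \<in> sets (H \<Otimes>\<^sub>M borel)"
  shows "sfin_rset H (\<lambda>\<omega>. A \<omega> \<inter> Pair \<omega> -` C)"
proof -
  obtain F where F: "\<And>i::nat. F i \<in> measurable H point_sets"
    "\<And>i \<omega>. \<omega> \<in> space H \<Longrightarrow> finite (F i \<omega>)" "\<And>\<omega>. \<omega> \<in> space H \<Longrightarrow> incseq (\<lambda>i. F i \<omega>)"
    "\<And>\<omega>. \<omega> \<in> space H \<Longrightarrow> A \<omega> = (\<Union>i. F i \<omega>)" using A by (elim sfin_rsetE) (rule that; simp)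
  have "(\<lambda>\<omega>. F i \<omega> \<inter> Pair \<omega> -` C) \<in> measurable H point_sets" for i
    unfolding measurable_point_sets_iff
  proof
    fix B :: "'b set" assume B: "B \<in> sets borel"
    \<comment> \<open>To count in \<open>B\<close> the points of a section of \<open>C\<close> is to
      count the points in a section of \<open>C \<inter> (space H \<times> B)\<close>.\<close>
    have "(\<lambda>\<omega>. npoints (F i \<omega> \<inter> Pair \<omega> -` (C \<inter> (space H \<times> B)))) \<in> borel_measurable H"
      using B by (intro npoints_section_measurable F C sets.Int pair_measureI) auto
    also have "?this \<longleftrightarrow> (\<lambda>\<omega>. npoints (F i \<omega> \<inter> Pair \<omega> -` C \<inter> B)) \<in> borel_measurable H"
      by (intro measurable_cong arg_cong[where f="npoints"]) auto
    finally show "(\<lambda>\<omega>. npoints (F i \<omega> \<inter> Pair \<omega> -` C \<inter> B)) \<in> borel_measurable H" .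
  qed
  then show ?thesis
    unfolding sfin_rset_def using F(2,3,4)
    by (intro exI[of _ "\<lambda>i \<omega>. F i \<omega> \<inter> Pair \<omega> -` C"] conjI allI ballI)
       (simp_all add: incseq_def le_infI1)
qed

lemma sfin_rset_measurable:
  assumes A: "sfin_rset H A"
  shows "A \<in> measurable H point_sets"
  unfolding measurable_point_sets_iff
proof
  fix B :: "'b set" assume B: "B \<in> sets borel"
  have "(\<lambda>\<omega>. npoints (A \<omega> \<inter> Pair \<omega> -` (space H \<times> B))) \<in> borel_measurable H"
    using B by (intro sfin_rset_npoints_section A pair_measureI) auto
  also have "?this \<longleftrightarrow> (\<lambda>\<omega>. npoints (A \<omega> \<inter> B)) \<in> borel_measurable H"
    by (intro measurable_cong arg_cong[where f="npoints"]) auto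
  finally show "(\<lambda>\<omega>. npoints (A \<omega> \<inter> B)) \<in> borel_measurable H" .
qed

lemma sfin_rset_Int:
  assumes A: "sfin_rset H A" and B: "B \<in> sets borel"
  shows "sfin_rset H (\<lambda>\<omega>. A \<omega> \<inter> B)"
proof -
  have "sfin_rset H (\<lambda>\<omega>. A \<omega> \<inter> Pair \<omega> -` (space H \<times> B))"
    using B by (intro sfin_rset_section A pair_measureI) auto
  then show ?thesis unfolding sfin_rset_def by auto
qed

lemma nn_integral_count_space_subset:
  "(\<integral>\<^sup>+ y. f y \<partial>count_space A) = (\<integral>\<^sup>+ y. f y * indicator A y \<partial>count_space UNIV)"
  by (rule nn_integral_count_space_indicator) simp

lemma nn_integral_count_space_mono_set:
  "A \<subseteq> B \<Longrightarrow> (\<integral>\<^sup>+ y. f y \<partial>count_space A) \<le> (\<integral>\<^sup>+ y. f y \<partial>count_space B)"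
  unfolding nn_integral_count_space_subset[of A] nn_integral_count_space_subset[of B]
  by (intro nn_integral_mono) (auto simp: indicator_def)

lemma sfin_rset_nn_integral:
  fixes f :: "'w \<times> 'a::topological_space \<Rightarrow> ennreal"
  assumes A: "sfin_rset H A" and f: "f \<in> borel_measurable (H \<Otimes>\<^sub>M borel)"
  shows "(\<lambda>\<omega>. \<integral>\<^sup>+ y. f (\<omega>, y) \<partial>count_space (A \<omega>)) \<in> borel_measurable H"
  using f
proof (induct rule: borel_measurable_induct)
  case (cong f g)
  have "(\<lambda>\<omega>. \<integral>\<^sup>+ y. f (\<omega>, y) \<partial>count_space (A \<omega>)) \<in> borel_measurable H \<longleftrightarrow>
        (\<lambda>\<omega>. \<integral>\<^sup>+ y. g (\<omega>, y) \<partial>count_space (A \<omega>)) \<in> borel_measurable H"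
    by (intro measurable_cong nn_integral_cong) (auto simp: cong(3) space_pair_measure)
  then show ?case using cong by simp
next
  case (set C)
  have "(\<integral>\<^sup>+ y. indicator C (\<omega>, y) \<partial>count_space (A \<omega>)) = npoints (A \<omega> \<inter> Pair \<omega> -` C)" for \<omega>
  proof -
    have "(\<integral>\<^sup>+ y. indicator C (\<omega>, y) \<partial>count_space (A \<omega>)) =
          (\<integral>\<^sup>+ y. indicator (A \<omega> \<inter> Pair \<omega> -` C) y \<partial>count_space UNIV)"
      unfolding nn_integral_count_space_subset[of "A \<omega>"] by (intro nn_integral_cong) (auto simp: indicator_def)
    then show ?thesis by simp
  qed
  then show ?case using sfin_rset_npoints_section[OF A set] by simp
next
  case (mult u c)
  then show ?case by (simp add: nn_integral_cmult)
next
  case (add u v)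
  then show ?case by (simp add: nn_integral_add)
next
  case (seq U)
  have "(\<integral>\<^sup>+ y. (SUP i. U i) (\<omega>, y) \<partial>count_space (A \<omega>)) =
        (SUP i. \<integral>\<^sup>+ y. U i (\<omega>, y) \<partial>count_space (A \<omega>))" for \<omega>
  proof -
    have "incseq (\<lambda>i y. U i (\<omega>, y))" using \<open>incseq U\<close> by (auto simp: incseq_def le_fun_def)
    from nn_integral_monotone_convergence_SUP[OF this, of "count_space (A \<omega>)"]
    show ?thesis by (simp add: image_comp)
  qed
  then show ?case using seq by simp
qed

lemma sfin_rset_pullback:
  assumes A: "sfin_rset H A" and g: "g \<in> measurable H' H"
  shows "sfin_rset H' (\<lambda>z. A (g z))"
proof -
  obtain F where F: "\<And>i::nat. F i \<in> measurable H point_sets"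
    "\<And>i \<omega>. \<omega> \<in> space H \<Longrightarrow> finite (F i \<omega>)" "\<And>\<omega>. \<omega> \<in> space H \<Longrightarrow> incseq (\<lambda>i. F i \<omega>)"
    "\<And>\<omega>. \<omega> \<in> space H \<Longrightarrow> A \<omega> = (\<Union>i. F i \<omega>)" using A by (elim sfin_rsetE) (rule that; simp)
  have gs: "g z \<in> space H" if "z \<in> space H'" for z using g that by (rule measurable_space)
  show ?thesis
    unfolding sfin_rset_def
    by (intro exI[of _ "\<lambda>i z. F i (g z)"]) (use F gs measurable_compose[OF g F(1)] in auto)
qed

lemma sfin_rset_mono_sets:
  assumes A: "sfin_rset H A" and "sets H \<subseteq> sets H'" "space H' = space H"
  shows "sfin_rset H' A"
proof (rule sfin_rset_pullback[OF A, of "\<lambda>x. x" H'])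
  show "(\<lambda>x. x) \<in> measurable H' H"
    using assms(2,3) sets.sets_into_space[of _ H]
    by (intro measurableI) (auto simp: vimage_def Int_absorb2 Collect_conj_eq)
qed

text \<open>The first projection is injective on \<open>A \<omega>\<close>, so the image has as many
  points in \<open>B\<close> as \<open>A \<omega>\<close> has in the strip
  \<open>B \<times> UNIV\<close>. For the atoms, this is where distinct time coordinates
  enter.\<close>

lemma sfin_rset_fst:
  fixes A :: "'w \<Rightarrow> (real \<times> real) set"
  assumes A: "sfin_rset H A" and inj: "\<And>\<omega>. \<omega> \<in> space H \<Longrightarrow> inj_on fst (A \<omega>)"
  shows "sfin_rset H (\<lambda>\<omega>. fst ` A \<omega>)"
proof -
  obtain F where F: "\<And>i::nat. F i \<in> measurable H point_sets"
    "\<And>i \<omega>. \<omega> \<in> space H \<Longrightarrow> finite (F i \<omega>)" "\<And>\<omega>. \<omega> \<in> space H \<Longrightarrow> incseq (\<lambda>i. F i \<omega>)"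
    "\<And>\<omega>. \<omega> \<in> space H \<Longrightarrow> A \<omega> = (\<Union>i. F i \<omega>)" using A by (elim sfin_rsetE) (rule that; simp)
  have "(\<lambda>\<omega>. fst ` F i \<omega>) \<in> measurable H point_sets" for i
    unfolding measurable_point_sets_iff
  proof
    fix B :: "real set" assume B: "B \<in> sets borel"
    have "(\<lambda>\<omega>. npoints (F i \<omega> \<inter> (B \<times> UNIV))) \<in> borel_measurable H"
      using B by (intro measurable_npoints F) (auto simp: borel_prod[symmetric])
    also have "?this \<longleftrightarrow> (\<lambda>\<omega>. npoints (fst ` F i \<omega> \<inter> B)) \<in> borel_measurable H"
    proof (intro measurable_cong)
      fix \<omega> assume w: "\<omega> \<in> space H"
      have "inj_on fst (F i \<omega> \<inter> (B \<times> UNIV))"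
        using inj[OF w] F(4)[OF w] by (auto simp: inj_on_def)
      moreover have "fst ` (F i \<omega> \<inter> (B \<times> UNIV)) = fst ` F i \<omega> \<inter> B" by force
      ultimately show "npoints (F i \<omega> \<inter> (B \<times> UNIV)) = npoints (fst ` F i \<omega> \<inter> B)"
        by (metis npoints_image)
    qed
    finally show "(\<lambda>\<omega>. npoints (fst ` F i \<omega> \<inter> B)) \<in> borel_measurable H" .
  qed
  then show ?thesis
    unfolding sfin_rset_def using F(2,3,4)
    by (intro exI[of _ "\<lambda>i \<omega>. fst ` F i \<omega>"] conjI allI ballI)
       (simp_all add: incseq_def image_mono image_UN)
qed

lemma sfin_rset_Un:
  fixes A A' :: "'w \<Rightarrow> ('a::topological_space) set"
  assumes A: "sfin_rset H A" and A': "sfin_rset H A'"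
    and disj: "\<And>\<omega>. \<omega> \<in> space H \<Longrightarrow> A \<omega> \<inter> A' \<omega> = {}"
  shows "sfin_rset H (\<lambda>\<omega>. A \<omega> \<union> A' \<omega>)"
proof -
  obtain F where F: "\<And>i::nat. F i \<in> measurable H point_sets"
    "\<And>i \<omega>. \<omega> \<in> space H \<Longrightarrow> finite (F i \<omega>)" "\<And>\<omega>. \<omega> \<in> space H \<Longrightarrow> incseq (\<lambda>i. F i \<omega>)"
    "\<And>\<omega>. \<omega> \<in> space H \<Longrightarrow> A \<omega> = (\<Union>i. F i \<omega>)" using A by (elim sfin_rsetE) (rule that; simp)
  obtain G where G: "\<And>i::nat. G i \<in> measurable H point_sets"
    "\<And>i \<omega>. \<omega> \<in> space H \<Longrightarrow> finite (G i \<omega>)" "\<And>\<omega>. \<omega> \<in> space H \<Longrightarrow> incseq (\<lambda>i. G i \<omega>)"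
    "\<And>\<omega>. \<omega> \<in> space H \<Longrightarrow> A' \<omega> = (\<Union>i. G i \<omega>)" using A' by (elim sfin_rsetE) (rule that; simp)
  have "(\<lambda>\<omega>. F i \<omega> \<union> G i \<omega>) \<in> measurable H point_sets" for i
    using disj F(4) G(4) by (intro measurable_point_sets_Un F G) blast
  then show ?thesis
    unfolding sfin_rset_def using F(2,3,4) G(2,3,4)
    by (intro exI[of _ "\<lambda>i \<omega>. F i \<omega> \<union> G i \<omega>"] conjI allI ballI)
       (simp_all add: incseq_def le_supI1 le_supI2 UN_Un_distrib)
qed

section \<open>Augmented filtrations and predictable sets\<close>

definition aug :: "'w measure \<Rightarrow> 'w measure \<Rightarrow> 'w measure" where
  "aug M F = sigma (space M) {E \<in> sets M. \<exists>A\<in>sets F. AE \<omega> in M. \<omega> \<in> E \<longleftrightarrow> \<omega> \<in> A}"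

lemma space_aug [simp]: "space (aug M F) = space M"
  by (simp add: aug_def space_measure_of_conv)

lemma sets_aug:
  assumes F: "subalgebra M F"
  shows "sets (aug M F) = {E \<in> sets M. \<exists>A\<in>sets F. AE \<omega> in M. \<omega> \<in> E \<longleftrightarrow> \<omega> \<in> A}" (is "_ = ?S")
proof -
  have sp: "space F = space M" and sub: "sets F \<subseteq> sets M"
    using F by (auto simp: subalgebra_def)
  have "sigma_algebra (space M) ?S"
    unfolding sigma_algebra_iff2
  proof (intro conjI ballI allI impI)
    show "?S \<subseteq> Pow (space M)" using sets.space_closed by auto
    show "{} \<in> ?S" by (auto intro!: bexI[of _ "{}"])
    fix E assume "E \<in> ?S"
    then obtain A where E: "E \<in> sets M" "A \<in> sets F" "AE \<omega> in M. \<omega> \<in> E \<longleftrightarrow> \<omega> \<in> A" by auto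
    have "AE \<omega> in M. \<omega> \<in> space M - E \<longleftrightarrow> \<omega> \<in> space F - A"
      using E(3) AE_space by eventually_elim (auto simp: sp)
    then show "space M - E \<in> ?S" using E by (auto intro!: bexI[of _ "space F - A"])
  next
    fix E :: "nat \<Rightarrow> _" assume E: "range E \<subseteq> ?S"
    then have "\<forall>i. \<exists>A\<in>sets F. AE \<omega> in M. \<omega> \<in> E i \<longleftrightarrow> \<omega> \<in> A" by auto
    then obtain A where A: "\<And>i. A i \<in> sets F" "\<And>i. AE \<omega> in M. \<omega> \<in> E i \<longleftrightarrow> \<omega> \<in> A i" by metis
    have "AE \<omega> in M. \<forall>i. \<omega> \<in> E i \<longleftrightarrow> \<omega> \<in> A i" using A(2) by (simp add: AE_all_countable)
    then have "AE \<omega> in M. \<omega> \<in> \<Union>(range E) \<longleftrightarrow> \<omega> \<in> \<Union>(range A)" by eventually_elim auto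
    moreover have "\<Union>(range E) \<in> sets M" "\<Union>(range A) \<in> sets F" using E A by auto
    ultimately show "\<Union>(range E) \<in> ?S" by blast
  qed
  then show ?thesis
    unfolding aug_def by (subst sets_measure_of) (auto simp: sigma_algebra.sigma_sets_eq dest: sets.sets_into_space)
qed

lemma sets_aug_iff:
  assumes "subalgebra M F"
  shows "E \<in> sets (aug M F) \<longleftrightarrow> E \<in> sets M \<and> (\<exists>A\<in>sets F. AE \<omega> in M. \<omega> \<in> E \<longleftrightarrow> \<omega> \<in> A)"
  by (simp add: sets_aug[OF assms])

lemma sets_aug_subset: "subalgebra M F \<Longrightarrow> sets (aug M F) \<subseteq> sets M"
  by (auto simp: sets_aug)

lemma sets_subset_aug: "subalgebra M F \<Longrightarrow> sets F \<subseteq> sets (aug M F)"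
  by (auto simp: sets_aug subalgebra_def)

lemma aug_mono: "subalgebra M F \<Longrightarrow> subalgebra M G \<Longrightarrow> sets F \<subseteq> sets G \<Longrightarrow> sets (aug M F) \<subseteq> sets (aug M G)"
  by (auto simp: sets_aug)

lemma AE_mem_aug: "subalgebra M F \<Longrightarrow> E \<in> sets M \<Longrightarrow> AE \<omega> in M. \<omega> \<in> E \<Longrightarrow> E \<in> sets (aug M F)"
proof -
  assume F: "subalgebra M F" and E: "E \<in> sets M" and ae: "AE \<omega> in M. \<omega> \<in> E"
  have "space M \<in> sets F" using F sets.top[of F] by (simp add: subalgebra_def)
  moreover have "AE \<omega> in M. \<omega> \<in> E \<longleftrightarrow> \<omega> \<in> space M"
    using ae AE_space by eventually_elim simp
  ultimately have "\<exists>A\<in>sets F. AE \<omega> in M. \<omega> \<in> E \<longleftrightarrow> \<omega> \<in> A" by (rule_tac bexI)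
  with E show "E \<in> sets (aug M F)" by (simp add: sets_aug_iff[OF F])
qed

lemma measurable_subalgebra_mono:
  "f \<in> measurable F N \<Longrightarrow> sets F \<subseteq> sets G \<Longrightarrow> space F = space G \<Longrightarrow> f \<in> measurable G N"
  unfolding measurable_def by auto

text \<open>Induction over the construction of a measurable function: indicators, multiples, sums
  and countable suprema each meet at most countably many null sets.\<close>

lemma aug_version_ennreal:
  fixes f :: "'w \<Rightarrow> ennreal"
  assumes F: "subalgebra M F" and f: "f \<in> borel_measurable (aug M F)"
  shows "\<exists>g\<in>borel_measurable F. AE \<omega> in M. f \<omega> = g \<omega>"
  using f
proof (induct rule: borel_measurable_induct)
  case (cong f g)
  from cong(4) obtain h where h: "h \<in> borel_measurable F" "AE \<omega> in M. g \<omega> = h \<omega>" by (rule bexE)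
  have "AE \<omega> in M. f \<omega> = h \<omega>" using h(2) AE_space
    by eventually_elim (simp add: cong(3)[symmetric])
  with h(1) show ?case by (rule_tac bexI)
next
  case (set E)
  then obtain A where A: "A \<in> sets F" "AE \<omega> in M. \<omega> \<in> E \<longleftrightarrow> \<omega> \<in> A"
    by (auto simp: sets_aug_iff[OF F])
  have "AE \<omega> in M. indicator E \<omega> = (indicator A \<omega> :: ennreal)"
    using A(2) by eventually_elim (auto simp: indicator_def)
  then show ?case using A(1) by (intro bexI[of _ "indicator A"]) auto
next
  case (mult u c)
  from mult(4) obtain h where h: "h \<in> borel_measurable F" "AE \<omega> in M. u \<omega> = h \<omega>" by (rule bexE)
  have "AE \<omega> in M. c * u \<omega> = c * h \<omega>" using h(2) by eventually_elim auto
  then show ?case using h(1) by (intro bexI[of _ "\<lambda>\<omega>. c * h \<omega>"]) auto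
next
  case (add u v)
  from add(3) obtain h where h1: "h \<in> borel_measurable F" "AE \<omega> in M. u \<omega> = h \<omega>" by (rule bexE)
  from add(7) obtain k where k1: "k \<in> borel_measurable F" "AE \<omega> in M. v \<omega> = k \<omega>" by (rule bexE)
  note h = h1 k1
  have "AE \<omega> in M. v \<omega> + u \<omega> = k \<omega> + h \<omega>" using h(2,4) by eventually_elim auto
  then show ?case using h(1,3) by (intro bexI[of _ "\<lambda>\<omega>. k \<omega> + h \<omega>"]) auto
next
  case (seq U)
  have "\<forall>i. \<exists>h\<in>borel_measurable F. AE \<omega> in M. U i \<omega> = h \<omega>" using seq(3) by blast
  then obtain h where h: "\<And>i. h i \<in> borel_measurable F" "\<And>i. AE \<omega> in M. U i \<omega> = h i \<omega>" by metis
  have "AE \<omega> in M. \<forall>i. U i \<omega> = h i \<omega>" using h(2) by (simp add: AE_all_countable)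
  then have "AE \<omega> in M. (SUP i. U i) \<omega> = (SUP i. h i \<omega>)"
    by eventually_elim (simp add: image_comp)
  then show ?case using h(1) by (intro bexI[of _ "\<lambda>\<omega>. SUP i. h i \<omega>"]) auto
qed

lemma aug_version_real:
  fixes f :: "'w \<Rightarrow> real"
  assumes F: "subalgebra M F" and f: "f \<in> borel_measurable (aug M F)"
  shows "\<exists>g\<in>borel_measurable F. AE \<omega> in M. f \<omega> = g \<omega>"
proof -
  have "(\<lambda>\<omega>. ennreal (f \<omega>)) \<in> borel_measurable (aug M F)"
       "(\<lambda>\<omega>. ennreal (- f \<omega>)) \<in> borel_measurable (aug M F)" using f by auto
  from this[THEN aug_version_ennreal[OF F]] obtain g h where
    g: "g \<in> borel_measurable F" "AE \<omega> in M. ennreal (f \<omega>) = g \<omega>" and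
    h: "h \<in> borel_measurable F" "AE \<omega> in M. ennreal (- f \<omega>) = h \<omega>" by auto
  have "AE \<omega> in M. f \<omega> = enn2real (g \<omega>) - enn2real (h \<omega>)"
    using g(2) h(2)
  proof eventually_elim
    case (elim \<omega>)
    show ?case unfolding elim[symmetric] by (cases "f \<omega> \<ge> 0") (auto simp: enn2real_ennreal ennreal_neg)
  qed
  then show ?thesis using g(1) h(1) by (intro bexI[of _ "\<lambda>\<omega>. enn2real (g \<omega>) - enn2real (h \<omega>)"]) auto
qed

text \<open>The predictable \<open>\<sigma>\<close>-algebra on \<open>\<Omega> \<times> (t0,\<infinity>)\<close>, enlarged by Borel marks.\<close>

definition mpred_gen :: "real \<Rightarrow> (real \<Rightarrow> 'w measure) \<Rightarrow> ('w \<times> real \<times> real) set set" where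
  "mpred_gen t0 H = {F \<times> ({q<..r} \<times> X) | F q r X. t0 \<le> q \<and> F \<in> sets (H q) \<and> X \<in> sets borel}"

definition mpred :: "real \<Rightarrow> (real \<Rightarrow> 'w measure) \<Rightarrow> ('w \<times> real \<times> real) measure" where
  "mpred t0 H = sigma (space (H t0) \<times> ({t0<..} \<times> UNIV)) (mpred_gen t0 H)"

lemma space_mpred [simp]: "space (mpred t0 H) = space (H t0) \<times> ({t0<..} \<times> UNIV)"
  by (simp add: mpred_def space_measure_of_conv)

lemma sets_borel_Ioc: "sets (borel :: real measure) = sigma_sets UNIV (range (\<lambda>(a, b). {a<..b}))"
  by (subst borel_sigma_sets_Ioc) (simp add: sets_measure_of_conv)

lemma Int_stable_Ioc: "Int_stable (range (\<lambda>(a, b). {a<..b::real}))"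
proof (rule Int_stableI)
  fix A B assume "A \<in> range (\<lambda>(a, b). {a<..b::real})" "B \<in> range (\<lambda>(a, b). {a<..b::real})"
  then obtain a b c d where "A = {a<..b}" "B = {c<..d}" by auto
  then have "A \<inter> B = {max a c<..min b d}" by auto
  then show "A \<inter> B \<in> range (\<lambda>(a, b). {a<..b::real})" by auto
qed

section \<open>The predictable sets of a filtration\<close>

locale filtr =
  fixes M :: "'w measure" and t0 :: real and H :: "real \<Rightarrow> 'w measure"
  assumes sub: "\<And>t. t0 \<le> t \<Longrightarrow> subalgebra M (H t)"
    and mono: "\<And>s t. t0 \<le> s \<Longrightarrow> s \<le> t \<Longrightarrow> sets (H s) \<subseteq> sets (H t)"
begin

lemma space_H: "t0 \<le> t \<Longrightarrow> space (H t) = space M"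
  using sub by (auto simp: subalgebra_def)

lemma sets_H: "t0 \<le> t \<Longrightarrow> sets (H t) \<subseteq> sets M"
  using sub by (auto simp: subalgebra_def)

lemma measurable_H_mono: "f \<in> measurable (H s) N \<Longrightarrow> t0 \<le> s \<Longrightarrow> s \<le> t \<Longrightarrow> f \<in> measurable (H t) N"
  using space_H[of s] space_H[of t] by (intro measurable_subalgebra_mono[of f "H s" N "H t"] mono) simp_all

lemma mpred_gen_Pow: "mpred_gen t0 H \<subseteq> Pow (space M \<times> ({t0<..} \<times> UNIV))"
  unfolding mpred_gen_def using sets.sets_into_space space_H by fastforce

lemma sets_mpred: "sets (mpred t0 H) = sigma_sets (space M \<times> ({t0<..} \<times> UNIV)) (mpred_gen t0 H)"
  using mpred_gen_Pow by (simp add: mpred_def sets_measure_of_conv space_H)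

lemma mpred_rect: "t0 \<le> q \<Longrightarrow> F \<in> sets (H q) \<Longrightarrow> X \<in> sets borel \<Longrightarrow> F \<times> ({q<..r} \<times> X) \<in> sets (mpred t0 H)"
  unfolding sets_mpred by (rule sigma_sets.Basic) (auto simp: mpred_gen_def)

lemma mpred_rect_inf:
  assumes "t0 \<le> q" "F \<in> sets (H q)" "X \<in> sets borel"
  shows "F \<times> ({q<..} \<times> X) \<in> sets (mpred t0 H)"
proof -
  have "F \<times> ({q<..} \<times> X) = (\<Union>i::nat. F \<times> ({q<..q + real i} \<times> X))"
    by auto (metis add.commute diff_le_eq real_arch_simple)
  also have "\<dots> \<in> sets (mpred t0 H)" by (intro sets.countable_UN) (auto intro: mpred_rect assms)
  finally show ?thesis .
qed

text \<open>Two generators meet in times after the larger of their left ends, when both events are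
  known by \<open>mono\<close>.\<close>

lemma Int_stable_mpred_gen: "Int_stable (mpred_gen t0 H)"
proof (rule Int_stableI)
  fix A B assume "A \<in> mpred_gen t0 H" "B \<in> mpred_gen t0 H"
  then obtain F q r X F' q' r' X' where
    A: "A = F \<times> ({q<..r} \<times> X)" "t0 \<le> q" "F \<in> sets (H q)" "X \<in> sets borel" and
    B: "B = F' \<times> ({q'<..r'} \<times> X')" "t0 \<le> q'" "F' \<in> sets (H q')" "X' \<in> sets borel"
    unfolding mpred_gen_def by auto
  have "A \<inter> B = (F \<inter> F') \<times> ({max q q'<..min r r'} \<times> (X \<inter> X'))" by (auto simp: A B)
  moreover have "F \<inter> F' \<in> sets (H (max q q'))"
    using A B mono[of q "max q q'"] mono[of q' "max q q'"] by auto
  ultimately show "A \<inter> B \<in> mpred_gen t0 H"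
    unfolding mpred_gen_def using A B
    by (intro CollectI exI[of _ "F \<inter> F'"] exI[of _ "max q q'"] exI[of _ "min r r'"] exI[of _ "X \<inter> X'"]) auto
qed

lemma mpred_to_mark: "(\<lambda>(\<omega>, s, x). x) \<in> measurable (mpred t0 H) borel"
proof (rule measurableI)
  fix A :: "real set" assume A: "A \<in> sets borel"
  have "(\<lambda>(\<omega>, s, x). x) -` A \<inter> space (mpred t0 H) = space (H t0) \<times> ({t0<..} \<times> A)"
    by auto
  also have "\<dots> \<in> sets (mpred t0 H)" using A by (intro mpred_rect_inf) auto
  finally show "(\<lambda>(\<omega>, s, x). x) -` A \<inter> space (mpred t0 H) \<in> sets (mpred t0 H)" .
qed simp

text \<open>A rectangle \<open>F \<times> {a<..b}\<close> with \<open>F\<close> known at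
  \<open>q\<close>, cut to the times after \<open>q\<close>, is again a generator, because its left
  end becomes \<open>max q a\<close>. So what is known at \<open>q\<close> is, together with the
  current time, predictable after \<open>q\<close>.\<close>

lemma mpred_after:
  assumes q: "t0 \<le> q"
  shows "(\<lambda>(\<omega>, s, x). (\<omega>, s)) \<in> measurable (restrict_space (mpred t0 H) (space M \<times> ({q<..} \<times> UNIV))) (H q \<Otimes>\<^sub>M borel)"
  (is "?f \<in> measurable ?R _")
proof (rule measurable_sigma_sets[OF sets_pair_measure pair_measure_closed])
  show "?f \<in> space ?R \<rightarrow> space (H q) \<times> space borel"
    using q by (auto simp: space_restrict_space space_H)
  fix Y assume "Y \<in> {a \<times> b |a b. a \<in> sets (H q) \<and> b \<in> sets (borel :: real measure)}"
  then obtain F B where Y: "Y = F \<times> B" "F \<in> sets (H q)" "B \<in> sets borel" by auto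
  have FM: "F \<subseteq> space M" using Y sets.sets_into_space space_H[OF q] by blast
  have S: "space M \<times> ({q<..} \<times> UNIV) \<in> sets (mpred t0 H)"
    using mpred_rect_inf[OF q sets.top[of "H q"], of UNIV] by (simp add: space_H q)
  have S': "space M \<times> {q<..} \<times> (UNIV::real set) \<inter> space M \<times> {t0<..} \<times> UNIV = space M \<times> {q<..} \<times> UNIV"
    using q by auto
  have Ioc_Pow: "range (\<lambda>(a, b). {a<..b::real}) \<subseteq> Pow UNIV" by simp
  have *: "F \<times> (({q<..} \<inter> B) \<times> UNIV) \<in> sets (mpred t0 H)"
    using Int_stable_Ioc Ioc_Pow Y(3) unfolding sets_borel_Ioc
  proof (induct rule: sigma_sets_induct_disjoint)
    case (basic A)
    then obtain a b where A: "A = {a<..b}" by auto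
    have "F \<times> (({q<..} \<inter> A) \<times> (UNIV::real set)) = F \<times> ({max q a<..b} \<times> UNIV)" by (auto simp: A)
    also have "\<dots> \<in> sets (mpred t0 H)"
      using q Y(2) mono[of q "max q a"] by (intro mpred_rect) auto
    finally show ?case .
  next
    case empty then show ?case by simp
  next
    case (compl A)
    have "F \<times> (({q<..} \<inter> (UNIV - A)) \<times> (UNIV::real set)) =
          F \<times> ({q<..} \<times> UNIV) - F \<times> (({q<..} \<inter> A) \<times> UNIV)" by auto
    also have "\<dots> \<in> sets (mpred t0 H)"
      using q Y(2) compl by (intro sets.Diff mpred_rect_inf) auto
    finally show ?case .
  next
    case (union A)
    have "F \<times> (({q<..} \<inter> \<Union>(range A)) \<times> (UNIV::real set)) = (\<Union>i. F \<times> (({q<..} \<inter> A i) \<times> UNIV))" by auto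
    also have "\<dots> \<in> sets (mpred t0 H)" using union by (intro sets.countable_UN) auto
    finally show ?case .
  qed
  have "?f -` Y \<inter> space ?R = F \<times> (({q<..} \<inter> B) \<times> UNIV)"
    using Y FM q by (auto simp: space_restrict_space space_H)
  also have "\<dots> \<in> sets ?R"
    using * S FM S' by (subst sets_restrict_space_iff) (auto simp: space_H)
  finally show "?f -` Y \<inter> space ?R \<in> sets ?R" .
qed

text \<open>Generators that start at \<open>q \<le> t\<close> use events known at \<open>t\<close>,
  and the others have no times in \<open>{..t}\<close>. This turns predictability of a region into
  adaptedness of the points selected by it.\<close>

lemma mpred_before:
  assumes t: "t0 \<le> t" and C: "C \<in> sets (mpred t0 H)"
  shows "C \<inter> (UNIV \<times> ({..t} \<times> UNIV)) \<in> sets (H t \<Otimes>\<^sub>M borel)"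
  using Int_stable_mpred_gen mpred_gen_Pow C unfolding sets_mpred
proof (induct rule: sigma_sets_induct_disjoint)
  case (basic A)
  then obtain F q r X where A: "A = F \<times> ({q<..r} \<times> X)" "t0 \<le> q" "F \<in> sets (H q)" "X \<in> sets borel"
    unfolding mpred_gen_def by auto
  show ?case
  proof (cases "q \<le> t")
    case True
    then have "F \<in> sets (H t)" using A mono by auto
    moreover have "A \<inter> (UNIV \<times> ({..t} \<times> UNIV)) = F \<times> ({q<..min r t} \<times> X)" by (auto simp: A)
    moreover have "{q<..min r t} \<times> X \<in> sets borel" using A by (auto simp: borel_prod[symmetric])
    ultimately show ?thesis by auto
  next
    case False
    then have "A \<inter> (UNIV \<times> ({..t} \<times> UNIV)) = {}" by (auto simp: A)
    then show ?thesis by simp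
  qed
next
  case empty then show ?case by simp
next
  case (compl A)
  have "(space M \<times> ({t0<..} \<times> UNIV) - A) \<inter> (UNIV \<times> ({..t} \<times> UNIV)) =
     space (H t) \<times> ({t0<..t} \<times> UNIV) - A \<inter> (UNIV \<times> ({..t} \<times> UNIV))" using t by (auto simp: space_H)
  also have "\<dots> \<in> sets (H t \<Otimes>\<^sub>M borel)"
    using compl by (intro sets.Diff pair_measureI) (auto simp: borel_prod[symmetric])
  finally show ?case .
next
  case (union A)
  have "\<Union>(range A) \<inter> (UNIV \<times> ({..t} \<times> UNIV)) = (\<Union>i. A i \<inter> (UNIV \<times> ({..t} \<times> UNIV)))" by auto
  moreover have "range (\<lambda>i. A i \<inter> (UNIV \<times> ({..t} \<times> UNIV))) \<subseteq> sets (H t \<Otimes>\<^sub>M borel)"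
    using union(3) by auto
  ultimately show ?case by (metis sets.countable_UN)
qed

lemma mpred_subset: "C \<in> sets (mpred t0 H) \<Longrightarrow> C \<in> sets (M \<Otimes>\<^sub>M borel)"
proof -
  assume C: "C \<in> sets (mpred t0 H)"
  have "C = (\<Union>i::nat. C \<inter> (UNIV \<times> ({..t0 + real i} \<times> UNIV)))"
    by auto (metis add.commute diff_le_eq real_arch_simple)
  also have "\<dots> \<in> sets (M \<Otimes>\<^sub>M borel)"
  proof (intro sets.countable_UN)
    have "C \<inter> (UNIV \<times> ({..t0 + real i} \<times> UNIV)) \<in> sets (M \<Otimes>\<^sub>M borel)" for i
    proof -
      have "sets (H (t0 + real i) \<Otimes>\<^sub>M (borel :: (real \<times> real) measure)) \<subseteq> sets (M \<Otimes>\<^sub>M borel)"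
        unfolding sets_pair_measure space_H[of "t0 + real i", simplified] using sets_H[of "t0 + real i"]
        by (intro sigma_sets_mono') auto
      then show ?thesis using mpred_before[OF _ C, of "t0 + real i"] by auto
    qed
    then show "range (\<lambda>i. C \<inter> (UNIV \<times> ({..t0 + real i} \<times> UNIV))) \<subseteq> sets (M \<Otimes>\<^sub>M borel)" by auto
  qed
  finally show "C \<in> sets (M \<Otimes>\<^sub>M borel)" .
qed

lemma filtr_aug: "filtr M t0 (\<lambda>t. aug M (H t))"
proof
  fix t assume "t0 \<le> t"
  then show "subalgebra M (aug M (H t))"
    using sets_aug_subset[OF sub] by (auto simp: subalgebra_def)
next
  fix s t :: real assume "t0 \<le> s" "s \<le> t"
  then show "sets (aug M (H s)) \<subseteq> sets (aug M (H t))"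
    by (intro aug_mono sub mono) auto
qed

text \<open>A generator for the augmented filtration and its version differ over a null set of
  outcomes only, for all times and marks at once, and complements and countable unions preserve
  this. It matters that \<open>y\<close> is quantified inside the almost sure statement, since the
  sets are evaluated at random atoms.\<close>

lemma mpred_aug_version:
  assumes "C \<in> sets (mpred t0 (\<lambda>t. aug M (H t)))"
  shows "\<exists>C'\<in>sets (mpred t0 H). AE \<omega> in M. \<forall>y. (\<omega>, y) \<in> C \<longleftrightarrow> (\<omega>, y) \<in> C'"
proof -
  interpret A: filtr M t0 "\<lambda>t. aug M (H t)" by (rule filtr_aug)
  show ?thesis
    using assms unfolding A.sets_mpred
  proof (induct rule: sigma_sets.induct)
    case (Basic C)
    then obtain F q r X where C: "C = F \<times> ({q<..r} \<times> X)" "t0 \<le> q" "F \<in> sets (aug M (H q))" "X \<in> sets borel"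
      unfolding mpred_gen_def by auto
    then obtain F' where F': "F' \<in> sets (H q)" "AE \<omega> in M. \<omega> \<in> F \<longleftrightarrow> \<omega> \<in> F'"
      by (auto simp: sets_aug_iff[OF sub])
    have "AE \<omega> in M. \<forall>y. (\<omega>, y) \<in> C \<longleftrightarrow> (\<omega>, y) \<in> F' \<times> ({q<..r} \<times> X)"
      using F'(2) by eventually_elim (auto simp: C)
    then show ?case using mpred_rect[OF C(2) F'(1) C(4)] by (rule bexI)
  next
    case Empty then show ?case by (intro bexI[of _ "{}"]) auto
  next
    case (Compl C)
    then obtain C' where C': "C' \<in> sets (mpred t0 H)" "AE \<omega> in M. \<forall>y. (\<omega>, y) \<in> C \<longleftrightarrow> (\<omega>, y) \<in> C'" by auto
    have "AE \<omega> in M. \<forall>y. (\<omega>, y) \<in> space M \<times> ({t0<..} \<times> UNIV) - C \<longleftrightarrow> (\<omega>, y) \<in> space (mpred t0 H) - C'"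
      using C'(2) by eventually_elim (auto simp: space_H)
    then show ?case using sets.compl_sets[OF C'(1)] by (rule bexI)
  next
    case (Union C)
    have "\<forall>i. \<exists>C'. C' \<in> sets (mpred t0 H) \<and> (AE \<omega> in M. \<forall>y. (\<omega>, y) \<in> C i \<longleftrightarrow> (\<omega>, y) \<in> C')"
      using Union(2) unfolding Bex_def by (rule allI)
    from choice[OF this] obtain C' where C'0:
      "\<forall>i. C' i \<in> sets (mpred t0 H) \<and> (AE \<omega> in M. \<forall>y. (\<omega>, y) \<in> C i \<longleftrightarrow> (\<omega>, y) \<in> C' i)" by (rule exE)
    then have C': "\<And>i. C' i \<in> sets (mpred t0 H)"
      "\<And>i. AE \<omega> in M. \<forall>y. (\<omega>, y) \<in> C i \<longleftrightarrow> (\<omega>, y) \<in> C' i" by blast+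
    have "AE \<omega> in M. \<forall>i. \<forall>y. (\<omega>, y) \<in> C i \<longleftrightarrow> (\<omega>, y) \<in> C' i"
      using C'(2) by (simp add: AE_all_countable)
    then have "AE \<omega> in M. \<forall>y. (\<omega>, y) \<in> \<Union>(range C) \<longleftrightarrow> (\<omega>, y) \<in> \<Union>(range C')"
      by eventually_elim auto
    moreover have "\<Union>(range C') \<in> sets (mpred t0 H)" using C'(1) by auto
    ultimately show ?case by (rule bexI)
  qed
qed

end

section \<open>Thinning without completing the filtration\<close>

text \<open>A finite subset of a directed union lies in one member, so counts are continuous along
  directed families. The families below are indexed by rationals but do not increase with the index,
  so the version for increasing sequences does not fit.\<close>

lemma npoints_UN_directed:
  assumes dir: "\<And>i j. i \<in> I \<Longrightarrow> j \<in> I \<Longrightarrow> \<exists>k\<in>I. F i \<union> F j \<subseteq> F k" and ne: "I \<noteq> {}"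
  shows "npoints (\<Union>i\<in>I. F i) = (SUP i\<in>I. npoints (F i))"
proof (rule antisym)
  have fin: "\<exists>k\<in>I. S \<subseteq> F k" if "finite S" "S \<subseteq> (\<Union>i\<in>I. F i)" for S
    using that
  proof (induct S)
    case empty then show ?case using ne by auto
  next
    case (insert x S)
    then obtain k j where k: "k \<in> I" "S \<subseteq> F k" "j \<in> I" "x \<in> F j" by auto
    from dir[OF k(1,3)] obtain l where "l \<in> I" "F k \<union> F j \<subseteq> F l" by auto
    then show ?case using k by (intro bexI[of _ l]) auto
  qed
  show "npoints (\<Union>i\<in>I. F i) \<le> (SUP i\<in>I. npoints (F i))"
  proof (cases "finite (\<Union>i\<in>I. F i)")
    case True
    from fin[OF this subset_refl] obtain k where k: "k \<in> I" "(\<Union>i\<in>I. F i) \<subseteq> F k" by auto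
    then have "npoints (\<Union>i\<in>I. F i) \<le> npoints (F k)" by (intro npoints_mono)
    also have "\<dots> \<le> (SUP i\<in>I. npoints (F i))" using k by (intro SUP_upper)
    finally show ?thesis .
  next
    case False
    have "of_nat c \<le> (SUP i\<in>I. npoints (F i))" for c :: nat
    proof -
      from infinite_arbitrarily_large[OF False] obtain S where
        S: "finite S" "card S = c" "S \<subseteq> (\<Union>i\<in>I. F i)" by blast
      from fin[OF S(1,3)] obtain k where k: "k \<in> I" "S \<subseteq> F k" by auto
      have "of_nat c = npoints S" using S by (simp add: npoints_finite)
      also have "\<dots> \<le> npoints (F k)" by (intro npoints_mono k)
      also have "\<dots> \<le> (SUP i\<in>I. npoints (F i))" using k by (intro SUP_upper)
      finally show ?thesis .
    qed
    then have "(SUP c. of_nat c) \<le> (SUP i\<in>I. npoints (F i))" by (rule SUP_least)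
    then have *: "(SUP i\<in>I. npoints (F i)) = \<top>"
      unfolding ennreal_SUP_of_nat_eq_top by (rule top_le)
    show ?thesis unfolding * by (rule top_greatest)
  qed
  show "(SUP i\<in>I. npoints (F i)) \<le> npoints (\<Union>i\<in>I. F i)"
    by (intro SUP_least npoints_mono) auto
qed

text \<open>Emptied where it is infinite, a random set is finite everywhere, as counting in random
  sections requires; the event of finiteness can be seen from the count itself.\<close>

lemma measurable_point_sets_If_finite:
  assumes "A \<in> measurable H point_sets"
  shows "(\<lambda>\<omega>. if finite (A \<omega>) then A \<omega> else {}) \<in> measurable H point_sets"
  unfolding measurable_point_sets_iff
proof
  fix B :: "'b set" assume B: "B \<in> sets borel"
  have [measurable]: "(\<lambda>\<omega>. npoints (A \<omega>)) \<in> borel_measurable H" "(\<lambda>\<omega>. npoints (A \<omega> \<inter> B)) \<in> borel_measurable H"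
    using measurable_npoints[OF assms, of UNIV] measurable_npoints[OF assms B] by auto
  have "(\<lambda>\<omega>. if npoints (A \<omega>) < \<infinity> then npoints (A \<omega> \<inter> B) else 0) \<in> borel_measurable H"
    by measurable
  also have "(\<lambda>\<omega>. if npoints (A \<omega>) < \<infinity> then npoints (A \<omega> \<inter> B) else 0) =
     (\<lambda>\<omega>. npoints ((if finite (A \<omega>) then A \<omega> else {}) \<inter> B))"
    by (simp only: npoints_less_top_iff) (simp add: fun_eq_iff)
  finally show "\<dots> \<in> borel_measurable H" .
qed

lemma borel_Times_UNIV: "B \<in> sets borel \<Longrightarrow> B \<times> X \<in> sets borel" if "X \<in> sets borel"
  for B X :: "real set"
  using that by (auto simp: borel_prod[symmetric])

text \<open>The marks are bounded from above only: the atoms to which this is applied have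
  nonnegative marks.\<close>

definition loc_fin :: "real \<Rightarrow> (real \<times> real) set \<Rightarrow> real \<Rightarrow> bool" where
  "loc_fin t0 A r \<longleftrightarrow> (\<forall>i::nat. finite (A \<inter> ({t0<..r} \<times> {..real i})))"

definition loc_fin_left :: "real \<Rightarrow> (real \<times> real) set \<Rightarrow> real \<Rightarrow> bool" where
  "loc_fin_left t0 A s \<longleftrightarrow> (\<forall>i::nat. finite (A \<inter> ({t0<..<s} \<times> {..real i})))"

definition raw_atoms :: "real \<Rightarrow> ('w \<Rightarrow> (real \<times> real) set) \<Rightarrow> ('w \<times> real \<times> real) set \<Rightarrow> 'w \<Rightarrow> (real \<times> real) set" where
  "raw_atoms t0 A C \<omega> = {(s, x) \<in> A \<omega>. t0 < s \<and>
     ((\<exists>r<s. \<not> loc_fin t0 (A \<omega>) r) \<or> loc_fin_left t0 (A \<omega>) s \<and> (\<omega>, s, x) \<in> C)}"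

definition raw_times :: "real \<Rightarrow> ('w \<Rightarrow> (real \<times> real) set) \<Rightarrow> ('w \<times> real \<times> real) set \<Rightarrow> 'w \<Rightarrow> real set" where
  "raw_times t0 A C \<omega> = fst ` raw_atoms t0 A C \<omega>"

lemma finite_Int_Times_mono:
  assumes "\<forall>i::'i. finite (A \<inter> (S \<times> X i))" and "S' \<subseteq> S"
  shows "\<forall>i. finite (A \<inter> (S' \<times> X i))"
proof
  fix i
  have "A \<inter> (S' \<times> X i) \<subseteq> A \<inter> (S \<times> X i)" using assms(2) by auto
  then show "finite (A \<inter> (S' \<times> X i))" using assms(1) finite_subset by blast
qed

lemma loc_fin_mono: "loc_fin t0 A r \<Longrightarrow> r' \<le> r \<Longrightarrow> loc_fin t0 A r'"
  unfolding loc_fin_def by (erule finite_Int_Times_mono) auto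

lemma loc_fin_le: "r \<le> t0 \<Longrightarrow> loc_fin t0 A r"
  unfolding loc_fin_def by auto

lemma loc_fin_left_mono: "loc_fin_left t0 A r \<Longrightarrow> r' \<le> r \<Longrightarrow> loc_fin_left t0 A r'"
  unfolding loc_fin_left_def by (erule finite_Int_Times_mono) auto

lemma loc_fin_imp_left: "loc_fin t0 A r \<Longrightarrow> s \<le> r \<Longrightarrow> loc_fin_left t0 A s"
  unfolding loc_fin_def loc_fin_left_def by (erule finite_Int_Times_mono) auto

text \<open>By \<open>uni\<close> there is at most one atom at the time \<open>s\<close>
  itself.\<close>

lemma loc_fin_of_left:
  assumes "loc_fin_left t0 A s" and uni: "\<And>x x'. (s, x) \<in> A \<Longrightarrow> (s, x') \<in> A \<Longrightarrow> x = x'"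
  shows "loc_fin t0 A s"
  unfolding loc_fin_def
proof
  fix i :: nat
  have "finite (A \<inter> ({s} \<times> UNIV))"
  proof (cases "\<exists>x. (s, x) \<in> A")
    case True
    then obtain x where "(s, x) \<in> A" by auto
    then have "A \<inter> ({s} \<times> UNIV) \<subseteq> {(s, x)}" using uni by auto
    then show ?thesis by (rule finite_subset) simp
  next
    case False
    then have "A \<inter> ({s} \<times> UNIV) = {}" by auto
    then show ?thesis by simp
  qed
  moreover have "finite (A \<inter> ({t0<..<s} \<times> {..real i}))" using assms by (auto simp: loc_fin_left_def)
  moreover have "A \<inter> ({t0<..s} \<times> {..real i}) \<subseteq> A \<inter> ({s} \<times> UNIV) \<union> A \<inter> ({t0<..<s} \<times> {..real i})" by auto
  ultimately show "finite (A \<inter> ({t0<..s} \<times> {..real i}))" by (meson finite_UnI finite_subset)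
qed

text \<open>Failure of \<open>loc_fin\<close> passes to larger times, so there is a rational
  witness; conditions on an accumulation in the past become countable unions.\<close>

lemma ex_Rats_not_loc_fin:
  "(\<exists>r<s. \<not> loc_fin t0 A r) \<longleftrightarrow> (\<exists>r\<in>\<rat>. r < s \<and> \<not> loc_fin t0 A r)"
  by (meson Rats_dense_in_real loc_fin_mono less_imp_le)

text \<open>
  Up to a null set the atoms are locally finite, but the filtration is not complete, and the thinned
  set has to be measurable without that null set.  After the atoms have accumulated from the right
  (which is known immediately afterwards) all atoms are kept, and at a time at which they
  accumulate from the left none is: then an infinite number of atoms in a Borel set does not hide
  whether the atom at the accumulation time belongs to the thinned set.
\<close>

context filtr begin

lemma raw_times_measurable:
  fixes A :: "'w \<Rightarrow> (real \<times> real) set"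
  assumes pos: "\<And>\<omega>. \<omega> \<in> space M \<Longrightarrow> A \<omega> \<subseteq> UNIV \<times> {0..}"
    and uni: "\<And>\<omega> s x x'. \<omega> \<in> space M \<Longrightarrow> (s, x) \<in> A \<omega> \<Longrightarrow> (s, x') \<in> A \<omega> \<Longrightarrow> x = x'"
    and ad: "\<And>t. t0 \<le> t \<Longrightarrow> (\<lambda>\<omega>. A \<omega> \<inter> ({..t} \<times> {0..})) \<in> measurable (H t) point_sets"
    and C: "C \<in> sets (mpred t0 H)" and t: "t0 \<le> t"
  shows "(\<lambda>\<omega>. raw_times t0 A C \<omega> \<inter> {..t}) \<in> measurable (H t) point_sets"
  unfolding measurable_point_sets_iff
proof
  fix B :: "real set" assume B: "B \<in> sets borel"
  \<comment> \<open>The points to be counted have \<open>s \<le> t\<close>, so a rational witness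
    \<open>r < s\<close> is below \<open>t\<close>, and \<open>loc_fin\<close> at \<open>r\<close>
    is known at time \<open>t\<close>.\<close>
  define R where "R = \<rat> \<inter> {..<t}"
  have R: "countable R" "R \<noteq> {}"
    using Rats_dense_in_real[of "t - 1" t] by (auto simp: R_def countable_rat)
  have sp: "space (H t) = space M" by (rule space_H[OF t])
  have spH: "space M \<in> sets (H t)" using sets.top[of "H t"] by (simp add: sp)
  have cnt: "(\<lambda>\<omega>. A \<omega> \<inter> (S \<times> X)) \<in> measurable (H t) point_sets"
    if "S \<in> sets borel" "X \<in> sets borel" "S \<subseteq> {..t}" for S X
  proof -
    have "(\<lambda>\<omega>. A \<omega> \<inter> ({..t} \<times> {0..}) \<inter> (S \<times> X)) \<in> measurable (H t) point_sets"
      by (intro measurable_point_sets_Int ad t borel_Times_UNIV that)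
    also have "?this \<longleftrightarrow> ?thesis"
    proof (rule measurable_cong)
      fix \<omega> assume "\<omega> \<in> space (H t)"
      then have "A \<omega> \<subseteq> UNIV \<times> {0..}" using pos sp by simp
      then show "A \<omega> \<inter> ({..t} \<times> {0..}) \<inter> (S \<times> X) = A \<omega> \<inter> (S \<times> X)" using that(3) by auto
    qed
    finally show ?thesis .
  qed
  have cntn: "(\<lambda>\<omega>. npoints (A \<omega> \<inter> (S \<times> X))) \<in> borel_measurable (H t)"
    if "S \<in> sets borel" "X \<in> sets borel" "S \<subseteq> {..t}" for S X
    using measurable_npoints[OF cnt[OF that], of UNIV] by simp
  have lf: "{\<omega> \<in> space M. loc_fin t0 (A \<omega>) r} \<in> sets (H t)" if "r \<le> t" for r
  proof -
    have [measurable]: "(\<lambda>\<omega>. npoints (A \<omega> \<inter> ({t0<..r} \<times> {..real i}))) \<in> borel_measurable (H t)" for i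
      using that by (intro cntn) auto
    have "{\<omega> \<in> space (H t). \<forall>i. npoints (A \<omega> \<inter> ({t0<..r} \<times> {..real i})) < \<infinity>} \<in> sets (H t)"
      by measurable
    then show ?thesis by (simp only: npoints_less_top_iff loc_fin_def sp)
  qed
  have FB: "{\<omega> \<in> space M. \<forall>i::nat. finite (A \<omega> \<inter> (({t0<..t} \<inter> B) \<times> {..real i}))} \<in> sets (H t)"
  proof -
    have [measurable]: "(\<lambda>\<omega>. npoints (A \<omega> \<inter> (({t0<..t} \<inter> B) \<times> {..real i}))) \<in> borel_measurable (H t)" for i
      using B by (intro cntn) auto
    have "{\<omega> \<in> space (H t). \<forall>i. npoints (A \<omega> \<inter> (({t0<..t} \<inter> B) \<times> {..real i})) < \<infinity>} \<in> sets (H t)"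
      by measurable
    then show ?thesis by (simp only: npoints_less_top_iff sp)
  qed
  \<comment> \<open>\<open>Z2\<close> collects the points after an accumulation of atoms, all of
    which are kept; \<open>Z1\<close> those with locally finite atoms before them that are selected
    by \<open>C\<close>.\<close>
  define Z1 Z2 where "Z1 \<omega> = {(s, x) \<in> A \<omega>. t0 < s \<and> s \<le> t \<and> s \<in> B \<and> loc_fin_left t0 (A \<omega>) s \<and> (\<omega>, s, x) \<in> C}"
    and "Z2 \<omega> = {(s, x) \<in> A \<omega>. t0 < s \<and> s \<le> t \<and> s \<in> B \<and> (\<exists>r<s. \<not> loc_fin t0 (A \<omega>) r)}" for \<omega>
  have Z2_m: "(\<lambda>\<omega>. npoints (Z2 \<omega>)) \<in> borel_measurable (H t)"
  proof -
    have "(\<lambda>\<omega>. SUP r\<in>R. if \<omega> \<in> {\<omega> \<in> space M. loc_fin t0 (A \<omega>) r} then 0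
        else npoints (A \<omega> \<inter> ((B \<inter> {r<..t}) \<times> UNIV))) \<in> borel_measurable (H t)"
      using B lf by (intro borel_measurable_SUP R measurable_If_set cntn)
        (auto simp: R_def sp spH Int_absorb1 intro!: sets.Int)
    also have "?this \<longleftrightarrow> ?thesis"
    proof (rule measurable_cong)
      fix \<omega> assume w: "\<omega> \<in> space (H t)"
      define F where "F r = (if loc_fin t0 (A \<omega>) r then {} else A \<omega> \<inter> ((B \<inter> {r<..t}) \<times> UNIV))" for r
      have "Z2 \<omega> = (\<Union>r\<in>R. F r)"
        unfolding Z2_def ex_Rats_not_loc_fin
        by (auto simp: F_def R_def split: if_splits) (metis linorder_not_less loc_fin_le order_less_le_trans less_imp_le)+
      also have "npoints \<dots> = (SUP r\<in>R. npoints (F r))"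
      proof (rule npoints_UN_directed)
        fix i j assume "i \<in> R" "j \<in> R"
        \<comment> \<open>Where \<open>loc_fin\<close> fails, the smaller index gives the larger
          set; where it holds, the set is empty.\<close>
        then show "\<exists>k\<in>R. F i \<union> F j \<subseteq> F k"
          by (intro bexI[of _ "if loc_fin t0 (A \<omega>) i then j else if loc_fin t0 (A \<omega>) j then i else min i j"])
             (auto simp: F_def min_def)
      qed (rule R)
      also have "\<dots> = (SUP r\<in>R. if \<omega> \<in> {\<omega> \<in> space M. loc_fin t0 (A \<omega>) r} then 0
        else npoints (A \<omega> \<inter> ((B \<inter> {r<..t}) \<times> UNIV)))"
        using w by (intro SUP_cong) (auto simp: F_def sp)
      finally show "(SUP r\<in>R. if \<omega> \<in> {\<omega> \<in> space M. loc_fin t0 (A \<omega>) r} then 0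
        else npoints (A \<omega> \<inter> ((B \<inter> {r<..t}) \<times> UNIV))) = npoints (Z2 \<omega>)" by simp
    qed
    finally show ?thesis .
  qed
  \<comment> \<open>\<open>D\<close> and \<open>K\<close> express the two conditions on the time
    \<open>s\<close> by jointly measurable sets, which can then be used for random sections.\<close>
  define D where "D = {(\<omega>, s, x) \<in> space M \<times> ({..t} \<times> (UNIV::real set)). \<exists>r<s. \<not> loc_fin t0 (A \<omega>) r}"
  have D: "D \<in> sets (H t \<Otimes>\<^sub>M borel)"
  proof -
    have "D = (\<Union>r\<in>R. (space M - {\<omega> \<in> space M. loc_fin t0 (A \<omega>) r}) \<times> ({r<..t} \<times> UNIV))"
      unfolding D_def ex_Rats_not_loc_fin by (auto simp: R_def)
    also have "\<dots> \<in> sets (H t \<Otimes>\<^sub>M borel)"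
      using lf by (intro sets.countable_UN' R image_subsetI pair_measureI borel_Times_UNIV)
        (auto simp: R_def sp[symmetric] intro!: sets.compl_sets)
    finally show ?thesis .
  qed
  define K where "K = {(\<omega>, s, x) \<in> space M \<times> ({..t} \<times> (UNIV::real set)). loc_fin_left t0 (A \<omega>) s}"
  have K: "K \<in> sets (H t \<Otimes>\<^sub>M borel)"
  proof -
    define c where "c i r \<omega> = npoints (A \<omega> \<inter> ({t0<..r} \<times> {..real i}))" for i :: nat and r \<omega>
    have c[measurable]: "c i r \<in> borel_measurable (H t)" if "r \<in> R" for i r
      unfolding c_def using that by (intro cntn) (auto simp: R_def)
    \<comment> \<open>The open interval up to \<open>s\<close> is exhausted by the closed ones up to
      rational \<open>r < s\<close>, so the count depends measurably on the outcome and on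
      \<open>s\<close> jointly.\<close>
    have *: "npoints (A \<omega> \<inter> ({t0<..<s} \<times> {..real i})) = (SUP r\<in>R. if r < s then c i r \<omega> else 0)"
      if "s \<le> t" for \<omega> s i
    proof -
      define F where "F r = (if r < s then A \<omega> \<inter> ({t0<..r} \<times> {..real i}) else {})" for r
      have "A \<omega> \<inter> ({t0<..<s} \<times> {..real i}) = (\<Union>r\<in>R. F r)"
      proof (intro set_eqI iffI)
        fix y assume y: "y \<in> A \<omega> \<inter> ({t0<..<s} \<times> {..real i})"
        then obtain r where "r \<in> \<rat>" "fst y < r" "r < s" using Rats_dense_in_real[of "fst y" s] by auto
        then show "y \<in> (\<Union>r\<in>R. F r)"
          using y that by (intro UN_I[of r]) (auto simp: F_def R_def)
      qed (auto simp: F_def split: if_splits)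
      also have "npoints \<dots> = (SUP r\<in>R. npoints (F r))"
      proof (rule npoints_UN_directed)
        fix i j assume "i \<in> R" "j \<in> R"
        then show "\<exists>k\<in>R. F i \<union> F j \<subseteq> F k"
          by (intro bexI[of _ "if i < s then if j < s then max i j else i else j"])
             (auto simp: F_def max_def)
      qed (rule R)
      also have "\<dots> = (SUP r\<in>R. if r < s then c i r \<omega> else 0)"
        by (intro SUP_cong) (auto simp: F_def c_def)
      finally show ?thesis .
    qed
    have [measurable]: "(\<lambda>z. SUP r\<in>R. if r < fst (snd z) then c i r (fst z) else 0) \<in>
      borel_measurable (H t \<Otimes>\<^sub>M (borel :: (real \<times> real) measure))" for i
      unfolding borel_prod[symmetric]
      by (intro borel_measurable_SUP R measurable_If) (auto intro!: measurable_compose[OF measurable_fst c])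
    have "{z \<in> space (H t \<Otimes>\<^sub>M (borel :: (real \<times> real) measure)).
        fst (snd z) \<le> t \<and> (\<forall>i. (SUP r\<in>R. if r < fst (snd z) then c i r (fst z) else 0) < \<infinity>)} \<in> sets (H t \<Otimes>\<^sub>M borel)"
    proof -
      have [measurable]: "(\<lambda>z. fst (snd z)) \<in> borel_measurable (H t \<Otimes>\<^sub>M (borel :: (real \<times> real) measure))"
        unfolding borel_prod[symmetric] by measurable
      show ?thesis by measurable
    qed
    also have "{z \<in> space (H t \<Otimes>\<^sub>M (borel :: (real \<times> real) measure)).
        fst (snd z) \<le> t \<and> (\<forall>i. (SUP r\<in>R. if r < fst (snd z) then c i r (fst z) else 0) < \<infinity>)} = K"
    proof (intro set_eqI iffI; clarify?)
      fix \<omega> s and x :: real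
      have iff: "(\<forall>i. (SUP r\<in>R. if r < s then c i r \<omega> else 0) < \<infinity>) \<longleftrightarrow> loc_fin_left t0 (A \<omega>) s" if "s \<le> t"
        unfolding loc_fin_left_def using *[OF that] by (simp only: npoints_less_top_iff[symmetric])
      { assume "(\<omega>, s, x) \<in> K"
        then show "(\<omega>, s, x) \<in> space (H t \<Otimes>\<^sub>M (borel :: (real \<times> real) measure)) \<and>
          fst (snd (\<omega>, s, x)) \<le> t \<and> (\<forall>i. (SUP r\<in>R. if r < fst (snd (\<omega>, s, x)) then c i r (fst (\<omega>, s, x)) else 0) < \<infinity>)"
          using iff by (auto simp: K_def space_pair_measure sp) }
      { assume "(\<omega>, s, x) \<in> space (H t \<Otimes>\<^sub>M (borel :: (real \<times> real) measure))" "fst (snd (\<omega>, s, x)) \<le> t"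
          "\<forall>i. (SUP r\<in>R. if r < fst (snd (\<omega>, s, x)) then c i r (fst (\<omega>, s, x)) else 0) < \<infinity>"
        then show "(\<omega>, s, x) \<in> K"
          using iff by (auto simp: K_def space_pair_measure sp) }
    qed
    finally show ?thesis .
  qed
  define Ct where "Ct = C \<inter> (UNIV \<times> ({..t} \<times> UNIV))"
  have Ct: "Ct \<in> sets (H t \<Otimes>\<^sub>M borel)" unfolding Ct_def by (rule mpred_before[OF t C])
  define f1 where "f1 \<omega> = (SUP i. npoints ((if finite (A \<omega> \<inter> (({t0<..t} \<inter> B) \<times> {..real i}))
       then A \<omega> \<inter> (({t0<..t} \<inter> B) \<times> {..real i}) else {}) \<inter> Pair \<omega> -` (D \<union> K \<inter> Ct)))" for \<omega>
  have f1: "f1 \<in> borel_measurable (H t)"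
    unfolding f1_def using B
    by (intro borel_measurable_SUP npoints_section_measurable measurable_point_sets_If_finite cnt sets.Un sets.Int D K Ct)
       auto
  define f2 where "f2 \<omega> = (SUP r\<in>R. if \<omega> \<in> {\<omega> \<in> space M. loc_fin t0 (A \<omega>) r} then
       (SUP i. npoints ((if finite (A \<omega> \<inter> (({t0<..r} \<inter> B) \<times> {..real i}))
       then A \<omega> \<inter> (({t0<..r} \<inter> B) \<times> {..real i}) else {}) \<inter> Pair \<omega> -` Ct)) else 0)" for \<omega>
  have f2: "f2 \<in> borel_measurable (H t)"
    unfolding f2_def using B lf
    by (intro borel_measurable_SUP R measurable_If_set npoints_section_measurable measurable_point_sets_If_finite cnt Ct)
       (auto simp: R_def sp spH intro!: sets.Int)
  \<comment> \<open>Three cases. If \<open>Z2\<close> is infinite, so is the count. If the atoms in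
    \<open>B\<close> are finite at every level, they can be counted in the section of
    \<open>D \<union> K \<inter> Ct\<close>. Otherwise the atoms accumulate from the left at the
    first accumulation time; \<open>Z1\<close> lies strictly before it and is exhausted by rational
    times at which the atoms are still locally finite.\<close>
  define g where "g \<omega> = (if \<omega> \<in> {\<omega> \<in> space M. npoints (Z2 \<omega>) = \<infinity>} then \<infinity> else
     if \<omega> \<in> {\<omega> \<in> space M. \<forall>i::nat. finite (A \<omega> \<inter> (({t0<..t} \<inter> B) \<times> {..real i}))} then f1 \<omega> else npoints (Z2 \<omega>) + f2 \<omega>)" for \<omega>
  have "{\<omega> \<in> space M. npoints (Z2 \<omega>) = \<infinity>} \<in> sets (H t)"
    using Z2_m unfolding sp[symmetric] by measurable
  then have "g \<in> borel_measurable (H t)"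
    unfolding g_def using FB f1 f2 Z2_m
    by (intro measurable_If_set borel_measurable_add) (auto simp: sp spH intro!: sets.Int)
  also have "g \<in> borel_measurable (H t) \<longleftrightarrow>
     (\<lambda>\<omega>. npoints (raw_times t0 A C \<omega> \<inter> {..t} \<inter> B)) \<in> borel_measurable (H t)"
  proof (rule measurable_cong)
    fix \<omega> assume "\<omega> \<in> space (H t)"
    then have w: "\<omega> \<in> space M" by (simp add: sp)
    have lfl: "loc_fin t0 (A \<omega>) s" if "loc_fin_left t0 (A \<omega>) s" for s
      using that uni[OF w] by (rule loc_fin_of_left)
    have lvl: "(SUP i. npoints (S \<inter> (UNIV \<times> {..real i}))) = npoints S" for S :: "(real \<times> real) set"
    proof -
      have "(\<Union>i. S \<inter> (UNIV \<times> {..real i})) = S" by (auto simp: real_arch_simple)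
      moreover have "incseq (\<lambda>i. S \<inter> (UNIV \<times> {..real i}))" by (auto simp: incseq_def)
      ultimately show ?thesis using SUP_npoints by metis
    qed
    have disj: "Z1 \<omega> \<inter> Z2 \<omega> = {}"
      unfolding Z1_def Z2_def using lfl loc_fin_mono by fastforce
    have "raw_times t0 A C \<omega> \<inter> {..t} \<inter> B = fst ` (Z1 \<omega> \<union> Z2 \<omega>)"
      unfolding raw_times_def raw_atoms_def Z1_def Z2_def by force
    also have "npoints \<dots> = npoints (Z1 \<omega> \<union> Z2 \<omega>)"
      by (intro npoints_image) (auto simp: inj_on_def Z1_def Z2_def dest: uni[OF w])
    also have "\<dots> = npoints (Z1 \<omega>) + npoints (Z2 \<omega>)"
      using disj by (rule npoints_Un_disjoint)
    finally have total: "npoints (raw_times t0 A C \<omega> \<inter> {..t} \<inter> B) = npoints (Z1 \<omega>) + npoints (Z2 \<omega>)" .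
    consider (inf) "npoints (Z2 \<omega>) = \<infinity>"
      | (fin) "npoints (Z2 \<omega>) < \<infinity>" "\<forall>i::nat. finite (A \<omega> \<inter> (({t0<..t} \<inter> B) \<times> {..real i}))"
      | (left) "npoints (Z2 \<omega>) < \<infinity>" "\<not> (\<forall>i::nat. finite (A \<omega> \<inter> (({t0<..t} \<inter> B) \<times> {..real i})))"
      by (auto simp: less_top[symmetric])
    then show "g \<omega> = npoints (raw_times t0 A C \<omega> \<inter> {..t} \<inter> B)"
    proof cases
      case inf
      then show ?thesis using w total by (simp add: g_def)
    next
      case fin
      then have "g \<omega> = f1 \<omega>" using w by (auto simp: g_def)
      also have "\<dots> = (SUP i. npoints ((Z1 \<omega> \<union> Z2 \<omega>) \<inter> (UNIV \<times> {..real i})))"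
        unfolding f1_def using fin w
        by (intro SUP_cong arg_cong[where f = npoints])
           (auto simp: Z1_def Z2_def D_def K_def Ct_def)
      also have "\<dots> = npoints (Z1 \<omega> \<union> Z2 \<omega>)"
        by (rule lvl)
      also have "\<dots> = npoints (Z1 \<omega>) + npoints (Z2 \<omega>)"
        using disj by (rule npoints_Un_disjoint)
      finally show ?thesis using total by simp
    next
      case left
      then obtain i where i: "infinite (A \<omega> \<inter> (({t0<..t} \<inter> B) \<times> {..real i}))" by auto
      define S where "S = {r. \<not> loc_fin t0 (A \<omega>) r}"
      have tS: "t \<in> S"
        using i finite_Int_Times_mono[of "A \<omega>" "{t0<..t}" "\<lambda>i::nat. {..real i}" "{t0<..t} \<inter> B"]
        unfolding S_def loc_fin_def by auto
      have bdd: "bdd_below S"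
        by (rule bdd_belowI[of _ t0]) (use loc_fin_le in \<open>auto simp: S_def intro: ccontr\<close>)
      define u where "u = Inf S"
      have ut: "u \<le> t" unfolding u_def by (intro cInf_lower tS bdd)
      have below: "loc_fin t0 (A \<omega>) r" if "r < u" for r
        using that cInf_lower[OF _ bdd] unfolding u_def S_def by force
      have above: "\<exists>r<s. \<not> loc_fin t0 (A \<omega>) r" if "u < s" for s
        using that cInf_lessD[of S s] tS unfolding u_def S_def by auto
      \<comment> \<open>If the atoms were locally finite to the left of the first accumulation time
        \<open>u\<close>, they would be so up to \<open>u\<close>. The infinitely many atoms found
        in \<open>B\<close> at level \<open>i\<close> would then be finitely many up to
        \<open>u\<close> and otherwise lie in the finite set \<open>Z2 \<omega>\<close>.\<close>
      have nl: "\<not> loc_fin_left t0 (A \<omega>) u"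
      proof
        assume "loc_fin_left t0 (A \<omega>) u"
        then have "loc_fin t0 (A \<omega>) u" by (rule lfl)
        then have "finite (A \<omega> \<inter> ({t0<..u} \<times> {..real i}))" by (simp add: loc_fin_def)
        moreover have "A \<omega> \<inter> (({t0<..t} \<inter> B) \<times> {..real i}) \<subseteq> A \<omega> \<inter> ({t0<..u} \<times> {..real i}) \<union> Z2 \<omega>"
        proof
          fix y assume y: "y \<in> A \<omega> \<inter> (({t0<..t} \<inter> B) \<times> {..real i})"
          show "y \<in> A \<omega> \<inter> ({t0<..u} \<times> {..real i}) \<union> Z2 \<omega>"
          proof (cases "fst y \<le> u")
            case True then show ?thesis using y by auto
          next
            case False
            then have "\<exists>r<fst y. \<not> loc_fin t0 (A \<omega>) r" by (intro above) simp
            then have "y \<in> Z2 \<omega>" using y unfolding Z2_def by auto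
            then show ?thesis by simp
          qed
        qed
        ultimately have "infinite (Z2 \<omega>)" using i by (meson finite_UnI finite_subset)
        moreover have "finite (Z2 \<omega>)" using left(1) by (rule npoints_less_top_iff[THEN iffD1])
        ultimately show False by contradiction
      qed
      define F where "F r = (if loc_fin t0 (A \<omega>) r then A \<omega> \<inter> (({t0<..r} \<inter> B) \<times> UNIV) \<inter> Pair \<omega> -` Ct else {})" for r
      \<comment> \<open>Points of \<open>Z1\<close> are strictly before \<open>u\<close>, so a
        rational time between the point and \<open>u\<close> captures them, with atoms that are
        locally finite up to that time.\<close>
      have "Z1 \<omega> = (\<Union>r\<in>R. F r)"
      proof (intro set_eqI iffI; clarify)
        fix s x assume sx: "(s, x) \<in> Z1 \<omega>"
        then have "s < u" using nl loc_fin_left_mono by (auto simp: Z1_def not_less[symmetric])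
        then obtain r where "r \<in> \<rat>" "s < r" "r < u" using Rats_dense_in_real by blast
        then have "r \<in> R" "(s, x) \<in> F r" using sx ut below by (auto simp: R_def F_def Z1_def Ct_def)
        then show "(s, x) \<in> (\<Union>r\<in>R. F r)" by auto
      next
        fix s x r assume "r \<in> R" "(s, x) \<in> F r"
        then show "(s, x) \<in> Z1 \<omega>"
          by (auto simp: F_def Z1_def Ct_def R_def split: if_splits intro: loc_fin_imp_left)
      qed
      also have "npoints \<dots> = (SUP r\<in>R. npoints (F r))"
      proof (rule npoints_UN_directed)
        fix i j assume "i \<in> R" "j \<in> R"
        then show "\<exists>k\<in>R. F i \<union> F j \<subseteq> F k"
          by (intro bexI[of _ "if loc_fin t0 (A \<omega>) i then if loc_fin t0 (A \<omega>) j then max i j else i else j"])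
             (auto simp: F_def max_def)
      qed (rule R)
      also have "\<dots> = f2 \<omega>"
        unfolding f2_def
      proof (intro SUP_cong refl)
        fix r assume "r \<in> R"
        show "npoints (F r) = (if \<omega> \<in> {\<omega> \<in> space M. loc_fin t0 (A \<omega>) r} then
          (SUP i. npoints ((if finite (A \<omega> \<inter> (({t0<..r} \<inter> B) \<times> {..real i}))
           then A \<omega> \<inter> (({t0<..r} \<inter> B) \<times> {..real i}) else {}) \<inter> Pair \<omega> -` Ct)) else 0)"
        proof (cases "loc_fin t0 (A \<omega>) r")
          case True
          have f: "finite (A \<omega> \<inter> (({t0<..r} \<inter> B) \<times> {..real i}))" for i
            using finite_Int_Times_mono[OF True[unfolded loc_fin_def], of "{t0<..r} \<inter> B"] by simp
          have "npoints (F r) = (SUP i. npoints (F r \<inter> (UNIV \<times> {..real i})))"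
            by (rule lvl[symmetric])
          also have "\<dots> = (SUP i. npoints (A \<omega> \<inter> (({t0<..r} \<inter> B) \<times> {..real i}) \<inter> Pair \<omega> -` Ct))"
            using True by (intro SUP_cong arg_cong[where f = npoints]) (auto simp: F_def)
          finally show ?thesis using True w f by simp
        qed (simp add: F_def)
      qed
      finally show ?thesis using left w total by (auto simp: g_def add.commute)
    qed
  qed
  finally show "(\<lambda>\<omega>. npoints (raw_times t0 A C \<omega> \<inter> {..t} \<inter> B)) \<in> borel_measurable (H t)" .
qed

end

section \<open>Independence and mean of the Poisson points\<close>

text \<open>The factor \<open>j\<close> cancels one factor of \<open>fact j\<close>, and what
  remains is \<open>\<mu>\<close> times the exponential series.\<close>

lemma poisson_mean:
  assumes "0 \<le> \<mu>"
  shows "(\<Sum>j. of_nat j * ennreal (exp (- \<mu>) * \<mu> ^ j / fact j)) = ennreal \<mu>"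
proof -
  have "(\<lambda>j. \<mu> ^ j /\<^sub>R fact j) sums exp \<mu>" by (rule exp_converges)
  then have "(\<lambda>j. (exp (- \<mu>) * \<mu>) * (\<mu> ^ j /\<^sub>R fact j)) sums (exp (- \<mu>) * \<mu> * exp \<mu>)"
    by (rule sums_mult)
  moreover have "exp (- \<mu>) * \<mu> * exp \<mu> = \<mu>" by (simp add: exp_minus)
  moreover have "(exp (- \<mu>) * \<mu>) * (\<mu> ^ j /\<^sub>R fact j) =
      real (Suc j) * (exp (- \<mu>) * \<mu> ^ Suc j / fact (Suc j))" for j
    by (simp add: field_simps del: of_nat_Suc)
  ultimately have "(\<lambda>j. real (Suc j) * (exp (- \<mu>) * \<mu> ^ Suc j / fact (Suc j))) sums \<mu>" by simp
  then have "(\<lambda>j. real j * (exp (- \<mu>) * \<mu> ^ j / fact j)) sums \<mu>"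
    by (subst (asm) sums_Suc_iff) simp
  then have "(\<Sum>j. ennreal (real j * (exp (- \<mu>) * \<mu> ^ j / fact j))) = ennreal \<mu>"
    using assms by (intro suminf_ennreal_eq) auto
  moreover have "of_nat j * ennreal p = ennreal (real j * p)" for j p
    by (simp only: ennreal_of_nat_eq_real_of_nat ennreal_mult'[OF of_nat_0_le_iff])
  ultimately show ?thesis by simp
qed

lemma poisson_total:
  "(\<lambda>j. exp (- \<mu>) * \<mu> ^ j / fact j) sums (1::real)"
proof -
  have "(\<lambda>j. exp (- \<mu>) * (\<mu> ^ j /\<^sub>R fact j)) sums (exp (- \<mu>) * exp \<mu>)"
    by (intro sums_mult exp_converges)
  then show ?thesis by (simp add: exp_minus divide_inverse mult_ac)
qed

text \<open>The family \<open>{Y}\<close> is trivially stable under intersection, so independence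
  extends from \<open>G\<close> to the generated sigma-algebra by the usual argument on one side
  only.\<close>

lemma (in prob_space) indep_event_sigma_sets:
  assumes G: "Int_stable G" "G \<subseteq> events" and Y: "Y \<in> events"
    and ind: "\<And>E. E \<in> G \<Longrightarrow> prob (E \<inter> Y) = prob E * prob Y"
    and F: "F \<in> sigma_sets (space M) G"
  shows "prob (F \<inter> Y) = prob F * prob Y"
proof -
  have "indep_set G {Y}" using assms by (intro indep_setI) auto
  then have "indep_set (sigma_sets (space M) G) (sigma_sets (space M) {Y})"
    using G by (intro indep_set_sigma_sets) (auto simp: Int_stable_def)
  then show ?thesis using F by (rule indep_setD) auto
qed

locale har_noise = prob_space M
  for M :: "'w measure" and n :: "'p::finite \<Rightarrow> nat" and \<phi> :: "'p \<Rightarrow> real"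
    and \<pi> :: "'m::finite \<Rightarrow> 'w \<Rightarrow> (real \<times> real) set" and \<xi> :: "'p \<Rightarrow> real \<Rightarrow> 'w \<Rightarrow> real" and t0 :: real +
  assumes ar: "ar_setting n \<phi>" and rp: "random_points M \<pi>" and rd: "random_drifts M n \<phi> \<pi> \<xi>"
begin

abbreviation Fr :: "real \<Rightarrow> 'w measure" where "Fr \<equiv> filt M n \<phi> \<pi> \<xi>"

lemma poisson: "poisson_random_measure M (restrict_space lborel (UNIV \<times> {0..})) (\<pi> m)"
  using rp by (auto simp: random_points_def)

lemma sets_\<nu>: "A \<in> sets (restrict_space lborel (UNIV \<times> {0..})) \<longleftrightarrow> A \<in> sets borel \<and> A \<subseteq> UNIV \<times> {0::real..}"
  for A :: "(real \<times> real) set"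
  by (subst sets_restrict_space_iff) (auto simp: borel_Times_UNIV)

lemma emeasure_\<nu>: "A \<subseteq> UNIV \<times> {0::real..} \<Longrightarrow>
   emeasure (restrict_space lborel (UNIV \<times> {0..})) A = emeasure lborel A" for A :: "(real \<times> real) set"
  by (subst emeasure_restrict_space) (auto simp: borel_Times_UNIV)

lemma pi_meas: "\<pi> m \<in> measurable M point_sets"
  using poisson[of m] by (simp add: poisson_random_measure_def)

lemma pi_pos: "\<omega> \<in> space M \<Longrightarrow> \<pi> m \<omega> \<subseteq> UNIV \<times> {0..}"
  using poisson[of m] by (auto simp: poisson_random_measure_def space_restrict_space)

lemma pi_uni: "\<omega> \<in> space M \<Longrightarrow> (s, x) \<in> \<pi> m \<omega> \<Longrightarrow> (s, x') \<in> \<pi> m' \<omega> \<Longrightarrow> m = m' \<and> x = x'"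
  using rp unfolding random_points_def by blast

lemma pi_count: "B \<in> sets borel \<Longrightarrow> (\<lambda>\<omega>. npoints (\<pi> m \<omega> \<inter> B)) \<in> borel_measurable M"
  by (rule measurable_npoints[OF pi_meas])

lemma pi_law:
  assumes "B \<in> sets borel" "B \<subseteq> UNIV \<times> {0..}" "emeasure lborel B < \<infinity>"
  shows "prob {\<omega>\<in>space M. npoints (\<pi> m \<omega> \<inter> B) = of_nat j} =
    exp (- measure lborel B) * measure lborel B ^ j / fact j"
  using poisson[of m] assms unfolding poisson_random_measure_def
  by (auto simp: sets_\<nu> emeasure_\<nu> measure_def)

lemma xi_meas: "(p, k) \<in> ar_index n \<phi> \<Longrightarrow> \<xi> p k \<in> borel_measurable M"
  using rd unfolding random_drifts_def indep_vars_def by fastforce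

lemma events_points_sub: "events_points M \<pi> I T \<subseteq> events" if "T \<in> sets borel"
proof -
  have "(\<lambda>\<omega>. \<pi> m \<omega> \<inter> (T \<times> {0..})) \<in> measurable M point_sets" for m
    using that by (intro measurable_point_sets_Int pi_meas borel_Times_UNIV) auto
  then show ?thesis unfolding events_points_def by (auto intro: measurable_sets)
qed

lemma events_drifts_sub: "events_drifts M n \<phi> \<xi> T \<subseteq> events"
  unfolding events_drifts_def using xi_meas by (auto intro: measurable_sets)

lemma space_filt [simp]: "space (Fr t) = space M"
  by (simp add: filt_def space_measure_of_conv)

lemma gen_Pow: "events_points M \<pi> UNIV {..t} \<union> events_drifts M n \<phi> \<xi> {..t} \<subseteq> Pow (space M)"
  by (auto simp: events_points_def events_drifts_def)

lemma sets_filt: "sets (Fr t) = sigma_sets (space M) (events_points M \<pi> UNIV {..t} \<union> events_drifts M n \<phi> \<xi> {..t})"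
  unfolding filt_def using gen_Pow by (rule sets_measure_of)

lemma filt_sub: "subalgebra M (Fr t)"
  unfolding subalgebra_def
proof
  show "sets (Fr t) \<subseteq> sets M" unfolding sets_filt
    using events_points_sub[of "{..t}"] events_drifts_sub by (intro sets.sigma_sets_subset) auto
qed simp

lemma pi_filt: "(\<lambda>\<omega>. \<pi> m \<omega> \<inter> ({..t} \<times> {0..})) \<in> measurable (Fr t) point_sets"
  by (rule measurableI) (auto simp: sets_filt events_points_def intro!: sigma_sets.Basic)

lemma xi_filt: "(p, k) \<in> ar_index n \<phi> \<Longrightarrow> k \<le> t \<Longrightarrow> \<xi> p k \<in> borel_measurable (Fr t)"
  by (rule measurableI) (auto simp: sets_filt events_drifts_def intro!: sigma_sets.Basic)

lemma filt_mono:
  assumes "s \<le> t"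
  shows "sets (Fr s) \<subseteq> sets (Fr t)"
  unfolding sets_filt[of s]
proof (rule sets.sigma_sets_subset[of _ "Fr t", simplified])
  have "(\<lambda>\<omega>. \<pi> m \<omega> \<inter> ({..s} \<times> {0..})) \<in> measurable (Fr t) point_sets" for m
  proof -
    have "(\<lambda>\<omega>. \<pi> m \<omega> \<inter> ({..t} \<times> {0..}) \<inter> ({..s} \<times> {0..})) \<in> measurable (Fr t) point_sets"
      by (intro measurable_point_sets_Int pi_filt borel_Times_UNIV) auto
    moreover have "\<pi> m \<omega> \<inter> ({..t} \<times> {0..}) \<inter> ({..s} \<times> {0..}) = \<pi> m \<omega> \<inter> ({..s} \<times> {0..})" for \<omega>
      using assms by auto
    ultimately show ?thesis by simp
  qed
  from measurable_sets[OF this] have "events_points M \<pi> UNIV {..s} \<subseteq> sets (Fr t)"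
    unfolding events_points_def by auto
  moreover have "events_drifts M n \<phi> \<xi> {..s} \<subseteq> sets (Fr t)"
    unfolding events_drifts_def using xi_filt[of _ _ t] assms by (force dest: measurable_sets)
  ultimately show "events_points M \<pi> UNIV {..s} \<union> events_drifts M n \<phi> \<xi> {..s} \<subseteq> sets (Fr t)" by simp
qed

sublocale raw: filtr M t0 Fr
  by unfold_locales (auto intro: filt_sub dest: filt_mono)

section \<open>Independence of the Poisson counts after a time from its past\<close>

definition cnt_ev :: "'m \<Rightarrow> (real \<times> real) set \<Rightarrow> 'w set set" where
  "cnt_ev m B = {(\<lambda>\<omega>. npoints (\<pi> m \<omega> \<inter> B)) -` S \<inter> space M | S. S \<in> sets borel}"

lemma cnt_ev_events: "B \<in> sets borel \<Longrightarrow> cnt_ev m B \<subseteq> events"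
  unfolding cnt_ev_def using pi_count by (auto intro: measurable_sets)

lemma Int_stable_cnt_ev: "Int_stable (cnt_ev m B)"
proof (rule Int_stableI)
  fix a b assume "a \<in> cnt_ev m B" "b \<in> cnt_ev m B"
  then obtain S T where "a = (\<lambda>\<omega>. npoints (\<pi> m \<omega> \<inter> B)) -` S \<inter> space M" "S \<in> sets borel"
    "b = (\<lambda>\<omega>. npoints (\<pi> m \<omega> \<inter> B)) -` T \<inter> space M" "T \<in> sets borel" by (auto simp: cnt_ev_def)
  then show "a \<inter> b \<in> cnt_ev m B"
    unfolding cnt_ev_def by (intro CollectI exI[of _ "S \<inter> T"]) auto
qed

text \<open>The joint independence over \<open>insert B AA\<close> is grouped into two blocks,
  \<open>AA\<close> and \<open>{B}\<close>, indexed by the booleans; \<open>B \<notin> AA\<close>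
  makes the blocks disjoint.\<close>

lemma indep_disjoint_counts:
  assumes fin: "finite AA" and disj: "disjoint AA" and AA: "AA \<subseteq> sets borel" "\<And>A. A \<in> AA \<Longrightarrow> A \<subseteq> UNIV \<times> {0..}"
    and B: "B \<in> sets borel" "B \<subseteq> UNIV \<times> {0..}" "B \<notin> AA" "\<And>A. A \<in> AA \<Longrightarrow> A \<inter> B = {}"
    and E: "E \<in> sigma_sets (space M) (\<Union>A\<in>AA. cnt_ev m A)" and Y: "Y \<in> cnt_ev m B"
  shows "prob (E \<inter> Y) = prob E * prob Y"
proof -
  have "disjoint (insert B AA)"
    using disj B(4) by (auto simp: disjoint_def pairwise_insert disjnt_def)
  moreover have "insert B AA \<subseteq> sets (restrict_space lborel (UNIV \<times> {0..}))"
    using AA B by (auto simp: sets_\<nu>)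
  ultimately have "indep_vars (\<lambda>_. borel) (\<lambda>A \<omega>. npoints (\<pi> m \<omega> \<inter> A)) (insert B AA)"
    using poisson[of m] fin unfolding poisson_random_measure_def by blast
  then have ind: "indep_sets (cnt_ev m) (insert B AA)"
    unfolding indep_vars_def2 cnt_ev_def by simp
  have "indep_sets (\<lambda>j. sigma_sets (space M) (\<Union>A\<in>(if j then AA else {B}). cnt_ev m A)) UNIV"
  proof (rule indep_sets_collect_sigma)
    show "indep_sets (cnt_ev m) (\<Union>j\<in>UNIV. if j then AA else {B})"
      using ind by (simp add: UNIV_bool Un_commute)
    show "disjoint_family_on (\<lambda>j. if j then AA else {B}) UNIV"
      using B(3) by (auto simp: disjoint_family_on_def)
  qed (rule Int_stable_cnt_ev)
  from indep_setsD[OF this, of UNIV "\<lambda>j. if j then E else Y"]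
  show ?thesis using E Y by (auto simp: UNIV_bool Int_commute mult.commute)
qed

text \<open>The independence of a Poisson random measure is given for disjoint sets only, so the sets
  which generate the past are first cut into disjoint cells.\<close>

definition cells :: "(real \<times> real) set \<Rightarrow> (real \<times> real) set set \<Rightarrow> (real \<times> real) set set" where
  "cells Q BB = {A. A \<noteq> {} \<and> (\<exists>S\<subseteq>BB. A = \<Inter>S \<inter> Q - \<Union>(BB - S))}"

lemma cells:
  assumes fin: "finite BB" and BB: "BB \<subseteq> sets borel" "BB \<subseteq> Pow Q" and Q: "Q \<in> sets borel"
  shows "finite (cells Q BB)" "disjoint (cells Q BB)" "cells Q BB \<subseteq> sets borel"
    "\<And>A. A \<in> cells Q BB \<Longrightarrow> A \<subseteq> Q"
    "\<And>B. B \<in> BB \<Longrightarrow> B = \<Union>{A \<in> cells Q BB. A \<subseteq> B}"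
proof -
  have "cells Q BB \<subseteq> (\<lambda>S. \<Inter>S \<inter> Q - \<Union>(BB - S)) ` Pow BB" by (auto simp: cells_def)
  then show "finite (cells Q BB)" using fin by (auto intro: finite_subset)
  show "disjoint (cells Q BB)"
  proof (rule disjointI)
    fix a b assume "a \<in> cells Q BB" "b \<in> cells Q BB" and ne: "a \<noteq> b"
    then obtain S T where a: "S \<subseteq> BB" "a = \<Inter>S \<inter> Q - \<Union>(BB - S)" and b: "T \<subseteq> BB" "b = \<Inter>T \<inter> Q - \<Union>(BB - T)"
      by (auto simp: cells_def)
    with ne have "S \<noteq> T" by auto
    then obtain B where "B \<in> BB" "B \<in> S \<and> B \<notin> T \<or> B \<in> T \<and> B \<notin> S" using a b by blast
    then show "a \<inter> b = {}" using a b by blast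
  qed
  show "cells Q BB \<subseteq> sets borel"
  proof
    fix A assume "A \<in> cells Q BB"
    then obtain S where S: "S \<subseteq> BB" "A = \<Inter>S \<inter> Q - \<Union>(BB - S)" by (auto simp: cells_def)
    have "\<Inter>S \<in> sets borel"
    proof (cases "S = {}")
      case False
      have "(\<Inter>B\<in>S. B) \<in> sets borel"
        using S(1) False BB finite_subset[OF S(1) fin] by (intro sets.finite_INT) auto
      then show ?thesis by simp
    qed simp
    moreover have "\<Union>(BB - S) \<in> sets borel"
      using fin BB by (intro sets.finite_Union) auto
    ultimately show "A \<in> sets borel" using Q S by auto
  qed
  show "A \<subseteq> Q" if "A \<in> cells Q BB" for A using that by (auto simp: cells_def)
  show "B = \<Union>{A \<in> cells Q BB. A \<subseteq> B}" if B: "B \<in> BB" for B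
  proof
    show "B \<subseteq> \<Union>{A \<in> cells Q BB. A \<subseteq> B}"
    proof
      fix y assume y: "y \<in> B"
      define S where "S = {B\<in>BB. y \<in> B}"
      have "y \<in> \<Inter>S \<inter> Q - \<Union>(BB - S)" using y B BB(2) by (auto simp: S_def)
      moreover have "\<Inter>S \<inter> Q - \<Union>(BB - S) \<subseteq> B" using y B by (auto simp: S_def)
      moreover have "\<Inter>S \<inter> Q - \<Union>(BB - S) \<in> cells Q BB"
        unfolding cells_def using calculation(1) by (intro CollectI conjI exI[of _ S]) (auto simp: S_def)
      ultimately show "y \<in> \<Union>{A \<in> cells Q BB. A \<subseteq> B}" by blast
    qed
  qed auto
qed

text \<open>Every set of a finite family in the past is a union of cells, and counts are additive
  over cells. So the sigma-algebra of the family is contained in one generated by counts in disjoint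
  sets, where independence is given.\<close>

lemma indep_past_counts:
  assumes B: "B \<in> sets borel" "B \<subseteq> {q<..} \<times> {0..}" and Y: "Y \<in> cnt_ev m B"
    and E: "E \<in> sigma_sets (space M) (events_points M \<pi> {m} {..q})"
  shows "prob (E \<inter> Y) = prob E * prob Y"
proof (cases "B = {}")
  case True
  then have "Y = {} \<or> Y = space M" using Y by (auto simp: cnt_ev_def split: if_splits)
  moreover have "E \<in> events"
    using E sets.sigma_sets_subset[OF events_points_sub[of "{..q}" "{m}"]] by auto
  ultimately show ?thesis using sets.sets_into_space[of E M]
    by (elim disjE) (simp_all add: prob_space Int_absorb2)
next
  case False
  define Q where "Q = {..q} \<times> {0::real..}"
  have Q: "Q \<in> sets borel" by (simp add: Q_def borel_Times_UNIV)
  define SS where "SS BB = sigma_sets (space M) (\<Union>A\<in>BB. cnt_ev m A)" for BB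
  \<comment> \<open>The finite families are directed under union, which makes \<open>G\<close>
    stable under intersection, and together they generate the past of
    \<open>\<pi> m\<close>.\<close>
  define fam where "fam = {BB. finite BB \<and> BB \<subseteq> sets borel \<and> (\<forall>A\<in>BB. A \<subseteq> Q)}"
  define G where "G = (\<Union>BB\<in>fam. SS BB)"
  have ev: "SS BB \<subseteq> events" if "BB \<in> fam" for BB
    unfolding SS_def using that cnt_ev_events by (intro sets.sigma_sets_subset) (auto simp: fam_def)
  have indS: "prob (E \<inter> Y) = prob E * prob Y" if "BB \<in> fam" "E \<in> SS BB" for BB E
  proof (rule indep_disjoint_counts[OF _ _ _ _ B(1) _ _ _ _ Y])
    have BB: "finite BB" "BB \<subseteq> sets borel" "BB \<subseteq> Pow Q" using that by (auto simp: fam_def)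
    note c = cells[OF BB Q]
    show "finite (cells Q BB)" "disjoint (cells Q BB)" "cells Q BB \<subseteq> sets borel" using c(1-3) by blast+
    show "A \<subseteq> UNIV \<times> {0..}" if "A \<in> cells Q BB" for A using c(4)[OF that] by (auto simp: Q_def)
    show "B \<subseteq> UNIV \<times> {0..}" using B by auto
    show d: "A \<inter> B = {}" if "A \<in> cells Q BB" for A using c(4)[OF that] B by (fastforce simp: Q_def)
    show "B \<notin> cells Q BB" using d[of B] False by auto
    define N where "N = sigma (space M) (\<Union>A\<in>cells Q BB. cnt_ev m A)"
    have gP: "(\<Union>A\<in>cells Q BB. cnt_ev m A) \<subseteq> Pow (space M)" by (auto simp: cnt_ev_def)
    have sN: "space N = space M" "sets N = sigma_sets (space M) (\<Union>A\<in>cells Q BB. cnt_ev m A)"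
      using gP by (auto simp: N_def space_measure_of_conv intro: sets_measure_of)
    have mA: "(\<lambda>\<omega>. npoints (\<pi> m \<omega> \<inter> A)) \<in> borel_measurable N" if "A \<in> cells Q BB" for A
    proof (rule measurableI)
      fix S :: "ennreal set" assume "S \<in> sets borel"
      then have "(\<lambda>\<omega>. npoints (\<pi> m \<omega> \<inter> A)) -` S \<inter> space M \<in> cnt_ev m A" by (auto simp: cnt_ev_def)
      then show "(\<lambda>\<omega>. npoints (\<pi> m \<omega> \<inter> A)) -` S \<inter> space N \<in> sets N"
        unfolding sN using that by (intro sigma_sets.Basic) auto
    qed simp
    have "cnt_ev m A \<subseteq> sets N" if A: "A \<in> BB" for A
    proof -
      let ?T = "{A' \<in> cells Q BB. A' \<subseteq> A}"
      have "npoints (\<pi> m \<omega> \<inter> A) = (\<Sum>A'\<in>?T. npoints (\<pi> m \<omega> \<inter> A'))" for \<omega>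
      proof -
        have "(\<Sum>A'\<in>?T. npoints (\<pi> m \<omega> \<inter> A')) = npoints (\<Union>A'\<in>?T. \<pi> m \<omega> \<inter> A')"
          using c(1,2) by (intro sum_emeasure) (auto simp: disjoint_family_on_def disjoint_def)
        also have "(\<Union>A'\<in>?T. \<pi> m \<omega> \<inter> A') = \<pi> m \<omega> \<inter> \<Union>?T" by auto
        also have "\<dots> = \<pi> m \<omega> \<inter> A" by (simp only: c(5)[OF A, symmetric])
        finally show ?thesis by simp
      qed
      moreover have "(\<lambda>\<omega>. \<Sum>A'\<in>?T. npoints (\<pi> m \<omega> \<inter> A')) \<in> borel_measurable N"
        using mA by (intro borel_measurable_sum) auto
      ultimately have "(\<lambda>\<omega>. npoints (\<pi> m \<omega> \<inter> A)) \<in> borel_measurable N" by simp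
      then show ?thesis unfolding cnt_ev_def sN(1)[symmetric] by (auto dest: measurable_sets)
    qed
    then have "SS BB \<subseteq> sets N"
      unfolding SS_def sN(1)[symmetric] by (intro sets.sigma_sets_subset) auto
    then show "E \<in> sigma_sets (space M) (\<Union>A\<in>cells Q BB. cnt_ev m A)" using that sN by auto
  qed
  show ?thesis
  proof (rule indep_event_sigma_sets[where G = G])
    show "Int_stable G"
    proof (rule Int_stableI)
      fix a b assume "a \<in> G" "b \<in> G"
      then obtain BB CC where *: "BB \<in> fam" "CC \<in> fam" "a \<in> SS BB" "b \<in> SS CC" by (auto simp: G_def)
      then have un: "BB \<union> CC \<in> fam" by (auto simp: fam_def)
      have "SS BB \<subseteq> SS (BB \<union> CC)" "SS CC \<subseteq> SS (BB \<union> CC)"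
        unfolding SS_def by (intro sigma_sets_mono'; auto)+
      then have "a \<in> SS (BB \<union> CC)" "b \<in> SS (BB \<union> CC)" using * by auto
      moreover have "sigma_algebra (space M) (SS (BB \<union> CC))"
        unfolding SS_def by (intro sigma_algebra_sigma_sets) (auto simp: cnt_ev_def)
      ultimately have "a \<inter> b \<in> SS (BB \<union> CC)"
        by (meson algebra.Int_stable Int_stable_def sigma_algebra_def)
      then show "a \<inter> b \<in> G" using un by (auto simp: G_def)
    qed
    show Ge: "G \<subseteq> events" using ev by (auto simp: G_def)
    show "Y \<in> events" using Y cnt_ev_events[OF B(1)] by auto
    show "prob (E \<inter> Y) = prob E * prob Y" if "E \<in> G" for E using that indS by (auto simp: G_def)
    have GP: "G \<subseteq> Pow (space M)" using Ge sets.space_closed by auto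
    define N where "N = sigma (space M) G"
    have sN: "space N = space M" "sets N = sigma_sets (space M) G"
      using GP by (auto simp: N_def space_measure_of_conv)
    have "(\<lambda>\<omega>. \<pi> m \<omega> \<inter> ({..q} \<times> {0..})) \<in> measurable N point_sets"
      unfolding measurable_point_sets_iff
    proof
      fix B :: "(real \<times> real) set" assume B: "B \<in> sets borel"
      show "(\<lambda>\<omega>. npoints (\<pi> m \<omega> \<inter> {..q} \<times> {0..} \<inter> B)) \<in> borel_measurable N"
      proof (rule measurableI)
        fix S :: "ennreal set" assume "S \<in> sets borel"
        then have "(\<lambda>\<omega>. npoints (\<pi> m \<omega> \<inter> (Q \<inter> B))) -` S \<inter> space M \<in> SS {Q \<inter> B}"
          unfolding SS_def by (intro sigma_sets.Basic) (auto simp: cnt_ev_def)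
        moreover have "{Q \<inter> B} \<in> fam" using Q B by (auto simp: fam_def)
        ultimately have "(\<lambda>\<omega>. npoints (\<pi> m \<omega> \<inter> (Q \<inter> B))) -` S \<inter> space M \<in> G" by (auto simp: G_def)
        then show "(\<lambda>\<omega>. npoints (\<pi> m \<omega> \<inter> {..q} \<times> {0..} \<inter> B)) -` S \<inter> space N \<in> sets N"
          unfolding sN by (intro sigma_sets.Basic) (simp add: Q_def Int_assoc)
      qed simp
    qed
    then have "events_points M \<pi> {m} {..q} \<subseteq> sets N"
      unfolding events_points_def sN(1)[symmetric] by (auto dest: measurable_sets)
    then have "sigma_sets (space M) (events_points M \<pi> {m} {..q}) \<subseteq> sets N"
      unfolding sN(1)[symmetric] by (intro sets.sigma_sets_subset) auto
    then show "E \<in> sigma_sets (space M) G" using E sN by auto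
  qed
qed

text \<open>The past is split by its source: all drifts, all the other Poisson measures, and
  \<open>\<pi> m\<close> up to \<open>q\<close>. The first two are taken for all times, because they
  are independent of the whole of \<open>\<pi> m\<close>; the third is
  \<open>indep_past_counts\<close>. Intersections of one event from each source form a generating
  system that is stable under intersection.\<close>

lemma indep_past:
  assumes B: "B \<in> sets borel" "B \<subseteq> {q<..} \<times> {0..}" and Y: "Y \<in> cnt_ev m B" and F: "F \<in> sets (Fr q)"
  shows "prob (F \<inter> Y) = prob F * prob Y"
proof -
  define DD where "DD = sigma_sets (space M) (events_drifts M n \<phi> \<xi> UNIV)"
  define PP where "PP I = sigma_sets (space M) (events_points M \<pi> I UNIV)" for I
  define RR where "RR = sigma_sets (space M) (\<Union>m'\<in>-{m}. PP {m'})"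
  define EE where "EE = sigma_sets (space M) (events_points M \<pi> {m} {..q})"
  have pw: "events_points M \<pi> I T \<subseteq> Pow (space M)" for I T by (auto simp: events_points_def)
  have pd: "events_drifts M n \<phi> \<xi> T \<subseteq> Pow (space M)" for T by (auto simp: events_drifts_def)
  have saD: "sigma_algebra (space M) DD" unfolding DD_def by (intro sigma_algebra_sigma_sets pd)
  have saP: "sigma_algebra (space M) (PP I)" for I unfolding PP_def by (intro sigma_algebra_sigma_sets pw)
  have RRP: "(\<Union>m'\<in>-{m}. PP {m'}) \<subseteq> Pow (space M)"
    unfolding PP_def using sigma_sets_into_sp[OF pw] by blast
  have saR: "sigma_algebra (space M) RR" unfolding RR_def by (intro sigma_algebra_sigma_sets RRP)
  have saE: "sigma_algebra (space M) EE" unfolding EE_def by (intro sigma_algebra_sigma_sets pw)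
  have IntI: "a \<inter> b \<in> X" if "sigma_algebra (space M) X" "a \<in> X" "b \<in> X" for X and a b :: "'w set"
    using that by (meson algebra.Int_stable Int_stable_def sigma_algebra_def)
  have topI: "space M \<in> X" if "sigma_algebra (space M) X" for X
    using that by (meson algebra.top sigma_algebra_def)
  have PPev: "PP I \<subseteq> events" for I unfolding PP_def by (intro sets.sigma_sets_subset events_points_sub) simp
  have DDev: "DD \<subseteq> events" unfolding DD_def by (intro sets.sigma_sets_subset events_drifts_sub)
  have RRev: "RR \<subseteq> events" unfolding RR_def using PPev by (intro sets.sigma_sets_subset) auto
  have mono_ep: "events_points M \<pi> I T \<subseteq> PP I" if T: "T \<in> sets borel" for I T
  proof
    fix A assume "A \<in> events_points M \<pi> I T"
    then obtain m' S where A: "A = (\<lambda>\<omega>. \<pi> m' \<omega> \<inter> (T \<times> {0..})) -` S \<inter> space M" "m' \<in> I" "S \<in> sets point_sets"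
      by (auto simp: events_points_def)
    have "(\<lambda>A. A \<inter> (T \<times> {0::real..})) \<in> measurable point_sets point_sets"
      by (rule measurable_point_sets_Int) (auto simp: borel_Times_UNIV T)
    from measurable_sets[OF this A(3)] have S': "(\<lambda>A. A \<inter> (T \<times> {0..})) -` S \<in> sets point_sets" by simp
    have "A = (\<lambda>\<omega>. \<pi> m' \<omega> \<inter> (UNIV \<times> {0..})) -` ((\<lambda>A. A \<inter> (T \<times> {0..})) -` S) \<inter> space M"
      unfolding A(1) by (auto simp: vimage_def Int_assoc Times_Int_Times)
    then show "A \<in> PP I" unfolding PP_def
      using A(2) S' by (intro sigma_sets.Basic) (auto simp: events_points_def)
  qed
  have EP: "EE \<subseteq> PP {m}"
    unfolding EE_def by (intro sigma_algebra.sigma_sets_subset[OF saP] mono_ep) simp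
  have RP: "RR \<subseteq> PP UNIV"
    unfolding RR_def
  proof (intro sigma_algebra.sigma_sets_subset[OF saP] UN_least)
    fix m' show "PP {m'} \<subseteq> PP UNIV"
      unfolding PP_def by (intro sigma_sets_mono') (auto simp: events_points_def)
  qed
  have PmP: "PP {m} \<subseteq> PP UNIV"
    unfolding PP_def by (intro sigma_sets_mono') (auto simp: events_points_def)
  have YP: "Y \<in> PP {m}"
  proof -
    obtain S where S: "Y = (\<lambda>\<omega>. npoints (\<pi> m \<omega> \<inter> B)) -` S \<inter> space M" "S \<in> sets borel"
      using Y by (auto simp: cnt_ev_def)
    have "{A. npoints (A \<inter> B) \<in> S} \<in> sets point_sets"
      unfolding point_sets_def using B(1) S(2) by (intro in_measure_of) auto
    moreover have "Y = (\<lambda>\<omega>. \<pi> m \<omega> \<inter> (UNIV \<times> {0..})) -` {A. npoints (A \<inter> B) \<in> S} \<inter> space M"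
    proof -
      have "UNIV \<times> {0..} \<inter> B = B" using B(2) by auto
      then show ?thesis unfolding S(1) by (auto simp: Int_assoc)
    qed
    ultimately show ?thesis unfolding PP_def events_points_def
      by (intro sigma_sets.Basic CollectI exI[of _ m] exI[of _ "{A. npoints (A \<inter> B) \<in> S}"]) auto
  qed
  have indR: "prob (R \<inter> X) = prob R * prob X" if "R \<in> RR" "X \<in> PP {m}" for R X
  proof -
    have "indep_sets (\<lambda>m. PP {m}) UNIV" using rp by (simp add: random_points_def PP_def)
    then have "indep_sets (\<lambda>j. sigma_sets (space M) (\<Union>m'\<in>(if j then -{m} else {m}). PP {m'})) UNIV"
    proof (intro indep_sets_collect_sigma)
      assume "indep_sets (\<lambda>m. PP {m}) UNIV"
      moreover have "(\<Union>j\<in>UNIV. if j then -{m} else {m}) = UNIV" by (auto simp: UNIV_bool)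
      ultimately show "indep_sets (\<lambda>m. PP {m}) (\<Union>j\<in>UNIV. if j then -{m} else {m})" by simp
      show "disjoint_family_on (\<lambda>j. if j then -{m} else {m}) UNIV"
        by (auto simp: disjoint_family_on_def)
      show "Int_stable (PP {i})" for i using IntI[OF saP] by (auto simp: Int_stable_def)
    qed
    from indep_setsD[OF this, of UNIV "\<lambda>j. if j then R else X"]
    show ?thesis using that by (auto simp: UNIV_bool RR_def Int_commute mult.commute)
  qed
  have indD: "prob (D \<inter> X) = prob D * prob X" if "D \<in> DD" "X \<in> PP UNIV" for D X
    using rd that unfolding random_drifts_def DD_def PP_def by (auto intro: indep_setD)
  have indE: "prob (E \<inter> Y) = prob E * prob Y" if "E \<in> EE" for E
    using indep_past_counts[OF B Y] that by (simp add: EE_def)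
  define G where "G = {D \<inter> R \<inter> E | D R E. D \<in> DD \<and> R \<in> RR \<and> E \<in> EE}"
  show ?thesis
  proof (rule indep_event_sigma_sets[where G = G])
    show "Int_stable G"
    proof (rule Int_stableI)
      fix a b assume "a \<in> G" "b \<in> G"
      then obtain D R E D' R' E' where
        *: "a = D \<inter> R \<inter> E" "D \<in> DD" "R \<in> RR" "E \<in> EE" "b = D' \<inter> R' \<inter> E'" "D' \<in> DD" "R' \<in> RR" "E' \<in> EE"
        by (auto simp: G_def)
      have "a \<inter> b = (D \<inter> D') \<inter> (R \<inter> R') \<inter> (E \<inter> E')" using * by auto
      then show "a \<inter> b \<in> G" unfolding G_def
        using IntI[OF saD *(2,6)] IntI[OF saR *(3,7)] IntI[OF saE *(4,8)] by blast
    qed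
    show "G \<subseteq> events" using DDev RRev EP PPev unfolding G_def by blast
    show "Y \<in> events" using YP PPev by auto
    show "prob (F \<inter> Y) = prob F * prob Y" if "F \<in> G" for F
    proof -
      obtain D R E where F: "F = D \<inter> R \<inter> E" and D: "D \<in> DD" and R: "R \<in> RR" and E: "E \<in> EE"
        using \<open>F \<in> G\<close> by (auto simp: G_def)
      have EY: "E \<inter> Y \<in> PP {m}" using E EP YP IntI[OF saP] by auto
      have RU: "R \<in> PP UNIV" using R RP by (rule rev_subsetD)
      have REY: "R \<inter> (E \<inter> Y) \<in> PP UNIV" by (rule IntI[OF saP RU subsetD[OF PmP EY]])
      have RE: "R \<inter> E \<in> PP UNIV" by (rule IntI[OF saP RU subsetD[OF PmP subsetD[OF EP E]]])
      have "prob (F \<inter> Y) = prob (D \<inter> (R \<inter> (E \<inter> Y)))" by (simp add: F Int_assoc)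
      also have "\<dots> = prob D * prob (R \<inter> (E \<inter> Y))"
        by (rule indD[OF D REY])
      also have "\<dots> = prob D * (prob R * (prob E * prob Y))"
        by (simp only: indR[OF R EY] indE[OF E])
      also have "\<dots> = prob D * prob (R \<inter> E) * prob Y"
        using indR[OF R, of E] E EP by auto
      also have "prob D * prob (R \<inter> E) = prob (D \<inter> (R \<inter> E))"
        by (rule indD[OF D RE, symmetric])
      finally show ?thesis by (simp add: F Int_assoc)
    qed
    have tops: "space M \<in> DD" "space M \<in> RR" "space M \<in> EE" using saD saR saE by (auto intro: topI)
    have "events_drifts M n \<phi> \<xi> {..q} \<subseteq> G"
    proof
      fix D assume D: "D \<in> events_drifts M n \<phi> \<xi> {..q}"
      then have "D \<in> DD" unfolding DD_def events_drifts_def by (intro sigma_sets.Basic) auto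
      moreover have "D = D \<inter> space M \<inter> space M" using D pd by blast
      ultimately show "D \<in> G" unfolding G_def using tops by blast
    qed
    moreover have "events_points M \<pi> UNIV {..q} \<subseteq> G"
    proof
      fix A assume A: "A \<in> events_points M \<pi> UNIV {..q}"
      then have As: "A \<subseteq> space M" using pw by blast
      from A obtain m' where m': "A \<in> events_points M \<pi> {m'} {..q}" by (auto simp: events_points_def)
      show "A \<in> G"
      proof (cases "m' = m")
        case True
        then have "A \<in> EE" using m' by (auto simp: EE_def)
        moreover have "A = space M \<inter> space M \<inter> A" using As by auto
        ultimately show ?thesis unfolding G_def using tops by blast
      next
        case False
        have "A \<in> PP {m'}" using mono_ep[of "{..q}" "{m'}"] m' by auto
        then have "A \<in> RR" unfolding RR_def using False by (intro sigma_sets.Basic) auto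
        moreover have "A = space M \<inter> A \<inter> space M" using As by auto
        ultimately show ?thesis unfolding G_def using tops by blast
      qed
    qed
    ultimately have "sets (Fr q) \<subseteq> sigma_sets (space M) G"
      unfolding sets_filt by (intro sigma_sets_mono') auto
    then show "F \<in> sigma_sets (space M) G" using F by auto
  qed
qed

text \<open>The Poisson weights sum to 1, so the count is almost surely finite and equals the sum of
  \<open>j\<close> times the indicator that it is \<open>j\<close>; independence of the past factors
  each term.\<close>

lemma pi_mean:
  assumes B: "B \<in> sets borel" "B \<subseteq> {q<..} \<times> {0..}" "emeasure lborel B < \<infinity>" and F: "F \<in> sets (Fr q)"
  shows "(\<integral>\<^sup>+ \<omega>. indicator F \<omega> * npoints (\<pi> m \<omega> \<inter> B) \<partial>M) = emeasure M F * emeasure lborel B"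
proof -
  define Y where "Y j = {\<omega>\<in>space M. npoints (\<pi> m \<omega> \<inter> B) = of_nat j}" for j :: nat
  define \<mu> where "\<mu> = measure lborel B"
  note [measurable] = pi_count[OF B(1), of m]
  have FM: "F \<in> events" using F filt_sub by (auto simp: subalgebra_def)
  have YM[measurable]: "Y j \<in> events" for j unfolding Y_def by measurable
  have Yc: "Y j \<in> cnt_ev m B" for j
    unfolding cnt_ev_def Y_def by (intro CollectI exI[of _ "{of_nat j}"]) auto
  have B': "B \<subseteq> UNIV \<times> {0..}" using B(2) by auto
  have law: "prob (Y j) = exp (- \<mu>) * \<mu> ^ j / fact j" for j
    unfolding Y_def \<mu>_def by (intro pi_law B B')
  have dY: "disjoint_family Y" by (auto simp: Y_def disjoint_family_on_def)
  have "(\<lambda>j. prob (Y j)) sums prob (\<Union>j. Y j)"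
    using dY by (intro finite_measure_UNION) auto
  moreover have "(\<lambda>j. prob (Y j)) sums 1" unfolding law by (rule poisson_total)
  ultimately have "prob (\<Union>j. Y j) = 1" by (rule sums_unique2)
  then have ae: "AE \<omega> in M. \<omega> \<in> (\<Union>j. Y j)" by (subst AE_in_set_eq_1) auto
  have "(\<integral>\<^sup>+ \<omega>. indicator F \<omega> * npoints (\<pi> m \<omega> \<inter> B) \<partial>M) =
        (\<integral>\<^sup>+ \<omega>. (\<Sum>j. of_nat j * indicator (F \<inter> Y j) \<omega>) \<partial>M)"
    using ae
  proof (intro nn_integral_cong_AE, eventually_elim)
    fix \<omega> assume "\<omega> \<in> (\<Union>j. Y j)"
    then obtain i where i: "\<omega> \<in> Y i" by auto
    have "(\<Sum>j. of_nat j * indicator (F \<inter> Y j) \<omega>) = (\<Sum>j\<in>{i}. of_nat j * indicator (F \<inter> Y j) \<omega> :: ennreal)"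
    proof (rule suminf_finite)
      fix j assume "j \<notin> {i}"
      then have "\<omega> \<notin> Y j" using dY i by (auto simp: disjoint_family_on_def)
      then show "of_nat j * indicator (F \<inter> Y j) \<omega> = (0::ennreal)" by simp
    qed simp
    also have "\<dots> = indicator F \<omega> * npoints (\<pi> m \<omega> \<inter> B)"
      using i by (auto simp: Y_def indicator_def)
    finally show "indicator F \<omega> * npoints (\<pi> m \<omega> \<inter> B) = (\<Sum>j. of_nat j * indicator (F \<inter> Y j) \<omega>)" by simp
  qed
  also have "\<dots> = (\<Sum>j. \<integral>\<^sup>+ \<omega>. of_nat j * indicator (F \<inter> Y j) \<omega> \<partial>M)"
    using FM by (intro nn_integral_suminf) auto
  also have "\<dots> = (\<Sum>j. emeasure M F * (of_nat j * ennreal (exp (- \<mu>) * \<mu> ^ j / fact j)))"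
  proof (intro suminf_cong)
    fix j
    have "(\<integral>\<^sup>+ \<omega>. of_nat j * indicator (F \<inter> Y j) \<omega> \<partial>M) = of_nat j * emeasure M (F \<inter> Y j)"
      using FM by (intro nn_integral_cmult_indicator) auto
    also have "emeasure M (F \<inter> Y j) = ennreal (prob F * prob (Y j))"
      using indep_past[OF B(1,2) Yc F] by (simp add: emeasure_eq_measure)
    also have "\<dots> = emeasure M F * ennreal (prob (Y j))"
      unfolding emeasure_eq_measure by (rule ennreal_mult) auto
    finally show "(\<integral>\<^sup>+ \<omega>. of_nat j * indicator (F \<inter> Y j) \<omega> \<partial>M) =
        emeasure M F * (of_nat j * ennreal (exp (- \<mu>) * \<mu> ^ j / fact j))"
      by (simp only: law mult.left_commute)
  qed
  also have "\<dots> = emeasure M F * (\<Sum>j. of_nat j * ennreal (exp (- \<mu>) * \<mu> ^ j / fact j))"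
    by (rule ennreal_suminf_cmult)
  also have "\<dots> = emeasure M F * ennreal \<mu>" by (simp add: poisson_mean \<mu>_def)
  also have "ennreal \<mu> = emeasure lborel B" using B(3) by (simp add: \<mu>_def emeasure_eq_ennreal_measure less_top[symmetric])
  finally show ?thesis .
qed

end

section \<open>Campbell's formula\<close>

lemma ex_nat_between: "\<exists>i::nat. - real i \<le> x \<and> x \<le> real i"
proof -
  obtain i :: nat where "\<bar>x\<bar> \<le> real i" using real_arch_simple by blast
  then show ?thesis by (intro exI[of _ i]) auto
qed

text \<open>\<open>Om0\<close> is an event of full probability on which the points are locally finite; the processes
  built from \<open>pt\<close> and \<open>CMt\<close> are empty off it, so that their measurability needs no null set.\<close>

locale har_base = har_noise M n \<phi> \<pi> \<xi> t0
  for M :: "'w measure" and n :: "'p::finite \<Rightarrow> nat" and \<phi> :: "'p \<Rightarrow> real"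
    and \<pi> :: "'m::finite \<Rightarrow> 'w \<Rightarrow> (real \<times> real) set" and \<xi> :: "'p \<Rightarrow> real \<Rightarrow> 'w \<Rightarrow> real" and t0 :: real +
  fixes CM :: "'m \<Rightarrow> 'w \<Rightarrow> real set" and CP :: "'p \<Rightarrow> real \<Rightarrow> 'w \<Rightarrow> real option" and Om0 :: "'w set"
  assumes ic: "initial_condition M n \<phi> \<pi> \<xi> t0 (CM, CP)"
    and Om0_sets: "Om0 \<in> sets M" and Om0_ae: "AE \<omega> in M. \<omega> \<in> Om0"
    and Om0_fin: "\<And>\<omega> m r. \<omega> \<in> Om0 \<Longrightarrow> loc_fin t0 (\<pi> m \<omega>) r"
    and Om0_CM: "\<And>\<omega> m i. \<omega> \<in> Om0 \<Longrightarrow> finite (CM m \<omega> \<inter> {- real i..real i})"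
begin

abbreviation Fa :: "real \<Rightarrow> 'w measure" where "Fa t \<equiv> aug M (Fr t)"

sublocale au: filtr M t0 Fa
  by (rule raw.filtr_aug)

lemma Om0_aug: "Om0 \<in> sets (Fa t)"
  by (intro AE_mem_aug filt_sub Om0_sets Om0_ae)

lemma Fr_Fa: "f \<in> measurable (Fr t) N \<Longrightarrow> f \<in> measurable (Fa t) N"
  by (rule measurable_subalgebra_mono[OF _ sets_subset_aug[OF filt_sub]]) auto

lemma Fa_M: "f \<in> measurable (Fa t) N \<Longrightarrow> f \<in> measurable M N"
  by (rule measurable_subalgebra_mono[OF _ sets_aug_subset[OF filt_sub]]) auto

text \<open>The time \<open>t0\<close> is left out because the predictable sets live on later times
  only; almost surely there is no atom at \<open>t0\<close>.\<close>

definition pt :: "'m \<Rightarrow> 'w \<Rightarrow> (real \<times> real) set" where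
  "pt m \<omega> = (if \<omega> \<in> Om0 then \<pi> m \<omega> \<inter> ({t0<..} \<times> UNIV) else {})"

definition atoms :: "'m \<Rightarrow> ('w \<times> real \<times> real) set \<Rightarrow> 'w \<Rightarrow> (real \<times> real) set" where
  "atoms m C \<omega> = pt m \<omega> \<inter> Pair \<omega> -` C"

definition times :: "'m \<Rightarrow> ('w \<times> real \<times> real) set \<Rightarrow> 'w \<Rightarrow> real set" where
  "times m C \<omega> = fst ` atoms m C \<omega>"

definition CMt :: "'m \<Rightarrow> 'w \<Rightarrow> real set" where
  "CMt m \<omega> = (if \<omega> \<in> Om0 then CM m \<omega> else {})"

definition NN :: "('m \<Rightarrow> ('w \<times> real \<times> real) set) \<Rightarrow> 'm \<Rightarrow> 'w \<Rightarrow> real set" where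
  "NN C m \<omega> = CMt m \<omega> \<union> times m (C m) \<omega>"

lemma Om0_space: "\<omega> \<in> Om0 \<Longrightarrow> \<omega> \<in> space M"
  using sets.sets_into_space[OF Om0_sets] by auto

lemma pt_sub: "pt m \<omega> \<subseteq> {t0<..} \<times> {0..}"
  using pi_pos[of \<omega> m] Om0_space by (auto simp: pt_def)

lemma pt_uni: "(s, x) \<in> pt m \<omega> \<Longrightarrow> (s, x') \<in> pt m' \<omega> \<Longrightarrow> m = m' \<and> x = x'"
  using pi_uni[of \<omega>] Om0_space by (auto simp: pt_def split: if_splits)

lemma inj_fst_pt: "inj_on fst (pt m \<omega>)"
  by (auto simp: inj_on_def dest: pt_uni)

lemma finite_pt: "finite (pt m \<omega> \<inter> ({..q} \<times> {..real i}))"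
proof (cases "\<omega> \<in> Om0")
  case True
  have "pt m \<omega> \<inter> ({..q} \<times> {..real i}) \<subseteq> \<pi> m \<omega> \<inter> ({t0<..q} \<times> {..real i})"
    by (auto simp: pt_def split: if_splits)
  moreover have "finite (\<pi> m \<omega> \<inter> ({t0<..q} \<times> {..real i}))"
    using Om0_fin[OF True, of m q] by (simp add: loc_fin_def)
  ultimately show ?thesis by (rule finite_subset)
qed (simp add: pt_def)

lemma countable_pt: "countable (pt m \<omega>)"
proof -
  have "pt m \<omega> = (\<Union>i::nat. \<Union>j::nat. pt m \<omega> \<inter> ({..real i} \<times> {..real j}))"
  proof (intro equalityI subsetI)
    fix y assume y: "y \<in> pt m \<omega>"
    obtain i j :: nat where "fst y \<le> real i" "snd y \<le> real j" using real_arch_simple by metis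
    then show "y \<in> (\<Union>i::nat. \<Union>j::nat. pt m \<omega> \<inter> ({..real i} \<times> {..real j}))"
      using y unfolding UN_iff by (intro bexI[of _ i] bexI[of _ j]) (simp_all add: mem_Times_iff)
  qed auto
  also have "countable \<dots>" by (intro countable_UN countableI_type countable_finite finite_pt)
  finally show ?thesis .
qed

lemma pt_rset: "sfin_rset (Fa q) (\<lambda>\<omega>. pt m \<omega> \<inter> ({..q} \<times> UNIV))"
  unfolding sfin_rset_def
proof (intro exI conjI allI ballI)
  fix i :: nat and \<omega> assume "\<omega> \<in> space (Fa q)"
  show "finite (pt m \<omega> \<inter> ({..q} \<times> {..real i}))" by (rule finite_pt)
next
  fix i :: nat
  have "(\<lambda>\<omega>. \<pi> m \<omega> \<inter> ({..q} \<times> {0..}) \<inter> ({t0<..q} \<times> {..real i})) \<in> measurable (Fa q) point_sets"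
    by (intro measurable_point_sets_Int Fr_Fa pi_filt borel_Times_UNIV) auto
  note * = measurable_npoints[OF this]
  show "(\<lambda>\<omega>. pt m \<omega> \<inter> ({..q} \<times> {..real i})) \<in> measurable (Fa q) point_sets"
    unfolding measurable_point_sets_iff
  proof
    fix B :: "(real \<times> real) set" assume B: "B \<in> sets borel"
    have "(\<lambda>\<omega>. npoints (\<pi> m \<omega> \<inter> ({..q} \<times> {0..}) \<inter> ({t0<..q} \<times> {..real i}) \<inter> B) * indicator Om0 \<omega>)
       \<in> borel_measurable (Fa q)"
      using *[OF B] Om0_aug by (intro borel_measurable_times_ennreal) auto
    also have "?this \<longleftrightarrow> (\<lambda>\<omega>. npoints (pt m \<omega> \<inter> ({..q} \<times> {..real i}) \<inter> B)) \<in> borel_measurable (Fa q)"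
    proof (rule measurable_cong)
      fix \<omega> assume "\<omega> \<in> space (Fa q)"
      then have "\<pi> m \<omega> \<subseteq> UNIV \<times> {0..}" using pi_pos by simp
      then have "\<omega> \<in> Om0 \<Longrightarrow> \<pi> m \<omega> \<inter> ({..q} \<times> {0..}) \<inter> ({t0<..q} \<times> {..real i}) \<inter> B = pt m \<omega> \<inter> ({..q} \<times> {..real i}) \<inter> B"
        by (auto simp: pt_def)
      then show "npoints (\<pi> m \<omega> \<inter> ({..q} \<times> {0..}) \<inter> ({t0<..q} \<times> {..real i}) \<inter> B) * indicator Om0 \<omega> =
         npoints (pt m \<omega> \<inter> ({..q} \<times> {..real i}) \<inter> B)"
        by (cases "\<omega> \<in> Om0") (auto simp: pt_def)
    qed
    finally show "(\<lambda>\<omega>. npoints (pt m \<omega> \<inter> ({..q} \<times> {..real i}) \<inter> B)) \<in> borel_measurable (Fa q)" .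
  qed
next
  fix \<omega>
  show "incseq (\<lambda>i. pt m \<omega> \<inter> ({..q} \<times> {..real i}))" by (auto simp: incseq_def)
  show "pt m \<omega> \<inter> ({..q} \<times> UNIV) = (\<Union>i. pt m \<omega> \<inter> ({..q} \<times> {..real i}))"
    by (auto simp: real_arch_simple)
qed

lemma atoms_rset:
  assumes C: "C \<in> sets (mpred t0 Fa)" and q: "t0 \<le> q"
  shows "sfin_rset (Fa q) (\<lambda>\<omega>. atoms m C \<omega> \<inter> ({..q} \<times> UNIV))"
proof -
  have "sfin_rset (Fa q) (\<lambda>\<omega>. pt m \<omega> \<inter> ({..q} \<times> UNIV) \<inter> Pair \<omega> -` (C \<inter> (UNIV \<times> ({..q} \<times> UNIV))))"
    by (intro sfin_rset_section pt_rset au.mpred_before q C)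
  moreover have "pt m \<omega> \<inter> ({..q} \<times> UNIV) \<inter> Pair \<omega> -` (C \<inter> (UNIV \<times> ({..q} \<times> UNIV))) = atoms m C \<omega> \<inter> ({..q} \<times> UNIV)"
    for \<omega> by (auto simp: atoms_def)
  ultimately show ?thesis by simp
qed

lemma times_rset:
  assumes C: "C \<in> sets (mpred t0 Fa)" and q: "t0 \<le> q"
  shows "sfin_rset (Fa q) (\<lambda>\<omega>. times m C \<omega> \<inter> {..q})"
proof -
  have "inj_on fst (atoms m C \<omega> \<inter> ({..q} \<times> UNIV))" for \<omega>
    by (rule inj_on_subset[OF inj_fst_pt]) (auto simp: atoms_def)
  then have "sfin_rset (Fa q) (\<lambda>\<omega>. fst ` (atoms m C \<omega> \<inter> ({..q} \<times> UNIV)))"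
    by (intro sfin_rset_fst atoms_rset C q)
  moreover have "fst ` (atoms m C \<omega> \<inter> ({..q} \<times> UNIV)) = times m C \<omega> \<inter> {..q}" for \<omega>
    by (force simp: times_def)
  ultimately show ?thesis by simp
qed

lemma times_sub: "times m C \<omega> \<subseteq> {t0<..}"
  using pt_sub[of m \<omega>] by (auto simp: times_def atoms_def)

lemma times_iff: "s \<in> times m C \<omega> \<longleftrightarrow> (\<exists>x. (s, x) \<in> pt m \<omega> \<and> (\<omega>, s, x) \<in> C)"
  by (force simp: times_def atoms_def)

lemma filt_left_sub: "sets (filt_left M n \<phi> \<pi> \<xi> t0) \<subseteq> sets (Fr t0)" "space (filt_left M n \<phi> \<pi> \<xi> t0) = space M"
proof -
  have sub: "(\<Union>s\<in>{..<t0}. sets (Fr s)) \<subseteq> sets (Fr t0)" by (intro UN_least filt_mono) simp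
  have "(\<Union>s\<in>{..<t0}. sets (Fr s)) \<subseteq> Pow (space M)"
  proof (intro UN_least)
    fix s show "sets (Fr s) \<subseteq> Pow (space M)" using sets.space_closed[of "Fr s"] by simp
  qed
  then show "sets (filt_left M n \<phi> \<pi> \<xi> t0) \<subseteq> sets (Fr t0)"
    unfolding filt_left_def using sets.sigma_sets_subset[OF sub] by (subst sets_measure_of) auto
  show "space (filt_left M n \<phi> \<pi> \<xi> t0) = space M"
    by (simp add: filt_left_def space_measure_of_conv)
qed

lemma filt_left_Fr: "f \<in> measurable (filt_left M n \<phi> \<pi> \<xi> t0) N \<Longrightarrow> f \<in> measurable (Fr t0) N"
  by (rule measurable_subalgebra_mono[OF _ filt_left_sub(1)]) (auto simp: filt_left_sub(2))

lemma CM_Fr: "CM m \<in> measurable (Fr t0) point_sets"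
  using ic by (intro filt_left_Fr) (auto simp: initial_condition_def)

lemma CP_Fr: "(p, k) \<in> ar_index n \<phi> \<Longrightarrow> k < t0 \<Longrightarrow> CP p k \<in> measurable (Fr t0) opt_borel"
  using ic by (intro filt_left_Fr) (auto simp: initial_condition_def)

lemma CM_sub: "\<omega> \<in> space M \<Longrightarrow> CM m \<omega> \<subseteq> {..<t0}"
  using ic by (auto simp: initial_condition_def)

lemma CM_disj: "\<omega> \<in> space M \<Longrightarrow> disjoint_family (\<lambda>m. CM m \<omega>)"
  using ic by (auto simp: initial_condition_def)

lemma CMt_sub: "CMt m \<omega> \<subseteq> {..<t0}"
  using CM_sub[of \<omega> m] Om0_space by (auto simp: CMt_def)

lemma CMt_rset: "sfin_rset (Fa q) (CMt m)" if q: "t0 \<le> q"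
proof -
  have "sfin_rset (Fa t0) (CMt m)"
    unfolding sfin_rset_def
  proof (intro exI conjI allI ballI)
    fix i :: nat and \<omega>
    show "finite (CMt m \<omega> \<inter> {- real i..real i})" by (auto simp: CMt_def Om0_CM)
  next
    fix i :: nat
    have "(\<lambda>\<omega>. if \<omega> \<in> Om0 then CM m \<omega> \<inter> {- real i..real i} else {}) \<in> measurable (Fa t0) point_sets"
      unfolding measurable_point_sets_iff
    proof
      fix B :: "real set" assume B: "B \<in> sets borel"
      have "(\<lambda>\<omega>. npoints (CM m \<omega> \<inter> {- real i..real i} \<inter> B)) \<in> borel_measurable (Fa t0)"
        using B by (intro measurable_npoints measurable_point_sets_Int Fr_Fa[OF CM_Fr]) auto
      then have "(\<lambda>\<omega>. npoints (CM m \<omega> \<inter> {- real i..real i} \<inter> B) * indicator Om0 \<omega>) \<in> borel_measurable (Fa t0)"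
        using Om0_aug by (intro borel_measurable_times_ennreal) auto
      also have "(\<lambda>\<omega>. npoints (CM m \<omega> \<inter> {- real i..real i} \<inter> B) * indicator Om0 \<omega>) =
         (\<lambda>\<omega>. npoints ((if \<omega> \<in> Om0 then CM m \<omega> \<inter> {- real i..real i} else {}) \<inter> B))" by (auto simp: fun_eq_iff)
      finally show "\<dots> \<in> borel_measurable (Fa t0)" .
    qed
    also have "(\<lambda>\<omega>. if \<omega> \<in> Om0 then CM m \<omega> \<inter> {- real i..real i} else {}) = (\<lambda>\<omega>. CMt m \<omega> \<inter> {- real i..real i})"
      by (auto simp: CMt_def fun_eq_iff)
    finally show "(\<lambda>\<omega>. CMt m \<omega> \<inter> {- real i..real i}) \<in> measurable (Fa t0) point_sets" .
  next
    fix \<omega>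
    show "incseq (\<lambda>i. CMt m \<omega> \<inter> {- real i..real i})" by (auto simp: incseq_def)
    show "CMt m \<omega> = (\<Union>i. CMt m \<omega> \<inter> {- real i..real i})"
      by (auto simp: ex_nat_between)
  qed
  from sfin_rset_mono_sets[OF this au.mono[OF order_refl q]] show ?thesis by simp
qed

lemma NN_rset:
  assumes C: "\<And>m. C m \<in> sets (mpred t0 Fa)" and q: "t0 \<le> q"
  shows "sfin_rset (Fa q) (\<lambda>\<omega>. NN C m \<omega> \<inter> {..q})"
proof -
  have "sfin_rset (Fa q) (\<lambda>\<omega>. CMt m \<omega> \<union> times m (C m) \<omega> \<inter> {..q})"
    using CMt_sub times_sub by (intro sfin_rset_Un CMt_rset q times_rset C) fastforce
  moreover have "CMt m \<omega> \<union> times m (C m) \<omega> \<inter> {..q} = NN C m \<omega> \<inter> {..q}" for \<omega>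
    using CMt_sub[of m \<omega>] q by (auto simp: NN_def)
  ultimately show ?thesis by simp
qed

lemma countable_CMt: "countable (CMt m \<omega>)"
proof -
  have "CMt m \<omega> = (\<Union>i::nat. CMt m \<omega> \<inter> {- real i..real i})"
  proof (intro equalityI subsetI)
    fix x assume x: "x \<in> CMt m \<omega>"
    obtain i :: nat where "- real i \<le> x \<and> x \<le> real i" using ex_nat_between by blast
    with x show "x \<in> (\<Union>i::nat. CMt m \<omega> \<inter> {- real i..real i})" by (intro UN_I[of i]) auto
  qed auto
  also have "countable \<dots>" by (intro countable_UN countableI_type countable_finite) (auto simp: CMt_def Om0_CM)
  finally show ?thesis .
qed

lemma countable_times: "countable (times m C \<omega>)"
  unfolding times_def atoms_def by (intro countable_image countable_Int1 countable_pt)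

definition box :: "nat \<Rightarrow> (real \<times> real) set" where
  "box i = {t0<..t0 + real i} \<times> {0..real i}"

lemma box_borel: "box i \<in> sets borel"
  by (simp add: box_def borel_Times_UNIV)

lemma box_finite: "emeasure lborel (box i) < \<infinity>"
  unfolding box_def lborel_prod[symmetric]
  by (subst lborel.emeasure_pair_measure_Times) (auto simp: ennreal_mult_less_top)

lemma section_borel: "C \<in> sets (mpred t0 Fa) \<Longrightarrow> Pair \<omega> -` C \<in> sets borel"
  using sets_Pair1[OF au.mpred_subset] by simp

lemma npoints_atoms_meas:
  assumes C: "C \<in> sets (mpred t0 Fa)" and B: "B \<in> sets borel" and q: "t0 \<le> q" "B \<subseteq> {..q} \<times> UNIV"
  shows "(\<lambda>\<omega>. npoints (atoms m C \<omega> \<inter> B)) \<in> borel_measurable M"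
proof -
  have "(\<lambda>\<omega>. npoints (atoms m C \<omega> \<inter> ({..q} \<times> UNIV) \<inter> B)) \<in> borel_measurable (Fa q)"
    by (intro measurable_npoints sfin_rset_measurable atoms_rset C q B)
  moreover have "atoms m C \<omega> \<inter> ({..q} \<times> UNIV) \<inter> B = atoms m C \<omega> \<inter> B" for \<omega> using q by auto
  ultimately show ?thesis by (intro Fa_M[of _ q]) simp
qed

lemma emeasure_section_meas:
  assumes C: "C \<in> sets (mpred t0 Fa)" and B: "B \<in> sets borel"
  shows "(\<lambda>\<omega>. emeasure lborel (Pair \<omega> -` C \<inter> B)) \<in> borel_measurable M"
proof -
  have "C \<inter> (space M \<times> B) \<in> sets (M \<Otimes>\<^sub>M lborel)"
    using au.mpred_subset[OF C] B by (auto cong: sets_pair_measure_cong)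
  from lborel.measurable_emeasure_Pair[OF this]
  have "(\<lambda>\<omega>. emeasure lborel (Pair \<omega> -` (C \<inter> (space M \<times> B)))) \<in> borel_measurable M" .
  also have "?this \<longleftrightarrow> ?thesis"
    by (intro measurable_cong arg_cong[where f="emeasure lborel"]) auto
  finally show ?thesis .
qed

text \<open>On a generator the formula is \<open>pi_mean\<close>, once the event of the augmented
  filtration is replaced by its version in the given one. The box has finite area, which permits the
  cancellation in the complement step.\<close>

lemma campbell_box:
  assumes C: "C \<in> sets (mpred t0 Fa)"
  shows "(\<integral>\<^sup>+ \<omega>. npoints (atoms m C \<omega> \<inter> box i) \<partial>M) = (\<integral>\<^sup>+ \<omega>. emeasure lborel (Pair \<omega> -` C \<inter> box i) \<partial>M)"
proof -
  note nm = npoints_atoms_meas[OF _ box_borel, of _ "t0 + real i" i m]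
  note em = emeasure_section_meas[OF _ box_borel, of _ i]
  have box_sub: "box i \<subseteq> {..t0 + real i} \<times> UNIV" by (auto simp: box_def)
  have rect: "(\<integral>\<^sup>+ \<omega>. npoints (atoms m A \<omega> \<inter> box i) \<partial>M) = (\<integral>\<^sup>+ \<omega>. emeasure lborel (Pair \<omega> -` A \<inter> box i) \<partial>M)"
    if Agen: "A \<in> mpred_gen t0 Fa" for A
  proof -
    obtain F q r X where A: "A = F \<times> ({q<..r} \<times> X)" "t0 \<le> q" "F \<in> sets (Fa q)" "X \<in> sets borel"
      using Agen unfolding mpred_gen_def by auto
    then obtain F' where F': "F' \<in> sets (Fr q)" "AE \<omega> in M. \<omega> \<in> F \<longleftrightarrow> \<omega> \<in> F'" and FM: "F \<in> sets M"
      by (auto simp: sets_aug_iff[OF filt_sub])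
    have FM': "F' \<in> sets M" using F'(1) filt_sub by (auto simp: subalgebra_def)
    define B where "B = ({q<..r} \<times> X) \<inter> box i"
    have B: "B \<in> sets borel" "B \<subseteq> {q<..} \<times> {0..}"
      using box_borel A(4) by (auto simp: B_def box_def borel_Times_UNIV)
    have "emeasure lborel B \<le> emeasure lborel (box i)"
      by (intro emeasure_mono) (auto simp: B_def box_borel)
    then have Bf: "emeasure lborel B < \<infinity>" using box_finite[of i] by (rule le_less_trans)
    have "(\<integral>\<^sup>+ \<omega>. npoints (atoms m A \<omega> \<inter> box i) \<partial>M) = (\<integral>\<^sup>+ \<omega>. indicator F' \<omega> * npoints (\<pi> m \<omega> \<inter> B) \<partial>M)"
      using F'(2) Om0_ae
    proof (intro nn_integral_cong_AE, eventually_elim)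
      case (elim \<omega>)
      have "\<omega> \<in> F \<Longrightarrow> atoms m A \<omega> \<inter> box i = \<pi> m \<omega> \<inter> B"
        using elim by (auto simp: atoms_def pt_def A B_def box_def)
      moreover have "\<omega> \<notin> F \<Longrightarrow> atoms m A \<omega> \<inter> box i = {}" by (auto simp: atoms_def A)
      ultimately show ?case using elim by (cases "\<omega> \<in> F") auto
    qed
    also have "\<dots> = emeasure M F' * emeasure lborel B" by (rule pi_mean[OF B Bf F'(1)])
    also have "emeasure M F' = emeasure M F" using F'(2) FM FM' by (intro emeasure_eq_AE) auto
    also have "emeasure M F * emeasure lborel B = (\<integral>\<^sup>+ \<omega>. emeasure lborel B * indicator F \<omega> \<partial>M)"
      unfolding nn_integral_cmult_indicator[OF FM] by (rule mult.commute)
    also have "\<dots> = (\<integral>\<^sup>+ \<omega>. emeasure lborel (Pair \<omega> -` A \<inter> box i) \<partial>M)"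
      by (intro nn_integral_cong) (auto simp: A B_def indicator_def vimage_def)
    finally show ?thesis .
  qed
  have Csig: "C \<in> sigma_sets (space M \<times> ({t0<..} \<times> UNIV)) (mpred_gen t0 Fa)"
    using C by (simp add: au.sets_mpred)
  show ?thesis
    using au.Int_stable_mpred_gen au.mpred_gen_Pow Csig
  proof (induct rule: sigma_sets_induct_disjoint)
    case (basic A) then show ?case by (rule rect)
  next
    case empty then show ?case by (simp add: atoms_def)
  next
    case (compl A)
    let ?U = "space M \<times> ({t0<..} \<times> (UNIV :: real set))"
    have A: "A \<in> sets (mpred t0 Fa)" using compl(1) by (simp add: au.sets_mpred)
    have U: "?U \<in> sets (mpred t0 Fa)" using sets.top[of "mpred t0 Fa"] by simp
    have D: "?U - A \<in> sets (mpred t0 Fa)" using A U by auto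
    have "(\<integral>\<^sup>+ \<omega>. npoints (atoms m (?U - A) \<omega> \<inter> box i) \<partial>M) + (\<integral>\<^sup>+ \<omega>. npoints (atoms m A \<omega> \<inter> box i) \<partial>M)
       = (\<integral>\<^sup>+ \<omega>. npoints (atoms m (?U - A) \<omega> \<inter> box i) + npoints (atoms m A \<omega> \<inter> box i) \<partial>M)"
      by (intro nn_integral_add[symmetric] nm A D box_sub) auto
    \<comment> \<open>The full space is not a generator, but inside \<open>box i\<close> it cannot
      be told from the generator with times up to \<open>t0 + real i\<close>.\<close>
    also have "\<dots> = (\<integral>\<^sup>+ \<omega>. npoints (atoms m (space M \<times> ({t0<..t0 + real i} \<times> UNIV)) \<omega> \<inter> box i) \<partial>M)"
    proof (intro nn_integral_cong)
      fix \<omega> assume "\<omega> \<in> space M"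
      then have "atoms m (space M \<times> ({t0<..t0 + real i} \<times> UNIV)) \<omega> \<inter> box i =
         (atoms m (?U - A) \<omega> \<inter> box i) \<union> (atoms m A \<omega> \<inter> box i)"
        by (auto simp: atoms_def box_def)
      moreover have "(atoms m (?U - A) \<omega> \<inter> box i) \<inter> (atoms m A \<omega> \<inter> box i) = {}" by (auto simp: atoms_def)
      ultimately show "npoints (atoms m (?U - A) \<omega> \<inter> box i) + npoints (atoms m A \<omega> \<inter> box i) =
         npoints (atoms m (space M \<times> ({t0<..t0 + real i} \<times> UNIV)) \<omega> \<inter> box i)"
        by (simp add: npoints_Un_disjoint)
    qed
    also have "\<dots> = (\<integral>\<^sup>+ \<omega>. emeasure lborel (Pair \<omega> -` (space M \<times> ({t0<..t0 + real i} \<times> UNIV)) \<inter> box i) \<partial>M)"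
    proof (rule rect)
      have "space M \<in> sets (Fa t0)" using sets.top[of "Fa t0"] by simp
      then show "space M \<times> ({t0<..t0 + real i} \<times> UNIV) \<in> mpred_gen t0 Fa" unfolding mpred_gen_def
        by (intro CollectI exI[of _ "space M"] exI[of _ t0] exI[of _ "t0 + real i"] exI[of _ UNIV]) auto
    qed
    also have "\<dots> = (\<integral>\<^sup>+ \<omega>. emeasure lborel (Pair \<omega> -` (?U - A) \<inter> box i) + emeasure lborel (Pair \<omega> -` A \<inter> box i) \<partial>M)"
    proof (intro nn_integral_cong)
      fix \<omega> assume "\<omega> \<in> space M"
      then have *: "Pair \<omega> -` (space M \<times> ({t0<..t0 + real i} \<times> UNIV)) \<inter> box i =
         (Pair \<omega> -` (?U - A) \<inter> box i) \<union> (Pair \<omega> -` A \<inter> box i)" by (auto simp: box_def)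
      show "emeasure lborel (Pair \<omega> -` (space M \<times> ({t0<..t0 + real i} \<times> UNIV)) \<inter> box i) =
         emeasure lborel (Pair \<omega> -` (?U - A) \<inter> box i) + emeasure lborel (Pair \<omega> -` A \<inter> box i)"
        unfolding * using section_borel[OF D, of \<omega>] section_borel[OF A, of \<omega>] box_borel
        by (intro plus_emeasure[symmetric]) auto
    qed
    also have "\<dots> = (\<integral>\<^sup>+ \<omega>. emeasure lborel (Pair \<omega> -` (?U - A) \<inter> box i) \<partial>M) + (\<integral>\<^sup>+ \<omega>. emeasure lborel (Pair \<omega> -` A \<inter> box i) \<partial>M)"
      by (intro nn_integral_add em A D)
    finally have eq: "(\<integral>\<^sup>+ \<omega>. npoints (atoms m (?U - A) \<omega> \<inter> box i) \<partial>M) + (\<integral>\<^sup>+ \<omega>. emeasure lborel (Pair \<omega> -` A \<inter> box i) \<partial>M)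
      = (\<integral>\<^sup>+ \<omega>. emeasure lborel (Pair \<omega> -` (?U - A) \<inter> box i) \<partial>M) + (\<integral>\<^sup>+ \<omega>. emeasure lborel (Pair \<omega> -` A \<inter> box i) \<partial>M)"
      by (simp only: compl(2))
    have "(\<integral>\<^sup>+ \<omega>. emeasure lborel (Pair \<omega> -` A \<inter> box i) \<partial>M) \<le> (\<integral>\<^sup>+ \<omega>. emeasure lborel (box i) \<partial>M)"
      by (intro nn_integral_mono emeasure_mono) (auto simp: box_borel)
    also have "\<dots> = emeasure lborel (box i)" by (simp add: emeasure_space_1)
    also have "\<dots> < \<infinity>" by (rule box_finite)
    finally have "(\<integral>\<^sup>+ \<omega>. emeasure lborel (Pair \<omega> -` A \<inter> box i) \<partial>M) \<noteq> \<top>" by (simp add: less_top[symmetric])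
    then show ?case using eq
      by (metis add.commute ennreal_add_left_cancel infinity_ennreal_def)
  next
    case (union A)
    have A: "A j \<in> sets (mpred t0 Fa)" for j using union(2) by (auto simp: au.sets_mpred)
    have "(\<integral>\<^sup>+ \<omega>. npoints (atoms m (\<Union>(range A)) \<omega> \<inter> box i) \<partial>M) = (\<integral>\<^sup>+ \<omega>. (\<Sum>j. npoints (atoms m (A j) \<omega> \<inter> box i)) \<partial>M)"
    proof (intro nn_integral_cong)
      fix \<omega>
      have "disjoint_family (\<lambda>j. atoms m (A j) \<omega> \<inter> box i)"
        using union(1) unfolding disjoint_family_on_def atoms_def by fastforce
      then have "(\<Sum>j. npoints (atoms m (A j) \<omega> \<inter> box i)) = npoints (\<Union>j. atoms m (A j) \<omega> \<inter> box i)"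
        by (intro suminf_emeasure) auto
      also have "(\<Union>j. atoms m (A j) \<omega> \<inter> box i) = atoms m (\<Union>(range A)) \<omega> \<inter> box i" by (auto simp: atoms_def)
      finally show "npoints (atoms m (\<Union>(range A)) \<omega> \<inter> box i) = (\<Sum>j. npoints (atoms m (A j) \<omega> \<inter> box i))" by simp
    qed
    also have "\<dots> = (\<Sum>j. \<integral>\<^sup>+ \<omega>. npoints (atoms m (A j) \<omega> \<inter> box i) \<partial>M)"
      by (intro nn_integral_suminf nm A box_sub) auto
    also have "\<dots> = (\<Sum>j. \<integral>\<^sup>+ \<omega>. emeasure lborel (Pair \<omega> -` A j \<inter> box i) \<partial>M)"
      by (simp only: union(3))
    also have "\<dots> = (\<integral>\<^sup>+ \<omega>. (\<Sum>j. emeasure lborel (Pair \<omega> -` A j \<inter> box i)) \<partial>M)"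
      by (intro nn_integral_suminf[symmetric] em A)
    also have "\<dots> = (\<integral>\<^sup>+ \<omega>. emeasure lborel (Pair \<omega> -` \<Union>(range A) \<inter> box i) \<partial>M)"
    proof (intro nn_integral_cong)
      fix \<omega>
      have "disjoint_family (\<lambda>j. Pair \<omega> -` A j \<inter> box i)"
        using union(1) unfolding disjoint_family_on_def by fastforce
      then have "(\<Sum>j. emeasure lborel (Pair \<omega> -` A j \<inter> box i)) = emeasure lborel (\<Union>j. Pair \<omega> -` A j \<inter> box i)"
        using section_borel[OF A, of \<omega>] box_borel by (intro suminf_emeasure) auto
      also have "(\<Union>j. Pair \<omega> -` A j \<inter> box i) = Pair \<omega> -` \<Union>(range A) \<inter> box i" by auto
      finally show "(\<Sum>j. emeasure lborel (Pair \<omega> -` A j \<inter> box i)) = emeasure lborel (Pair \<omega> -` \<Union>(range A) \<inter> box i)" .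
    qed
    finally show ?case .
  qed
qed

lemma incseq_box: "incseq box"
  by (auto simp: incseq_def box_def)

lemma UN_box: "(\<Union>i. box i) = {t0<..} \<times> {0..}"
proof -
  have "\<exists>i. (s, x) \<in> box i" if "t0 < s" "0 \<le> x" for s x
  proof -
    obtain i :: nat where "max (s - t0) x \<le> real i" using real_arch_simple by blast
    then show ?thesis using that by (intro exI[of _ i]) (auto simp: box_def)
  qed
  then show ?thesis by (auto simp: box_def)
qed

lemma npoints_atoms_SUP: "(SUP i. npoints (atoms m C \<omega> \<inter> box i)) = npoints (atoms m C \<omega>)"
proof -
  have "(\<Union>i. atoms m C \<omega> \<inter> box i) = atoms m C \<omega>"
    using pt_sub[of m \<omega>] by (auto simp: Int_UN_distrib[symmetric] UN_box atoms_def)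
  moreover have "incseq (\<lambda>i. atoms m C \<omega> \<inter> box i)" using incseq_box by (auto simp: incseq_def)
  ultimately show ?thesis by (metis SUP_npoints)
qed

lemma npoints_atoms_measurable:
  assumes C: "C \<in> sets (mpred t0 Fa)"
  shows "(\<lambda>\<omega>. npoints (atoms m C \<omega>)) \<in> borel_measurable M"
  unfolding npoints_atoms_SUP[symmetric]
  by (intro borel_measurable_SUP npoints_atoms_meas[OF C box_borel, of "t0 + real _"]) (auto simp: box_def)

text \<open>Turns the mean number of selected atoms into the mean area of the selecting region, even
  though the region depends on the past of the atoms themselves. The bounds on the Picard iteration
  rest on it.\<close>

lemma campbell:
  assumes C: "C \<in> sets (mpred t0 Fa)"
  shows "(\<integral>\<^sup>+ \<omega>. npoints (atoms m C \<omega>) \<partial>M) = (\<integral>\<^sup>+ \<omega>. emeasure lborel (Pair \<omega> -` C \<inter> UNIV \<times> {0..}) \<partial>M)"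
proof -
  have "(\<integral>\<^sup>+ \<omega>. npoints (atoms m C \<omega>) \<partial>M) = (SUP i. \<integral>\<^sup>+ \<omega>. npoints (atoms m C \<omega> \<inter> box i) \<partial>M)"
    unfolding npoints_atoms_SUP[symmetric]
  proof (intro nn_integral_monotone_convergence_SUP)
    show "incseq (\<lambda>i \<omega>. npoints (atoms m C \<omega> \<inter> box i))"
      using incseq_box by (auto simp: incseq_def le_fun_def intro!: npoints_mono)
    show "(\<lambda>\<omega>. npoints (atoms m C \<omega> \<inter> box i)) \<in> borel_measurable M" for i
      by (intro npoints_atoms_meas[OF C box_borel, of "t0 + real i"]) (auto simp: box_def)
  qed
  also have "\<dots> = (SUP i. \<integral>\<^sup>+ \<omega>. emeasure lborel (Pair \<omega> -` C \<inter> box i) \<partial>M)"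
    by (simp only: campbell_box[OF C])
  also have "\<dots> = (\<integral>\<^sup>+ \<omega>. (SUP i. emeasure lborel (Pair \<omega> -` C \<inter> box i)) \<partial>M)"
  proof (intro nn_integral_monotone_convergence_SUP[symmetric])
    show "incseq (\<lambda>i \<omega>. emeasure lborel (Pair \<omega> -` C \<inter> box i))"
    proof (intro incseq_SucI le_funI emeasure_mono)
      show "Pair \<omega> -` C \<inter> box i \<subseteq> Pair \<omega> -` C \<inter> box (Suc i)" for \<omega> i
        using incseq_SucD[OF incseq_box, of i] by auto
    qed (use section_borel[OF C] box_borel in auto)
    show "(\<lambda>\<omega>. emeasure lborel (Pair \<omega> -` C \<inter> box i)) \<in> borel_measurable M" for i
      by (rule emeasure_section_meas[OF C box_borel])
  qed
  also have "\<dots> = (\<integral>\<^sup>+ \<omega>. emeasure lborel (Pair \<omega> -` C \<inter> UNIV \<times> {0..}) \<partial>M)"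
  proof (intro nn_integral_cong)
    fix \<omega>
    have "(SUP i. emeasure lborel (Pair \<omega> -` C \<inter> box i)) = emeasure lborel (\<Union>i. Pair \<omega> -` C \<inter> box i)"
    proof (intro SUP_emeasure_incseq incseq_SucI)
      show "Pair \<omega> -` C \<inter> box i \<subseteq> Pair \<omega> -` C \<inter> box (Suc i)" for i
        using incseq_SucD[OF incseq_box, of i] by auto
    qed (use section_borel[OF C] box_borel in auto)
    also have "(\<Union>i. Pair \<omega> -` C \<inter> box i) = Pair \<omega> -` C \<inter> UNIV \<times> {0..}"
      using sets.sets_into_space[OF C] by (auto simp: Int_UN_distrib[symmetric] UN_box)
    finally show "(SUP i. emeasure lborel (Pair \<omega> -` C \<inter> box i)) = emeasure lborel (Pair \<omega> -` C \<inter> UNIV \<times> {0..})" .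
  qed
  finally show ?thesis .
qed

end

section \<open>Measurability of the drives\<close>

lemma summable_on_iff_abs_summable_on:
  fixes f :: "'a \<Rightarrow> real"
  shows "f summable_on A \<longleftrightarrow> Infinite_Set_Sum.abs_summable_on f A"
  using summable_on_iff_abs_summable_on_real[of f A] abs_summable_equivalent[of f A] by (rule trans)

lemma summable_on_iff_nn_integral:
  fixes f :: "'a \<Rightarrow> real"
  shows "f summable_on A \<longleftrightarrow> (\<integral>\<^sup>+ x. ennreal \<bar>f x\<bar> \<partial>count_space A) < \<infinity>"
proof -
  have "f summable_on A \<longleftrightarrow> Infinite_Set_Sum.abs_summable_on f A"
    by (rule summable_on_iff_abs_summable_on)
  also have "\<dots> \<longleftrightarrow> integrable (count_space A) f" by (rule abs_summable_on_def)
  also have "\<dots> \<longleftrightarrow> (\<integral>\<^sup>+ x. ennreal \<bar>f x\<bar> \<partial>count_space A) < \<infinity>"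
    by (simp add: integrable_iff_bounded)
  finally show ?thesis .
qed

text \<open>Joint measurability cannot be read off the limit along finite sets that defines
  \<open>infsum\<close>; integrals against the counting measure give it, and the case distinction
  keeps the value 0 of a divergent sum.\<close>

lemma infsum_eq_nn_integrals:
  fixes f :: "'a \<Rightarrow> real"
  shows "infsum f A = (if (\<integral>\<^sup>+ x. ennreal \<bar>f x\<bar> \<partial>count_space A) < \<infinity>
    then enn2real (\<integral>\<^sup>+ x. ennreal (f x) \<partial>count_space A) - enn2real (\<integral>\<^sup>+ x. ennreal (- f x) \<partial>count_space A) else 0)"
proof (cases "f summable_on A")
  case True
  then have abs: "Infinite_Set_Sum.abs_summable_on f A"
    by (rule summable_on_iff_abs_summable_on[THEN iffD1])
  then have "infsum f A = (\<integral> x. f x \<partial>count_space A)"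
    by (simp add: infsetsum_infsum[symmetric] infsetsum_def)
  also have "\<dots> = enn2real (\<integral>\<^sup>+ x. ennreal (f x) \<partial>count_space A) - enn2real (\<integral>\<^sup>+ x. ennreal (- f x) \<partial>count_space A)"
    using abs by (intro real_lebesgue_integral_def) (simp add: abs_summable_on_def)
  finally show ?thesis using True by (simp add: summable_on_iff_nn_integral)
next
  case False
  then show ?thesis by (simp add: infsum_not_exists summable_on_iff_nn_integral)
qed

lemma ennreal_infsum_le:
  fixes f :: "'a \<Rightarrow> real"
  shows "ennreal \<bar>infsum f A\<bar> \<le> (\<integral>\<^sup>+ x. ennreal \<bar>f x\<bar> \<partial>count_space A)"
proof (cases "f summable_on A")
  case True
  then have abs: "Infinite_Set_Sum.abs_summable_on f A"
    by (rule summable_on_iff_abs_summable_on[THEN iffD1])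
  then have "infsum f A = (\<integral> x. f x \<partial>count_space A)"
    by (simp add: infsetsum_infsum[symmetric] infsetsum_def)
  then show ?thesis
    using integral_norm_bound_ennreal[of "count_space A" f] abs by (simp add: abs_summable_on_def)
next
  case False
  then show ?thesis by (simp add: infsum_not_exists)
qed

lemma borel_measurable_infsum:
  fixes f :: "'z \<Rightarrow> 'a \<Rightarrow> real"
  assumes "(\<lambda>z. \<integral>\<^sup>+ x. ennreal \<bar>f z x\<bar> \<partial>count_space (A z)) \<in> borel_measurable Z"
    and "(\<lambda>z. \<integral>\<^sup>+ x. ennreal (f z x) \<partial>count_space (A z)) \<in> borel_measurable Z"
    and "(\<lambda>z. \<integral>\<^sup>+ x. ennreal (- f z x) \<partial>count_space (A z)) \<in> borel_measurable Z"
  shows "(\<lambda>z. infsum (f z) (A z)) \<in> borel_measurable Z"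
  unfolding infsum_eq_nn_integrals using assms by measurable

section \<open>Measurability of values that may be missing\<close>

fun opt_val :: "real option \<Rightarrow> real" where
  "opt_val None = 0"
| "opt_val (Some x) = x"

lemma space_opt_borel [simp]: "space opt_borel = UNIV"
  by (simp add: opt_borel_def space_measure_of_conv)

lemma None_opt_borel: "{None} \<in> sets opt_borel"
  unfolding opt_borel_def by (intro in_measure_of) auto

lemma Some_opt_borel: "B \<in> sets borel \<Longrightarrow> Some ` B \<in> sets opt_borel"
  unfolding opt_borel_def by (intro in_measure_of) auto

lemma opt_val_measurable: "opt_val \<in> borel_measurable opt_borel"
proof (rule measurableI)
  fix B :: "real set" assume B: "B \<in> sets borel"
  have "opt_val -` B = Some ` B \<union> (if 0 \<in> B then {None} else {})"
  proof (intro set_eqI)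
    fix x show "x \<in> opt_val -` B \<longleftrightarrow> x \<in> Some ` B \<union> (if 0 \<in> B then {None} else {})" by (cases x) auto
  qed
  moreover have "Some ` B \<union> (if 0 \<in> B then {None} else {}) \<in> sets opt_borel"
    using B None_opt_borel Some_opt_borel by (intro sets.Un) auto
  ultimately show "opt_val -` B \<inter> space opt_borel \<in> sets opt_borel" by simp
qed simp

lemma measurable_Some:
  assumes "f \<in> borel_measurable H"
  shows "(\<lambda>\<omega>. Some (f \<omega>)) \<in> measurable H opt_borel"
  unfolding opt_borel_def
proof (rule measurable_measure_of)
  fix y :: "real option set" assume "y \<in> insert {None} {Some ` B |B. B \<in> sets borel}"
  then consider "y = {None}" | B where "y = Some ` B" "B \<in> sets borel" by auto
  then show "(\<lambda>\<omega>. Some (f \<omega>)) -` y \<inter> space H \<in> sets H"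
  proof cases
    case 1 then have "(\<lambda>\<omega>. Some (f \<omega>)) -` y = {}" by auto
    then show ?thesis by simp
  next
    case 2 then have "(\<lambda>\<omega>. Some (f \<omega>)) -` y = f -` B" by auto
    then show ?thesis using 2 assms by (auto intro: measurable_sets)
  qed
qed auto

lemma pred_None:
  assumes "f \<in> measurable H opt_borel"
  shows "Measurable.pred H (\<lambda>\<omega>. f \<omega> = None)"
  using measurable_sets[OF assms None_opt_borel] by (simp add: pred_def vimage_def Int_def conj_commute)

lemma opt_app_eq: "opt_app f w = (if w = None then 0 else f (opt_val w))"
  by (cases w) auto

lemma psi1_eq: "psi1 w = (if w = None then 0 else 1 + \<bar>opt_val w\<bar>)"
  by (cases w) auto

lemma psi1_measurable: "f \<in> measurable H opt_borel \<Longrightarrow> (\<lambda>\<omega>. psi1 (f \<omega>)) \<in> borel_measurable H"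
  using pred_None[of f H] measurable_compose[OF _ opt_val_measurable, of f H]
  unfolding psi1_eq by (intro measurable_If) auto

text \<open>The drive with the absolute values of its terms: it dominates the modulus of the drive
  and is finite exactly when the drive converges, so convergence becomes a bound on one measurable
  function.\<close>

definition adrive ::
    "('p::finite \<Rightarrow> nat) \<Rightarrow> ('p \<Rightarrow> real) \<Rightarrow> ('m::finite, 'p) har_params \<Rightarrow> 'm + 'p \<Rightarrow>
     ('m, 'p, 'w) proc \<Rightarrow> real \<Rightarrow> 'w \<Rightarrow> ennreal" where
  "adrive n \<phi> \<MM> \<alpha> = (\<lambda>(N, W) t \<omega>.
     (\<Sum>m\<in>UNIV. \<integral>\<^sup>+ s. ennreal \<bar>hM \<MM> \<alpha> m (t - s)\<bar> \<partial>count_space (N m \<omega> \<inter> {..<t})) +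
     (\<Sum>p\<in>UNIV. \<integral>\<^sup>+ k. ennreal \<bar>opt_app (J \<MM> \<alpha> p (t - k)) (W p k \<omega>)\<bar> \<partial>count_space (ar_times n \<phi> p \<inter> {..<t})))"

lemma drive_converges_iff: "drive_converges n \<phi> \<MM> \<alpha> X t \<omega> \<longleftrightarrow> adrive n \<phi> \<MM> \<alpha> X t \<omega> < \<infinity>"
  by (cases X) (simp add: drive_converges_def adrive_def summable_on_iff_nn_integral ennreal_add_less_top less_top[symmetric] ennreal_add_eq_top)

lemma drive_le_adrive: "ennreal \<bar>drive n \<phi> \<MM> \<alpha> X t \<omega>\<bar> \<le> adrive n \<phi> \<MM> \<alpha> X t \<omega>"
proof -
  obtain N W where X: "X = (N, W)" by (cases X)
  let ?f = "\<lambda>m. \<Sum>\<^sub>\<infinity>s\<in>N m \<omega> \<inter> {..<t}. hM \<MM> \<alpha> m (t - s)"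
  let ?g = "\<lambda>p. \<Sum>\<^sub>\<infinity>k\<in>ar_times n \<phi> p \<inter> {..<t}. opt_app (J \<MM> \<alpha> p (t - k)) (W p k \<omega>)"
  have "\<bar>(\<Sum>m\<in>UNIV. ?f m) + (\<Sum>p\<in>UNIV. ?g p)\<bar> \<le> (\<Sum>m\<in>UNIV. \<bar>?f m\<bar>) + (\<Sum>p\<in>UNIV. \<bar>?g p\<bar>)"
    by (intro order_trans[OF abs_triangle_ineq] add_mono sum_abs)
  then have "ennreal \<bar>(\<Sum>m\<in>UNIV. ?f m) + (\<Sum>p\<in>UNIV. ?g p)\<bar> \<le> ennreal ((\<Sum>m\<in>UNIV. \<bar>?f m\<bar>) + (\<Sum>p\<in>UNIV. \<bar>?g p\<bar>))"
    by (rule ennreal_leI)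
  also have "\<dots> = (\<Sum>m\<in>UNIV. ennreal \<bar>?f m\<bar>) + (\<Sum>p\<in>UNIV. ennreal \<bar>?g p\<bar>)"
    by (simp add: ennreal_plus sum_nonneg sum_ennreal)
  also have "\<dots> \<le> adrive n \<phi> \<MM> \<alpha> X t \<omega>"
    unfolding adrive_def X prod.case by (intro add_mono sum_mono ennreal_infsum_le)
  finally show ?thesis by (simp add: drive_def X)
qed

text \<open>Causality: a drive at \<open>t\<close> reads the process strictly before
  \<open>t\<close>. Uniqueness, the stationarity of the iterates and the gluing of pieces all come
  down to this.\<close>

lemma drive_cong_gen:
  assumes "\<And>m. N m \<omega> \<inter> {..<t} = N' m \<omega>' \<inter> {..<t}"
    and "\<And>p k. (p, k) \<in> ar_index n \<phi> \<Longrightarrow> k < t \<Longrightarrow> W p k \<omega> = W' p k \<omega>'"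
  shows "drive n \<phi> \<MM> \<alpha> (N, W) t \<omega> = drive n \<phi> \<MM> \<alpha> (N', W') t \<omega>'"
    and "adrive n \<phi> \<MM> \<alpha> (N, W) t \<omega> = adrive n \<phi> \<MM> \<alpha> (N', W') t \<omega>'"
proof -
  have W: "W p k \<omega> = W' p k \<omega>'" if "k \<in> ar_times n \<phi> p \<inter> {..<t}" for p k
    using assms(2)[of p k] that by (auto simp: ar_index_def)
  have "(\<Sum>p\<in>UNIV. \<Sum>\<^sub>\<infinity>k\<in>ar_times n \<phi> p \<inter> {..<t}. opt_app (J \<MM> \<alpha> p (t - k)) (W p k \<omega>)) =
        (\<Sum>p\<in>UNIV. \<Sum>\<^sub>\<infinity>k\<in>ar_times n \<phi> p \<inter> {..<t}. opt_app (J \<MM> \<alpha> p (t - k)) (W' p k \<omega>'))"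
    using W by (intro sum.cong infsum_cong) auto
  then show "drive n \<phi> \<MM> \<alpha> (N, W) t \<omega> = drive n \<phi> \<MM> \<alpha> (N', W') t \<omega>'"
    unfolding drive_def using assms(1) by simp
  have "(\<Sum>p\<in>UNIV. \<integral>\<^sup>+ k. ennreal \<bar>opt_app (J \<MM> \<alpha> p (t - k)) (W p k \<omega>)\<bar> \<partial>count_space (ar_times n \<phi> p \<inter> {..<t})) =
        (\<Sum>p\<in>UNIV. \<integral>\<^sup>+ k. ennreal \<bar>opt_app (J \<MM> \<alpha> p (t - k)) (W' p k \<omega>')\<bar> \<partial>count_space (ar_times n \<phi> p \<inter> {..<t}))"
    using W by (intro sum.cong nn_integral_cong) auto
  then show "adrive n \<phi> \<MM> \<alpha> (N, W) t \<omega> = adrive n \<phi> \<MM> \<alpha> (N', W') t \<omega>'"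
    unfolding adrive_def using assms(1) by simp
qed

lemma measurable_ext0:
  assumes "f \<in> borel_measurable (restrict_space borel {0<..})"
  shows "ext0 f \<in> borel_measurable borel"
proof -
  have "{x::real. 0 < x} = {0<..}" by auto
  then have "(\<lambda>x. if 0 < x then f x else 0) \<in> borel_measurable borel"
    using assms by (subst measurable_If_restrict_space_iff) auto
  then show ?thesis by (simp add: ext0_def[abs_def])
qed

lemma countable_ar_times: "countable (ar_times n \<phi> p)"
  by (simp add: ar_times_def)

lemma infinite_ar_times:
  assumes "1 \<le> n p"
  shows "infinite (ar_times n \<phi> p)"
proof -
  have "inj (\<lambda>j::int. real_of_int j / real (n p) + \<phi> p)"
    using assms by (auto simp: inj_on_def field_simps)
  then show ?thesis unfolding ar_times_def by (auto dest: finite_imageD)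
qed

locale har_par = har_base M n \<phi> \<pi> \<xi> t0 CM CP Om0
  for M :: "'w measure" and n :: "'p::finite \<Rightarrow> nat" and \<phi> :: "'p \<Rightarrow> real"
    and \<pi> :: "'m::finite \<Rightarrow> 'w \<Rightarrow> (real \<times> real) set" and \<xi> :: "'p \<Rightarrow> real \<Rightarrow> 'w \<Rightarrow> real" and t0 :: real
    and CM :: "'m \<Rightarrow> 'w \<Rightarrow> real set" and CP :: "'p \<Rightarrow> real \<Rightarrow> 'w \<Rightarrow> real option" and Om0 :: "'w set" +
  fixes \<MM> :: "('m, 'p) har_params"
  assumes par: "parameters \<MM>"
begin

abbreviation "dr \<equiv> drive n \<phi> \<MM>"
abbreviation "adr \<equiv> adrive n \<phi> \<MM>"

lemma hM_meas: "ext0 (hM \<MM> \<alpha> m) \<in> borel_measurable borel"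
  using par by (intro measurable_ext0) (auto simp: parameters_def)

lemma J_meas: "(\<lambda>z. if 0 < fst z then J \<MM> \<alpha> p (fst z) (snd z) else 0) \<in> borel_measurable (borel :: (real \<times> real) measure)"
proof -
  have *: "{z :: real \<times> real. 0 < fst z} = {0<..} \<times> UNIV" by auto
  have "(\<lambda>(s, w). J \<MM> \<alpha> p s w) \<in> borel_measurable (restrict_space borel ({0<..} \<times> UNIV))"
    using par by (auto simp: parameters_def)
  then show ?thesis
    using * by (subst measurable_If_restrict_space_iff) (auto simp: split_beta' borel_Times_UNIV)
qed

lemma n_ge: "1 \<le> n p"
  using ar by (auto simp: ar_setting_def)

text \<open>The same argument serves two measurable structures: the product of \<open>Fa a\<close>
  with the time, for a truncated process, and the predictable one. What differs is how sums over the
  random points are measured, which is left to \<open>cN\<close>. A term of the series is known only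
  from its own time on, hence the restriction to \<open>k < t z\<close> in
  \<open>cW\<close>.\<close>

lemma drive_measurable_gen:
  fixes Z :: "'z measure" and w :: "'z \<Rightarrow> 'w" and t :: "'z \<Rightarrow> real"
  assumes t: "t \<in> borel_measurable Z"
    and cN: "\<And>m (g :: real \<Rightarrow> ennreal). g \<in> borel_measurable borel \<Longrightarrow>
       (\<lambda>z. \<integral>\<^sup>+ u. g (t z - u) \<partial>count_space (N m (w z) \<inter> {..<t z})) \<in> borel_measurable Z"
    and cW: "\<And>p k. (p, k) \<in> ar_index n \<phi> \<Longrightarrow>
       (\<lambda>z. W p k (w z)) \<in> measurable (restrict_space Z {z. k < t z}) opt_borel"
  shows "(\<lambda>z. dr \<alpha> (N, W) (t z) (w z)) \<in> borel_measurable Z"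
    and "(\<lambda>z. adr \<alpha> (N, W) (t z) (w z)) \<in> borel_measurable Z"
proof -
  have N: "(\<lambda>z. \<integral>\<^sup>+ u. ennreal (f (hM \<MM> \<alpha> m (t z - u))) \<partial>count_space (N m (w z) \<inter> {..<t z})) \<in> borel_measurable Z"
    if f: "f \<in> borel_measurable borel" for f :: "real \<Rightarrow> real" and m
  proof -
    have "(\<lambda>z. \<integral>\<^sup>+ u. ennreal (f (ext0 (hM \<MM> \<alpha> m) (t z - u))) \<partial>count_space (N m (w z) \<inter> {..<t z})) \<in> borel_measurable Z"
      using measurable_compose[OF measurable_compose[OF hM_meas f] measurable_ennreal] by (intro cN)
    also have "?this \<longleftrightarrow> ?thesis"
      by (intro measurable_cong nn_integral_cong) (auto simp: ext0_def)
    finally show ?thesis .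
  qed
  have Wt: "(\<lambda>z. \<integral>\<^sup>+ k. ennreal (f (opt_app (J \<MM> \<alpha> p (t z - k)) (W p k (w z))))
      \<partial>count_space (ar_times n \<phi> p \<inter> {..<t z})) \<in> borel_measurable Z"
    if f: "f \<in> borel_measurable borel" and f0: "f 0 = 0" for f :: "real \<Rightarrow> real" and p
  proof -
    define F where "F k z = (if k < t z then opt_app (J \<MM> \<alpha> p (t z - k)) (W p k (w z)) else 0)" for k z
    have F: "F k \<in> borel_measurable Z" if k: "k \<in> ar_times n \<phi> p" for k
    proof -
      let ?R = "restrict_space Z {z. k < t z}"
      have idx: "(p, k) \<in> ar_index n \<phi>" using k by (auto simp: ar_index_def)
      note W1 = cW[OF idx]
      have "(\<lambda>z. if W p k (w z) = None then 0 else
          (if 0 < fst (t z - k, opt_val (W p k (w z))) then J \<MM> \<alpha> p (fst (t z - k, opt_val (W p k (w z)))) (snd (t z - k, opt_val (W p k (w z)))) else 0)) \<in> borel_measurable ?R"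
      proof (rule measurable_If)
        have "(\<lambda>z. (t z - k, opt_val (W p k (w z)))) \<in> measurable ?R (borel \<Otimes>\<^sub>M borel)"
          using measurable_compose[OF W1 opt_val_measurable] measurable_restrict_space1[OF t]
          by (intro measurable_Pair) auto
        then show "(\<lambda>z. if 0 < fst (t z - k, opt_val (W p k (w z))) then J \<MM> \<alpha> p (fst (t z - k, opt_val (W p k (w z)))) (snd (t z - k, opt_val (W p k (w z)))) else 0) \<in> borel_measurable ?R"
          unfolding borel_prod by (rule measurable_compose[OF _ J_meas])
        show "{x \<in> space ?R. W p k (w x) = None} \<in> sets ?R"
          using pred_None[OF W1] by (simp add: pred_def)
      qed simp
      also have "?this \<longleftrightarrow> (\<lambda>z. opt_app (J \<MM> \<alpha> p (t z - k)) (W p k (w z))) \<in> borel_measurable ?R"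
        by (intro measurable_cong) (auto simp: space_restrict_space opt_app_eq)
      finally have "(\<lambda>z. opt_app (J \<MM> \<alpha> p (t z - k)) (W p k (w z))) \<in> borel_measurable ?R" .
      moreover have "{z \<in> space Z. k < t z} \<in> sets Z" using t by measurable
      ultimately show ?thesis
        unfolding F_def[abs_def] by (subst measurable_If_restrict_space_iff) auto
    qed
    \<comment> \<open>Enumerating the autoregressive times turns the integral against their counting
      measure into a series of measurable functions.\<close>
    let ?e = "from_nat_into (ar_times n \<phi> p)"
    have bij: "bij_betw ?e UNIV (ar_times n \<phi> p)"
      by (intro bij_betw_from_nat_into countable_ar_times infinite_ar_times n_ge)
    have e: "?e i \<in> ar_times n \<phi> p" for i using bij by (auto simp: bij_betw_def)
    have "(\<lambda>z. \<Sum>i. ennreal (f (F (?e i) z))) \<in> borel_measurable Z"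
      using measurable_compose[OF F[OF e] f] by auto
    also have "(\<lambda>z. \<Sum>i. ennreal (f (F (?e i) z))) = (\<lambda>z. \<integral>\<^sup>+ k. ennreal (f (F k z)) \<partial>count_space (ar_times n \<phi> p))"
    proof
      fix z
      have "(\<integral>\<^sup>+ k. ennreal (f (F k z)) \<partial>count_space (ar_times n \<phi> p)) = (\<integral>\<^sup>+ i. ennreal (f (F (?e i) z)) \<partial>count_space UNIV)"
        using bij by (rule nn_integral_bij_count_space[symmetric])
      then show "(\<Sum>i. ennreal (f (F (?e i) z))) = (\<integral>\<^sup>+ k. ennreal (f (F k z)) \<partial>count_space (ar_times n \<phi> p))"
        by (simp add: nn_integral_count_space_nat)
    qed
    also have "\<dots> = (\<lambda>z. \<integral>\<^sup>+ k. ennreal (f (opt_app (J \<MM> \<alpha> p (t z - k)) (W p k (w z)))) \<partial>count_space (ar_times n \<phi> p \<inter> {..<t z}))"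
    proof
      fix z
      show "(\<integral>\<^sup>+ k. ennreal (f (F k z)) \<partial>count_space (ar_times n \<phi> p)) =
        (\<integral>\<^sup>+ k. ennreal (f (opt_app (J \<MM> \<alpha> p (t z - k)) (W p k (w z)))) \<partial>count_space (ar_times n \<phi> p \<inter> {..<t z}))"
        unfolding nn_integral_count_space_subset[of "ar_times n \<phi> p"] nn_integral_count_space_subset[of "ar_times n \<phi> p \<inter> {..<t z}"]
        by (intro nn_integral_cong) (auto simp: F_def f0 indicator_def)
    qed
    finally show ?thesis .
  qed
  have idm: "(\<lambda>x::real. x) \<in> borel_measurable borel" "(\<lambda>x::real. - x) \<in> borel_measurable borel"
    "(\<lambda>x::real. \<bar>x\<bar>) \<in> borel_measurable borel" by auto
  show "(\<lambda>z. dr \<alpha> (N, W) (t z) (w z)) \<in> borel_measurable Z"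
    unfolding drive_def prod.case
    by (intro borel_measurable_add borel_measurable_sum borel_measurable_infsum N[OF idm(1)] N[OF idm(2)] N[OF idm(3)]
       Wt[OF idm(1)] Wt[OF idm(2)] Wt[OF idm(3)]) auto
  show "(\<lambda>z. adr \<alpha> (N, W) (t z) (w z)) \<in> borel_measurable Z"
    unfolding adrive_def prod.case
    by (intro borel_measurable_add borel_measurable_sum N[OF idm(3)] Wt[OF idm(3)]) auto
qed

text \<open>The past frozen at \<open>a\<close>. Its drive at later times is a function of the time
  and of what is known at \<open>a\<close>, and it is the part of the drive which an iteration after
  \<open>a\<close> leaves unchanged.\<close>

definition trunc :: "real \<Rightarrow> ('m, 'p, 'w) proc \<Rightarrow> ('m, 'p, 'w) proc" where
  "trunc a = (\<lambda>(N, W). (\<lambda>m \<omega>. N m \<omega> \<inter> {..a}, \<lambda>p k \<omega>. if k \<le> a then W p k \<omega> else None))"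

definition nice :: "('m, 'p, 'w) proc \<Rightarrow> bool" where
  "nice = (\<lambda>(N, W). (\<forall>m. \<forall>q\<ge>t0. sfin_rset (Fa q) (\<lambda>\<omega>. N m \<omega> \<inter> {..q})) \<and>
     (\<forall>(p, k)\<in>ar_index n \<phi>. W p k \<in> measurable (Fa (max t0 k)) opt_borel) \<and>
     (\<forall>m \<omega>. countable (N m \<omega>)))"

lemma niceD:
  assumes "nice (N, W)"
  shows "\<And>m q. t0 \<le> q \<Longrightarrow> sfin_rset (Fa q) (\<lambda>\<omega>. N m \<omega> \<inter> {..q})"
    and "\<And>p k. (p, k) \<in> ar_index n \<phi> \<Longrightarrow> W p k \<in> measurable (Fa (max t0 k)) opt_borel"
    and "\<And>m \<omega>. countable (N m \<omega>)"
  using assms by (auto simp: nice_def)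

lemma drive_trunc_measurable:
  assumes X: "nice X" and a: "t0 \<le> a"
  shows "(\<lambda>(\<omega>, s). dr \<alpha> (trunc a X) s \<omega>) \<in> borel_measurable (Fa a \<Otimes>\<^sub>M borel)"
    and "(\<lambda>(\<omega>, s). adr \<alpha> (trunc a X) s \<omega>) \<in> borel_measurable (Fa a \<Otimes>\<^sub>M borel)"
proof -
  obtain N W where XNW: "X = (N, W)" by (cases X)
  let ?N = "\<lambda>m \<omega>. N m \<omega> \<inter> {..a}" and ?W = "\<lambda>p k \<omega>. if k \<le> a then W p k \<omega> else None"
  have cN: "(\<lambda>z. \<integral>\<^sup>+ u. g (snd z - u) \<partial>count_space (?N m (fst z) \<inter> {..<snd z})) \<in> borel_measurable (Fa a \<Otimes>\<^sub>M borel)"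
    if g: "g \<in> borel_measurable borel" for m and g :: "real \<Rightarrow> ennreal"
  proof -
    have [measurable]: "(\<lambda>y. g (snd (fst y) - snd y)) \<in> borel_measurable ((Fa a \<Otimes>\<^sub>M borel) \<Otimes>\<^sub>M borel)"
      by (rule measurable_compose[OF _ g]) measurable
    have "sfin_rset (Fa a) (?N m)" using niceD(1)[OF X[unfolded XNW] a] .
    then have "sfin_rset (Fa a \<Otimes>\<^sub>M (borel :: real measure)) (\<lambda>z. ?N m (fst z))"
      by (rule sfin_rset_pullback) simp
    moreover have "(\<lambda>(z, u). if u < snd z then g (snd z - u) else 0) \<in> borel_measurable ((Fa a \<Otimes>\<^sub>M borel) \<Otimes>\<^sub>M borel)"
      unfolding case_prod_beta by measurable
    ultimately have "(\<lambda>z. \<integral>\<^sup>+ u. (\<lambda>(z, u). if u < snd z then g (snd z - u) else 0) (z, u) \<partial>count_space (?N m (fst z))) \<in> borel_measurable (Fa a \<Otimes>\<^sub>M borel)"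
      by (rule sfin_rset_nn_integral)
    also have "(\<lambda>z. \<integral>\<^sup>+ u. (\<lambda>(z, u). if u < snd z then g (snd z - u) else 0) (z, u) \<partial>count_space (?N m (fst z))) =
       (\<lambda>z. \<integral>\<^sup>+ u. g (snd z - u) \<partial>count_space (?N m (fst z) \<inter> {..<snd z}))"
    proof
      fix z :: "'w \<times> real"
      show "(\<integral>\<^sup>+ u. (\<lambda>(z, u). if u < snd z then g (snd z - u) else 0) (z, u) \<partial>count_space (?N m (fst z))) =
        (\<integral>\<^sup>+ u. g (snd z - u) \<partial>count_space (?N m (fst z) \<inter> {..<snd z}))"
        unfolding nn_integral_count_space_subset[of "?N m (fst z)"] nn_integral_count_space_subset[of "?N m (fst z) \<inter> {..<snd z}"]
        by (intro nn_integral_cong) (auto simp: indicator_def)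
    qed
    finally show ?thesis .
  qed
  have cW: "(\<lambda>z. ?W p k (fst z)) \<in> measurable (restrict_space (Fa a \<Otimes>\<^sub>M borel) {z. k < snd z}) opt_borel"
    if "(p, k) \<in> ar_index n \<phi>" for p k
  proof (cases "k \<le> a")
    case True
    have "W p k \<in> measurable (Fa a) opt_borel"
      by (rule au.measurable_H_mono[OF niceD(2)[OF X[unfolded XNW] that]]) (use True a in auto)
    then have "(\<lambda>z. W p k (fst z)) \<in> measurable (Fa a \<Otimes>\<^sub>M (borel :: real measure)) opt_borel"
      by (rule measurable_compose[OF measurable_fst])
    then show ?thesis using True by (simp add: measurable_restrict_space1)
  next
    case False then show ?thesis by simp
  qed
  have snd: "snd \<in> borel_measurable (Fa a \<Otimes>\<^sub>M (borel :: real measure))" by simp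
  note * = drive_measurable_gen[where Z = "Fa a \<Otimes>\<^sub>M (borel :: real measure)" and w = fst and N = ?N and W = ?W, OF snd cN cW]
  show "(\<lambda>(\<omega>, s). dr \<alpha> (trunc a X) s \<omega>) \<in> borel_measurable (Fa a \<Otimes>\<^sub>M borel)"
    using *(1)[of \<alpha>] by (simp add: trunc_def XNW case_prod_beta)
  show "(\<lambda>(\<omega>, s). adr \<alpha> (trunc a X) s \<omega>) \<in> borel_measurable (Fa a \<Otimes>\<^sub>M borel)"
    using *(2)[of \<alpha>] by (simp add: trunc_def XNW case_prod_beta)
qed

lemma drive_at_measurable:
  assumes X: "nice X" and b: "t0 \<le> b"
  shows "(\<lambda>\<omega>. dr \<alpha> X b \<omega>) \<in> borel_measurable (Fa b)"
proof -
  obtain N W where XNW: "X = (N, W)" by (cases X)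
  have "(\<lambda>\<omega>. (\<omega>, b)) \<in> measurable (Fa b) (Fa b \<Otimes>\<^sub>M borel)" by simp
  from measurable_compose[OF this drive_trunc_measurable(1)[OF X b, of \<alpha>]]
  have "(\<lambda>\<omega>. dr \<alpha> (trunc b X) b \<omega>) \<in> borel_measurable (Fa b)" by simp
  moreover have "dr \<alpha> (trunc b X) b \<omega> = dr \<alpha> X b \<omega>" for \<omega>
    unfolding XNW trunc_def prod.case by (intro drive_cong_gen) auto
  ultimately show ?thesis by simp
qed

text \<open>The sum over the points before \<open>s\<close> is the supremum, over rational
  \<open>q < s\<close>, of the sums over the points up to \<open>q\<close>. Each of these uses
  points known at \<open>q\<close> and is therefore predictable after \<open>q\<close>.\<close>

lemma predictable_sum:
  fixes g :: "real \<Rightarrow> ennreal"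
  assumes N: "\<And>q. t0 \<le> q \<Longrightarrow> sfin_rset (Fa q) (\<lambda>\<omega>. A \<omega> \<inter> {..q})" and cA: "\<And>\<omega>. countable (A \<omega>)"
    and g: "g \<in> borel_measurable borel"
  shows "(\<lambda>(\<omega>, s, x). \<integral>\<^sup>+ u. g (s - u) \<partial>count_space (A \<omega> \<inter> {..<s})) \<in> borel_measurable (mpred t0 Fa)"
proof -
  define Q where "Q = \<rat> \<inter> {t0<..}"
  have Q: "countable Q" by (auto simp: Q_def countable_rat)
  have Qne: "Q \<noteq> {}" using Rats_dense_in_real[of t0 "t0 + 1"] by (auto simp: Q_def)
  have part: "(\<lambda>(\<omega>, s, x). if q < s then \<integral>\<^sup>+ u. g (s - u) \<partial>count_space (A \<omega> \<inter> {..q}) else 0) \<in> borel_measurable (mpred t0 Fa)"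
    if q: "q \<in> Q" for q
  proof -
    have tq: "t0 \<le> q" using q by (auto simp: Q_def)
    have gm: "(\<lambda>y. g (snd (fst y) - snd y)) \<in> borel_measurable ((Fa q \<Otimes>\<^sub>M borel) \<Otimes>\<^sub>M borel)"
      by (rule measurable_compose[OF _ g]) measurable
    have "sfin_rset (Fa q \<Otimes>\<^sub>M (borel :: real measure)) (\<lambda>z. A (fst z) \<inter> {..q})"
      by (rule sfin_rset_pullback[OF N[OF tq]]) simp
    from sfin_rset_nn_integral[OF this gm]
    have m: "(\<lambda>z. \<integral>\<^sup>+ u. g (snd z - u) \<partial>count_space (A (fst z) \<inter> {..q})) \<in> borel_measurable (Fa q \<Otimes>\<^sub>M borel)" by simp
    let ?S = "space M \<times> ({q<..} \<times> (UNIV::real set))"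
    have "(\<lambda>z. (\<lambda>z. \<integral>\<^sup>+ u. g (snd z - u) \<partial>count_space (A (fst z) \<inter> {..q})) ((\<lambda>(\<omega>, s, x). (\<omega>, s)) z))
        \<in> borel_measurable (restrict_space (mpred t0 Fa) ?S)"
      by (rule measurable_compose[OF au.mpred_after[OF tq] m])
    moreover have "space M \<in> sets (Fa q)" using sets.top[of "Fa q"] by simp
    then have S: "?S \<in> sets (mpred t0 Fa)" by (intro au.mpred_rect_inf tq) auto
    ultimately have "(\<lambda>z. if z \<in> ?S then (\<lambda>z. \<integral>\<^sup>+ u. g (snd z - u) \<partial>count_space (A (fst z) \<inter> {..q})) ((\<lambda>(\<omega>, s, x). (\<omega>, s)) z) else 0) \<in> borel_measurable (mpred t0 Fa)"
    proof (subst measurable_If_restrict_space_iff)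
      have "{x \<in> space (mpred t0 Fa). x \<in> ?S} = ?S" using sets.sets_into_space[OF S] by auto
      then show "{x \<in> space (mpred t0 Fa). x \<in> ?S} \<in> sets (mpred t0 Fa)" using S by simp
    qed auto
    also have "?this \<longleftrightarrow> ?thesis"
      by (intro measurable_cong) (auto split: if_splits)
    finally show ?thesis .
  qed
  have "(\<lambda>z. SUP q\<in>Q. (\<lambda>(\<omega>, s, x). if q < s then \<integral>\<^sup>+ u. g (s - u) \<partial>count_space (A \<omega> \<inter> {..q}) else 0) z) \<in> borel_measurable (mpred t0 Fa)"
    by (intro borel_measurable_SUP Q part)
  also have "?this \<longleftrightarrow> ?thesis"
  proof (intro measurable_cong)
    fix z assume "z \<in> space (mpred t0 Fa)"
    then obtain \<omega> s x where z: "z = (\<omega>, s, x)" "\<omega> \<in> space M" "t0 < s" by auto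
    define F where "F q u = (if q < s \<and> u \<le> q then g (s - u) else 0)" for q u
    let ?B = "A \<omega> \<inter> {..<s}"
    have "(SUP q\<in>Q. \<integral>\<^sup>+ u. F q u \<partial>count_space ?B) = (\<integral>\<^sup>+ u. (SUP q\<in>Q. F q u) \<partial>count_space ?B)"
    proof (rule nn_integral_monotone_convergence_SUP_countable[symmetric])
      \<comment> \<open>\<open>F\<close> increases in \<open>q\<close> below \<open>s\<close> and
        vanishes from \<open>s\<close> on: not monotone in \<open>q\<close>, but still a chain of
        functions.\<close>
      have "F q \<le> F q' \<or> F q' \<le> F q" for q q'
        by (cases "q < s"; cases "q' < s"; cases "q \<le> q'") (auto simp: F_def le_fun_def)
      then show "Complete_Partial_Order.chain (\<le>) (F ` Q)" unfolding Complete_Partial_Order.chain_def by auto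
    qed (use Qne cA in auto)
    also have "\<dots> = (\<integral>\<^sup>+ u. g (s - u) \<partial>count_space ?B)"
    proof (intro nn_integral_cong)
      fix u assume "u \<in> space (count_space ?B)"
      then have "u < s" by auto
      then obtain q where q: "q \<in> \<rat>" "max t0 u < q" "q < s" using Rats_dense_in_real[of "max t0 u" s] z(3) by auto
      then have qQ: "q \<in> Q" "F q u = g (s - u)" by (auto simp: Q_def F_def)
      show "(SUP q\<in>Q. F q u) = g (s - u)"
      proof (rule antisym)
        show "(SUP q\<in>Q. F q u) \<le> g (s - u)" by (intro SUP_least) (simp add: F_def)
        have "F q u \<le> (SUP q\<in>Q. F q u)" by (rule SUP_upper[OF qQ(1)])
        then show "g (s - u) \<le> (SUP q\<in>Q. F q u)" by (simp only: qQ(2))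
      qed
    qed
    also have "(SUP q\<in>Q. \<integral>\<^sup>+ u. F q u \<partial>count_space ?B) =
      (SUP q\<in>Q. if q < s then \<integral>\<^sup>+ u. g (s - u) \<partial>count_space (A \<omega> \<inter> {..q}) else 0)"
    proof (intro SUP_cong refl)
      fix q assume "q \<in> Q"
      show "(\<integral>\<^sup>+ u. F q u \<partial>count_space ?B) = (if q < s then \<integral>\<^sup>+ u. g (s - u) \<partial>count_space (A \<omega> \<inter> {..q}) else 0)"
      proof (cases "q < s")
        case True
        have "(\<integral>\<^sup>+ u. F q u \<partial>count_space ?B) = (\<integral>\<^sup>+ u. g (s - u) \<partial>count_space (A \<omega> \<inter> {..q}))"
          unfolding nn_integral_count_space_subset[of ?B] nn_integral_count_space_subset[of "A \<omega> \<inter> {..q}"]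
          using True by (intro nn_integral_cong) (auto simp: F_def indicator_def)
        then show ?thesis using True by simp
      qed (simp add: F_def)
    qed
    finally show "(SUP q\<in>Q. (\<lambda>(\<omega>, s, x). if q < s then \<integral>\<^sup>+ u. g (s - u) \<partial>count_space (A \<omega> \<inter> {..q}) else 0) z) =
      (case z of (\<omega>, s, x) \<Rightarrow> \<integral>\<^sup>+ u. g (s - u) \<partial>count_space (A \<omega> \<inter> {..<s}))"
      by (simp add: z)
  qed
  finally show ?thesis .
qed

lemma mpred_time: "(\<lambda>(\<omega>, s, x). s) \<in> borel_measurable (mpred t0 Fa)"
proof -
  have "(\<lambda>z. snd ((\<lambda>(\<omega>, s, x). (\<omega>, s)) z)) \<in> borel_measurable (restrict_space (mpred t0 Fa) (space M \<times> ({t0<..} \<times> UNIV)))"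
    by (rule measurable_compose[OF au.mpred_after[OF order_refl] measurable_snd])
  moreover have "(space M \<times> ({t0<..} \<times> UNIV)) \<inter> space (mpred t0 Fa) \<in> sets (mpred t0 Fa)"
    using sets.top[of "mpred t0 Fa"] by simp
  ultimately have "(\<lambda>z. if z \<in> space M \<times> ({t0<..} \<times> UNIV) then snd ((\<lambda>(\<omega>, s, x). (\<omega>, s)) z) else 0) \<in> borel_measurable (mpred t0 Fa)"
    by (subst (asm) measurable_restrict_space_iff[where c = 0]) auto
  also have "?this \<longleftrightarrow> ?thesis" by (intro measurable_cong) auto
  finally show ?thesis .
qed

lemma sets_restrict_space_cong_Int:
  assumes "A \<inter> space P = B \<inter> space P"
  shows "sets (restrict_space P A) = sets (restrict_space P B)"
  unfolding sets_restrict_space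
proof (intro image_cong refl)
  fix X assume "X \<in> sets P"
  then have "X \<subseteq> space P" by (rule sets.sets_into_space)
  then show "A \<inter> X = B \<inter> X" using assms by blast
qed

lemma drive_predictable:
  assumes X: "nice X"
  shows "(\<lambda>(\<omega>, s, x). dr \<alpha> X s \<omega>) \<in> borel_measurable (mpred t0 Fa)"
    and "(\<lambda>(\<omega>, s, x). adr \<alpha> X s \<omega>) \<in> borel_measurable (mpred t0 Fa)"
proof -
  obtain N W where XNW: "X = (N, W)" by (cases X)
  have cN: "(\<lambda>z. \<integral>\<^sup>+ u. g (fst (snd z) - u) \<partial>count_space (N m (fst z) \<inter> {..<fst (snd z)})) \<in> borel_measurable (mpred t0 Fa)"
    if g: "g \<in> borel_measurable borel" for m and g :: "real \<Rightarrow> ennreal"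
    using predictable_sum[OF niceD(1)[OF X[unfolded XNW]] niceD(3)[OF X[unfolded XNW]] g, of m]
    by (simp add: split_beta')
  have cW: "(\<lambda>z. W p k (fst z)) \<in> measurable (restrict_space (mpred t0 Fa) {z. k < fst (snd z)}) opt_borel"
    if "(p, k) \<in> ar_index n \<phi>" for p k
  proof -
    have W: "W p k \<in> measurable (Fa (max t0 k)) opt_borel"
      using niceD(2)[OF X[unfolded XNW] that] .
    have "(\<lambda>z. W p k (fst ((\<lambda>(\<omega>, s, x). (\<omega>, s)) z))) \<in>
       measurable (restrict_space (mpred t0 Fa) (space M \<times> ({max t0 k<..} \<times> UNIV))) opt_borel"
      by (rule measurable_compose[OF au.mpred_after measurable_compose[OF measurable_fst W]]) simp
    \<comment> \<open>All times of the predictable space exceed \<open>t0\<close>, so restricting to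
      times after \<open>k\<close> or after \<open>max t0 k\<close> is the same.\<close>
    also have "measurable (restrict_space (mpred t0 Fa) (space M \<times> ({max t0 k<..} \<times> UNIV))) opt_borel =
       measurable (restrict_space (mpred t0 Fa) {z. k < fst (snd z)}) opt_borel"
      by (intro measurable_cong_sets sets_restrict_space_cong_Int) auto
    finally show ?thesis by (simp add: case_prod_beta)
  qed
  have t: "(\<lambda>z. fst (snd z)) \<in> borel_measurable (mpred t0 Fa)"
    using mpred_time by (simp add: split_beta')
  note * = drive_measurable_gen[where Z = "mpred t0 Fa" and w = fst and t = "\<lambda>z. fst (snd z)" and N = N and W = W, OF t cN cW]
  show "(\<lambda>(\<omega>, s, x). dr \<alpha> X s \<omega>) \<in> borel_measurable (mpred t0 Fa)"
    using *(1)[of \<alpha>] by (simp add: XNW case_prod_beta)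
  show "(\<lambda>(\<omega>, s, x). adr \<alpha> X s \<omega>) \<in> borel_measurable (mpred t0 Fa)"
    using *(2)[of \<alpha>] by (simp add: XNW case_prod_beta)
qed

end

section \<open>Integrability of the initial condition\<close>

text \<open>The hypothesis compares the mean measure of \<open>A\<close> with \<open>c\<close> times
  \<open>\<nu>\<close>, and the comparison of measures passes to integrals. As \<open>f\<close> does
  not depend on the outcome, counts in deterministic sets suffice, and measurability is carried
  along.\<close>

lemma rset_nn_integral_le:
  fixes f :: "'a::topological_space \<Rightarrow> ennreal" and \<nu> :: "'a measure"
  assumes A: "A \<in> measurable M point_sets" and \<nu>: "sets \<nu> = sets borel"
    and le: "\<And>B. B \<in> sets borel \<Longrightarrow> (\<integral>\<^sup>+ \<omega>. npoints (A \<omega> \<inter> B) \<partial>M) \<le> c * emeasure \<nu> B"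
    and f: "f \<in> borel_measurable \<nu>"
  shows "(\<lambda>\<omega>. \<integral>\<^sup>+ u. f u \<partial>count_space (A \<omega>)) \<in> borel_measurable M \<and>
    (\<integral>\<^sup>+ \<omega>. \<integral>\<^sup>+ u. f u \<partial>count_space (A \<omega>) \<partial>M) \<le> c * (\<integral>\<^sup>+ u. f u \<partial>\<nu>)"
  using f
proof (induct rule: borel_measurable_induct)
  case (cong f g)
  have sp: "space \<nu> = UNIV" using sets_eq_imp_space_eq[OF \<nu>] by simp
  have "f = g" using cong(3) by (auto simp: sp fun_eq_iff)
  then show ?case using cong(4) by simp
next
  case (set B)
  then have B: "B \<in> sets borel" by (simp add: \<nu>)
  have *: "(\<integral>\<^sup>+ u. indicator B u \<partial>count_space (A \<omega>)) = npoints (A \<omega> \<inter> B)" for \<omega>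
  proof -
    have "(\<integral>\<^sup>+ u. indicator B u \<partial>count_space (A \<omega>)) = (\<integral>\<^sup>+ u. indicator (A \<omega> \<inter> B) u \<partial>count_space UNIV)"
      unfolding nn_integral_count_space_subset[of "A \<omega>"] by (intro nn_integral_cong) (auto simp: indicator_def)
    then show ?thesis by simp
  qed
  show ?case unfolding * using measurable_npoints[OF A B] le[OF B] set by simp
next
  case (mult u a)
  have eq: "(\<integral>\<^sup>+ x. a * u x \<partial>count_space (A \<omega>)) = a * (\<integral>\<^sup>+ x. u x \<partial>count_space (A \<omega>))" for \<omega>
    by (rule nn_integral_cmult) simp
  have m: "(\<lambda>\<omega>. \<integral>\<^sup>+ x. u x \<partial>count_space (A \<omega>)) \<in> borel_measurable M"
    and le: "(\<integral>\<^sup>+ \<omega>. \<integral>\<^sup>+ x. u x \<partial>count_space (A \<omega>) \<partial>M) \<le> c * (\<integral>\<^sup>+ x. u x \<partial>\<nu>)"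
    using mult(4) by blast+
  have "(\<integral>\<^sup>+ \<omega>. a * (\<integral>\<^sup>+ x. u x \<partial>count_space (A \<omega>)) \<partial>M) = a * (\<integral>\<^sup>+ \<omega>. \<integral>\<^sup>+ x. u x \<partial>count_space (A \<omega>) \<partial>M)"
    by (rule nn_integral_cmult[OF m])
  also have "\<dots> \<le> a * (c * (\<integral>\<^sup>+ x. u x \<partial>\<nu>))" using le by (rule mult_left_mono) simp
  also have "\<dots> = c * (\<integral>\<^sup>+ x. a * u x \<partial>\<nu>)"
    using mult(2) by (simp add: nn_integral_cmult mult.left_commute)
  finally show ?case unfolding eq using m by simp
next
  case (add u v)
  have m: "(\<lambda>\<omega>. \<integral>\<^sup>+ x. v x \<partial>count_space (A \<omega>)) \<in> borel_measurable M"
    "(\<lambda>\<omega>. \<integral>\<^sup>+ x. u x \<partial>count_space (A \<omega>)) \<in> borel_measurable M" using add by blast+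
  have "(\<integral>\<^sup>+ \<omega>. \<integral>\<^sup>+ x. v x + u x \<partial>count_space (A \<omega>) \<partial>M) =
      (\<integral>\<^sup>+ \<omega>. \<integral>\<^sup>+ x. v x \<partial>count_space (A \<omega>) \<partial>M) + (\<integral>\<^sup>+ \<omega>. \<integral>\<^sup>+ x. u x \<partial>count_space (A \<omega>) \<partial>M)"
    using add by (simp add: nn_integral_add)
  also have "\<dots> \<le> c * (\<integral>\<^sup>+ x. v x \<partial>\<nu>) + c * (\<integral>\<^sup>+ x. u x \<partial>\<nu>)" using add by (intro add_mono) auto
  also have "\<dots> = c * (\<integral>\<^sup>+ x. v x + u x \<partial>\<nu>)" using add by (simp add: nn_integral_add distrib_left)
  finally show ?case using borel_measurable_add[OF m] by (simp add: nn_integral_add)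
next
  case (seq U)
  have s: "(\<integral>\<^sup>+ y. (SUP i. U i) y \<partial>count_space (A \<omega>)) = (SUP i. \<integral>\<^sup>+ y. U i y \<partial>count_space (A \<omega>))" for \<omega>
    using nn_integral_monotone_convergence_SUP[OF \<open>incseq U\<close>, of "count_space (A \<omega>)"] by (simp add: image_comp)
  have "(\<integral>\<^sup>+ \<omega>. (SUP i. \<integral>\<^sup>+ y. U i y \<partial>count_space (A \<omega>)) \<partial>M) = (SUP i. \<integral>\<^sup>+ \<omega>. \<integral>\<^sup>+ y. U i y \<partial>count_space (A \<omega>) \<partial>M)"
    using seq by (intro nn_integral_monotone_convergence_SUP)
      (auto simp: incseq_def le_fun_def intro!: nn_integral_mono)
  also have "\<dots> \<le> c * (\<integral>\<^sup>+ y. (SUP i. U i) y \<partial>\<nu>)"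
  proof (rule SUP_least)
    fix i
    have "(\<integral>\<^sup>+ \<omega>. \<integral>\<^sup>+ y. U i y \<partial>count_space (A \<omega>) \<partial>M) \<le> c * (\<integral>\<^sup>+ y. U i y \<partial>\<nu>)" using seq by auto
    also have "\<dots> \<le> c * (\<integral>\<^sup>+ y. (SUP i. U i) y \<partial>\<nu>)"
      by (intro mult_left_mono nn_integral_mono) (auto simp: le_fun_def[symmetric] intro: SUP_upper le_funD)
    finally show "(\<integral>\<^sup>+ \<omega>. \<integral>\<^sup>+ y. U i y \<partial>count_space (A \<omega>) \<partial>M) \<le> c * (\<integral>\<^sup>+ y. (SUP i. U i) y \<partial>\<nu>)" .
  qed
  finally have le: "(\<integral>\<^sup>+ \<omega>. (SUP i. \<integral>\<^sup>+ y. U i y \<partial>count_space (A \<omega>)) \<partial>M) \<le> c * (\<integral>\<^sup>+ y. (SUP i. U i) y \<partial>\<nu>)" .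
  have m: "(\<lambda>\<omega>. \<integral>\<^sup>+ y. U i y \<partial>count_space (A \<omega>)) \<in> borel_measurable M" for i using seq(3) by blast
  show ?case unfolding s using le by (intro conjI borel_measurable_SUP m) auto
qed

lemma psi1_opt_add: "psi1 (opt_add r d) \<le> psi1 r + psi1 d"
  by (cases r; cases d) auto

lemma psi1_nonneg: "0 \<le> psi1 w"
  by (cases w) auto

lemma psi1_ge1: "w \<noteq> None \<Longrightarrow> 1 \<le> psi1 w"
  by (cases w) auto

lemma nn_integral_count_space_less_top_finite:
  assumes "finite A" "\<And>x. x \<in> A \<Longrightarrow> f x < (\<infinity>::ennreal)"
  shows "(\<integral>\<^sup>+ x. f x \<partial>count_space A) < \<infinity>"
  using assms by (simp add: nn_integral_count_space_finite less_top[symmetric])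

lemma nn_integral_count_space_Un_le:
  "(\<integral>\<^sup>+ x. f x \<partial>count_space (A \<union> B)) \<le> (\<integral>\<^sup>+ x. f x \<partial>count_space A) + (\<integral>\<^sup>+ x. f x \<partial>count_space B)"
proof -
  have "(\<integral>\<^sup>+ x. f x \<partial>count_space (A \<union> B)) \<le> (\<integral>\<^sup>+ x. f x * indicator A x + f x * indicator B x \<partial>count_space UNIV)"
    unfolding nn_integral_count_space_subset[of "A \<union> B"] by (intro nn_integral_mono) (auto simp: indicator_def)
  also have "\<dots> = (\<integral>\<^sup>+ x. f x \<partial>count_space A) + (\<integral>\<^sup>+ x. f x \<partial>count_space B)"
    unfolding nn_integral_count_space_subset[of A] nn_integral_count_space_subset[of B]
    by (rule nn_integral_add) auto
  finally show ?thesis .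
qed

lemma borel_measurable_count_space_sum:
  fixes f :: "'i \<Rightarrow> 'a \<Rightarrow> ennreal"
  assumes "countable I" "\<And>i. i \<in> I \<Longrightarrow> f i \<in> borel_measurable Z"
  shows "(\<lambda>z. \<integral>\<^sup>+ i. f i z \<partial>count_space I) \<in> borel_measurable Z"
proof -
  interpret sigma_finite_measure "count_space I" by (intro sigma_finite_measure_count_space_countable assms)
  have "(\<lambda>(i, z). f i z) \<in> borel_measurable (count_space I \<Otimes>\<^sub>M Z)"
    using assms by (intro measurable_pair_measure_countable1) auto
  then have "(\<lambda>(z, i). f i z) \<in> borel_measurable (Z \<Otimes>\<^sub>M count_space I)"
    by (subst measurable_pair_swap_iff) (simp add: split_beta')
  then show ?thesis by (rule borel_measurable_nn_integral)
qed

lemma in_L1_nn_integral: "in_L1 f \<Longrightarrow> (\<integral>\<^sup>+ x. ennreal \<bar>ext0 f x\<bar> \<partial>lborel) < \<infinity>"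
  unfolding in_L1_def integrable_iff_bounded by simp

lemma nn_integral_reflect:
  fixes f :: "real \<Rightarrow> ennreal"
  assumes "f \<in> borel_measurable borel"
  shows "(\<integral>\<^sup>+ u. f (s - u) \<partial>lborel) = (\<integral>\<^sup>+ u. f u \<partial>lborel)"
  using nn_integral_real_affine[OF assms, of "- 1" s] by simp

lemma nn_integral_shift:
  fixes f :: "real \<Rightarrow> ennreal"
  assumes "f \<in> borel_measurable borel"
  shows "(\<integral>\<^sup>+ s. f (s - u) \<partial>lborel) = (\<integral>\<^sup>+ u. f u \<partial>lborel)"
  using nn_integral_real_affine[OF assms, of 1 "- u"] by simp

lemma npoints_int_interval: "npoints {j::int. a \<le> real_of_int j \<and> real_of_int j \<le> b} \<le> ennreal (max 0 (b - a + 1))"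
proof -
  have eq: "{j::int. a \<le> real_of_int j \<and> real_of_int j \<le> b} = {\<lceil>a\<rceil>..\<lfloor>b\<rfloor>}"
    by (auto simp: ceiling_le_iff le_floor_iff)
  have "real (card {\<lceil>a\<rceil>..\<lfloor>b\<rfloor>}) \<le> max 0 (b - a + 1)"
    by (simp, linarith)
  then have "ennreal (real (card {\<lceil>a\<rceil>..\<lfloor>b\<rfloor>})) \<le> ennreal (max 0 (b - a + 1))" by (rule ennreal_leI)
  then show ?thesis unfolding eq npoints_finite[OF finite_atLeastAtMost_int] ennreal_of_nat_eq_real_of_nat .
qed

lemma finite_ar_times_bounded:
  assumes "1 \<le> n p"
  shows "finite (ar_times n \<phi> p \<inter> {a..b})"
proof -
  have "ar_times n \<phi> p \<inter> {a..b} \<subseteq> (\<lambda>j::int. of_int j / real (n p) + \<phi> p) ` {\<lceil>(a - \<phi> p) * real (n p)\<rceil>..\<lfloor>(b - \<phi> p) * real (n p)\<rfloor>}"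
  proof
    fix k assume k: "k \<in> ar_times n \<phi> p \<inter> {a..b}"
    then obtain j :: int where j: "k = of_int j / real (n p) + \<phi> p" by (auto simp: ar_times_def)
    have "of_int j = (k - \<phi> p) * real (n p)" using assms j by simp
    then have "(a - \<phi> p) * real (n p) \<le> of_int j" "of_int j \<le> (b - \<phi> p) * real (n p)"
      using k by (auto intro: mult_right_mono)
    then show "k \<in> (\<lambda>j::int. of_int j / real (n p) + \<phi> p) ` {\<lceil>(a - \<phi> p) * real (n p)\<rceil>..\<lfloor>(b - \<phi> p) * real (n p)\<rfloor>}"
      by (auto simp: j ceiling_le_iff le_floor_iff)
  qed
  then show ?thesis by (rule finite_subset) simp
qed

text \<open>After the shift \<open>v = s - k\<close>, the times \<open>k\<close> with
  \<open>v + k\<close> in \<open>{a..b}\<close> correspond to the integers in an interval of length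
  \<open>n p * (b - a)\<close>, and there are at most that length plus one of them. So integrability
  over the line gives summability over the grid once time is averaged over a window.\<close>

lemma ar_times_sum_shift_le:
  fixes f :: "real \<Rightarrow> ennreal"
  assumes n: "1 \<le> n p" and f: "f \<in> borel_measurable borel"
  shows "(\<integral>\<^sup>+ k. (\<integral>\<^sup>+ s. f (s - k) * indicator {a..b} s \<partial>lborel) \<partial>count_space (ar_times n \<phi> p)) \<le>
     ennreal (max 0 (real (n p) * (b - a) + 1)) * (\<integral>\<^sup>+ v. f v \<partial>lborel)"
proof -
  let ?A = "ar_times n \<phi> p"
  have "(\<integral>\<^sup>+ k. (\<integral>\<^sup>+ s. f (s - k) * indicator {a..b} s \<partial>lborel) \<partial>count_space ?A) =
        (\<integral>\<^sup>+ k. (\<integral>\<^sup>+ v. f v * indicator {a..b} (v + k) \<partial>lborel) \<partial>count_space ?A)"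
  proof (rule nn_integral_cong)
    fix k :: real
    have "(\<lambda>v. f v * indicator {a..b} (v + k)) \<in> borel_measurable borel" using f by measurable
    from nn_integral_shift[OF this, of k]
    show "(\<integral>\<^sup>+ s. f (s - k) * indicator {a..b} s \<partial>lborel) = (\<integral>\<^sup>+ v. f v * indicator {a..b} (v + k) \<partial>lborel)"
      by simp
  qed
  also have "\<dots> = (\<integral>\<^sup>+ v. (\<integral>\<^sup>+ k. f v * indicator {a..b} (v + k) \<partial>count_space ?A) \<partial>lborel)"
  proof (rule nn_integral_count_space_nn_integral[symmetric, OF countable_ar_times])
    fix k :: real
    have "(\<lambda>v. f v * indicator {a..b} (v + k)) \<in> borel_measurable borel" using f by measurable
    then show "(\<lambda>v. f v * indicator {a..b} (v + k)) \<in> borel_measurable lborel" by simp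
  qed
  also have "\<dots> \<le> (\<integral>\<^sup>+ v. f v * ennreal (max 0 (real (n p) * (b - a) + 1)) \<partial>lborel)"
  proof (intro nn_integral_mono)
    fix v :: real
    have "(\<integral>\<^sup>+ k. f v * indicator {a..b} (v + k) \<partial>count_space ?A) = f v * (\<integral>\<^sup>+ k. indicator {a..b} (v + k) \<partial>count_space ?A)"
      by (intro nn_integral_cmult) auto
    also have "(\<integral>\<^sup>+ k. indicator {a..b} (v + k) \<partial>count_space ?A) = npoints (?A \<inter> {a - v..b - v})"
    proof -
      have "(\<integral>\<^sup>+ k. indicator {a..b} (v + k) \<partial>count_space ?A) = (\<integral>\<^sup>+ k. indicator (?A \<inter> {a - v..b - v}) k \<partial>count_space UNIV)"
        unfolding nn_integral_count_space_subset[of ?A] by (intro nn_integral_cong) (auto simp: indicator_def)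
      then show ?thesis by simp
    qed
    also have "\<dots> \<le> npoints ((\<lambda>j::int. of_int j / real (n p) + \<phi> p) ` {j::int. (a - v - \<phi> p) * real (n p) \<le> of_int j \<and> of_int j \<le> (b - v - \<phi> p) * real (n p)})"
    proof (intro npoints_mono subsetI)
      fix k assume k: "k \<in> ?A \<inter> {a - v..b - v}"
      then obtain j :: int where j: "k = of_int j / real (n p) + \<phi> p" by (auto simp: ar_times_def)
      have "of_int j = (k - \<phi> p) * real (n p)" using n j by simp
      then have "(a - v - \<phi> p) * real (n p) \<le> of_int j" "of_int j \<le> (b - v - \<phi> p) * real (n p)"
        using k by (auto intro: mult_right_mono)
      then show "k \<in> (\<lambda>j::int. of_int j / real (n p) + \<phi> p) ` {j::int. (a - v - \<phi> p) * real (n p) \<le> of_int j \<and> of_int j \<le> (b - v - \<phi> p) * real (n p)}"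
        by (auto simp: j)
    qed
    also have "\<dots> = npoints {j::int. (a - v - \<phi> p) * real (n p) \<le> of_int j \<and> of_int j \<le> (b - v - \<phi> p) * real (n p)}"
      using n by (intro npoints_image) (auto simp: inj_on_def)
    also have "\<dots> \<le> ennreal (max 0 (real (n p) * (b - a) + 1))"
      using npoints_int_interval[of "(a - v - \<phi> p) * real (n p)" "(b - v - \<phi> p) * real (n p)"]
      by (simp add: algebra_simps)
    finally show "(\<integral>\<^sup>+ k. f v * indicator {a..b} (v + k) \<partial>count_space ?A) \<le> f v * ennreal (max 0 (real (n p) * (b - a) + 1))"
      by (simp add: mult_left_mono)
  qed
  also have "\<dots> = ennreal (max 0 (real (n p) * (b - a) + 1)) * (\<integral>\<^sup>+ v. f v \<partial>lborel)"
    using f by (subst nn_integral_multc) (auto simp: mult.commute)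
  finally show ?thesis .
qed

text \<open>For fixed \<open>t\<close> the values \<open>t - k\<close> run through a translate of
  the multiples of \<open>1 / n p\<close>, so this sum is one of those whose supremum is the
  norm.\<close>

lemma ar_times_norm_L1inf:
  assumes n: "1 \<le> n p"
  shows "(\<integral>\<^sup>+ k. ennreal \<bar>ext0 f (t - k)\<bar> \<partial>count_space (ar_times n \<phi> p)) \<le> norm_L1inf (real (n p)) f"
proof -
  have "bij_betw (\<lambda>j::int. of_int (- j) / real (n p) + \<phi> p) UNIV (ar_times n \<phi> p)"
  proof (rule bij_betw_imageI)
    show "inj (\<lambda>j::int. of_int (- j) / real (n p) + \<phi> p)" using n by (auto simp: inj_on_def)
    show "range (\<lambda>j::int. of_int (- j) / real (n p) + \<phi> p) = ar_times n \<phi> p"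
      unfolding ar_times_def
    proof (intro equalityI image_subsetI)
      fix j :: int
      show "of_int (- j) / real (n p) + \<phi> p \<in> range (\<lambda>j::int. of_int j / real (n p) + \<phi> p)" by blast
      have "of_int j / real (n p) + \<phi> p = of_int (- (- j)) / real (n p) + \<phi> p" by simp
      then show "of_int j / real (n p) + \<phi> p \<in> range (\<lambda>j::int. of_int (- j) / real (n p) + \<phi> p)" by blast
    qed
  qed
  from nn_integral_bij_count_space[OF this, of "\<lambda>k. ennreal \<bar>ext0 f (t - k)\<bar>"]
  have "(\<integral>\<^sup>+ k. ennreal \<bar>ext0 f (t - k)\<bar> \<partial>count_space (ar_times n \<phi> p)) =
     (\<integral>\<^sup>+ j. ennreal \<bar>ext0 f (t - (of_int (- j) / real (n p) + \<phi> p))\<bar> \<partial>count_space UNIV)" by simp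
  also have "\<dots> = (\<integral>\<^sup>+ j. ennreal \<bar>ext0 f ((t - \<phi> p) + of_int j / real (n p))\<bar> \<partial>count_space UNIV)"
    by (simp add: algebra_simps)
  also have "\<dots> \<le> norm_L1inf (real (n p)) f"
    unfolding norm_L1inf_def by (rule SUP_upper) simp
  finally show ?thesis .
qed

locale har_ic = har_noise M n \<phi> \<pi> \<xi> t0
  for M :: "'w measure" and n :: "'p::finite \<Rightarrow> nat" and \<phi> :: "'p \<Rightarrow> real"
    and \<pi> :: "'m::finite \<Rightarrow> 'w \<Rightarrow> (real \<times> real) set" and \<xi> :: "'p \<Rightarrow> real \<Rightarrow> 'w \<Rightarrow> real" and t0 :: real +
  fixes CM :: "'m \<Rightarrow> 'w \<Rightarrow> real set" and CP :: "'p \<Rightarrow> real \<Rightarrow> 'w \<Rightarrow> real option"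
    and \<MM> :: "('m, 'p) har_params"
  assumes ic0: "initial_condition M n \<phi> \<pi> \<xi> t0 (CM, CP)" and param: "parameters \<MM>"
    and hM_L1: "\<And>\<alpha> m. in_L1 (hM \<MM> \<alpha> m)"
    and hP_L1: "\<And>m p. in_L1 (hP \<MM> (Inl m) p)" and bP_L1: "\<And>m p. in_L1 (bP \<MM> (Inl m) p)"
    and hP_Linf: "\<And>p p'. in_L1inf (real (n p)) (hP \<MM> (Inr p') p)"
    and bP_Linf: "\<And>p p'. in_L1inf (real (n p)) (bP \<MM> (Inr p') p)"
    and integ: "ic_integrable M n \<phi> t0 (CM, CP)"
begin

lemma n1: "1 \<le> n p"
  using ar by (auto simp: ar_setting_def)

lemma CM_before: "\<omega> \<in> space M \<Longrightarrow> CM m \<omega> \<subseteq> {..<t0}"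
  using ic0 by (auto simp: initial_condition_def)

lemma ext_meas:
  "ext0 (hM \<MM> \<alpha> m) \<in> borel_measurable borel" "ext0 (hP \<MM> \<alpha> p) \<in> borel_measurable borel"
  "ext0 (bP \<MM> \<alpha> p) \<in> borel_measurable borel"
  using param by (auto intro!: measurable_ext0 simp: parameters_def)

lemma param_nonneg: "0 < s \<Longrightarrow> 0 \<le> hP \<MM> \<alpha> p s" "0 < s \<Longrightarrow> 0 \<le> bP \<MM> \<alpha> p s"
  using param by (auto simp: parameters_def)

lemma J_bound: "0 < s \<Longrightarrow> \<bar>J \<MM> \<alpha> p s w\<bar> \<le> hP \<MM> \<alpha> p s * \<bar>w\<bar> + bP \<MM> \<alpha> p s"
  using param by (auto simp: parameters_def)

text \<open>From \<open>h * \<bar>w\<bar> + b \<le> (h + b) * (1 + \<bar>w\<bar>)\<close>: the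
  second factor is \<open>psi1\<close>, the weight in which the initial condition is integrable, and
  \<open>h + b\<close> is the kernel that goes with it.\<close>

definition kp :: "'m + 'p \<Rightarrow> 'p \<Rightarrow> real \<Rightarrow> ennreal" where
  "kp \<alpha> p s = ennreal \<bar>ext0 (hP \<MM> \<alpha> p) s\<bar> + ennreal \<bar>ext0 (bP \<MM> \<alpha> p) s\<bar>"

lemma kp_meas: "kp \<alpha> p \<in> borel_measurable borel"
  unfolding kp_def[abs_def] using ext_meas by measurable

lemma kp_finite: "kp \<alpha> p s < \<infinity>"
  by (simp add: kp_def)

lemma opt_J_bound:
  assumes s: "0 < s"
  shows "ennreal \<bar>opt_app (J \<MM> \<alpha> p s) w\<bar> \<le> kp \<alpha> p s * ennreal (psi1 w)"
proof (cases w)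
  case (Some x)
  have "\<bar>J \<MM> \<alpha> p s x\<bar> \<le> (hP \<MM> \<alpha> p s + bP \<MM> \<alpha> p s) * (1 + \<bar>x\<bar>)"
    using J_bound[OF s, of \<alpha> p x] param_nonneg[OF s, of \<alpha> p]
    by (simp add: algebra_simps) (smt (verit) mult_nonneg_nonneg abs_ge_zero)
  then have "ennreal \<bar>J \<MM> \<alpha> p s x\<bar> \<le> ennreal ((hP \<MM> \<alpha> p s + bP \<MM> \<alpha> p s) * (1 + \<bar>x\<bar>))"
    by (rule ennreal_leI)
  also have "\<dots> = ennreal (hP \<MM> \<alpha> p s + bP \<MM> \<alpha> p s) * ennreal (1 + \<bar>x\<bar>)"
    using param_nonneg[OF s, of \<alpha> p] by (intro ennreal_mult) auto
  also have "ennreal (hP \<MM> \<alpha> p s + bP \<MM> \<alpha> p s) = kp \<alpha> p s"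
    using s param_nonneg[OF s, of \<alpha> p] by (simp add: kp_def ext0_def)
  finally show ?thesis using Some by simp
qed simp

lemma kp_L1: "(\<integral>\<^sup>+ x. kp (Inl m) p x \<partial>lborel) < \<infinity>"
proof -
  have "(\<integral>\<^sup>+ x. kp (Inl m) p x \<partial>lborel) = (\<integral>\<^sup>+ x. ennreal \<bar>ext0 (hP \<MM> (Inl m) p) x\<bar> \<partial>lborel) + (\<integral>\<^sup>+ x. ennreal \<bar>ext0 (bP \<MM> (Inl m) p) x\<bar> \<partial>lborel)"
    unfolding kp_def using ext_meas by (intro nn_integral_add) auto
  then show ?thesis using in_L1_nn_integral[OF hP_L1] in_L1_nn_integral[OF bP_L1] by simp
qed

lemma kp_Linf: "(\<integral>\<^sup>+ k. kp (Inr p') p (t - k) \<partial>count_space (ar_times n \<phi> p)) < \<infinity>"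
proof -
  have "(\<integral>\<^sup>+ k. kp (Inr p') p (t - k) \<partial>count_space (ar_times n \<phi> p)) =
    (\<integral>\<^sup>+ k. ennreal \<bar>ext0 (hP \<MM> (Inr p') p) (t - k)\<bar> \<partial>count_space (ar_times n \<phi> p)) +
    (\<integral>\<^sup>+ k. ennreal \<bar>ext0 (bP \<MM> (Inr p') p) (t - k)\<bar> \<partial>count_space (ar_times n \<phi> p))"
    unfolding kp_def by (intro nn_integral_add) auto
  also have "\<dots> \<le> norm_L1inf (real (n p)) (hP \<MM> (Inr p') p) + norm_L1inf (real (n p)) (bP \<MM> (Inr p') p)"
    by (intro add_mono ar_times_norm_L1inf n1)
  also have "\<dots> < \<infinity>" using hP_Linf[of p p'] bP_Linf[of p p'] by (simp add: in_L1inf_def)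
  finally show ?thesis .
qed

text \<open>The regular part contributes a finite mean and is therefore almost surely finite. The
  discrete part has almost surely finitely many points and values, so for it the finiteness of each
  value of \<open>f\<close> and \<open>G\<close> is enough.\<close>

lemma AE_CM_fin: "AE \<omega> in M. \<forall>m i. finite (CM m \<omega> \<inter> {- real i..real i})"
  and AE_CM_sum: "\<And>m f. f \<in> borel_measurable borel \<Longrightarrow> (\<And>u. f u < \<infinity>) \<Longrightarrow> (\<integral>\<^sup>+ u. f u \<partial>lborel) < \<infinity> \<Longrightarrow>
     AE \<omega> in M. (\<integral>\<^sup>+ u. f u \<partial>count_space (CM m \<omega>)) < \<infinity>"
  and AE_CP_sum: "\<And>p G. (\<And>k. G k < \<infinity>) \<Longrightarrow> (\<integral>\<^sup>+ k. G k \<partial>count_space (ar_times n \<phi> p)) < \<infinity> \<Longrightarrow>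
     AE \<omega> in M. (\<integral>\<^sup>+ k. G k * ennreal (psi1 (CP p k \<omega>)) \<partial>count_space (ar_times n \<phi> p \<inter> {..<t0})) < \<infinity>"
proof -
  obtain K :: real and RM DM :: "'m \<Rightarrow> 'w \<Rightarrow> real set" and RP DP :: "'p \<Rightarrow> real \<Rightarrow> 'w \<Rightarrow> real option" where
    A1: "\<forall>m. RM m \<in> measurable M point_sets \<and> DM m \<in> measurable M point_sets" and
    A2: "\<forall>(p, k)\<in>ar_index n \<phi>. k < t0 \<longrightarrow> RP p k \<in> measurable M opt_borel \<and> DP p k \<in> measurable M opt_borel" and
    A3: "\<forall>\<omega>\<in>space M. \<forall>m. CM m \<omega> = RM m \<omega> \<union> DM m \<omega>" and
    A4: "\<forall>\<omega>\<in>space M. \<forall>(p, k)\<in>ar_index n \<phi>. k < t0 \<longrightarrow> CP p k \<omega> = opt_add (RP p k \<omega>) (DP p k \<omega>)" and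
    D: "AE \<omega> in M. (\<Sum>m\<in>UNIV. npoints (DM m \<omega> \<inter> {..<t0})) + (\<Sum>p\<in>UNIV. ic_mass n \<phi> t0 p (DP p) {..<t0} \<omega>) < \<infinity>" and
    A5: "\<forall>B\<in>sets borel.
          (\<forall>m. (\<integral>\<^sup>+ \<omega>. npoints (RM m \<omega> \<inter> B) \<partial>M) \<le> ennreal K * emeasure lborel B) \<and>
          (\<forall>p. (\<integral>\<^sup>+ \<omega>. ic_mass n \<phi> t0 p (RP p) B \<omega> \<partial>M) \<le>
               ennreal K * (\<Sum>q\<in>UNIV. npoints (ar_times n \<phi> q \<inter> B)))"
    using integ unfolding ic_integrable_def prod.case by (elim exE conjE) (rule that)
  have RM: "RM m \<in> measurable M point_sets" for m using A1 by blast
  have RP: "RP p k \<in> measurable M opt_borel" if "(p, k) \<in> ar_index n \<phi>" "k < t0" for p k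
    using A2 that by blast
  have CMd: "CM m \<omega> = RM m \<omega> \<union> DM m \<omega>" if "\<omega> \<in> space M" for m \<omega> using A3 that by blast
  have CPd: "CP p k \<omega> = opt_add (RP p k \<omega>) (DP p k \<omega>)" if "\<omega> \<in> space M" "(p, k) \<in> ar_index n \<phi>" "k < t0" for \<omega> p k
    using A4 that by blast
  have RMK: "(\<integral>\<^sup>+ \<omega>. npoints (RM m \<omega> \<inter> B) \<partial>M) \<le> ennreal K * emeasure lborel B" if "B \<in> sets borel" for B m
    using A5 that by blast
  have RPK: "(\<integral>\<^sup>+ \<omega>. ic_mass n \<phi> t0 p (RP p) B \<omega> \<partial>M) \<le> ennreal K * (\<Sum>q\<in>UNIV. npoints (ar_times n \<phi> q \<inter> B))"
    if "B \<in> sets borel" for B p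
    using A5 that by blast
  have DM: "AE \<omega> in M. \<forall>m. finite (DM m \<omega> \<inter> {..<t0})"
    using D
  proof eventually_elim
    case (elim \<omega>)
    show ?case
    proof
      fix m
      have "npoints (DM m \<omega> \<inter> {..<t0}) \<le> (\<Sum>m\<in>UNIV. npoints (DM m \<omega> \<inter> {..<t0}))"
        by (rule member_le_sum) auto
      also have "\<dots> \<le> \<dots> + (\<Sum>p\<in>UNIV. ic_mass n \<phi> t0 p (DP p) {..<t0} \<omega>)" by simp
      also have "\<dots> < \<infinity>" by (rule elim)
      finally show "finite (DM m \<omega> \<inter> {..<t0})" by (simp only: npoints_less_top_iff)
    qed
  qed
  have DP: "AE \<omega> in M. \<forall>p. ic_mass n \<phi> t0 p (DP p) {..<t0} \<omega> < \<infinity>"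
    using D by eventually_elim (simp add: less_top[symmetric])
  have CMsub: "CM m \<omega> \<subseteq> RM m \<omega> \<union> (DM m \<omega> \<inter> {..<t0})" if "\<omega> \<in> space M" for m \<omega>
    using CMd[OF that] CM_before[OF that] by blast
  have "AE \<omega> in M. finite (CM m \<omega> \<inter> {- real i..real i})" for m i
  proof -
    have "(\<integral>\<^sup>+ \<omega>. npoints (RM m \<omega> \<inter> {- real i..real i}) \<partial>M) \<le> ennreal K * emeasure lborel {- real i..real i}"
      by (rule RMK) simp
    also have "\<dots> < \<infinity>" by (simp add: ennreal_mult_less_top)
    finally have "AE \<omega> in M. npoints (RM m \<omega> \<inter> {- real i..real i}) \<noteq> \<infinity>"
      by (intro nn_integral_PInf_AE measurable_npoints RM) auto
    then show ?thesis using DM AE_space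
    proof eventually_elim
      case (elim \<omega>)
      then have "finite (RM m \<omega> \<inter> {- real i..real i})"
        using npoints_less_top_iff[of "RM m \<omega> \<inter> {- real i..real i}"] by (simp add: less_top)
      moreover have "CM m \<omega> \<inter> {- real i..real i} \<subseteq> (RM m \<omega> \<inter> {- real i..real i}) \<union> (DM m \<omega> \<inter> {..<t0})"
        using CMsub[OF elim(3), of m] by blast
      ultimately show ?case using elim(2) by (meson finite_UnI finite_subset)
    qed
  qed
  then show "AE \<omega> in M. \<forall>m i. finite (CM m \<omega> \<inter> {- real i..real i})"
    by (simp add: AE_all_countable AE_finite_all)
  { fix m and f :: "real \<Rightarrow> ennreal"
    assume f: "f \<in> borel_measurable borel" "\<And>u. f u < \<infinity>" "(\<integral>\<^sup>+ u. f u \<partial>lborel) < \<infinity>"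
    have *: "(\<lambda>\<omega>. \<integral>\<^sup>+ u. f u \<partial>count_space (RM m \<omega>)) \<in> borel_measurable M \<and>
      (\<integral>\<^sup>+ \<omega>. \<integral>\<^sup>+ u. f u \<partial>count_space (RM m \<omega>) \<partial>M) \<le> ennreal K * (\<integral>\<^sup>+ u. f u \<partial>lborel)"
      using f(1) by (intro rset_nn_integral_le RM RMK) auto
    have "ennreal K * (\<integral>\<^sup>+ u. f u \<partial>lborel) < \<infinity>" using f(3) by (simp add: ennreal_mult_less_top)
    then have "AE \<omega> in M. (\<integral>\<^sup>+ u. f u \<partial>count_space (RM m \<omega>)) \<noteq> \<infinity>"
      using * by (intro nn_integral_PInf_AE) (auto simp: top_unique less_top)
    then show "AE \<omega> in M. (\<integral>\<^sup>+ u. f u \<partial>count_space (CM m \<omega>)) < \<infinity>"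
      using DM AE_space
    proof eventually_elim
      case (elim \<omega>)
      have "(\<integral>\<^sup>+ u. f u \<partial>count_space (CM m \<omega>)) \<le> (\<integral>\<^sup>+ u. f u \<partial>count_space (RM m \<omega> \<union> (DM m \<omega> \<inter> {..<t0})))"
        by (intro nn_integral_count_space_mono_set CMsub elim)
      also have "\<dots> \<le> (\<integral>\<^sup>+ u. f u \<partial>count_space (RM m \<omega>)) + (\<integral>\<^sup>+ u. f u \<partial>count_space (DM m \<omega> \<inter> {..<t0}))"
        by (rule nn_integral_count_space_Un_le)
      also have "\<dots> < \<infinity>"
        using elim f(2) nn_integral_count_space_less_top_finite[of "DM m \<omega> \<inter> {..<t0}" f] by (simp add: less_top)
      finally show ?case .
    qed }
  { fix p and G :: "real \<Rightarrow> ennreal"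
    assume G: "\<And>k. G k < \<infinity>" "(\<integral>\<^sup>+ k. G k \<partial>count_space (ar_times n \<phi> p)) < \<infinity>"
    let ?A = "ar_times n \<phi> p \<inter> {..<t0}"
    have cA: "countable ?A" using countable_ar_times by (rule countable_Int1)
    have idx: "(p, k) \<in> ar_index n \<phi>" "k < t0" if "k \<in> ?A" for k using that by (auto simp: ar_index_def)
    have Rm: "(\<lambda>\<omega>. ennreal (psi1 (RP p k \<omega>))) \<in> borel_measurable M" if "k \<in> ?A" for k
      using psi1_measurable[OF RP[OF idx[OF that]]] by measurable
    \<comment> \<open>A single time lies in at most \<open>CARD('p)\<close> of the grids, so
      \<open>c\<close> bounds the mean weight of the regular value at any time.\<close>
    define c where "c = ennreal K * of_nat (CARD('p))"
    have cf: "c < \<infinity>" by (simp add: c_def ennreal_mult_less_top of_nat_less_top)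
    have E: "(\<integral>\<^sup>+ \<omega>. ennreal (psi1 (RP p k \<omega>)) \<partial>M) \<le> c" if k: "k \<in> ?A" for k
    proof -
      have "ic_mass n \<phi> t0 p (RP p) {k} \<omega> = ennreal (psi1 (RP p k \<omega>))" for \<omega>
      proof -
        have "?A \<inter> {k} = {k}" using k by auto
        then show ?thesis by (simp add: ic_mass_def nn_integral_count_space_finite)
      qed
      then have "(\<integral>\<^sup>+ \<omega>. ennreal (psi1 (RP p k \<omega>)) \<partial>M) \<le> ennreal K * (\<Sum>q\<in>UNIV. npoints (ar_times n \<phi> q \<inter> {k}))"
        using RPK[of "{k}" p] by simp
      also have "\<dots> \<le> ennreal K * (\<Sum>q\<in>(UNIV :: 'p set). 1)"
      proof (intro mult_left_mono sum_mono)
        fix q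
        have "npoints (ar_times n \<phi> q \<inter> {k}) \<le> npoints {k}" by (intro npoints_mono) auto
        then show "npoints (ar_times n \<phi> q \<inter> {k}) \<le> 1" by simp
      qed simp
      finally show ?thesis by (simp add: c_def)
    qed
    have "(\<integral>\<^sup>+ \<omega>. (\<integral>\<^sup>+ k. G k * ennreal (psi1 (RP p k \<omega>)) \<partial>count_space ?A) \<partial>M) =
       (\<integral>\<^sup>+ k. (\<integral>\<^sup>+ \<omega>. G k * ennreal (psi1 (RP p k \<omega>)) \<partial>M) \<partial>count_space ?A)"
      using Rm by (intro nn_integral_count_space_nn_integral cA borel_measurable_times_ennreal) auto
    also have "\<dots> = (\<integral>\<^sup>+ k. G k * (\<integral>\<^sup>+ \<omega>. ennreal (psi1 (RP p k \<omega>)) \<partial>M) \<partial>count_space ?A)"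
      using Rm by (intro nn_integral_cong nn_integral_cmult) auto
    also have "\<dots> \<le> (\<integral>\<^sup>+ k. G k * c \<partial>count_space ?A)"
      using E by (intro nn_integral_mono mult_left_mono) auto
    also have "\<dots> \<le> (\<integral>\<^sup>+ k. G k * c \<partial>count_space (ar_times n \<phi> p))"
      by (intro nn_integral_count_space_mono_set) auto
    also have "\<dots> = (\<integral>\<^sup>+ k. G k \<partial>count_space (ar_times n \<phi> p)) * c" by (intro nn_integral_multc) auto
    also have "\<dots> < \<infinity>" using G(2) cf by (simp add: ennreal_mult_less_top)
    finally have "AE \<omega> in M. (\<integral>\<^sup>+ k. G k * ennreal (psi1 (RP p k \<omega>)) \<partial>count_space ?A) \<noteq> \<infinity>"
      using Rm by (intro nn_integral_PInf_AE borel_measurable_count_space_sum cA borel_measurable_times_ennreal) auto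
    then show "AE \<omega> in M. (\<integral>\<^sup>+ k. G k * ennreal (psi1 (CP p k \<omega>)) \<partial>count_space ?A) < \<infinity>"
      using DP AE_space
    proof eventually_elim
      case (elim \<omega>)
      \<comment> \<open>A value other than \<open>None\<close> has weight at least 1, so a finite
        mass leaves finitely many of them.\<close>
      let ?D = "{k \<in> ?A. DP p k \<omega> \<noteq> None}"
      have "npoints ?D = (\<integral>\<^sup>+ k. indicator ?D k \<partial>count_space UNIV)" by simp
      also have "\<dots> \<le> (\<integral>\<^sup>+ k. ennreal (psi1 (DP p k \<omega>)) * indicator ?A k \<partial>count_space UNIV)"
        using ennreal_leI[OF psi1_ge1] by (intro nn_integral_mono) (auto simp: indicator_def)
      also have "\<dots> = ic_mass n \<phi> t0 p (DP p) {..<t0} \<omega>"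
        unfolding ic_mass_def nn_integral_count_space_subset[of ?A, symmetric] by (simp add: Int_assoc)
      also have "\<dots> < \<infinity>" using elim by simp
      finally have finD: "finite ?D" by (simp only: npoints_less_top_iff)
      have "(\<integral>\<^sup>+ k. G k * ennreal (psi1 (CP p k \<omega>)) \<partial>count_space ?A) \<le>
        (\<integral>\<^sup>+ k. G k * ennreal (psi1 (RP p k \<omega>)) + G k * ennreal (psi1 (DP p k \<omega>)) \<partial>count_space ?A)"
      proof (intro nn_integral_mono)
        fix k assume "k \<in> space (count_space ?A)"
        then have k: "k \<in> ?A" by simp
        have "ennreal (psi1 (CP p k \<omega>)) \<le> ennreal (psi1 (RP p k \<omega>)) + ennreal (psi1 (DP p k \<omega>))"
          unfolding CPd[OF elim(3) idx[OF k]] using psi1_opt_add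
          by (subst ennreal_plus[symmetric]) (auto intro!: ennreal_leI psi1_nonneg)
        then have "G k * ennreal (psi1 (CP p k \<omega>)) \<le> G k * (ennreal (psi1 (RP p k \<omega>)) + ennreal (psi1 (DP p k \<omega>)))"
          by (rule mult_left_mono) simp
        then show "G k * ennreal (psi1 (CP p k \<omega>)) \<le> G k * ennreal (psi1 (RP p k \<omega>)) + G k * ennreal (psi1 (DP p k \<omega>))"
          by (simp only: distrib_left)
      qed
      also have "\<dots> = (\<integral>\<^sup>+ k. G k * ennreal (psi1 (RP p k \<omega>)) \<partial>count_space ?A) + (\<integral>\<^sup>+ k. G k * ennreal (psi1 (DP p k \<omega>)) \<partial>count_space ?A)"
        by (rule nn_integral_add) auto
      also have "(\<integral>\<^sup>+ k. G k * ennreal (psi1 (DP p k \<omega>)) \<partial>count_space ?A) = (\<integral>\<^sup>+ k. G k * ennreal (psi1 (DP p k \<omega>)) \<partial>count_space ?D)"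
        unfolding nn_integral_count_space_subset[of ?A] nn_integral_count_space_subset[of ?D]
        by (intro nn_integral_cong) (auto simp: indicator_def)
      also have "(\<integral>\<^sup>+ k. G k * ennreal (psi1 (RP p k \<omega>)) \<partial>count_space ?A) + \<dots> < \<infinity>"
        using elim(1) nn_integral_count_space_less_top_finite[OF finD, of "\<lambda>k. G k * ennreal (psi1 (DP p k \<omega>))"] G(1)
        by (simp add: less_top ennreal_mult_less_top)
      finally show ?case .
    qed }
qed

end

section \<open>Paths on which the initial condition acts summably\<close>

context har_ic begin

text \<open>The drives of the point processes have to converge at almost every time only, so for
  them the contribution is integrated over windows. At the autoregressive times the equation holds
  pointwise, and the sums are required to be finite time by time. Both lists of conditions are
  countable.\<close>

definition ic_good :: "'w \<Rightarrow> bool" where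
  "ic_good \<omega> \<longleftrightarrow>
    (\<forall>m m' (j::nat). (\<integral>\<^sup>+ u. (\<integral>\<^sup>+ s. ennreal \<bar>ext0 (hM \<MM> (Inl m) m') (s - u)\<bar> * indicator {t0..t0 + real j} s \<partial>lborel) \<partial>count_space (CM m' \<omega>)) < \<infinity>) \<and>
    (\<forall>m p (j::nat). (\<integral>\<^sup>+ k. (\<integral>\<^sup>+ s. kp (Inl m) p (s - k) * indicator {t0..t0 + real j} s \<partial>lborel) * ennreal (psi1 (CP p k \<omega>))
       \<partial>count_space (ar_times n \<phi> p \<inter> {..<t0})) < \<infinity>) \<and>
    (\<forall>p' m. \<forall>t\<in>ar_times n \<phi> p'. (\<integral>\<^sup>+ u. ennreal \<bar>ext0 (hM \<MM> (Inr p') m) (t - u)\<bar> \<partial>count_space (CM m \<omega>)) < \<infinity>) \<and>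
    (\<forall>p' p. \<forall>t\<in>ar_times n \<phi> p'. (\<integral>\<^sup>+ k. kp (Inr p') p (t - k) * ennreal (psi1 (CP p k \<omega>))
       \<partial>count_space (ar_times n \<phi> p \<inter> {..<t0})) < \<infinity>)"

text \<open>Each condition is an instance of \<open>AE_CM_sum\<close> or \<open>AE_CP_sum\<close>.
  For the windows, an exchange of integrals shows that the kernel averaged over the window is again
  integrable over the line, or summable over the grid.\<close>

lemma AE_ic_good: "AE \<omega> in M. ic_good \<omega>"
proof -
  have 1: "AE \<omega> in M. (\<integral>\<^sup>+ u. (\<integral>\<^sup>+ s. ennreal \<bar>ext0 (hM \<MM> (Inl m) m') (s - u)\<bar> * indicator {t0..t0 + real j} s \<partial>lborel) \<partial>count_space (CM m' \<omega>)) < \<infinity>"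
    for m m' and j :: nat
  proof (rule AE_CM_sum)
    let ?h = "\<lambda>x. ennreal \<bar>ext0 (hM \<MM> (Inl m) m') x\<bar>"
    let ?f = "\<lambda>u. \<integral>\<^sup>+ s. ?h (s - u) * indicator {t0..t0 + real j} s \<partial>lborel"
    note [measurable] = ext_meas(1)[of "Inl m" m']
    have h: "?h \<in> borel_measurable borel" by measurable
    have m2: "(\<lambda>(u, s). ?h (s - u) * indicator {t0..t0 + real j} s) \<in> borel_measurable (lborel \<Otimes>\<^sub>M lborel)"
      by measurable
    from lborel.borel_measurable_nn_integral[OF m2]
    show "?f \<in> borel_measurable borel" by simp
    show "?f u < \<infinity>" for u
    proof -
      have "?f u \<le> (\<integral>\<^sup>+ s. ?h (s - u) \<partial>lborel)" by (intro nn_integral_mono) (auto simp: indicator_def)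
      also have "\<dots> = (\<integral>\<^sup>+ s. ?h s \<partial>lborel)" by (rule nn_integral_shift[OF h])
      also have "\<dots> < \<infinity>" by (rule in_L1_nn_integral[OF hM_L1])
      finally show ?thesis .
    qed
    have "(\<integral>\<^sup>+ u. ?f u \<partial>lborel) = (\<integral>\<^sup>+ s. (\<integral>\<^sup>+ u. ?h (s - u) * indicator {t0..t0 + real j} s \<partial>lborel) \<partial>lborel)"
      using m2 by (intro lborel_pair.Fubini'[symmetric]) (simp add: split_beta')
    also have "\<dots> = (\<integral>\<^sup>+ s. (\<integral>\<^sup>+ u. ?h u \<partial>lborel) * indicator {t0..t0 + real j} s \<partial>lborel)"
    proof (rule nn_integral_cong)
      fix s :: real
      have "(\<integral>\<^sup>+ u. ?h (s - u) * indicator {t0..t0 + real j} s \<partial>lborel) = (\<integral>\<^sup>+ u. ?h (s - u) \<partial>lborel) * indicator {t0..t0 + real j} s"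
        by (rule nn_integral_multc) measurable
      then show "(\<integral>\<^sup>+ u. ?h (s - u) * indicator {t0..t0 + real j} s \<partial>lborel) = (\<integral>\<^sup>+ u. ?h u \<partial>lborel) * indicator {t0..t0 + real j} s"
        by (simp add: nn_integral_reflect[OF h])
    qed
    also have "\<dots> = (\<integral>\<^sup>+ u. ?h u \<partial>lborel) * emeasure lborel {t0..t0 + real j}"
      by (rule nn_integral_cmult_indicator) simp
    also have "\<dots> < \<infinity>" using in_L1_nn_integral[OF hM_L1] by (simp add: ennreal_mult_less_top)
    finally show "(\<integral>\<^sup>+ u. ?f u \<partial>lborel) < \<infinity>" .
  qed
  have 2: "AE \<omega> in M. (\<integral>\<^sup>+ k. (\<integral>\<^sup>+ s. kp (Inl m) p (s - k) * indicator {t0..t0 + real j} s \<partial>lborel) * ennreal (psi1 (CP p k \<omega>))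
       \<partial>count_space (ar_times n \<phi> p \<inter> {..<t0})) < \<infinity>" for m p and j :: nat
  proof (rule AE_CP_sum)
    show "(\<integral>\<^sup>+ s. kp (Inl m) p (s - k) * indicator {t0..t0 + real j} s \<partial>lborel) < \<infinity>" for k
    proof -
      have "(\<integral>\<^sup>+ s. kp (Inl m) p (s - k) * indicator {t0..t0 + real j} s \<partial>lborel) \<le> (\<integral>\<^sup>+ s. kp (Inl m) p (s - k) \<partial>lborel)"
        by (intro nn_integral_mono) (auto simp: indicator_def)
      also have "\<dots> = (\<integral>\<^sup>+ s. kp (Inl m) p s \<partial>lborel)" by (rule nn_integral_shift[OF kp_meas])
      also have "\<dots> < \<infinity>" by (rule kp_L1)
      finally show ?thesis .
    qed
    have "(\<integral>\<^sup>+ k. (\<integral>\<^sup>+ s. kp (Inl m) p (s - k) * indicator {t0..t0 + real j} s \<partial>lborel) \<partial>count_space (ar_times n \<phi> p)) \<le>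
      ennreal (max 0 (real (n p) * (t0 + real j - t0) + 1)) * (\<integral>\<^sup>+ v. kp (Inl m) p v \<partial>lborel)"
      by (intro ar_times_sum_shift_le n1 kp_meas)
    also have "\<dots> < \<infinity>" using kp_L1[of m p] by (simp add: ennreal_mult_less_top)
    finally show "(\<integral>\<^sup>+ k. (\<integral>\<^sup>+ s. kp (Inl m) p (s - k) * indicator {t0..t0 + real j} s \<partial>lborel) \<partial>count_space (ar_times n \<phi> p)) < \<infinity>" .
  qed
  have 3: "AE \<omega> in M. (\<integral>\<^sup>+ u. ennreal \<bar>ext0 (hM \<MM> (Inr p') m) (t - u)\<bar> \<partial>count_space (CM m \<omega>)) < \<infinity>" for p' m t
  proof (rule AE_CM_sum)
    note [measurable] = ext_meas(1)[of "Inr p'" m]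
    show "(\<lambda>u. ennreal \<bar>ext0 (hM \<MM> (Inr p') m) (t - u)\<bar>) \<in> borel_measurable borel" by measurable
    have h: "(\<lambda>x. ennreal \<bar>ext0 (hM \<MM> (Inr p') m) x\<bar>) \<in> borel_measurable borel" by measurable
    show "(\<integral>\<^sup>+ u. ennreal \<bar>ext0 (hM \<MM> (Inr p') m) (t - u)\<bar> \<partial>lborel) < \<infinity>"
      using in_L1_nn_integral[OF hM_L1, of "Inr p'" m] nn_integral_reflect[OF h, of t] by simp
  qed simp
  have 4: "AE \<omega> in M. (\<integral>\<^sup>+ k. kp (Inr p') p (t - k) * ennreal (psi1 (CP p k \<omega>))
       \<partial>count_space (ar_times n \<phi> p \<inter> {..<t0})) < \<infinity>" for p' p t
    by (rule AE_CP_sum[OF kp_finite kp_Linf])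
  show ?thesis
    unfolding ic_good_def
    by (intro AE_conjI AE_all_countable[THEN iffD2] allI AE_ball_countable[THEN iffD2] countable_ar_times ballI 1 2 3 4)
qed

end

locale har_full = har_par M n \<phi> \<pi> \<xi> t0 CM CP Om0 \<MM> + har_ic M n \<phi> \<pi> \<xi> t0 CM CP \<MM>
  for M :: "'w measure" and n :: "'p::finite \<Rightarrow> nat" and \<phi> :: "'p \<Rightarrow> real"
    and \<pi> :: "'m::finite \<Rightarrow> 'w \<Rightarrow> (real \<times> real) set" and \<xi> :: "'p \<Rightarrow> real \<Rightarrow> 'w \<Rightarrow> real" and t0 :: real
    and CM :: "'m \<Rightarrow> 'w \<Rightarrow> real set" and CP :: "'p \<Rightarrow> real \<Rightarrow> 'w \<Rightarrow> real option" and Om0 :: "'w set"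
    and \<MM> :: "('m, 'p) har_params"
begin

text \<open>The ranges of summation do not depend on \<open>s\<close>, since \<open>ext0\<close>
  already removes the terms after \<open>s\<close>; sums and time integral can then be
  exchanged.\<close>

definition drive_bound :: "'m + 'p \<Rightarrow> ('m \<Rightarrow> ('w \<times> real \<times> real) set) \<Rightarrow> ('p \<Rightarrow> real \<Rightarrow> 'w \<Rightarrow> real option) \<Rightarrow> real \<Rightarrow> 'w \<Rightarrow> real \<Rightarrow> ennreal" where
  "drive_bound \<alpha> C W a \<omega> s =
    (\<Sum>m\<in>UNIV. (\<integral>\<^sup>+ u. ennreal \<bar>ext0 (hM \<MM> \<alpha> m) (s - u)\<bar> \<partial>count_space (CMt m \<omega>)) +
       (\<integral>\<^sup>+ u. ennreal \<bar>ext0 (hM \<MM> \<alpha> m) (s - u)\<bar> \<partial>count_space (times m (C m) \<omega> \<inter> {..a}))) +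
    (\<Sum>p\<in>UNIV. (\<integral>\<^sup>+ k. kp \<alpha> p (s - k) * ennreal (psi1 (CP p k \<omega>)) \<partial>count_space (ar_times n \<phi> p \<inter> {..<t0})) +
       (\<integral>\<^sup>+ k. kp \<alpha> p (s - k) * ennreal (psi1 (W p k \<omega>)) \<partial>count_space (ar_times n \<phi> p \<inter> {t0..a})))"

lemma adr_le_bound:
  assumes W: "\<And>p k. (p, k) \<in> ar_index n \<phi> \<Longrightarrow> k < t0 \<Longrightarrow> W p k \<omega> = CP p k \<omega>"
  shows "adr \<alpha> (trunc a (NN C, W)) s \<omega> \<le> drive_bound \<alpha> C W a \<omega> s"
  unfolding adrive_def drive_bound_def trunc_def prod.case
proof (intro add_mono sum_mono)
  fix m
  have "(\<integral>\<^sup>+ u. ennreal \<bar>hM \<MM> \<alpha> m (s - u)\<bar> \<partial>count_space (NN C m \<omega> \<inter> {..a} \<inter> {..<s})) =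
        (\<integral>\<^sup>+ u. ennreal \<bar>ext0 (hM \<MM> \<alpha> m) (s - u)\<bar> \<partial>count_space (NN C m \<omega> \<inter> {..a} \<inter> {..<s}))"
    by (intro nn_integral_cong) (auto simp: ext0_def)
  also have "\<dots> \<le> (\<integral>\<^sup>+ u. ennreal \<bar>ext0 (hM \<MM> \<alpha> m) (s - u)\<bar> \<partial>count_space (CMt m \<omega> \<union> (times m (C m) \<omega> \<inter> {..a})))"
    by (intro nn_integral_count_space_mono_set) (auto simp: NN_def)
  also have "\<dots> \<le> (\<integral>\<^sup>+ u. ennreal \<bar>ext0 (hM \<MM> \<alpha> m) (s - u)\<bar> \<partial>count_space (CMt m \<omega>)) +
       (\<integral>\<^sup>+ u. ennreal \<bar>ext0 (hM \<MM> \<alpha> m) (s - u)\<bar> \<partial>count_space (times m (C m) \<omega> \<inter> {..a}))"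
    by (rule nn_integral_count_space_Un_le)
  finally show "(\<integral>\<^sup>+ u. ennreal \<bar>hM \<MM> \<alpha> m (s - u)\<bar> \<partial>count_space (NN C m \<omega> \<inter> {..a} \<inter> {..<s})) \<le> \<dots>" .
next
  fix p
  let ?W = "\<lambda>k. if k < t0 then CP p k \<omega> else if k \<le> a then W p k \<omega> else None"
  let ?A = "ar_times n \<phi> p"
  have "(\<integral>\<^sup>+ k. ennreal \<bar>opt_app (J \<MM> \<alpha> p (s - k)) (if k \<le> a then W p k \<omega> else None)\<bar> \<partial>count_space (?A \<inter> {..<s})) \<le>
     (\<integral>\<^sup>+ k. kp \<alpha> p (s - k) * ennreal (psi1 (?W k)) \<partial>count_space (?A \<inter> {..<s}))"
  proof (intro nn_integral_mono)
    fix k assume "k \<in> space (count_space (?A \<inter> {..<s}))"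
    then have k: "k \<in> ?A" "k < s" by auto
    have "(p, k) \<in> ar_index n \<phi>" using k by (auto simp: ar_index_def)
    then have "(if k \<le> a then W p k \<omega> else None) = ?W k \<or> (if k \<le> a then W p k \<omega> else None) = None"
      using W[of p k] by auto
    then show "ennreal \<bar>opt_app (J \<MM> \<alpha> p (s - k)) (if k \<le> a then W p k \<omega> else None)\<bar> \<le> kp \<alpha> p (s - k) * ennreal (psi1 (?W k))"
      using opt_J_bound[of "s - k" \<alpha> p] k(2) by (elim disjE) simp_all
  qed
  also have "\<dots> \<le> (\<integral>\<^sup>+ k. kp \<alpha> p (s - k) * ennreal (psi1 (?W k)) \<partial>count_space (?A \<inter> {..<t0} \<union> ?A \<inter> {t0..}))"
    by (intro nn_integral_count_space_mono_set) auto
  also have "\<dots> \<le> (\<integral>\<^sup>+ k. kp \<alpha> p (s - k) * ennreal (psi1 (?W k)) \<partial>count_space (?A \<inter> {..<t0})) +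
      (\<integral>\<^sup>+ k. kp \<alpha> p (s - k) * ennreal (psi1 (?W k)) \<partial>count_space (?A \<inter> {t0..}))"
    by (rule nn_integral_count_space_Un_le)
  also have "(\<integral>\<^sup>+ k. kp \<alpha> p (s - k) * ennreal (psi1 (?W k)) \<partial>count_space (?A \<inter> {..<t0})) =
      (\<integral>\<^sup>+ k. kp \<alpha> p (s - k) * ennreal (psi1 (CP p k \<omega>)) \<partial>count_space (?A \<inter> {..<t0}))"
    by (intro nn_integral_cong) auto
  also have "(\<integral>\<^sup>+ k. kp \<alpha> p (s - k) * ennreal (psi1 (?W k)) \<partial>count_space (?A \<inter> {t0..})) =
      (\<integral>\<^sup>+ k. kp \<alpha> p (s - k) * ennreal (psi1 (W p k \<omega>)) \<partial>count_space (?A \<inter> {t0..a}))"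
    unfolding nn_integral_count_space_subset[of "?A \<inter> {t0..}"] nn_integral_count_space_subset[of "?A \<inter> {t0..a}"]
    by (intro nn_integral_cong) (auto simp: indicator_def)
  finally show "(\<integral>\<^sup>+ k. ennreal \<bar>opt_app (J \<MM> \<alpha> p (s - k)) (if k \<le> a then W p k \<omega> else None)\<bar> \<partial>count_space (?A \<inter> {..<s})) \<le>
      (\<integral>\<^sup>+ k. kp \<alpha> p (s - k) * ennreal (psi1 (CP p k \<omega>)) \<partial>count_space (?A \<inter> {..<t0})) +
      (\<integral>\<^sup>+ k. kp \<alpha> p (s - k) * ennreal (psi1 (W p k \<omega>)) \<partial>count_space (?A \<inter> {t0..a}))" .
qed

lemma CMt_CM: "CMt m \<omega> \<subseteq> CM m \<omega>"
  by (auto simp: CMt_def)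

lemma finite_ar: "finite (ar_times n \<phi> p \<inter> {t0..a})"
  by (rule finite_ar_times_bounded[where n = n, OF n1])

lemma adr_at_finite:
  assumes good: "ic_good \<omega>" and fin: "\<And>m. finite (times m (C m) \<omega> \<inter> {..k})"
    and W: "\<And>p k. (p, k) \<in> ar_index n \<phi> \<Longrightarrow> k < t0 \<Longrightarrow> W p k \<omega> = CP p k \<omega>"
    and k: "(p, k) \<in> ar_index n \<phi>"
  shows "adr (Inr p) (NN C, W) k \<omega> < \<infinity>"
proof -
  have kA: "k \<in> ar_times n \<phi> p" using k by (auto simp: ar_index_def)
  have "adr (Inr p) (NN C, W) k \<omega> = adr (Inr p) (trunc k (NN C, W)) k \<omega>"
    unfolding trunc_def prod.case by (rule drive_cong_gen) auto
  also have "\<dots> \<le> drive_bound (Inr p) C W k \<omega> k" by (rule adr_le_bound) (rule W)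
  also have "\<dots> < \<infinity>"
  proof -
    have "(\<integral>\<^sup>+ u. ennreal \<bar>ext0 (hM \<MM> (Inr p) m) (k - u)\<bar> \<partial>count_space (CMt m \<omega>)) < \<infinity>" for m
      using good kA nn_integral_count_space_mono_set[OF CMt_CM, of m \<omega> "\<lambda>u. ennreal \<bar>ext0 (hM \<MM> (Inr p) m) (k - u)\<bar>"]
      unfolding ic_good_def by (blast intro: le_less_trans)
    moreover have "(\<integral>\<^sup>+ u. ennreal \<bar>ext0 (hM \<MM> (Inr p) m) (k - u)\<bar> \<partial>count_space (times m (C m) \<omega> \<inter> {..k})) < \<infinity>" for m
      by (rule nn_integral_count_space_less_top_finite[OF fin]) simp
    moreover have "(\<integral>\<^sup>+ k'. kp (Inr p) p' (k - k') * ennreal (psi1 (CP p' k' \<omega>)) \<partial>count_space (ar_times n \<phi> p' \<inter> {..<t0})) < \<infinity>" for p'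
      using good kA unfolding ic_good_def by blast
    moreover have "(\<integral>\<^sup>+ k'. kp (Inr p) p' (k - k') * ennreal (psi1 (W p' k' \<omega>)) \<partial>count_space (ar_times n \<phi> p' \<inter> {t0..k})) < \<infinity>" for p'
      using kp_finite by (intro nn_integral_count_space_less_top_finite[OF finite_ar]) (auto simp: ennreal_mult_less_top)
    ultimately show ?thesis unfolding drive_bound_def
      by (simp add: less_top[symmetric])
  qed
  finally show ?thesis .
qed

text \<open>A statement on one path, without means: finitely many new points and terms of the series
  each contribute an integrable function of time, and the initial condition does so by
  \<open>ic_good\<close>. It brings almost every path into one of the events to which the iteration
  is localised.\<close>

lemma int_finite:
  assumes good: "ic_good \<omega>" and fin: "\<And>m. finite (times m (C m) \<omega> \<inter> {..a})"
    and W: "\<And>p k. (p, k) \<in> ar_index n \<phi> \<Longrightarrow> k < t0 \<Longrightarrow> W p k \<omega> = CP p k \<omega>"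
    and c: "t0 \<le> c"
  shows "(\<integral>\<^sup>+ s. adr (Inl m) (trunc a (NN C, W)) s \<omega> * indicator {c<..b} s \<partial>lborel) < \<infinity>"
proof -
  obtain j :: nat where j: "b - t0 \<le> real j" using real_arch_simple by blast
  \<comment> \<open>Lebesgue measure on a window of \<open>ic_good\<close> that covers
    \<open>{c<..b}\<close>.\<close>
  define \<nu> where "\<nu> = density lborel (indicator {t0..t0 + real j})"
  have s\<nu>: "sets \<nu> = sets borel" by (simp add: \<nu>_def)
  have int_\<nu>: "(\<integral>\<^sup>+ s. f s \<partial>\<nu>) = (\<integral>\<^sup>+ s. f s * indicator {t0..t0 + real j} s \<partial>lborel)" if "f \<in> borel_measurable borel" for f
    unfolding \<nu>_def using that by (subst nn_integral_density) (auto simp: mult.commute)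
  have le_\<nu>: "(\<integral>\<^sup>+ s. f s \<partial>\<nu>) \<le> (\<integral>\<^sup>+ s. f s \<partial>lborel)" if "f \<in> borel_measurable borel" for f
    unfolding int_\<nu>[OF that] by (intro nn_integral_mono) (auto simp: indicator_def)
  let ?h = "\<lambda>m' u s. ennreal \<bar>ext0 (hM \<MM> (Inl m) m') (s - u)\<bar>"
  have hm: "?h m' u \<in> borel_measurable borel" for m' u using ext_meas(1)[of "Inl m" m'] by measurable
  have hm\<nu>: "?h m' u \<in> borel_measurable \<nu>" for m' u using hm s\<nu> measurable_cong_sets by blast
  let ?g = "\<lambda>p w k s. kp (Inl m) p (s - k) * ennreal (psi1 (w p k))"
  have gm: "?g p w k \<in> borel_measurable borel" for p w k using kp_meas[of "Inl m" p] by measurable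
  have gm\<nu>: "?g p w k \<in> borel_measurable \<nu>" for p w k using gm s\<nu> measurable_cong_sets by blast
  have kpm: "(\<lambda>s. kp (Inl m) p (s - k)) \<in> borel_measurable borel" for p k using kp_meas[of "Inl m" p] by measurable
  have ct: "countable (times m' (C m') \<omega> \<inter> {..a})" for m' by (intro countable_Int1 countable_times)
  have ca: "countable (ar_times n \<phi> p \<inter> S)" for p S by (intro countable_Int1 countable_ar_times)
  have 1: "(\<integral>\<^sup>+ s. (\<integral>\<^sup>+ u. ?h m' u s \<partial>count_space (CMt m' \<omega>)) \<partial>\<nu>) < \<infinity>" for m'
  proof -
    have "(\<integral>\<^sup>+ s. (\<integral>\<^sup>+ u. ?h m' u s \<partial>count_space (CMt m' \<omega>)) \<partial>\<nu>) = (\<integral>\<^sup>+ u. (\<integral>\<^sup>+ s. ?h m' u s \<partial>\<nu>) \<partial>count_space (CMt m' \<omega>))"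
      by (rule nn_integral_count_space_nn_integral[OF countable_CMt hm\<nu>])
    also have "\<dots> \<le> (\<integral>\<^sup>+ u. (\<integral>\<^sup>+ s. ?h m' u s \<partial>\<nu>) \<partial>count_space (CM m' \<omega>))"
      by (rule nn_integral_count_space_mono_set[OF CMt_CM])
    also have "\<dots> < \<infinity>" unfolding int_\<nu>[OF hm] using good unfolding ic_good_def by blast
    finally show ?thesis .
  qed
  have 2: "(\<integral>\<^sup>+ s. (\<integral>\<^sup>+ u. ?h m' u s \<partial>count_space (times m' (C m') \<omega> \<inter> {..a})) \<partial>\<nu>) < \<infinity>" for m'
  proof -
    have "(\<integral>\<^sup>+ s. (\<integral>\<^sup>+ u. ?h m' u s \<partial>count_space (times m' (C m') \<omega> \<inter> {..a})) \<partial>\<nu>) =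
       (\<integral>\<^sup>+ u. (\<integral>\<^sup>+ s. ?h m' u s \<partial>\<nu>) \<partial>count_space (times m' (C m') \<omega> \<inter> {..a}))"
      by (rule nn_integral_count_space_nn_integral[OF ct hm\<nu>])
    also have "\<dots> < \<infinity>"
    proof (rule nn_integral_count_space_less_top_finite[OF fin])
      fix u
      have h0: "(\<lambda>s. ennreal \<bar>ext0 (hM \<MM> (Inl m) m') s\<bar>) \<in> borel_measurable borel" using ext_meas(1)[of "Inl m" m'] by measurable
      have "(\<integral>\<^sup>+ s. ?h m' u s \<partial>\<nu>) \<le> (\<integral>\<^sup>+ s. ?h m' u s \<partial>lborel)" by (rule le_\<nu>[OF hm])
      also have "\<dots> < \<infinity>" unfolding nn_integral_shift[OF h0] by (rule in_L1_nn_integral[OF hM_L1])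
      finally show "(\<integral>\<^sup>+ s. ?h m' u s \<partial>\<nu>) < \<infinity>" .
    qed
    finally show ?thesis .
  qed
  have gsplit: "(\<integral>\<^sup>+ s. kp (Inl m) q (s - k) * c \<partial>\<nu>) =
     (\<integral>\<^sup>+ s. kp (Inl m) q (s - k) * indicator {t0..t0 + real j} s \<partial>lborel) * c" for q k and c :: ennreal
  proof -
    have "(\<integral>\<^sup>+ s. kp (Inl m) q (s - k) * c \<partial>\<nu>) = (\<integral>\<^sup>+ s. kp (Inl m) q (s - k) \<partial>\<nu>) * c"
      using kpm s\<nu> measurable_cong_sets by (intro nn_integral_multc) blast
    then show ?thesis by (simp only: int_\<nu>[OF kpm])
  qed
  have 3: "(\<integral>\<^sup>+ s. (\<integral>\<^sup>+ k. ?g p (\<lambda>p k. CP p k \<omega>) k s \<partial>count_space (ar_times n \<phi> p \<inter> {..<t0})) \<partial>\<nu>) < \<infinity>" for p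
  proof -
    have "(\<integral>\<^sup>+ s. (\<integral>\<^sup>+ k. ?g p (\<lambda>p k. CP p k \<omega>) k s \<partial>count_space (ar_times n \<phi> p \<inter> {..<t0})) \<partial>\<nu>) =
       (\<integral>\<^sup>+ k. (\<integral>\<^sup>+ s. ?g p (\<lambda>p k. CP p k \<omega>) k s \<partial>\<nu>) \<partial>count_space (ar_times n \<phi> p \<inter> {..<t0}))"
      by (rule nn_integral_count_space_nn_integral[OF ca gm\<nu>])
    also have "\<dots> < \<infinity>" unfolding gsplit using good unfolding ic_good_def by blast
    finally show ?thesis .
  qed
  have 4: "(\<integral>\<^sup>+ s. (\<integral>\<^sup>+ k. ?g p (\<lambda>p k. W p k \<omega>) k s \<partial>count_space (ar_times n \<phi> p \<inter> {t0..a})) \<partial>\<nu>) < \<infinity>" for p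
  proof -
    have "(\<integral>\<^sup>+ s. (\<integral>\<^sup>+ k. ?g p (\<lambda>p k. W p k \<omega>) k s \<partial>count_space (ar_times n \<phi> p \<inter> {t0..a})) \<partial>\<nu>) =
       (\<integral>\<^sup>+ k. (\<integral>\<^sup>+ s. ?g p (\<lambda>p k. W p k \<omega>) k s \<partial>\<nu>) \<partial>count_space (ar_times n \<phi> p \<inter> {t0..a}))"
      by (rule nn_integral_count_space_nn_integral[OF ca gm\<nu>])
    also have "\<dots> < \<infinity>"
    proof (rule nn_integral_count_space_less_top_finite[OF finite_ar])
      fix k
      have "(\<integral>\<^sup>+ s. kp (Inl m) p (s - k) * indicator {t0..t0 + real j} s \<partial>lborel) \<le> (\<integral>\<^sup>+ s. kp (Inl m) p (s - k) \<partial>lborel)"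
        by (intro nn_integral_mono) (auto simp: indicator_def)
      also have "\<dots> < \<infinity>" unfolding nn_integral_shift[OF kp_meas] by (rule kp_L1)
      finally show "(\<integral>\<^sup>+ s. ?g p (\<lambda>p k. W p k \<omega>) k s \<partial>\<nu>) < \<infinity>"
        unfolding gsplit by (simp add: ennreal_mult_less_top)
    qed
    finally show ?thesis .
  qed
  note m1 = borel_measurable_count_space_sum[OF countable_CMt hm\<nu>]
  note m2 = borel_measurable_count_space_sum[OF ct hm\<nu>]
  note m3 = borel_measurable_count_space_sum[OF ca gm\<nu>]
  have "(\<integral>\<^sup>+ s. adr (Inl m) (trunc a (NN C, W)) s \<omega> * indicator {c<..b} s \<partial>lborel) \<le>
    (\<integral>\<^sup>+ s. drive_bound (Inl m) C W a \<omega> s * indicator {t0..t0 + real j} s \<partial>lborel)"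
    using c j by (intro nn_integral_mono mult_mono adr_le_bound[where W = W and \<omega> = \<omega>, OF W]) (auto simp: indicator_def)
  also have "\<dots> = (\<integral>\<^sup>+ s. drive_bound (Inl m) C W a \<omega> s \<partial>\<nu>)"
  proof (rule int_\<nu>[symmetric])
    have "drive_bound (Inl m) C W a \<omega> \<in> borel_measurable \<nu>"
      unfolding drive_bound_def[abs_def] by (intro borel_measurable_add borel_measurable_sum m1 m2 m3)
    then show "drive_bound (Inl m) C W a \<omega> \<in> borel_measurable borel" using s\<nu> measurable_cong_sets by blast
  qed
  also have "\<dots> = (\<Sum>m'\<in>UNIV. (\<integral>\<^sup>+ s. (\<integral>\<^sup>+ u. ?h m' u s \<partial>count_space (CMt m' \<omega>)) \<partial>\<nu>) +
       (\<integral>\<^sup>+ s. (\<integral>\<^sup>+ u. ?h m' u s \<partial>count_space (times m' (C m') \<omega> \<inter> {..a})) \<partial>\<nu>)) +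
    (\<Sum>p\<in>UNIV. (\<integral>\<^sup>+ s. (\<integral>\<^sup>+ k. ?g p (\<lambda>p k. CP p k \<omega>) k s \<partial>count_space (ar_times n \<phi> p \<inter> {..<t0})) \<partial>\<nu>) +
       (\<integral>\<^sup>+ s. (\<integral>\<^sup>+ k. ?g p (\<lambda>p k. W p k \<omega>) k s \<partial>count_space (ar_times n \<phi> p \<inter> {t0..a})) \<partial>\<nu>))"
    unfolding drive_bound_def
    by (subst nn_integral_add, intro borel_measurable_sum borel_measurable_add m1 m2, intro borel_measurable_sum borel_measurable_add m3)
       (intro arg_cong2[where f = "(+)"] trans[OF nn_integral_sum] sum.cong refl nn_integral_add borel_measurable_add m1 m2 m3)
  also have "\<dots> < \<infinity>"
    using 1 2 3 4 by (simp add: less_top[symmetric])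
  finally show ?thesis .
qed

end

section \<open>Picard iteration between autoregressive times\<close>

lemma lipschitz_fun_measurable: "lipschitz_fun f \<Longrightarrow> f \<in> borel_measurable borel"
  unfolding lipschitz_fun_def by (auto dest!: lipschitz_on_continuous_on intro!: borel_measurable_continuous_onI)

lemma lipschitz_fun_bound: "lipschitz_fun f \<Longrightarrow> \<exists>L\<ge>0. \<forall>x. f x \<le> \<bar>f 0\<bar> + L * \<bar>x\<bar>"
proof -
  assume "lipschitz_fun f"
  then obtain L where L: "L-lipschitz_on UNIV f" by (auto simp: lipschitz_fun_def)
  have "f x \<le> \<bar>f 0\<bar> + L * \<bar>x\<bar>" for x
    using lipschitz_onD[OF L, of x 0] by (simp add: dist_real_def)
  then show ?thesis using lipschitz_on_nonneg[OF L] by blast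
qed

text \<open>The section at each time lies between 0 and the rate; an infinite rate is the trivial
  case.\<close>

lemma emeasure_hypograph_le:
  fixes rate :: "real \<Rightarrow> ennreal"
  assumes S: "S \<in> sets borel" and sub: "\<And>s x. (s, x) \<in> S \<Longrightarrow> s \<in> T \<and> 0 \<le> x \<and> ennreal x \<le> rate s"
  shows "emeasure lborel S \<le> (\<integral>\<^sup>+ s. rate s * indicator T s \<partial>lborel)"
proof -
  have "S \<in> sets (lborel \<Otimes>\<^sub>M lborel)" using S by (subst lborel_prod) simp
  then have "emeasure lborel S = (\<integral>\<^sup>+ s. emeasure lborel (Pair s -` S) \<partial>lborel)"
    unfolding lborel_prod[symmetric] by (rule lborel.emeasure_pair_measure_alt)
  also have "\<dots> \<le> (\<integral>\<^sup>+ s. rate s * indicator T s \<partial>lborel)"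
  proof (rule nn_integral_mono)
    fix s :: real
    show "emeasure lborel (Pair s -` S) \<le> rate s * indicator T s"
    proof (cases "s \<in> T")
      case True
      show ?thesis
      proof (cases "rate s = \<infinity>")
        case False
        then obtain r where r: "rate s = ennreal r" "0 \<le> r" by (cases "rate s") auto
        have "Pair s -` S \<subseteq> {0..r}"
        proof
          fix x assume "x \<in> Pair s -` S"
          then have "0 \<le> x" "ennreal x \<le> ennreal r" using sub[of s x] r by auto
          then show "x \<in> {0..r}" using r(2) by (simp add: ennreal_le_iff)
        qed
        then have "emeasure lborel (Pair s -` S) \<le> emeasure lborel {0..r}" by (intro emeasure_mono) auto
        then show ?thesis using r True by simp
      qed (use True in simp)
    next
      case False
      then have "Pair s -` S = {}" using sub by auto
      then show ?thesis by simp
    qed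
  qed
  finally show ?thesis .
qed

section \<open>The equation up to a given time\<close>

context har_full begin

abbreviation prc :: "('m \<Rightarrow> ('w \<times> real \<times> real) set) \<Rightarrow> ('p \<Rightarrow> real \<Rightarrow> 'w \<Rightarrow> real option) \<Rightarrow> ('m, 'p, 'w) proc" where
  "prc C W \<equiv> (NN C, W)"

definition nice_W :: "('p \<Rightarrow> real \<Rightarrow> 'w \<Rightarrow> real option) \<Rightarrow> bool" where
  "nice_W W \<longleftrightarrow> (\<forall>(p, k)\<in>ar_index n \<phi>. W p k \<in> measurable (Fa (max t0 k)) opt_borel \<and> (k < t0 \<longrightarrow> W p k = CP p k))"

lemma nice_WD:
  assumes "nice_W W" "(p, k) \<in> ar_index n \<phi>"
  shows "W p k \<in> measurable (Fa (max t0 k)) opt_borel" "k < t0 \<Longrightarrow> W p k = CP p k"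
  using assms by (auto simp: nice_W_def)

lemma nice_prc:
  assumes C: "\<And>m. C m \<in> sets (mpred t0 Fa)" and W: "nice_W W"
  shows "nice (prc C W)"
  unfolding nice_def prod.case
proof (intro conjI allI impI ballI)
  fix m q assume "t0 \<le> q"
  then show "sfin_rset (Fa q) (\<lambda>\<omega>. NN C m \<omega> \<inter> {..q})" by (rule NN_rset[OF C])
next
  fix z assume "z \<in> ar_index n \<phi>"
  then show "case z of (p, k) \<Rightarrow> W p k \<in> measurable (Fa (max t0 k)) opt_borel"
    using nice_WD(1)[OF W] by (cases z) simp
next
  fix m \<omega>
  show "countable (NN C m \<omega>)" unfolding NN_def by (intro countable_Un countable_CMt countable_times)
qed

lemma nice_trunc:
  assumes X: "nice X"
  shows "nice (trunc a X)"
proof -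
  obtain N W where XNW: "X = (N, W)" by (cases X)
  note nd = niceD[OF X[unfolded XNW]]
  show ?thesis
    unfolding nice_def XNW trunc_def prod.case
  proof (intro conjI allI impI ballI)
    fix m q assume q: "t0 \<le> q"
    have "sfin_rset (Fa q) (\<lambda>\<omega>. N m \<omega> \<inter> {..q} \<inter> {..a})"
      by (intro sfin_rset_Int nd(1)[OF q]) simp
    then show "sfin_rset (Fa q) (\<lambda>\<omega>. N m \<omega> \<inter> {..a} \<inter> {..q})" by (simp only: Int_ac)
  next
    fix z assume z: "z \<in> ar_index n \<phi>"
    obtain p k where pk: "z = (p, k)" by (cases z)
    show "case z of (p, k) \<Rightarrow> (\<lambda>\<omega>. if k \<le> a then W p k \<omega> else None) \<in> measurable (Fa (max t0 k)) opt_borel"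
      using nd(2)[OF z[unfolded pk]] by (cases "k \<le> a") (simp_all add: pk)
  next
    fix m \<omega> show "countable (N m \<omega> \<inter> {..a})" by (intro countable_Int1 nd(3))
  qed
qed

text \<open>Only the trace of \<open>C m\<close> on the atoms matters, so the equation is stated
  atom by atom. The finiteness up to \<open>a\<close> is what the next piece needs to know of its
  past.\<close>

definition eqn_upto :: "real \<Rightarrow> ('m \<Rightarrow> ('w \<times> real \<times> real) set) \<Rightarrow> ('p \<Rightarrow> real \<Rightarrow> 'w \<Rightarrow> real option) \<Rightarrow> 'w \<Rightarrow> bool" where
  "eqn_upto a C W \<omega> \<longleftrightarrow>
     (\<forall>m. finite (times m (C m) \<omega> \<inter> {..a})) \<and>
     (\<forall>m s x. (s, x) \<in> pt m \<omega> \<longrightarrow> s \<le> a \<longrightarrow> ((\<omega>, s, x) \<in> C m \<longleftrightarrow> x \<le> PhiM \<MM> m (dr (Inl m) (prc C W) s \<omega>))) \<and>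
     (\<forall>p k. (p, k) \<in> ar_index n \<phi> \<longrightarrow> t0 \<le> k \<longrightarrow> k \<le> a \<longrightarrow>
        W p k \<omega> = Some (\<xi> p k \<omega> + PhiP \<MM> p (dr (Inr p) (prc C W) k \<omega>)))"

definition agree_upto :: "real \<Rightarrow> 'w \<Rightarrow> ('m \<Rightarrow> ('w \<times> real \<times> real) set) \<Rightarrow> ('m \<Rightarrow> ('w \<times> real \<times> real) set) \<Rightarrow> bool" where
  "agree_upto a \<omega> C C' \<longleftrightarrow> (\<forall>m s x. (s, x) \<in> pt m \<omega> \<longrightarrow> s \<le> a \<longrightarrow> ((\<omega>, s, x) \<in> C m \<longleftrightarrow> (\<omega>, s, x) \<in> C' m))"

lemma agree_times:
  assumes "agree_upto a \<omega> C C'"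
  shows "times m (C m) \<omega> \<inter> {..a} = times m (C' m) \<omega> \<inter> {..a}"
  using assms unfolding agree_upto_def set_eq_iff Int_iff times_iff atMost_iff by blast

lemma agree_drive:
  assumes C: "agree_upto a \<omega> C C'" and s: "s \<le> a"
    and W: "\<And>p k. (p, k) \<in> ar_index n \<phi> \<Longrightarrow> k < s \<Longrightarrow> W p k \<omega> = W' p k \<omega>"
  shows "dr \<alpha> (prc C W) s \<omega> = dr \<alpha> (prc C' W') s \<omega>"
proof (rule drive_cong_gen(1))
  fix m
  have "times m (C m) \<omega> \<inter> {..<s} = times m (C m) \<omega> \<inter> {..a} \<inter> {..<s}" using s by auto
  also have "\<dots> = times m (C' m) \<omega> \<inter> {..a} \<inter> {..<s}" by (simp only: agree_times[OF C])
  also have "\<dots> = times m (C' m) \<omega> \<inter> {..<s}" using s by auto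
  finally show "NN C m \<omega> \<inter> {..<s} = NN C' m \<omega> \<inter> {..<s}" by (auto simp: NN_def)
qed (rule W)

lemma eqn_upto_cong:
  assumes C: "agree_upto a \<omega> C C'"
    and W: "\<And>p k. (p, k) \<in> ar_index n \<phi> \<Longrightarrow> k \<le> a \<Longrightarrow> W p k \<omega> = W' p k \<omega>"
    and E: "eqn_upto a C W \<omega>"
  shows "eqn_upto a C' W' \<omega>"
proof -
  have d: "dr \<alpha> (prc C W) s \<omega> = dr \<alpha> (prc C' W') s \<omega>" if "s \<le> a" for \<alpha> s
    using that by (intro agree_drive[OF C]) (auto intro: W)
  show ?thesis
    unfolding eqn_upto_def
  proof (intro conjI allI impI)
    show "finite (times m (C' m) \<omega> \<inter> {..a})" for m
      using E by (simp add: eqn_upto_def agree_times[OF C, symmetric])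
    show "(\<omega>, s, x) \<in> C' m \<longleftrightarrow> x \<le> PhiM \<MM> m (dr (Inl m) (prc C' W') s \<omega>)" if "(s, x) \<in> pt m \<omega>" "s \<le> a" for m s x
      using E that C unfolding eqn_upto_def agree_upto_def d[OF that(2), symmetric] by blast
    show "W' p k \<omega> = Some (\<xi> p k \<omega> + PhiP \<MM> p (dr (Inr p) (prc C' W') k \<omega>))"
      if "(p, k) \<in> ar_index n \<phi>" "t0 \<le> k" "k \<le> a" for p k
      using E that unfolding eqn_upto_def d[OF that(3), symmetric] W[OF that(1,3), symmetric] by blast
  qed
qed

definition stage :: "real \<Rightarrow> ('m \<Rightarrow> ('w \<times> real \<times> real) set) \<Rightarrow> ('p \<Rightarrow> real \<Rightarrow> 'w \<Rightarrow> real option) \<Rightarrow> bool" where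
  "stage a C W \<longleftrightarrow> (\<forall>m. C m \<in> sets (mpred t0 Fa)) \<and> nice_W W \<and> (AE \<omega> in M. eqn_upto a C W \<omega>)"

text \<open>The drive at \<open>b\<close> reads the strict past only, so the terms at
  \<open>b\<close> can be computed from the old \<open>W\<close> and then written into it.\<close>

definition next_W :: "real \<Rightarrow> ('m \<Rightarrow> ('w \<times> real \<times> real) set) \<Rightarrow> ('p \<Rightarrow> real \<Rightarrow> 'w \<Rightarrow> real option) \<Rightarrow> 'p \<Rightarrow> real \<Rightarrow> 'w \<Rightarrow> real option" where
  "next_W b C W p k = (if k = b then (\<lambda>\<omega>. Some (\<xi> p b \<omega> + PhiP \<MM> p (dr (Inr p) (prc C W) b \<omega>))) else W p k)"

lemma PhiM_meas: "PhiM \<MM> m \<in> borel_measurable borel"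
  using par by (intro lipschitz_fun_measurable) (auto simp: parameters_def)

lemma PhiP_meas: "PhiP \<MM> p \<in> borel_measurable borel"
  using par by (intro lipschitz_fun_measurable) (auto simp: parameters_def)

lemma nice_next_W:
  assumes C: "\<And>m. C m \<in> sets (mpred t0 Fa)" and W: "nice_W W" and b: "t0 \<le> b"
  shows "nice_W (next_W b C W)"
  unfolding nice_W_def
proof (intro ballI, clarify)
  fix p k assume pk: "(p, k) \<in> ar_index n \<phi>"
  show "next_W b C W p k \<in> measurable (Fa (max t0 k)) opt_borel \<and> (k < t0 \<longrightarrow> next_W b C W p k = CP p k)"
  proof (cases "k = b")
    case True
    have "\<xi> p k \<in> borel_measurable (Fa k)" by (rule Fr_Fa[OF xi_filt[OF pk order_refl]])
    moreover have "(\<lambda>\<omega>. PhiP \<MM> p (dr (Inr p) (prc C W) b \<omega>)) \<in> borel_measurable (Fa b)"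
      by (rule measurable_compose[OF drive_at_measurable[OF nice_prc[OF C W] b] PhiP_meas])
    ultimately have "(\<lambda>\<omega>. Some (\<xi> p b \<omega> + PhiP \<MM> p (dr (Inr p) (prc C W) b \<omega>))) \<in> measurable (Fa b) opt_borel"
      using True by (intro measurable_Some borel_measurable_add) auto
    then show ?thesis using True b by (simp add: next_W_def max_absorb2)
  next
    case False
    then show ?thesis using nice_WD[OF W pk] by (simp add: next_W_def)
  qed
qed

text \<open>\<open>t0\<close> may itself be an autoregressive time, so its terms have to be set
  before the first piece. There are no new points yet, since \<open>pt\<close> begins after
  \<open>t0\<close>.\<close>

lemma stage_base: "\<exists>W. stage t0 (\<lambda>_. {}) W"
proof -
  define W0 where "W0 p k = (if k < t0 then CP p k else (\<lambda>_. None))" for p k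
  have W0: "nice_W W0"
    unfolding nice_W_def
  proof (intro ballI, clarify)
    fix p k assume "(p, k) \<in> ar_index n \<phi>"
    then show "W0 p k \<in> measurable (Fa (max t0 k)) opt_borel \<and> (k < t0 \<longrightarrow> W0 p k = CP p k)"
      using Fr_Fa[OF CP_Fr, of p k] by (auto simp: W0_def max_def)
  qed
  have "stage t0 (\<lambda>_. {}) (next_W t0 (\<lambda>_. {}) W0)"
    unfolding stage_def
  proof (intro conjI allI AE_I2)
    show "nice_W (next_W t0 (\<lambda>_. {}) W0)" by (intro nice_next_W W0) auto
    fix \<omega>
    have t: "times m {} \<omega> = {}" for m by (auto simp: times_iff)
    have "dr (Inr p) (prc (\<lambda>_. {}) W0) t0 \<omega> = dr (Inr p) (prc (\<lambda>_. {}) (next_W t0 (\<lambda>_. {}) W0)) t0 \<omega>" for p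
      by (rule drive_cong_gen(1)) (auto simp: next_W_def)
    then show "eqn_upto t0 (\<lambda>_. {}) (next_W t0 (\<lambda>_. {}) W0) \<omega>"
      using pt_sub[of _ \<omega>] unfolding eqn_upto_def by (fastforce simp: t next_W_def)
  qed simp
  then show ?thesis by blast
qed

end

text \<open>\<open>small\<close> says that in the dominating linear system a point of type
  \<open>m'\<close> has in the mean at most 1/2 children within the piece, which is a subcritical
  branching. The end \<open>b\<close> may be an autoregressive time: \<open>gap\<close> concerns the
  open interval.\<close>

locale har_step = har_full M n \<phi> \<pi> \<xi> t0 CM CP Om0 \<MM>
  for M :: "'w measure" and n :: "'p::finite \<Rightarrow> nat" and \<phi> :: "'p \<Rightarrow> real"
    and \<pi> :: "'m::finite \<Rightarrow> 'w \<Rightarrow> (real \<times> real) set" and \<xi> :: "'p \<Rightarrow> real \<Rightarrow> 'w \<Rightarrow> real" and t0 :: real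
    and CM :: "'m \<Rightarrow> 'w \<Rightarrow> real set" and CP :: "'p \<Rightarrow> real \<Rightarrow> 'w \<Rightarrow> real option" and Om0 :: "'w set"
    and \<MM> :: "('m, 'p) har_params" +
  fixes a b c0 L :: real and C :: "'m \<Rightarrow> ('w \<times> real \<times> real) set" and W :: "'p \<Rightarrow> real \<Rightarrow> 'w \<Rightarrow> real option"
  assumes ab: "t0 \<le> a" "a < b" and gap: "\<And>p. ar_times n \<phi> p \<inter> {a<..<b} = {}"
    and c0: "0 \<le> c0" and L0: "0 \<le> L" and Phi_le: "\<And>m x. PhiM \<MM> m x \<le> c0 + L * \<bar>x\<bar>"
    and small: "\<And>m'. (\<Sum>m\<in>UNIV. ennreal L * (\<integral>\<^sup>+ v. ennreal \<bar>ext0 (hM \<MM> (Inl m) m') v\<bar> * indicator {0<..b - a} v \<partial>lborel)) \<le> 1 / 2"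
    and C: "\<And>m. C m \<in> sets (mpred t0 Fa)" and W: "nice_W W"
begin

definition base :: "('m, 'p, 'w) proc" where "base = trunc a (prc C W)"

definition A :: "'m \<Rightarrow> 'w \<Rightarrow> real \<Rightarrow> ennreal" where "A m \<omega> s = adr (Inl m) base s \<omega>"

definition Gc :: "nat \<Rightarrow> 'w set" where
  "Gc c = {\<omega> \<in> space M. \<forall>m. (\<integral>\<^sup>+ s. A m \<omega> s * indicator {a<..b} s \<partial>lborel) \<le> of_nat c}"

text \<open>
  \<open>D\<close> is the sequence of Picard iterates on the interval from \<open>a\<close> to \<open>b\<close>, and \<open>Dbar\<close> that of a
  monotone linear system which dominates it.  The past enters the latter through \<open>A\<close>, which is
  integrable in time on almost every path but need not have a finite mean; on \<open>Gc c\<close> its integral is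
  at most \<open>c\<close>, and there the means of \<open>Dbar c\<close> are bounded by the smallness of the kernels.
\<close>

primrec Dbar :: "nat \<Rightarrow> nat \<Rightarrow> 'm \<Rightarrow> ('w \<times> real \<times> real) set" where
  "Dbar c 0 = (\<lambda>m. {})"
| "Dbar c (Suc j) = (\<lambda>m. {(\<omega>, s, x) \<in> space (mpred t0 Fa). \<omega> \<in> Gc c \<and> a < s \<and> s \<le> b \<and>
     ennreal x \<le> ennreal c0 + ennreal L * (A m \<omega> s +
       (\<Sum>m'\<in>UNIV. \<integral>\<^sup>+ u. ennreal \<bar>ext0 (hM \<MM> (Inl m) m') (s - u)\<bar> \<partial>count_space (times m' (Dbar c j m') \<omega> \<inter> {..<s})))})"

primrec D :: "nat \<Rightarrow> 'm \<Rightarrow> ('w \<times> real \<times> real) set" where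
  "D 0 = (\<lambda>m. {z \<in> C m. fst (snd z) \<le> a})"
| "D (Suc j) = (\<lambda>m. {z \<in> C m. fst (snd z) \<le> a} \<union> {(\<omega>, s, x) \<in> space (mpred t0 Fa). a < s \<and> s \<le> b \<and>
     x \<le> PhiM \<MM> m (dr (Inl m) (prc (D j) W) s \<omega>)})"

lemma A_section_meas: "A m \<omega> \<in> borel_measurable borel" if "\<omega> \<in> space M"
proof -
  have "(\<lambda>s. (\<omega>, s)) \<in> measurable borel (Fa a \<Otimes>\<^sub>M borel)" using that by (intro measurable_Pair1') simp
  from measurable_compose[OF this drive_trunc_measurable(2)[OF nice_prc[OF C W] ab(1), of "Inl m"]]
  show ?thesis by (simp add: A_def[abs_def] base_def)
qed

lemma Gc_sets: "Gc c \<in> sets (Fa a)"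
proof -
  have "(\<lambda>(\<omega>, s). A m \<omega> s * indicator {a<..b} s) \<in> borel_measurable (Fa a \<Otimes>\<^sub>M borel)" for m
    using drive_trunc_measurable(2)[OF nice_prc[OF C W] ab(1), of "Inl m"]
    unfolding A_def base_def split_beta' by (intro borel_measurable_times_ennreal) auto
  then have "(\<lambda>(\<omega>, s). A m \<omega> s * indicator {a<..b} s) \<in> borel_measurable (Fa a \<Otimes>\<^sub>M lborel)" for m
    by (subst measurable_cong_sets[OF sets_pair_measure_cong[OF refl sets_lborel] refl])
  from lborel.borel_measurable_nn_integral[OF this]
  have [measurable]: "(\<lambda>\<omega>. \<integral>\<^sup>+ s. A m \<omega> s * indicator {a<..b} s \<partial>lborel) \<in> borel_measurable (Fa a)" for m by simp
  have "{\<omega> \<in> space (Fa a). \<forall>m\<in>UNIV. (\<integral>\<^sup>+ s. A m \<omega> s * indicator {a<..b} s \<partial>lborel) \<le> of_nat c} \<in> sets (Fa a)"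
    by measurable
  then show ?thesis by (simp add: Gc_def)
qed

lemma mpred_Gc: "(\<lambda>z. fst z \<in> Gc c \<and> a < fst (snd z)) \<in> measurable (mpred t0 Fa) (count_space UNIV)"
proof -
  have "{z \<in> space (mpred t0 Fa). fst z \<in> Gc c \<and> a < fst (snd z)} = Gc c \<times> ({a<..} \<times> UNIV)"
    using ab by (auto simp: Gc_def)
  then show ?thesis
    using au.mpred_rect_inf[OF ab(1) Gc_sets, of UNIV c] by (simp add: pred_def)
qed

lemma mpred_time': "(\<lambda>z. fst (snd z)) \<in> borel_measurable (mpred t0 Fa)"
  and mpred_mark': "(\<lambda>z. snd (snd z)) \<in> borel_measurable (mpred t0 Fa)"
  using mpred_time au.mpred_to_mark by (simp_all add: split_beta')

lemma A_pred: "(\<lambda>z. A m (fst z) (fst (snd z))) \<in> borel_measurable (mpred t0 Fa)"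
  using drive_predictable(2)[OF nice_trunc[OF nice_prc[OF C W]], of "Inl m" a]
  by (simp add: A_def base_def split_beta')

lemma times_sum_pred:
  assumes E: "E \<in> sets (mpred t0 Fa)"
  shows "(\<lambda>z. \<integral>\<^sup>+ u. ennreal \<bar>ext0 (hM \<MM> \<alpha> m) (fst (snd z) - u)\<bar> \<partial>count_space (times m' E (fst z) \<inter> {..<fst (snd z)})) \<in> borel_measurable (mpred t0 Fa)"
proof -
  have g: "(\<lambda>x. ennreal \<bar>ext0 (hM \<MM> \<alpha> m) x\<bar>) \<in> borel_measurable borel" using hM_meas[of \<alpha> m] by measurable
  show ?thesis
    using predictable_sum[OF times_rset[OF E] countable_times g, of m'] by (simp add: split_beta')
qed

lemma Dbar_sets: "Dbar c j m \<in> sets (mpred t0 Fa)"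
proof (induct j arbitrary: m)
  case (Suc j)
  let ?r = "\<lambda>z. ennreal c0 + ennreal L * (A m (fst z) (fst (snd z)) + (\<Sum>m'\<in>UNIV. \<integral>\<^sup>+ u. ennreal \<bar>ext0 (hM \<MM> (Inl m) m') (fst (snd z) - u)\<bar>
       \<partial>count_space (times m' (Dbar c j m') (fst z) \<inter> {..<fst (snd z)})))"
  have r: "?r \<in> borel_measurable (mpred t0 Fa)"
    by (intro borel_measurable_add borel_measurable_times_ennreal borel_measurable_const A_pred borel_measurable_sum times_sum_pred Suc)
  note [measurable] = r mpred_time' mpred_mark' mpred_Gc
  have "{z \<in> space (mpred t0 Fa). (fst z \<in> Gc c \<and> a < fst (snd z)) \<and> fst (snd z) \<le> b \<and> ennreal (snd (snd z)) \<le> ?r z} \<in> sets (mpred t0 Fa)"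
    by measurable
  also have "{z \<in> space (mpred t0 Fa). (fst z \<in> Gc c \<and> a < fst (snd z)) \<and> fst (snd z) \<le> b \<and> ennreal (snd (snd z)) \<le> ?r z} = Dbar c (Suc j) m"
    by auto
  finally show ?case .
qed simp

lemma D0_sets: "{z \<in> C m. fst (snd z) \<le> a} \<in> sets (mpred t0 Fa)"
proof -
  note [measurable] = mpred_time'
  have "{z \<in> space (mpred t0 Fa). fst (snd z) \<le> a} \<in> sets (mpred t0 Fa)" by measurable
  then have "C m \<inter> {z \<in> space (mpred t0 Fa). fst (snd z) \<le> a} \<in> sets (mpred t0 Fa)" using C by (intro sets.Int)
  also have "C m \<inter> {z \<in> space (mpred t0 Fa). fst (snd z) \<le> a} = {z \<in> C m. fst (snd z) \<le> a}"
    using sets.sets_into_space[OF C[of m]] by blast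
  finally show ?thesis .
qed

lemma D_sets: "D j m \<in> sets (mpred t0 Fa)"
proof (induct j arbitrary: m)
  case 0 show ?case using D0_sets by simp
next
  case (Suc j)
  have "(\<lambda>z. dr (Inl m) (prc (D j) W) (fst (snd z)) (fst z)) \<in> borel_measurable (mpred t0 Fa)"
    using drive_predictable(1)[OF nice_prc[OF Suc W], of "Inl m"] by (simp add: split_beta')
  from measurable_compose[OF this PhiM_meas]
  have r: "(\<lambda>z. PhiM \<MM> m (dr (Inl m) (prc (D j) W) (fst (snd z)) (fst z))) \<in> borel_measurable (mpred t0 Fa)" .
  note [measurable] = r mpred_time' mpred_mark'
  have "{z \<in> space (mpred t0 Fa). a < fst (snd z) \<and> fst (snd z) \<le> b \<and> snd (snd z) \<le> PhiM \<MM> m (dr (Inl m) (prc (D j) W) (fst (snd z)) (fst z))} \<in> sets (mpred t0 Fa)"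
    by measurable
  then have "{z \<in> C m. fst (snd z) \<le> a} \<union> {z \<in> space (mpred t0 Fa). a < fst (snd z) \<and> fst (snd z) \<le> b \<and> snd (snd z) \<le> PhiM \<MM> m (dr (Inl m) (prc (D j) W) (fst (snd z)) (fst z))} \<in> sets (mpred t0 Fa)"
    using D0_sets by (intro sets.Un)
  moreover have "{z \<in> space (mpred t0 Fa). a < fst (snd z) \<and> fst (snd z) \<le> b \<and> snd (snd z) \<le> PhiM \<MM> m (dr (Inl m) (prc (D j) W) (fst (snd z)) (fst z))} =
     {(\<omega>, s, x) \<in> space (mpred t0 Fa). a < s \<and> s \<le> b \<and> x \<le> PhiM \<MM> m (dr (Inl m) (prc (D j) W) s \<omega>)}" by auto
  ultimately show ?case by simp
qed

lemma Dbar_mono: "Dbar c j m \<subseteq> Dbar c (Suc j) m"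
proof (induct j arbitrary: m)
  case (Suc j)
  have t: "times m' (Dbar c j m') \<omega> \<inter> {..<s} \<subseteq> times m' (Dbar c (Suc j) m') \<omega> \<inter> {..<s}" for m' \<omega> s
    using Suc[of m'] unfolding subset_iff times_iff Int_iff by blast
  have "(\<Sum>m'\<in>UNIV. \<integral>\<^sup>+ u. ennreal \<bar>ext0 (hM \<MM> (Inl m) m') (s - u)\<bar> \<partial>count_space (times m' (Dbar c j m') \<omega> \<inter> {..<s})) \<le>
     (\<Sum>m'\<in>UNIV. \<integral>\<^sup>+ u. ennreal \<bar>ext0 (hM \<MM> (Inl m) m') (s - u)\<bar> \<partial>count_space (times m' (Dbar c (Suc j) m') \<omega> \<inter> {..<s}))" for s \<omega>
    by (intro sum_mono nn_integral_count_space_mono_set t)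
  then have "ennreal c0 + ennreal L * (A m \<omega> s + (\<Sum>m'\<in>UNIV. \<integral>\<^sup>+ u. ennreal \<bar>ext0 (hM \<MM> (Inl m) m') (s - u)\<bar> \<partial>count_space (times m' (Dbar c j m') \<omega> \<inter> {..<s}))) \<le>
     ennreal c0 + ennreal L * (A m \<omega> s + (\<Sum>m'\<in>UNIV. \<integral>\<^sup>+ u. ennreal \<bar>ext0 (hM \<MM> (Inl m) m') (s - u)\<bar> \<partial>count_space (times m' (Dbar c (Suc j) m') \<omega> \<inter> {..<s})))" for s \<omega>
    by (intro add_mono mult_left_mono) auto
  then show ?case
    unfolding Dbar.simps(2)[of c j] Dbar.simps(2)[of c "Suc j"] by (auto intro: order_trans)
qed simp

lemma atoms_mono: "E \<subseteq> E' \<Longrightarrow> atoms m E \<omega> \<subseteq> atoms m E' \<omega>"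
  by (auto simp: atoms_def)

lemma Dbar_after: "(\<omega>, s, x) \<in> Dbar c j m \<Longrightarrow> a < s \<and> s \<le> b \<and> \<omega> \<in> Gc c"
  by (cases j) auto

lemma npoints_times: "npoints (times m E \<omega>) = npoints (atoms m E \<omega>)"
  unfolding times_def by (rule npoints_image, rule inj_on_subset[OF inj_fst_pt]) (auto simp: atoms_def)

definition Hs :: "'m \<Rightarrow> 'm \<Rightarrow> ennreal" where
  "Hs m m' = (\<integral>\<^sup>+ v. ennreal \<bar>ext0 (hM \<MM> (Inl m) m') v\<bar> * indicator {0<..b - a} v \<partial>lborel)"

text \<open>The points of \<open>Dbar\<close> lie after \<open>a\<close>, so up to time
  \<open>b\<close> a point acts over a lag of at most \<open>b - a\<close> and contributes at most
  \<open>Hs m m'\<close>.\<close>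

lemma times_int_le:
  "(\<integral>\<^sup>+ s. (\<integral>\<^sup>+ u. ennreal \<bar>ext0 (hM \<MM> (Inl m) m') (s - u)\<bar> \<partial>count_space (times m' (Dbar c j m') \<omega>)) * indicator {a<..b} s \<partial>lborel)
   \<le> npoints (atoms m' (Dbar c j m') \<omega>) * Hs m m'"
proof -
  let ?T = "times m' (Dbar c j m') \<omega>" and ?h = "\<lambda>x. ennreal \<bar>ext0 (hM \<MM> (Inl m) m') x\<bar>"
  note [measurable] = hM_meas[of "Inl m" m']
  have "(\<integral>\<^sup>+ s. (\<integral>\<^sup>+ u. ?h (s - u) \<partial>count_space ?T) * indicator {a<..b} s \<partial>lborel) =
     (\<integral>\<^sup>+ s. (\<integral>\<^sup>+ u. ?h (s - u) * indicator {a<..b} s \<partial>count_space ?T) \<partial>lborel)"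
    by (intro nn_integral_cong nn_integral_multc[symmetric]) auto
  also have "\<dots> = (\<integral>\<^sup>+ u. (\<integral>\<^sup>+ s. ?h (s - u) * indicator {a<..b} s \<partial>lborel) \<partial>count_space ?T)"
    by (rule nn_integral_count_space_nn_integral[OF countable_times]) measurable
  also have "\<dots> \<le> (\<integral>\<^sup>+ u. Hs m m' \<partial>count_space ?T)"
  proof (rule nn_integral_mono)
    fix u assume "u \<in> space (count_space ?T)"
    then have u: "a < u" using Dbar_after by (auto simp: times_iff)
    have m: "(\<lambda>v. ?h v * indicator {0<..b - a} v) \<in> borel_measurable borel" by measurable
    have "(\<integral>\<^sup>+ s. ?h (s - u) * indicator {a<..b} s \<partial>lborel) \<le> (\<integral>\<^sup>+ s. ?h (s - u) * indicator {0<..b - a} (s - u) \<partial>lborel)"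
      using u by (intro nn_integral_mono) (auto simp: indicator_def ext0_def)
    also have "\<dots> = Hs m m'" unfolding Hs_def by (rule nn_integral_shift[OF m])
    finally show "(\<integral>\<^sup>+ s. ?h (s - u) * indicator {a<..b} s \<partial>lborel) \<le> Hs m m'" .
  qed
  also have "\<dots> = (\<integral>\<^sup>+ u. Hs m m' * indicator ?T u \<partial>count_space UNIV)"
    by (rule nn_integral_count_space_subset)
  also have "\<dots> = Hs m m' * npoints ?T" by (rule nn_integral_cmult_indicator) simp
  also have "\<dots> = npoints (atoms m' (Dbar c j m') \<omega>) * Hs m m'" by (simp only: npoints_times mult.commute)
  finally show ?thesis .
qed

definition KK :: "nat \<Rightarrow> ennreal" where
  "KK c = (\<Sum>m\<in>(UNIV :: 'm set). ennreal c0 * ennreal (b - a) + ennreal L * of_nat c)"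

lemma Dbar_section_le:
  assumes w: "\<omega> \<in> space M"
  shows "(\<Sum>m\<in>UNIV. emeasure lborel (Pair \<omega> -` Dbar c (Suc j) m \<inter> UNIV \<times> {0..})) \<le>
    KK c + (1 / 2) * (\<Sum>m'\<in>UNIV. npoints (atoms m' (Dbar c j m') \<omega>))"
proof (cases "\<omega> \<in> Gc c")
  case False
  then have e: "Pair \<omega> -` Dbar c (Suc j) m = {}" for m by auto
  show ?thesis unfolding e by simp
next
  case True
  let ?n = "\<lambda>m'. npoints (atoms m' (Dbar c j m') \<omega>)"
  let ?T = "\<lambda>m'. times m' (Dbar c j m') \<omega>"
  let ?I = "\<lambda>m m' s. \<integral>\<^sup>+ u. ennreal \<bar>ext0 (hM \<MM> (Inl m) m') (s - u)\<bar> \<partial>count_space (?T m')"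
  have Im: "?I m m' \<in> borel_measurable borel" for m m'
  proof (rule borel_measurable_count_space_sum[OF countable_times])
    note [measurable] = hM_meas[of "Inl m" m']
    show "(\<lambda>s. ennreal \<bar>ext0 (hM \<MM> (Inl m) m') (s - u)\<bar>) \<in> borel_measurable borel" for u by measurable
  qed
  have each: "emeasure lborel (Pair \<omega> -` Dbar c (Suc j) m \<inter> UNIV \<times> {0..}) \<le>
     (ennreal c0 * ennreal (b - a) + ennreal L * of_nat c) + (\<Sum>m'\<in>UNIV. ?n m' * (ennreal L * Hs m m'))" for m
  proof -
    have "emeasure lborel (Pair \<omega> -` Dbar c (Suc j) m \<inter> UNIV \<times> {0..}) \<le>
      (\<integral>\<^sup>+ s. (ennreal c0 + ennreal L * (A m \<omega> s + (\<Sum>m'\<in>UNIV. ?I m m' s))) * indicator {a<..b} s \<partial>lborel)"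
    proof (rule emeasure_hypograph_le)
      show "Pair \<omega> -` Dbar c (Suc j) m \<inter> UNIV \<times> {0..} \<in> sets borel"
        by (intro sets.Int section_borel Dbar_sets borel_Times_UNIV) auto
      fix s x assume sx: "(s, x) \<in> Pair \<omega> -` Dbar c (Suc j) m \<inter> UNIV \<times> {0..}"
      have "(\<Sum>m'\<in>UNIV. \<integral>\<^sup>+ u. ennreal \<bar>ext0 (hM \<MM> (Inl m) m') (s - u)\<bar> \<partial>count_space (?T m' \<inter> {..<s})) \<le> (\<Sum>m'\<in>UNIV. ?I m m' s)"
        by (intro sum_mono nn_integral_count_space_mono_set) auto
      then have "ennreal c0 + ennreal L * (A m \<omega> s + (\<Sum>m'\<in>UNIV. \<integral>\<^sup>+ u. ennreal \<bar>ext0 (hM \<MM> (Inl m) m') (s - u)\<bar> \<partial>count_space (?T m' \<inter> {..<s}))) \<le>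
        ennreal c0 + ennreal L * (A m \<omega> s + (\<Sum>m'\<in>UNIV. ?I m m' s))"
        by (intro add_mono mult_left_mono) auto
      then show "s \<in> {a<..b} \<and> 0 \<le> x \<and> ennreal x \<le> ennreal c0 + ennreal L * (A m \<omega> s + (\<Sum>m'\<in>UNIV. ?I m m' s))"
        using sx by (auto intro: order_trans)
    qed
    also have "\<dots> = (\<integral>\<^sup>+ s. ennreal c0 * indicator {a<..b} s + (ennreal L * (A m \<omega> s * indicator {a<..b} s) + (\<Sum>m'\<in>UNIV. ennreal L * (?I m m' s * indicator {a<..b} s))) \<partial>lborel)"
      by (intro nn_integral_cong) (simp add: distrib_left distrib_right sum_distrib_left sum_distrib_right mult.assoc)
    also have "\<dots> = (\<integral>\<^sup>+ s. ennreal c0 * indicator {a<..b} s \<partial>lborel) + ((\<integral>\<^sup>+ s. ennreal L * (A m \<omega> s * indicator {a<..b} s) \<partial>lborel) +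
       (\<Sum>m'\<in>UNIV. \<integral>\<^sup>+ s. ennreal L * (?I m m' s * indicator {a<..b} s) \<partial>lborel))"
    proof -
      note [measurable] = Im A_section_meas[OF w]
      show ?thesis by (simp add: nn_integral_add nn_integral_sum)
    qed
    also have "\<dots> = ennreal c0 * ennreal (b - a) + (ennreal L * (\<integral>\<^sup>+ s. A m \<omega> s * indicator {a<..b} s \<partial>lborel) +
       (\<Sum>m'\<in>UNIV. ennreal L * (\<integral>\<^sup>+ s. ?I m m' s * indicator {a<..b} s \<partial>lborel)))"
    proof -
      note [measurable] = Im A_section_meas[OF w]
      show ?thesis using ab by (simp add: nn_integral_cmult nn_integral_cmult_indicator)
    qed
    also have "\<dots> \<le> ennreal c0 * ennreal (b - a) + (ennreal L * of_nat c + (\<Sum>m'\<in>UNIV. ennreal L * (?n m' * Hs m m')))"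
      using True by (intro add_mono order_refl mult_left_mono sum_mono times_int_le) (auto simp: Gc_def)
    finally show ?thesis by (simp add: add.assoc mult.left_commute)
  qed
  have "(\<Sum>m\<in>UNIV. emeasure lborel (Pair \<omega> -` Dbar c (Suc j) m \<inter> UNIV \<times> {0..})) \<le>
    (\<Sum>m\<in>UNIV. (ennreal c0 * ennreal (b - a) + ennreal L * of_nat c) + (\<Sum>m'\<in>UNIV. ?n m' * (ennreal L * Hs m m')))"
    by (intro sum_mono each)
  also have "\<dots> = KK c + (\<Sum>m\<in>UNIV. \<Sum>m'\<in>UNIV. ?n m' * (ennreal L * Hs m m'))"
    by (simp only: sum.distrib KK_def)
  \<comment> \<open>\<open>small\<close> bounds, for a fixed type \<open>m'\<close> of the parent,
    the sum over the types \<open>m\<close> of the children; hence the exchange of the sums.\<close>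
  also have "(\<Sum>m\<in>UNIV. \<Sum>m'\<in>UNIV. ?n m' * (ennreal L * Hs m m')) = (\<Sum>m'\<in>UNIV. ?n m' * (\<Sum>m\<in>UNIV. ennreal L * Hs m m'))"
    by (subst sum.swap) (simp only: sum_distrib_left)
  also have "\<dots> \<le> (\<Sum>m'\<in>UNIV. ?n m' * (1 / 2))"
    using small by (intro sum_mono mult_left_mono) (simp_all add: Hs_def)
  also have "\<dots> = (1 / 2) * (\<Sum>m'\<in>UNIV. ?n m')" by (simp only: sum_distrib_left mult.commute)
  finally show ?thesis by (simp add: add_left_mono)
qed

text \<open>By Campbell's formula one step maps a bound \<open>x\<close> on the mean number of
  points to \<open>KK c + x / 2\<close>, and \<open>2 * KK c\<close> is the fixed point of this
  map.\<close>

lemma Dbar_mean_le: "(\<Sum>m\<in>UNIV. \<integral>\<^sup>+ \<omega>. npoints (atoms m (Dbar c j m) \<omega>) \<partial>M) \<le> 2 * KK c"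
proof (induct j)
  case 0 show ?case by (simp add: atoms_def)
next
  case (Suc j)
  have sm: "(\<lambda>\<omega>. emeasure lborel (Pair \<omega> -` Dbar c (Suc j) m \<inter> UNIV \<times> {0..})) \<in> borel_measurable M" for m
    by (intro emeasure_section_meas Dbar_sets borel_Times_UNIV) auto
  have "(\<Sum>m\<in>UNIV. \<integral>\<^sup>+ \<omega>. npoints (atoms m (Dbar c (Suc j) m) \<omega>) \<partial>M) =
     (\<Sum>m\<in>UNIV. \<integral>\<^sup>+ \<omega>. emeasure lborel (Pair \<omega> -` Dbar c (Suc j) m \<inter> UNIV \<times> {0..}) \<partial>M)"
    by (intro sum.cong refl campbell Dbar_sets)
  also have "\<dots> = (\<integral>\<^sup>+ \<omega>. (\<Sum>m\<in>UNIV. emeasure lborel (Pair \<omega> -` Dbar c (Suc j) m \<inter> UNIV \<times> {0..})) \<partial>M)"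
    by (intro nn_integral_sum[symmetric] sm)
  also have "\<dots> \<le> (\<integral>\<^sup>+ \<omega>. KK c + (1 / 2) * (\<Sum>m'\<in>UNIV. npoints (atoms m' (Dbar c j m') \<omega>)) \<partial>M)"
    by (intro nn_integral_mono Dbar_section_le)
  also have "\<dots> = KK c + (1 / 2) * (\<Sum>m'\<in>UNIV. \<integral>\<^sup>+ \<omega>. npoints (atoms m' (Dbar c j m') \<omega>) \<partial>M)"
  proof -
    note nm = npoints_atoms_measurable[OF Dbar_sets]
    have "(\<integral>\<^sup>+ \<omega>. KK c + (1 / 2) * (\<Sum>m'\<in>UNIV. npoints (atoms m' (Dbar c j m') \<omega>)) \<partial>M) =
      (\<integral>\<^sup>+ \<omega>. KK c \<partial>M) + (\<integral>\<^sup>+ \<omega>. (1 / 2) * (\<Sum>m'\<in>UNIV. npoints (atoms m' (Dbar c j m') \<omega>)) \<partial>M)"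
      by (intro nn_integral_add borel_measurable_times_ennreal borel_measurable_sum nm) auto
    also have "(\<integral>\<^sup>+ \<omega>. (1 / 2) * (\<Sum>m'\<in>UNIV. npoints (atoms m' (Dbar c j m') \<omega>)) \<partial>M) = (1 / 2) * (\<integral>\<^sup>+ \<omega>. (\<Sum>m'\<in>UNIV. npoints (atoms m' (Dbar c j m') \<omega>)) \<partial>M)"
      by (intro nn_integral_cmult borel_measurable_sum nm)
    also have "(\<integral>\<^sup>+ \<omega>. (\<Sum>m'\<in>UNIV. npoints (atoms m' (Dbar c j m') \<omega>)) \<partial>M) = (\<Sum>m'\<in>UNIV. \<integral>\<^sup>+ \<omega>. npoints (atoms m' (Dbar c j m') \<omega>) \<partial>M)"
      by (intro nn_integral_sum nm)
    finally show ?thesis by (simp add: emeasure_space_1)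
  qed
  also have "\<dots> \<le> KK c + (1 / 2) * (2 * KK c)" by (intro add_mono mult_left_mono Suc) auto
  also have "(1 / 2) * (2 * KK c) = KK c"
    by (simp add: mult.assoc[symmetric] ennreal_divide_times)
  finally show ?case by (simp add: mult_2)
qed

definition Dinf :: "nat \<Rightarrow> 'm \<Rightarrow> ('w \<times> real \<times> real) set" where
  "Dinf c m = (\<Union>j. Dbar c j m)"

text \<open>The bound on the means does not depend on the number of steps and passes to the
  increasing limit. The null set is common to all levels \<open>c\<close>, so that \<open>c\<close>
  may afterwards be chosen for each path.\<close>

lemma AE_Dinf_finite: "AE \<omega> in M. \<forall>c m. finite (times m (Dinf c m) \<omega>)"
proof -
  have "AE \<omega> in M. finite (times m (Dinf c m) \<omega>)" for c m
  proof -
    have "(\<integral>\<^sup>+ \<omega>. npoints (atoms m (Dinf c m) \<omega>) \<partial>M) = (\<integral>\<^sup>+ \<omega>. (SUP j. npoints (atoms m (Dbar c j m) \<omega>)) \<partial>M)"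
    proof (intro nn_integral_cong)
      fix \<omega>
      have "incseq (\<lambda>j. atoms m (Dbar c j m) \<omega>)"
        by (intro incseq_SucI atoms_mono Dbar_mono)
      moreover have "(\<Union>j. atoms m (Dbar c j m) \<omega>) = atoms m (Dinf c m) \<omega>" by (auto simp: atoms_def Dinf_def)
      ultimately show "npoints (atoms m (Dinf c m) \<omega>) = (SUP j. npoints (atoms m (Dbar c j m) \<omega>))"
        by (metis SUP_npoints)
    qed
    also have "\<dots> = (SUP j. \<integral>\<^sup>+ \<omega>. npoints (atoms m (Dbar c j m) \<omega>) \<partial>M)"
    proof (intro nn_integral_monotone_convergence_SUP npoints_atoms_measurable Dbar_sets)
      show "incseq (\<lambda>j \<omega>. npoints (atoms m (Dbar c j m) \<omega>))"
        by (intro incseq_SucI le_funI npoints_mono atoms_mono Dbar_mono)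
    qed
    also have "\<dots> \<le> 2 * KK c"
    proof (rule SUP_least)
      fix j
      have "(\<integral>\<^sup>+ \<omega>. npoints (atoms m (Dbar c j m) \<omega>) \<partial>M) \<le> (\<Sum>m\<in>UNIV. \<integral>\<^sup>+ \<omega>. npoints (atoms m (Dbar c j m) \<omega>) \<partial>M)"
        by (rule member_le_sum) auto
      also have "\<dots> \<le> 2 * KK c" by (rule Dbar_mean_le)
      finally show "(\<integral>\<^sup>+ \<omega>. npoints (atoms m (Dbar c j m) \<omega>) \<partial>M) \<le> 2 * KK c" .
    qed
    also have "\<dots> < \<infinity>" by (simp add: KK_def ennreal_mult_less_top of_nat_less_top less_top[symmetric] ennreal_mult_eq_top_iff)
    finally have "AE \<omega> in M. npoints (atoms m (Dinf c m) \<omega>) \<noteq> \<infinity>"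
      by (intro nn_integral_PInf_AE npoints_atoms_measurable) (auto simp: Dinf_def intro: Dbar_sets)
    then show ?thesis
    proof eventually_elim
      case (elim \<omega>)
      then have "npoints (times m (Dinf c m) \<omega>) < \<infinity>" by (simp add: npoints_times less_top)
      then show ?case by (rule npoints_less_top_iff[THEN iffD1])
    qed
  qed
  then show ?thesis by (simp add: AE_all_countable AE_finite_all)
qed

end

section \<open>Stationarity of the Picard iterates\<close>

context har_step begin

lemma D_dominated:
  assumes w: "\<omega> \<in> Gc c" and y: "(s, x) \<in> pt m \<omega>" "(\<omega>, s, x) \<in> D j m" "a < s"
  shows "(\<omega>, s, x) \<in> Dbar c j m"
  using y
proof (induct j arbitrary: m s x)
  case 0 then show ?case by simp
next
  case (Suc j)
  then have sp: "\<omega> \<in> space M" "t0 < s" and sb: "s \<le> b" and x: "x \<le> PhiM \<MM> m (dr (Inl m) (prc (D j) W) s \<omega>)"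
    by auto
  have D0: "times m' (D j m') \<omega> \<inter> {..a} \<subseteq> times m' (C m') \<omega> \<inter> {..a}" for m'
  proof
    fix u assume "u \<in> times m' (D j m') \<omega> \<inter> {..a}"
    then obtain x' where "(u, x') \<in> pt m' \<omega>" "(\<omega>, u, x') \<in> D j m'" "u \<le> a" by (auto simp: times_iff)
    then have "(\<omega>, u, x') \<in> C m'" by (cases j) auto
    then show "u \<in> times m' (C m') \<omega> \<inter> {..a}" using \<open>u \<le> a\<close> \<open>(u, x') \<in> pt m' \<omega>\<close> by (auto simp: times_iff)
  qed
  have sub: "NN (D j) m' \<omega> \<inter> {..<s} \<subseteq> (NN C m' \<omega> \<inter> {..a} \<inter> {..<s}) \<union> (times m' (Dbar c j m') \<omega> \<inter> {..<s})" for m'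
  proof
    fix u assume u: "u \<in> NN (D j) m' \<omega> \<inter> {..<s}"
    show "u \<in> (NN C m' \<omega> \<inter> {..a} \<inter> {..<s}) \<union> (times m' (Dbar c j m') \<omega> \<inter> {..<s})"
    proof (cases "u \<le> a")
      case True
      then show ?thesis using u D0[of m'] unfolding NN_def by auto
    next
      case False
      then have "u \<notin> CMt m' \<omega>" using CMt_sub[of m' \<omega>] ab by auto
      then have "u \<in> times m' (D j m') \<omega>" using u by (auto simp: NN_def)
      then obtain x' where x': "(u, x') \<in> pt m' \<omega>" "(\<omega>, u, x') \<in> D j m'" unfolding times_iff by blast
      then have "(\<omega>, u, x') \<in> Dbar c j m'" using False by (intro Suc(1)) auto
      then show ?thesis using x' u unfolding times_iff Un_iff Int_iff by blast
    qed
  qed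
  have "adr (Inl m) (prc (D j) W) s \<omega> \<le> A m \<omega> s +
     (\<Sum>m'\<in>UNIV. \<integral>\<^sup>+ u. ennreal \<bar>ext0 (hM \<MM> (Inl m) m') (s - u)\<bar> \<partial>count_space (times m' (Dbar c j m') \<omega> \<inter> {..<s}))"
  proof -
    let ?h = "\<lambda>m' u. ennreal \<bar>hM \<MM> (Inl m) m' (s - u)\<bar>"
    let ?w = "\<lambda>p k. ennreal \<bar>opt_app (J \<MM> (Inl m) p (s - k)) (W p k \<omega>)\<bar>"
    have h: "(\<integral>\<^sup>+ u. ?h m' u \<partial>count_space (NN (D j) m' \<omega> \<inter> {..<s})) \<le>
       (\<integral>\<^sup>+ u. ?h m' u \<partial>count_space (NN C m' \<omega> \<inter> {..a} \<inter> {..<s})) +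
       (\<integral>\<^sup>+ u. ennreal \<bar>ext0 (hM \<MM> (Inl m) m') (s - u)\<bar> \<partial>count_space (times m' (Dbar c j m') \<omega> \<inter> {..<s}))" for m'
    proof -
      have "(\<integral>\<^sup>+ u. ?h m' u \<partial>count_space (NN (D j) m' \<omega> \<inter> {..<s})) \<le>
         (\<integral>\<^sup>+ u. ?h m' u \<partial>count_space ((NN C m' \<omega> \<inter> {..a} \<inter> {..<s}) \<union> (times m' (Dbar c j m') \<omega> \<inter> {..<s})))"
        by (rule nn_integral_count_space_mono_set[OF sub])
      also have "\<dots> \<le> (\<integral>\<^sup>+ u. ?h m' u \<partial>count_space (NN C m' \<omega> \<inter> {..a} \<inter> {..<s})) +
         (\<integral>\<^sup>+ u. ?h m' u \<partial>count_space (times m' (Dbar c j m') \<omega> \<inter> {..<s}))"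
        by (rule nn_integral_count_space_Un_le)
      also have "(\<integral>\<^sup>+ u. ?h m' u \<partial>count_space (times m' (Dbar c j m') \<omega> \<inter> {..<s})) =
         (\<integral>\<^sup>+ u. ennreal \<bar>ext0 (hM \<MM> (Inl m) m') (s - u)\<bar> \<partial>count_space (times m' (Dbar c j m') \<omega> \<inter> {..<s}))"
        by (intro nn_integral_cong) (auto simp: ext0_def)
      finally show ?thesis .
    qed
    have w: "(\<integral>\<^sup>+ k. ?w p k \<partial>count_space (ar_times n \<phi> p \<inter> {..<s})) =
      (\<integral>\<^sup>+ k. ennreal \<bar>opt_app (J \<MM> (Inl m) p (s - k)) (if k \<le> a then W p k \<omega> else None)\<bar> \<partial>count_space (ar_times n \<phi> p \<inter> {..<s}))" for p
    proof (intro nn_integral_cong)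
      fix k assume "k \<in> space (count_space (ar_times n \<phi> p \<inter> {..<s}))"
      \<comment> \<open>Since \<open>s \<le> b\<close>, an autoregressive time before
        \<open>s\<close> is before \<open>b\<close>, and by \<open>gap\<close> it is at most
        \<open>a\<close>: the series is frozen throughout the piece.\<close>
      then have "k \<le> a" using gap[of p] sb by (auto simp: disjoint_iff not_le[symmetric])
      then show "?w p k = ennreal \<bar>opt_app (J \<MM> (Inl m) p (s - k)) (if k \<le> a then W p k \<omega> else None)\<bar>" by simp
    qed
    have "adr (Inl m) (prc (D j) W) s \<omega> \<le>
      (\<Sum>m'\<in>UNIV. (\<integral>\<^sup>+ u. ?h m' u \<partial>count_space (NN C m' \<omega> \<inter> {..a} \<inter> {..<s})) +
       (\<integral>\<^sup>+ u. ennreal \<bar>ext0 (hM \<MM> (Inl m) m') (s - u)\<bar> \<partial>count_space (times m' (Dbar c j m') \<omega> \<inter> {..<s}))) +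
      (\<Sum>p\<in>UNIV. \<integral>\<^sup>+ k. ?w p k \<partial>count_space (ar_times n \<phi> p \<inter> {..<s}))"
      unfolding adrive_def prod.case by (intro add_mono sum_mono h order_refl)
    also have "\<dots> = A m \<omega> s + (\<Sum>m'\<in>UNIV. \<integral>\<^sup>+ u. ennreal \<bar>ext0 (hM \<MM> (Inl m) m') (s - u)\<bar> \<partial>count_space (times m' (Dbar c j m') \<omega> \<inter> {..<s}))"
      unfolding A_def base_def trunc_def adrive_def prod.case w by (simp add: sum.distrib ac_simps)
    finally show ?thesis .
  qed
  then have le: "ennreal L * adr (Inl m) (prc (D j) W) s \<omega> \<le> ennreal L * (A m \<omega> s +
     (\<Sum>m'\<in>UNIV. \<integral>\<^sup>+ u. ennreal \<bar>ext0 (hM \<MM> (Inl m) m') (s - u)\<bar> \<partial>count_space (times m' (Dbar c j m') \<omega> \<inter> {..<s})))"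
    by (rule mult_left_mono) simp
  have "ennreal x \<le> ennreal (c0 + L * \<bar>dr (Inl m) (prc (D j) W) s \<omega>\<bar>)"
    using order_trans[OF x Phi_le] by (rule ennreal_leI)
  also have "\<dots> = ennreal c0 + ennreal L * ennreal \<bar>dr (Inl m) (prc (D j) W) s \<omega>\<bar>"
    using c0 L0 by (simp add: ennreal_mult)
  also have "\<dots> \<le> ennreal c0 + ennreal L * adr (Inl m) (prc (D j) W) s \<omega>"
    by (intro add_left_mono mult_left_mono drive_le_adrive) simp
  also have "\<dots> \<le> ennreal c0 + ennreal L * (A m \<omega> s +
     (\<Sum>m'\<in>UNIV. \<integral>\<^sup>+ u. ennreal \<bar>ext0 (hM \<MM> (Inl m) m') (s - u)\<bar> \<partial>count_space (times m' (Dbar c j m') \<omega> \<inter> {..<s})))"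
    by (rule add_left_mono[OF le])
  finally show ?case using sp sb Suc(4) w by simp
qed

lemma D_before: "s \<le> a \<Longrightarrow> (\<omega>, s, x) \<in> D j m \<longleftrightarrow> (\<omega>, s, x) \<in> C m"
  by (cases j) auto

lemma D_range: "(\<omega>, s, x) \<in> D j m \<Longrightarrow> s \<le> a \<or> a < s \<and> s \<le> b"
  by (cases j) auto

lemma D_between:
  assumes "a < s" "s \<le> b" "\<omega> \<in> space M"
  shows "(\<omega>, s, x) \<in> D (Suc j) m \<longleftrightarrow> x \<le> PhiM \<MM> m (dr (Inl m) (prc (D j) W) s \<omega>)"
  using assms ab by auto

text \<open>A lower limit of sets is predictable whether or not the iterates converge; where they
  are stationary it is their common value.\<close>

definition Dlim :: "'m \<Rightarrow> ('w \<times> real \<times> real) set" where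
  "Dlim m = (\<Union>i. \<Inter>j\<in>{i..}. D j m)"

lemma Dlim_sets: "Dlim m \<in> sets (mpred t0 Fa)"
  unfolding Dlim_def by (intro sets.countable_UN' sets.countable_INT') (auto intro: D_sets)

context
  fixes \<omega> c
  assumes w: "\<omega> \<in> Gc c" and fin: "\<And>m. finite (times m (Dinf c m) \<omega>)"
begin

definition SS :: "real set" where "SS = (\<Union>m. times m (Dinf c m) \<omega>)"

lemma SS_finite: "finite SS"
  unfolding SS_def using fin by auto

lemma w_space: "\<omega> \<in> space M"
  using w by (auto simp: Gc_def)

lemma D_in_SS: "(s, x) \<in> pt m \<omega> \<Longrightarrow> (\<omega>, s, x) \<in> D j m \<Longrightarrow> a < s \<Longrightarrow> s \<in> SS"
  using D_dominated[OF w] unfolding SS_def Dinf_def UN_iff times_iff by blast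

text \<open>All iterates take their points from the finite set \<open>SS\<close>, and whether a point is accepted
  depends on the earlier ones only.\<close>

lemma D_stable_step:
  "(s, x) \<in> pt m \<omega> \<Longrightarrow> card (SS \<inter> {..<s}) < j \<Longrightarrow> (\<omega>, s, x) \<in> D j m \<longleftrightarrow> (\<omega>, s, x) \<in> D (Suc j) m"
proof (induct j arbitrary: m s x)
  case 0 then show ?case by simp
next
  case (Suc j)
  consider "s \<le> a" | "b < s" | "a < s" "s \<le> b" by linarith
  then show ?case
  proof cases
    case 1 then show ?thesis by (simp only: D_before)
  next
    case 2 then show ?thesis using D_range[of \<omega> s x "Suc j" m] D_range[of \<omega> s x "Suc (Suc j)" m] ab by linarith
  next
    case 3
    have same: "(\<omega>, u, x') \<in> D j m' \<longleftrightarrow> (\<omega>, u, x') \<in> D (Suc j) m'" if u: "u < s" "(u, x') \<in> pt m' \<omega>" for u x' m'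
    proof (cases "u \<le> a")
      case True then show ?thesis by (simp only: D_before)
    next
      case False
      show ?thesis
      proof (cases "u \<in> SS")
        case True
        \<comment> \<open>The candidate \<open>u\<close> is before \<open>s\<close> but not before
          itself, so the number of earlier candidates drops and the induction hypothesis applies to
          \<open>u\<close>.\<close>
        have "SS \<inter> {..<u} \<subset> SS \<inter> {..<s}" using True u by auto
        then have "card (SS \<inter> {..<u}) < card (SS \<inter> {..<s})" using SS_finite by (intro psubset_card_mono) auto
        then show ?thesis using Suc(1)[OF u(2)] Suc(3) by simp
      next
        case nS: False
        then show ?thesis using D_in_SS[OF u(2), of j] D_in_SS[OF u(2), of "Suc j"] False by auto
      qed
    qed
    have "dr (Inl m) (prc (D j) W) s \<omega> = dr (Inl m) (prc (D (Suc j)) W) s \<omega>"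
    proof (rule drive_cong_gen(1))
      fix m'
      have "times m' (D j m') \<omega> \<inter> {..<s} = times m' (D (Suc j) m') \<omega> \<inter> {..<s}"
        using same unfolding set_eq_iff Int_iff times_iff lessThan_iff by blast
      then show "NN (D j) m' \<omega> \<inter> {..<s} = NN (D (Suc j)) m' \<omega> \<inter> {..<s}" unfolding NN_def by blast
    qed simp
    then show ?thesis unfolding D_between[OF 3 w_space] by simp
  qed
qed

text \<open>No time has more than \<open>card SS\<close> candidates before it, so one index serves
  all atoms.\<close>

lemma D_stable:
  assumes y: "(s, x) \<in> pt m \<omega>" and j: "card SS < j"
  shows "(\<omega>, s, x) \<in> Dlim m \<longleftrightarrow> (\<omega>, s, x) \<in> D j m"
proof -
  have lt: "card (SS \<inter> {..<s}) < i" if "card SS < i" for i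
    using card_mono[OF SS_finite, of "SS \<inter> {..<s}"] that by auto
  have eq: "(\<omega>, s, x) \<in> D i m \<longleftrightarrow> (\<omega>, s, x) \<in> D j m" if "j \<le> i" for i
    using that
  proof (induct i rule: dec_induct)
    case (step i)
    then show ?case using D_stable_step[OF y, of i] lt[of i] j by simp
  qed simp
  show ?thesis
  proof
    assume "(\<omega>, s, x) \<in> Dlim m"
    then obtain i where "\<forall>j\<ge>i. (\<omega>, s, x) \<in> D j m" by (auto simp: Dlim_def)
    then have "(\<omega>, s, x) \<in> D (max i j) m" by auto
    then show "(\<omega>, s, x) \<in> D j m" using eq[of "max i j"] by simp
  next
    assume Dj: "(\<omega>, s, x) \<in> D j m"
    have "(\<omega>, s, x) \<in> (\<Inter>i\<in>{j..}. D i m)"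
    proof (rule INT_I)
      fix i assume "i \<in> {j..}"
      then have "j \<le> i" by simp
      from eq[OF this] Dj show "(\<omega>, s, x) \<in> D i m" by (rule iffD2)
    qed
    then show "(\<omega>, s, x) \<in> Dlim m" unfolding Dlim_def by (rule UN_I[OF UNIV_I])
  qed
qed

lemma Dlim_agree: "agree_upto a \<omega> C Dlim"
  unfolding agree_upto_def
proof (intro allI impI)
  fix m s x assume y: "(s, x) \<in> pt m \<omega>" and s: "s \<le> a"
  show "(\<omega>, s, x) \<in> C m \<longleftrightarrow> (\<omega>, s, x) \<in> Dlim m"
    unfolding D_stable[OF y lessI] D_before[OF s] ..
qed

lemma Dlim_eqn:
  assumes E: "eqn_upto a C W \<omega>"
  shows "eqn_upto b Dlim (next_W b Dlim W) \<omega>"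
proof -
  let ?W = "next_W b Dlim W"
  note ag = Dlim_agree
  have Wd: "dr \<alpha> (prc Dlim W) s \<omega> = dr \<alpha> (prc Dlim ?W) s \<omega>" if "s \<le> b" for \<alpha> s
    using that by (intro drive_cong_gen(1)) (auto simp: next_W_def)
  have agj: "agree_upto b \<omega> (D j) Dlim" if "card SS < j" for j
    unfolding agree_upto_def using D_stable[OF _ that] by blast
  have Ea: "eqn_upto a Dlim ?W \<omega>"
    by (rule eqn_upto_cong[OF ag _ E]) (use ab in \<open>auto simp: next_W_def\<close>)
  show ?thesis
    unfolding eqn_upto_def
  proof (intro conjI allI impI)
    fix m
    have "times m (Dlim m) \<omega> \<inter> {..b} \<subseteq> (times m (Dlim m) \<omega> \<inter> {..a}) \<union> SS"
    proof
      fix s assume "s \<in> times m (Dlim m) \<omega> \<inter> {..b}"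
      then obtain x where x: "(s, x) \<in> pt m \<omega>" "(\<omega>, s, x) \<in> Dlim m" unfolding times_iff Int_iff by blast
      then have "(\<omega>, s, x) \<in> D (Suc (card SS)) m" using D_stable[OF x(1) lessI] by simp
      then have "a < s \<Longrightarrow> s \<in> SS" using D_in_SS[OF x(1)] by blast
      then show "s \<in> (times m (Dlim m) \<omega> \<inter> {..a}) \<union> SS"
        using x unfolding Un_iff Int_iff times_iff atMost_iff not_le[symmetric] by blast
    qed
    moreover have "finite (times m (Dlim m) \<omega> \<inter> {..a})" using Ea by (simp add: eqn_upto_def)
    ultimately show "finite (times m (Dlim m) \<omega> \<inter> {..b})" using SS_finite by (meson finite_UnI finite_subset)
  next
    fix m s x assume y: "(s, x) \<in> pt m \<omega>" and s: "s \<le> b"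
    show "(\<omega>, s, x) \<in> Dlim m \<longleftrightarrow> x \<le> PhiM \<MM> m (dr (Inl m) (prc Dlim ?W) s \<omega>)"
    proof (cases "s \<le> a")
      case True
      then show ?thesis using Ea y unfolding eqn_upto_def by blast
    next
      case False
      have j: "card SS < Suc (card SS)" by simp
      \<comment> \<open>Two consecutive iterates beyond \<open>card SS\<close> both coincide with
        the limit on the atoms, and the second is defined by the drive of the first; so the rule of
        the iteration becomes the equation.\<close>
      have "(\<omega>, s, x) \<in> Dlim m \<longleftrightarrow> (\<omega>, s, x) \<in> D (Suc (Suc (card SS))) m" by (rule D_stable[OF y]) simp
      also have "\<dots> \<longleftrightarrow> x \<le> PhiM \<MM> m (dr (Inl m) (prc (D (Suc (card SS))) W) s \<omega>)"
        using False s by (intro D_between w_space) auto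
      also have "dr (Inl m) (prc (D (Suc (card SS))) W) s \<omega> = dr (Inl m) (prc Dlim W) s \<omega>"
        by (rule agree_drive[OF agj[OF j] s]) simp
      finally show ?thesis by (simp only: Wd[OF s])
    qed
  next
    fix p k assume pk: "(p, k) \<in> ar_index n \<phi>" "t0 \<le> k" "k \<le> b"
    have "k \<in> ar_times n \<phi> p" using pk by (auto simp: ar_index_def)
    then have "k \<le> a \<or> k = b" using gap[of p] pk by fastforce
    then show "?W p k \<omega> = Some (\<xi> p k \<omega> + PhiP \<MM> p (dr (Inr p) (prc Dlim ?W) k \<omega>))"
    proof
      assume "k \<le> a"
      then show ?thesis using Ea pk unfolding eqn_upto_def by blast
    next
      assume k: "k = b"
      then show ?thesis using Wd[of b "Inr p"] by (simp add: next_W_def)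
    qed
  qed
qed

end

lemma stage_step:
  assumes st: "stage a C W"
  shows "stage b Dlim (next_W b Dlim W) \<and> (AE \<omega> in M. agree_upto a \<omega> C Dlim)"
proof -
  have "AE \<omega> in M. eqn_upto b Dlim (next_W b Dlim W) \<omega> \<and> agree_upto a \<omega> C Dlim"
    using AE_Dinf_finite AE_ic_good st[unfolded stage_def, THEN conjunct2, THEN conjunct2] AE_space
  proof eventually_elim
    case (elim \<omega>)
    have fin: "finite (times m (C m) \<omega> \<inter> {..a})" for m using elim(3) by (simp add: eqn_upto_def)
    have "(\<integral>\<^sup>+ s. A m \<omega> s * indicator {a<..b} s \<partial>lborel) < \<infinity>" for m
      unfolding A_def base_def
      by (rule int_finite[OF elim(2) fin _ ab(1)]) (use nice_WD(2)[OF W] in auto)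
    then have "\<exists>c::nat. (\<integral>\<^sup>+ s. A m \<omega> s * indicator {a<..b} s \<partial>lborel) \<le> of_nat c" for m
      using ennreal_Ex_less_of_nat[of "\<integral>\<^sup>+ s. A m \<omega> s * indicator {a<..b} s \<partial>lborel"] by (auto intro: less_imp_le)
    then obtain c where c: "\<And>m. (\<integral>\<^sup>+ s. A m \<omega> s * indicator {a<..b} s \<partial>lborel) \<le> of_nat (c m)" by metis
    have "\<omega> \<in> Gc (Max (range c))"
      unfolding Gc_def
    proof (intro CollectI conjI allI)
      fix m
      have "of_nat (c m) \<le> (of_nat (Max (range c)) :: ennreal)" by (intro of_nat_mono Max_ge) auto
      then show "(\<integral>\<^sup>+ s. A m \<omega> s * indicator {a<..b} s \<partial>lborel) \<le> of_nat (Max (range c))"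
        using c[of m] by (rule order_trans[rotated])
    qed (rule elim(4))
    moreover have "finite (times m (Dinf (Max (range c)) m) \<omega>)" for m using elim(1) by blast
    ultimately show ?case using Dlim_eqn[OF _ _ elim(3)] Dlim_agree by blast
  qed
  then show ?thesis
    unfolding stage_def using ab W by (auto intro!: Dlim_sets nice_next_W)
qed

end

section \<open>The solution for all times\<close>

lemma dependent_nat_choice_pair:
  assumes "P 0 x0 y0"
    and "\<And>i x y. P i x y \<Longrightarrow> \<exists>x' y'. P (Suc i) x' y' \<and> Q i x y x' y'"
  shows "\<exists>f g. \<forall>i::nat. P i (f i) (g i) \<and> Q i (f i) (g i) (f (Suc i)) (g (Suc i))"
proof -
  have "\<exists>h. \<forall>i. (\<lambda>i z. P i (fst z) (snd z)) i (h i) \<and> (\<lambda>i z z'. Q i (fst z) (snd z) (fst z') (snd z')) i (h i) (h (Suc i))"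
  proof (rule dependent_nat_choice)
    show "\<exists>z. P 0 (fst z) (snd z)" using assms(1) by (intro exI[of _ "(x0, y0)"]) simp
    fix z and i :: nat assume "P i (fst z) (snd z)"
    from assms(2)[OF this] show "\<exists>z'. P (Suc i) (fst z') (snd z') \<and> Q i (fst z) (snd z) (fst z') (snd z')" by auto
  qed
  then obtain h where "\<forall>i. P i (fst (h i)) (snd (h i)) \<and> Q i (fst (h i)) (snd (h i)) (fst (h (Suc i))) (snd (h (Suc i)))" by auto
  then show ?thesis by (intro exI[of _ "\<lambda>i. fst (h i)"] exI[of _ "\<lambda>i. snd (h i)"]) simp
qed

text \<open>A grid of mesh \<open>\<delta>\<close> is added to \<open>S\<close> only to bound the
  steps. The sequence jumps to the next point of a locally finite set, and a strictly increasing
  sequence in such a set cannot stay bounded.\<close>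

lemma ex_discrete_enumeration:
  fixes S :: "real set" and t0 \<delta> :: real
  assumes \<delta>: "0 < \<delta>" and fin: "\<And>T. finite (S \<inter> {t0..T})"
  shows "\<exists>\<tau> :: nat \<Rightarrow> real. \<tau> 0 = t0 \<and> (\<forall>i. \<tau> i < \<tau> (Suc i) \<and> \<tau> (Suc i) \<le> \<tau> i + \<delta> \<and> S \<inter> {\<tau> i<..<\<tau> (Suc i)} = {}) \<and>
     (\<forall>T. \<exists>i. T \<le> \<tau> i)"
proof -
  define Z where "Z = S \<union> range (\<lambda>i::nat. t0 + \<delta> * real i)"
  have finZ: "finite (Z \<inter> {t0..T})" for T
  proof -
    have "range (\<lambda>i::nat. t0 + \<delta> * real i) \<inter> {t0..T} \<subseteq> (\<lambda>i::nat. t0 + \<delta> * real i) ` {..nat \<lfloor>(T - t0) / \<delta>\<rfloor>}"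
    proof (intro subsetI)
      fix x assume "x \<in> range (\<lambda>i::nat. t0 + \<delta> * real i) \<inter> {t0..T}"
      then obtain i :: nat where i: "x = t0 + \<delta> * real i" "t0 + \<delta> * real i \<le> T" by auto
      then have "real i \<le> (T - t0) / \<delta>" using \<delta> by (simp add: field_simps)
      then have "i \<le> nat \<lfloor>(T - t0) / \<delta>\<rfloor>" by (simp add: le_nat_floor)
      then show "x \<in> (\<lambda>i::nat. t0 + \<delta> * real i) ` {..nat \<lfloor>(T - t0) / \<delta>\<rfloor>}" using i by auto
    qed
    then have "finite (range (\<lambda>i::nat. t0 + \<delta> * real i) \<inter> {t0..T})" by (rule finite_subset) simp
    then show ?thesis using fin[of T] by (simp add: Z_def Int_Un_distrib2)
  qed
  have fi: "finite (Z \<inter> {t<..t + \<delta>})" if "t0 \<le> t" for t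
    by (rule finite_subset[OF _ finZ[of "t + \<delta>"]]) (use that in auto)
  have ne: "Z \<inter> {t<..t + \<delta>} \<noteq> {}" if "t0 \<le> t" for t
  proof -
    define i where "i = nat (\<lfloor>(t - t0) / \<delta>\<rfloor> + 1)"
    have nn: "0 \<le> \<lfloor>(t - t0) / \<delta>\<rfloor>" using that \<delta> by simp
    have "real i = of_int \<lfloor>(t - t0) / \<delta>\<rfloor> + 1" using nn by (simp add: i_def)
    then have "(t - t0) / \<delta> < real i" "real i \<le> (t - t0) / \<delta> + 1" by linarith+
    then have "t < t0 + \<delta> * real i" "t0 + \<delta> * real i \<le> t + \<delta>" using \<delta> by (simp_all add: field_simps)
    then have "t0 + \<delta> * real i \<in> Z \<inter> {t<..t + \<delta>}" by (simp add: Z_def)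
    then show ?thesis by blast
  qed
  define nxt where "nxt t = Min (Z \<inter> {t<..t + \<delta>})" for t
  have nxt: "nxt t \<in> Z" "t < nxt t" "nxt t \<le> t + \<delta>" "Z \<inter> {t<..<nxt t} = {}" if "t0 \<le> t" for t
  proof -
    have "nxt t \<in> Z \<inter> {t<..t + \<delta>}" unfolding nxt_def by (rule Min_in[OF fi[OF that] ne[OF that]])
    then show *: "nxt t \<in> Z" "t < nxt t" "nxt t \<le> t + \<delta>" by auto
    show "Z \<inter> {t<..<nxt t} = {}"
    proof (rule ccontr)
      assume "Z \<inter> {t<..<nxt t} \<noteq> {}"
      then obtain x where x: "x \<in> Z" "t < x" "x < nxt t" by auto
      then have "nxt t \<le> x" unfolding nxt_def using fi[OF that] *(3) by (intro Min_le) (auto simp: nxt_def)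
      then show False using x by simp
    qed
  qed
  define \<tau> where "\<tau> = rec_nat t0 (\<lambda>_. nxt)"
  have \<tau>: "\<tau> 0 = t0" "\<tau> (Suc i) = nxt (\<tau> i)" for i by (simp_all add: \<tau>_def)
  have ge: "t0 \<le> \<tau> i" for i
  proof (induct i)
    case (Suc i) then show ?case using nxt(2)[of "\<tau> i"] by (simp add: \<tau>)
  qed (simp add: \<tau>)
  have sm: "strict_mono \<tau>" by (rule strict_mono_Suc_iff[THEN iffD2]) (simp add: \<tau> nxt(2)[OF ge])
  have unb: "\<exists>i. T \<le> \<tau> i" for T
  proof (rule ccontr)
    assume "\<not> (\<exists>i. T \<le> \<tau> i)"
    then have lt: "\<tau> i < T" for i by (simp add: not_le)
    have "\<tau> i \<in> insert t0 (Z \<inter> {t0..T})" for i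
      using lt[of i] ge[of i] nxt(1)[OF ge] by (cases i) (auto simp: \<tau> less_imp_le)
    then have "range \<tau> \<subseteq> insert t0 (Z \<inter> {t0..T})" by (intro image_subsetI)
    then have "finite (range \<tau>)" using finZ[of T] by (auto intro: finite_subset)
    then show False using strict_mono_imp_inj_on[OF sm] by (auto dest: finite_imageD)
  qed
  show ?thesis
  proof (intro exI[of _ \<tau>] conjI allI)
    fix i
    show "\<tau> i < \<tau> (Suc i)" "\<tau> (Suc i) \<le> \<tau> i + \<delta>" using nxt(2,3)[OF ge] by (simp_all add: \<tau>)
    show "S \<inter> {\<tau> i<..<\<tau> (Suc i)} = {}" using nxt(4)[OF ge[of i]] by (auto simp: \<tau> Z_def)
  qed (use \<tau> unb in auto)
qed

text \<open>The integrals over \<open>{0<..1 / real (Suc k)}\<close> are values of the finite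
  measures with density \<open>h x y\<close> on sets that decrease to the empty set. As the types
  are finitely many, one \<open>\<delta>\<close> serves them all.\<close>

lemma ex_small_integrals:
  fixes h :: "'a::finite \<Rightarrow> 'b::finite \<Rightarrow> real \<Rightarrow> ennreal"
  assumes m: "\<And>x y. h x y \<in> borel_measurable borel" and fin: "\<And>x y. (\<integral>\<^sup>+ v. h x y v \<partial>lborel) < \<infinity>"
  shows "\<exists>\<delta>>0. \<forall>y. (\<Sum>x\<in>UNIV. ennreal L * (\<integral>\<^sup>+ v. h x y v * indicator {0<..\<delta>} v \<partial>lborel)) \<le> 1 / 2"
proof -
  define F where "F k = {0<..1 / real (Suc k)}" for k
  have int: "(\<integral>\<^sup>+ v. h x y v * indicator (F k) v \<partial>lborel) = emeasure (density lborel (h x y)) (F k)" for x y k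
    using m by (subst emeasure_density) (auto simp: F_def)
  have lim: "(\<lambda>k. \<integral>\<^sup>+ v. h x y v * indicator (F k) v \<partial>lborel) \<longlonglongrightarrow> 0" for x y
  proof -
    have "(\<lambda>k. emeasure (density lborel (h x y)) (F k)) \<longlonglongrightarrow> emeasure (density lborel (h x y)) (\<Inter>k. F k)"
    proof (rule Lim_emeasure_decseq)
      show "decseq F" unfolding decseq_Suc_iff F_def by (auto intro: order_trans simp: field_simps)
      show "emeasure (density lborel (h x y)) (F k) \<noteq> \<infinity>" for k
      proof -
        have "emeasure (density lborel (h x y)) (F k) \<le> (\<integral>\<^sup>+ v. h x y v \<partial>lborel)"
          unfolding int[symmetric] by (intro nn_integral_mono) (auto simp: indicator_def)
        then show ?thesis using fin[of x y] by (auto simp: top_unique)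
      qed
    qed (auto simp: F_def)
    moreover have "(\<Inter>k. F k) = {}"
    proof (rule ccontr)
      assume "(\<Inter>k. F k) \<noteq> {}"
      then obtain v where "v \<in> (\<Inter>k. F k)" by blast
      then have v: "0 < v" "v \<le> 1 / real (Suc k)" for k unfolding F_def by auto
      obtain k where "1 / real (Suc k) < v" using reals_Archimedean[OF v(1)] by (auto simp: inverse_eq_divide)
      then show False using v(2)[of k] by simp
    qed
    ultimately show ?thesis by (simp add: int)
  qed
  have "\<forall>\<^sub>F k in sequentially. \<forall>y. (\<Sum>x\<in>UNIV. ennreal L * (\<integral>\<^sup>+ v. h x y v * indicator (F k) v \<partial>lborel)) < 1 / 2"
  proof (rule eventually_all_finite)
    fix y
    have "(\<lambda>k. \<Sum>x\<in>UNIV. ennreal L * (\<integral>\<^sup>+ v. h x y v * indicator (F k) v \<partial>lborel)) \<longlonglongrightarrow> (\<Sum>x\<in>(UNIV::'a set). ennreal L * 0)"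
      by (intro tendsto_sum ennreal_tendsto_cmult lim) simp
    then show "\<forall>\<^sub>F k in sequentially. (\<Sum>x\<in>UNIV. ennreal L * (\<integral>\<^sup>+ v. h x y v * indicator (F k) v \<partial>lborel)) < 1 / 2"
      by (rule order_tendstoD) (simp add: ennreal_zero_less_divide)
  qed
  then obtain k where "\<forall>y. (\<Sum>x\<in>UNIV. ennreal L * (\<integral>\<^sup>+ v. h x y v * indicator (F k) v \<partial>lborel)) < 1 / 2"
    by (auto simp: eventually_sequentially)
  then show ?thesis unfolding F_def by (intro exI[of _ "1 / real (Suc k)"]) (auto intro: less_imp_le)
qed

context har_full begin

lemma eqn_upto_mono:
  assumes "eqn_upto b C W \<omega>" "a \<le> b"
  shows "eqn_upto a C W \<omega>"
proof -
  have "finite (times m (C m) \<omega> \<inter> {..a})" for m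
  proof (rule finite_subset)
    show "times m (C m) \<omega> \<inter> {..a} \<subseteq> times m (C m) \<omega> \<inter> {..b}" using assms(2) by auto
    show "finite (times m (C m) \<omega> \<inter> {..b})" using assms(1) unfolding eqn_upto_def by blast
  qed
  moreover have "(\<omega>, s, x) \<in> C m \<longleftrightarrow> x \<le> PhiM \<MM> m (dr (Inl m) (prc C W) s \<omega>)" if "(s, x) \<in> pt m \<omega>" "s \<le> a" for m s x
    using assms(1) that(1) order_trans[OF that(2) assms(2)] unfolding eqn_upto_def by blast
  moreover have "W p k \<omega> = Some (\<xi> p k \<omega> + PhiP \<MM> p (dr (Inr p) (prc C W) k \<omega>))"
    if "(p, k) \<in> ar_index n \<phi>" "t0 \<le> k" "k \<le> a" for p k
    using assms(1) that(1,2) order_trans[OF that(3) assms(2)] unfolding eqn_upto_def by blast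
  ultimately show ?thesis unfolding eqn_upto_def by blast
qed

lemma agree_upto_mono: "agree_upto b \<omega> C C' \<Longrightarrow> a \<le> b \<Longrightarrow> agree_upto a \<omega> C C'"
  unfolding agree_upto_def by (meson order_trans)

lemma agree_upto_trans: "agree_upto a \<omega> C C' \<Longrightarrow> agree_upto a \<omega> C' C'' \<Longrightarrow> agree_upto a \<omega> C C''"
  unfolding agree_upto_def by blast

lemma ex_stage_step:
  assumes "t0 \<le> a" "a < b" "b \<le> a + \<delta>" "\<And>p. ar_times n \<phi> p \<inter> {a<..<b} = {}"
    and "0 \<le> c0" "0 \<le> L" "\<And>m x. PhiM \<MM> m x \<le> c0 + L * \<bar>x\<bar>"
    and small: "\<And>m'. (\<Sum>m\<in>UNIV. ennreal L * (\<integral>\<^sup>+ v. ennreal \<bar>ext0 (hM \<MM> (Inl m) m') v\<bar> * indicator {0<..\<delta>} v \<partial>lborel)) \<le> 1 / 2"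
    and st: "stage a C W"
  shows "\<exists>C' W'. stage b C' W' \<and> (AE \<omega> in M. agree_upto a \<omega> C C') \<and> (\<forall>p k. k \<le> a \<longrightarrow> W' p k = W p k)"
proof -
  have "(\<Sum>m\<in>UNIV. ennreal L * (\<integral>\<^sup>+ v. ennreal \<bar>ext0 (hM \<MM> (Inl m) m') v\<bar> * indicator {0<..b - a} v \<partial>lborel)) \<le>
     (\<Sum>m\<in>UNIV. ennreal L * (\<integral>\<^sup>+ v. ennreal \<bar>ext0 (hM \<MM> (Inl m) m') v\<bar> * indicator {0<..\<delta>} v \<partial>lborel))" for m'
    using assms(3) by (intro sum_mono mult_left_mono nn_integral_mono) (auto simp: indicator_def)
  then have sm: "(\<Sum>m\<in>UNIV. ennreal L * (\<integral>\<^sup>+ v. ennreal \<bar>ext0 (hM \<MM> (Inl m) m') v\<bar> * indicator {0<..b - a} v \<partial>lborel)) \<le> 1 / 2" for m'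
    using small[of m'] by (rule order_trans)
  have stC: "C m \<in> sets (mpred t0 Fa)" for m using st by (simp add: stage_def)
  have stW: "nice_W W" using st by (simp add: stage_def)
  interpret S: har_step M n \<phi> \<pi> \<xi> t0 CM CP Om0 \<MM> a b c0 L C W
    by unfold_locales (fact assms(1,2,4-7) sm stC stW)+
  show ?thesis
    using S.stage_step[OF st] assms(2) by (intro exI[of _ S.Dlim] exI[of _ "next_W b S.Dlim W"]) (auto simp: next_W_def)
qed

lemma ex_solution:
  "\<exists>C W. (\<forall>m. C m \<in> sets (mpred t0 Fa)) \<and> nice_W W \<and> (AE \<omega> in M. \<forall>T. eqn_upto T C W \<omega>)"
proof -
  have "\<forall>m. \<exists>L\<ge>0. \<forall>x. PhiM \<MM> m x \<le> \<bar>PhiM \<MM> m 0\<bar> + L * \<bar>x\<bar>"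
  proof
    fix m
    have "lipschitz_fun (PhiM \<MM> m)" using par unfolding parameters_def by blast
    then show "\<exists>L\<ge>0. \<forall>x. PhiM \<MM> m x \<le> \<bar>PhiM \<MM> m 0\<bar> + L * \<bar>x\<bar>" by (rule lipschitz_fun_bound)
  qed
  then obtain Lm where Lm: "\<And>m. 0 \<le> Lm m" "\<And>m x. PhiM \<MM> m x \<le> \<bar>PhiM \<MM> m 0\<bar> + Lm m * \<bar>x\<bar>" by metis
  \<comment> \<open>The sums over the finitely many types give constants of linear growth that are
    common to all \<open>PhiM\<close>.\<close>
  define L where "L = (\<Sum>m\<in>UNIV. Lm m)"
  define c0 where "c0 = (\<Sum>m\<in>(UNIV::'m set). \<bar>PhiM \<MM> m 0\<bar>)"
  have L0: "0 \<le> L" "0 \<le> c0" unfolding L_def c0_def by (intro sum_nonneg Lm; simp)+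
  have Phi: "PhiM \<MM> m x \<le> c0 + L * \<bar>x\<bar>" for m x
  proof -
    have "Lm m \<le> L" unfolding L_def by (intro member_le_sum Lm) auto
    moreover have "\<bar>PhiM \<MM> m 0\<bar> \<le> c0" unfolding c0_def by (intro member_le_sum[of m UNIV "\<lambda>m. \<bar>PhiM \<MM> m 0\<bar>"]) auto
    ultimately have "\<bar>PhiM \<MM> m 0\<bar> + Lm m * \<bar>x\<bar> \<le> c0 + L * \<bar>x\<bar>" by (intro add_mono mult_right_mono) auto
    then show ?thesis using Lm(2)[of m x] by linarith
  qed
  have hm: "(\<lambda>v. ennreal \<bar>ext0 (hM \<MM> (Inl m) m') v\<bar>) \<in> borel_measurable borel" for m m'
    using hM_meas[of "Inl m" m'] by measurable
  from ex_small_integrals[where h = "\<lambda>m m' v. ennreal \<bar>ext0 (hM \<MM> (Inl m) m') v\<bar>" and L = L, OF hm in_L1_nn_integral[OF hM_L1]]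
  obtain \<delta> where \<delta>: "0 < \<delta>" and small: "\<And>m'. (\<Sum>m\<in>UNIV. ennreal L * (\<integral>\<^sup>+ v. ennreal \<bar>ext0 (hM \<MM> (Inl m) m') v\<bar> * indicator {0<..\<delta>} v \<partial>lborel)) \<le> 1 / 2"
    by blast
  have "finite ((\<Union>p. ar_times n \<phi> p) \<inter> {t0..T})" for T
  proof -
    have "(\<Union>p. ar_times n \<phi> p) \<inter> {t0..T} = (\<Union>p. ar_times n \<phi> p \<inter> {t0..T})" by blast
    moreover have "finite (\<Union>p. ar_times n \<phi> p \<inter> {t0..T})" by (rule finite_UN_I[OF finite_class.finite_UNIV finite_ar])
    ultimately show ?thesis by (simp only:)
  qed
  from ex_discrete_enumeration[OF \<delta> this] obtain \<tau> :: "nat \<Rightarrow> real" where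
    \<tau>0: "\<tau> 0 = t0" and \<tau>s: "\<And>i. \<tau> i < \<tau> (Suc i)" "\<And>i. \<tau> (Suc i) \<le> \<tau> i + \<delta>"
      "\<And>i. (\<Union>p. ar_times n \<phi> p) \<inter> {\<tau> i<..<\<tau> (Suc i)} = {}" and \<tau>u: "\<And>T. \<exists>i. T \<le> \<tau> i" by blast
  have sm: "strict_mono \<tau>" by (rule strict_mono_Suc_iff[THEN iffD2]) (simp add: \<tau>s)
  have \<tau>ge: "t0 \<le> \<tau> i" for i using strict_mono_less_eq[OF sm, of 0 i] by (simp add: \<tau>0)
  obtain W0 where "stage (\<tau> 0) (\<lambda>_. {}) W0" using stage_base by (auto simp: \<tau>0)
  then have "\<exists>C W. \<forall>i. stage (\<tau> i) (C i) (W i) \<and> ((AE \<omega> in M. agree_upto (\<tau> i) \<omega> (C i) (C (Suc i))) \<and> (\<forall>p k. k \<le> \<tau> i \<longrightarrow> W (Suc i) p k = W i p k))"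
  proof (rule dependent_nat_choice_pair[where P = "\<lambda>i C W. stage (\<tau> i) C W" and
      Q = "\<lambda>i C W C' W'. (AE \<omega> in M. agree_upto (\<tau> i) \<omega> C C') \<and> (\<forall>p k. k \<le> \<tau> i \<longrightarrow> W' p k = W p k)"])
    fix i C W assume "stage (\<tau> i) C W"
    then show "\<exists>C' W'. stage (\<tau> (Suc i)) C' W' \<and> ((AE \<omega> in M. agree_upto (\<tau> i) \<omega> C C') \<and> (\<forall>p k. k \<le> \<tau> i \<longrightarrow> W' p k = W p k))"
      using \<tau>s(3)[of i] by (intro ex_stage_step[OF \<tau>ge \<tau>s(1,2) _ L0(2,1) Phi small]) auto
  qed
  then obtain C W where st: "\<And>i. stage (\<tau> i) (C i) (W i)" and ag: "\<And>i. AE \<omega> in M. agree_upto (\<tau> i) \<omega> (C i) (C (Suc i))"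
    and Ws: "\<And>i p k. k \<le> \<tau> i \<Longrightarrow> W (Suc i) p k = W i p k" by blast
  \<comment> \<open>The points of successive stages agree only almost surely, so each time slice is
    taken from the stage at whose end it was completed; on almost every path the result agrees with
    every stage up to its time. The terms of the series agree exactly, and any stage that is late
    enough gives \<open>Wf\<close>.\<close>
  define Cf where "Cf m = (\<Union>i. {z \<in> C (Suc i) m. \<tau> i < fst (snd z) \<and> fst (snd z) \<le> \<tau> (Suc i)})" for m
  define Wf where "Wf p k = W (LEAST i. k \<le> \<tau> i) p k" for p k
  have Wm: "W j p k = W i p k" if "i \<le> j" "k \<le> \<tau> i" for i j p k
    using that
  proof (induct j rule: dec_induct)
    case (step j)
    then have "k \<le> \<tau> j" using strict_mono_less_eq[OF sm, of i j] by linarith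
    then show ?case using step Ws by simp
  qed simp
  have Wf: "Wf p k = W i p k" if "k \<le> \<tau> i" for p k i
    unfolding Wf_def using that by (intro Wm[symmetric] Least_le LeastI[of "\<lambda>i. k \<le> \<tau> i"])
  have Csets: "C i m \<in> sets (mpred t0 Fa)" for i m using st[of i] by (simp add: stage_def)
  have tm: "(\<lambda>z. fst (snd z)) \<in> borel_measurable (mpred t0 Fa)" using mpred_time by (simp add: split_beta')
  have "{z \<in> C (Suc i) m. \<tau> i < fst (snd z) \<and> fst (snd z) \<le> \<tau> (Suc i)} \<in> sets (mpred t0 Fa)" for i m
  proof -
    note [measurable] = tm
    have "{z \<in> space (mpred t0 Fa). \<tau> i < fst (snd z) \<and> fst (snd z) \<le> \<tau> (Suc i)} \<in> sets (mpred t0 Fa)" by measurable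
    from sets.Int[OF Csets this, of "Suc i" m]
    show ?thesis using sets.sets_into_space[OF Csets[of "Suc i" m]] by (auto elim!: back_subst[where P = "\<lambda>x. x \<in> sets _"])
  qed
  then have Cf: "Cf m \<in> sets (mpred t0 Fa)" for m unfolding Cf_def by (intro sets.countable_UN) auto
  have nW: "nice_W Wf"
    unfolding nice_W_def
  proof (intro ballI, clarify)
    fix p k assume pk: "(p, k) \<in> ar_index n \<phi>"
    obtain i where "k \<le> \<tau> i" using \<tau>u by blast
    then have "Wf p k = W i p k" by (rule Wf)
    moreover have "nice_W (W i)" using st[of i] by (simp add: stage_def)
    ultimately show "Wf p k \<in> measurable (Fa (max t0 k)) opt_borel \<and> (k < t0 \<longrightarrow> Wf p k = CP p k)"
      using nice_WD[OF _ pk, of "W i"] by simp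
  qed
  have eqAE: "AE \<omega> in M. \<forall>i. eqn_upto (\<tau> i) (C i) (W i) \<omega>"
    using st by (simp add: AE_all_countable stage_def)
  have agAE: "AE \<omega> in M. \<forall>i. agree_upto (\<tau> i) \<omega> (C i) (C (Suc i))"
    using ag by (simp add: AE_all_countable)
  have "AE \<omega> in M. \<forall>T. eqn_upto T Cf Wf \<omega>"
    using eqAE agAE
  proof eventually_elim
    case (elim \<omega>)
    have chain: "agree_upto (\<tau> i) \<omega> (C i) (C j)" if "i \<le> j" for i j
      using that
    proof (induct j rule: dec_induct)
      case base show ?case by (simp add: agree_upto_def)
    next
      case (step j)
      have "agree_upto (\<tau> i) \<omega> (C j) (C (Suc j))"
      proof (rule agree_upto_mono)
        show "agree_upto (\<tau> j) \<omega> (C j) (C (Suc j))" using elim(2) by (rule spec)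
        show "\<tau> i \<le> \<tau> j" using step(1) by (simp add: strict_mono_less_eq[OF sm])
      qed
      then show ?case using step(3) by (rule agree_upto_trans[rotated])
    qed
    have agf: "agree_upto (\<tau> i) \<omega> (C i) Cf" for i
      unfolding agree_upto_def
    proof (intro allI impI)
      fix m s x assume y: "(s, x) \<in> pt m \<omega>" and s: "s \<le> \<tau> i"
      have s0: "t0 < s" using pt_sub[of m \<omega>] y by auto
      define j where "j = (LEAST j. s \<le> \<tau> j)"
      have sj: "s \<le> \<tau> j" unfolding j_def using s by (rule LeastI)
      have ji: "j \<le> i" unfolding j_def using s by (rule Least_le)
      have "j \<noteq> 0" using sj s0 by (intro notI) (simp add: \<tau>0)
      then obtain l where l: "j = Suc l" by (cases j) auto
      have ls: "\<tau> l < s" using not_less_Least[of l "\<lambda>j. s \<le> \<tau> j"] l by (simp add: j_def not_le)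
      have "(\<omega>, s, x) \<in> Cf m \<longleftrightarrow> (\<omega>, s, x) \<in> C j m"
      proof
        assume "(\<omega>, s, x) \<in> Cf m"
        then obtain r where r: "(\<omega>, s, x) \<in> C (Suc r) m" "\<tau> r < s" "s \<le> \<tau> (Suc r)" by (auto simp: Cf_def)
        have "r < Suc l" using r(2) sj l strict_mono_less[OF sm, of r "Suc l"] by simp
        moreover have "l < Suc r" using r(3) ls strict_mono_less[OF sm, of l "Suc r"] by simp
        ultimately have "r = l" by simp
        then show "(\<omega>, s, x) \<in> C j m" using r l by simp
      next
        assume "(\<omega>, s, x) \<in> C j m"
        then show "(\<omega>, s, x) \<in> Cf m" using ls sj by (auto simp: Cf_def l)
      qed
      also have "\<dots> \<longleftrightarrow> (\<omega>, s, x) \<in> C i m"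
        using chain[OF ji] y sj unfolding agree_upto_def by blast
      finally show "(\<omega>, s, x) \<in> C i m \<longleftrightarrow> (\<omega>, s, x) \<in> Cf m" by simp
    qed
    show ?case
    proof
      fix T
      obtain i where i: "T \<le> \<tau> i" using \<tau>u by blast
      have "eqn_upto (\<tau> i) Cf Wf \<omega>"
        by (rule eqn_upto_cong[OF agf[of i] _ elim(1)[THEN spec, of i]]) (simp add: Wf)
      then show "eqn_upto T Cf Wf \<omega>" using i by (rule eqn_upto_mono)
    qed
  qed
  then show ?thesis using Cf nW by blast
qed

end

section \<open>Return to the given filtration\<close>

lemma AE_fst:
  assumes "AE x in M. P x" "sigma_finite_measure N"
  shows "AE z in M \<Otimes>\<^sub>M N. P (fst z)"
proof -
  interpret sigma_finite_measure N by fact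
  obtain S where S: "{x \<in> space M. \<not> P x} \<subseteq> S" "emeasure M S = 0" "S \<in> sets M" using assms(1) by (rule AE_E)
  have "S \<times> space N \<in> null_sets (M \<Otimes>\<^sub>M N)"
    using S by (intro null_setsI) (simp_all add: emeasure_pair_measure_Times)
  then show ?thesis
    by (rule AE_I') (use S in \<open>auto simp: space_pair_measure\<close>)
qed

lemma countable_ar_index: "countable (ar_index n \<phi> :: ('p::finite \<times> real) set)"
  unfolding ar_index_def by (intro countable_SIGMA countable_finite countable_ar_times) simp

context har_full begin

text \<open>The line above \<open>t0\<close> is Lebesgue null, so its Poisson count has mean 0 and
  is almost surely 0.\<close>

lemma AE_no_atom: "AE \<omega> in M. \<forall>m x. (t0, x) \<notin> \<pi> m \<omega>"
proof -
  have "AE \<omega> in M. npoints (\<pi> m \<omega> \<inter> ({t0} \<times> {0..})) = 0" for m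
  proof -
    have B: "{t0} \<times> {0::real..} \<in> sets borel" by (rule borel_Times_UNIV) auto
    have sub: "{t0} \<times> {0::real..} \<subseteq> UNIV \<times> {0..}" by auto
    have e: "emeasure lborel ({t0} \<times> {0::real..}) = 0"
      unfolding lborel_prod[symmetric] by (subst lborel.emeasure_pair_measure_Times) auto
    have "prob {\<omega>\<in>space M. npoints (\<pi> m \<omega> \<inter> ({t0} \<times> {0..})) = of_nat 0} = 1"
      using pi_law[OF B sub _, of m 0] e by (simp add: measure_def)
    then show ?thesis
      using pi_count[OF B, of m] by (subst (asm) prob_Collect_eq_1) auto
  qed
  then have "AE \<omega> in M. \<forall>m. npoints (\<pi> m \<omega> \<inter> ({t0} \<times> {0..})) = 0"
    by (rule AE_all_countable[THEN iffD2, OF allI])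
  then show ?thesis using AE_space
  proof eventually_elim
    case (elim \<omega>)
    show ?case
    proof (intro allI notI)
      fix m x assume x: "(t0, x) \<in> \<pi> m \<omega>"
      then have "(t0, x) \<in> \<pi> m \<omega> \<inter> ({t0} \<times> {0..})" using pi_pos[OF elim(2), of m] by auto
      then have "\<pi> m \<omega> \<inter> ({t0} \<times> {0..}) \<noteq> {}" by blast
      moreover have "\<pi> m \<omega> \<inter> ({t0} \<times> {0..}) = {}" using elim(1) by (simp add: emeasure_count_space_eq_0)
      ultimately show False by contradiction
    qed
  qed
qed

section \<open>The solution in a version for the given filtration\<close>

context
  fixes C C' :: "'m \<Rightarrow> ('w \<times> real \<times> real) set" and W :: "'p \<Rightarrow> real \<Rightarrow> 'w \<Rightarrow> real option" and g :: "'p \<Rightarrow> real \<Rightarrow> 'w \<Rightarrow> real"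
  assumes C: "\<And>m. C m \<in> sets (mpred t0 Fa)" and W: "nice_W W" and C': "\<And>m. C' m \<in> sets (mpred t0 Fr)"
    and g: "\<And>p k. (p, k) \<in> ar_index n \<phi> \<Longrightarrow> t0 \<le> k \<Longrightarrow> g p k \<in> borel_measurable (Fr k)"
begin

text \<open>Built from \<open>CM\<close> and \<open>\<pi>\<close> without the restriction to
  \<open>Om0\<close>: adaptedness and the initial condition are required on every path, and
  \<open>Om0\<close> need not belong to the given filtration.\<close>

definition rN :: "'m \<Rightarrow> 'w \<Rightarrow> real set" where
  "rN m \<omega> = CM m \<omega> \<union> raw_times t0 (\<pi> m) (C' m) \<omega>"

definition rW :: "'p \<Rightarrow> real \<Rightarrow> 'w \<Rightarrow> real option" where
  "rW p k \<omega> = (if k < t0 then CP p k \<omega> else Some (g p k \<omega>))"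

lemma raw_sub: "raw_times t0 (\<pi> m) (C' m) \<omega> \<subseteq> {t0<..}"
  by (auto simp: raw_times_def raw_atoms_def)

lemma raw_upto: "t0 \<le> t \<Longrightarrow> (\<lambda>\<omega>. raw_times t0 (\<pi> m) (C' m) \<omega> \<inter> {..t}) \<in> measurable (Fr t) point_sets"
  by (rule raw.raw_times_measurable[OF pi_pos _ pi_filt C']) (auto dest: pi_uni)

lemma rN_upto:
  assumes t: "t0 \<le> t"
  shows "(\<lambda>\<omega>. rN m \<omega> \<inter> {..t}) \<in> measurable (Fr t) point_sets"
proof -
  have "(\<lambda>\<omega>. CM m \<omega> \<union> raw_times t0 (\<pi> m) (C' m) \<omega> \<inter> {..t}) \<in> measurable (Fr t) point_sets"
  proof (intro measurable_point_sets_Un raw_upto t)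
    show "CM m \<in> measurable (Fr t) point_sets" by (rule raw.measurable_H_mono[OF CM_Fr order_refl t])
    fix \<omega> assume "\<omega> \<in> space (Fr t)"
    then show "CM m \<omega> \<inter> (raw_times t0 (\<pi> m) (C' m) \<omega> \<inter> {..t}) = {}"
      using CM_sub[of \<omega> m] raw_sub[of m \<omega>] by fastforce
  qed
  also have "?this \<longleftrightarrow> ?thesis"
  proof (rule measurable_cong)
    fix \<omega> assume "\<omega> \<in> space (Fr t)"
    then show "CM m \<omega> \<union> raw_times t0 (\<pi> m) (C' m) \<omega> \<inter> {..t} = rN m \<omega> \<inter> {..t}"
      using CM_sub[of \<omega> m] t by (auto simp: rN_def)
  qed
  finally show ?thesis .
qed

lemma rN_meas: "rN m \<in> measurable M point_sets"
  unfolding measurable_point_sets_iff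
proof
  fix B :: "real set" assume B: "B \<in> sets borel"
  have "(\<lambda>\<omega>. SUP i. npoints (rN m \<omega> \<inter> {..t0 + real i} \<inter> B)) \<in> borel_measurable M"
  proof (intro borel_measurable_SUP)
    fix i
    have "(\<lambda>\<omega>. npoints (rN m \<omega> \<inter> {..t0 + real i} \<inter> B)) \<in> borel_measurable (Fr (t0 + real i))"
      by (intro measurable_npoints rN_upto B) simp
    then show "(\<lambda>\<omega>. npoints (rN m \<omega> \<inter> {..t0 + real i} \<inter> B)) \<in> borel_measurable M"
      by (intro Fa_M Fr_Fa)
  qed auto
  moreover have "(SUP i. npoints (rN m \<omega> \<inter> {..t0 + real i} \<inter> B)) = npoints (rN m \<omega> \<inter> B)" for \<omega>
  proof -
    have "(\<Union>i. rN m \<omega> \<inter> {..t0 + real i} \<inter> B) = rN m \<omega> \<inter> B"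
    proof (intro equalityI subsetI)
      fix x assume x: "x \<in> rN m \<omega> \<inter> B"
      obtain i :: nat where "x - t0 \<le> real i" using real_arch_simple by blast
      then show "x \<in> (\<Union>i. rN m \<omega> \<inter> {..t0 + real i} \<inter> B)" using x by (intro UN_I[of i]) auto
    qed auto
    moreover have "incseq (\<lambda>i. rN m \<omega> \<inter> {..t0 + real i} \<inter> B)" by (intro incseq_SucI) auto
    ultimately show ?thesis using SUP_npoints by metis
  qed
  ultimately show "(\<lambda>\<omega>. npoints (rN m \<omega> \<inter> B)) \<in> borel_measurable M" by simp
qed

lemma rN_disjoint:
  assumes w: "\<omega> \<in> space M"
  shows "disjoint_family (\<lambda>m. rN m \<omega>)"
  unfolding disjoint_family_on_def
proof (intro ballI impI)
  fix m m' :: 'm assume mm: "m \<noteq> m'"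
  have "CM m \<omega> \<inter> CM m' \<omega> = {}" using CM_disj[OF w] mm by (auto simp: disjoint_family_on_def)
  moreover have "raw_times t0 (\<pi> m) (C' m) \<omega> \<inter> raw_times t0 (\<pi> m') (C' m') \<omega> = {}"
    using mm by (auto simp: raw_times_def raw_atoms_def dest: pi_uni[OF w])
  moreover have "CM i \<omega> \<inter> raw_times t0 (\<pi> j) (C' j) \<omega> = {}" for i j
    using CM_sub[OF w, of i] raw_sub[of j \<omega>] by fastforce
  ultimately show "rN m \<omega> \<inter> rN m' \<omega> = {}" unfolding rN_def by blast
qed

lemma rW_meas:
  assumes "(p, k) \<in> ar_index n \<phi>" "t0 \<le> t" "k \<le> t"
  shows "rW p k \<in> measurable (Fr t) opt_borel"
proof (cases "k < t0")
  case True
  then have "rW p k = CP p k" by (simp add: rW_def fun_eq_iff)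
  then show ?thesis using raw.measurable_H_mono[OF CP_Fr[OF assms(1) True] order_refl assms(2)] by simp
next
  case False
  then have "rW p k = (\<lambda>\<omega>. Some (g p k \<omega>))" by (simp add: rW_def fun_eq_iff)
  moreover have "g p k \<in> borel_measurable (Fr t)"
    using False assms by (intro raw.measurable_H_mono[OF g]) auto
  ultimately show ?thesis using measurable_Some by simp
qed

definition good :: "'w \<Rightarrow> bool" where
  "good \<omega> \<longleftrightarrow> \<omega> \<in> Om0 \<and> ic_good \<omega> \<and> (\<forall>T. eqn_upto T C W \<omega>) \<and> (\<forall>m y. (\<omega>, y) \<in> C m \<longleftrightarrow> (\<omega>, y) \<in> C' m) \<and>
    (\<forall>(p, k)\<in>ar_index n \<phi>. t0 \<le> k \<longrightarrow> opt_val (W p k \<omega>) = g p k \<omega>) \<and> (\<forall>m x. (t0, x) \<notin> \<pi> m \<omega>)"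

text \<open>On \<open>Om0\<close> the atoms are locally finite, so the provisions for accumulating
  atoms do not apply and the thinning is the plain one.\<close>

lemma good_raw:
  assumes "good \<omega>"
  shows "raw_times t0 (\<pi> m) (C' m) \<omega> = times m (C m) \<omega>"
proof -
  have o: "\<omega> \<in> Om0" using assms by (simp add: good_def)
  have "raw_atoms t0 (\<pi> m) (C' m) \<omega> = atoms m (C m) \<omega>"
    using assms Om0_fin[OF o, of m] loc_fin_imp_left[OF Om0_fin[OF o, of m] order_refl]
    unfolding raw_atoms_def atoms_def pt_def good_def by auto
  then show ?thesis by (simp add: raw_times_def times_def)
qed

lemma good_rN:
  assumes "good \<omega>"
  shows "rN m \<omega> = NN C m \<omega>"
  using assms good_raw[OF assms, of m] by (simp add: rN_def NN_def CMt_def good_def)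

lemma good_rW:
  assumes G: "good \<omega>" and pk: "(p, k) \<in> ar_index n \<phi>"
  shows "rW p k \<omega> = W p k \<omega>"
proof (cases "k < t0")
  case True
  then show ?thesis using nice_WD(2)[OF W pk] by (simp add: rW_def)
next
  case False
  have E: "eqn_upto k C W \<omega>" using G by (simp add: good_def)
  \<comment> \<open>\<open>opt_val\<close> does not distinguish \<open>None\<close> from 0; the
    equation excludes \<open>None\<close>.\<close>
  have "W p k \<omega> \<noteq> None" using E pk False unfolding eqn_upto_def by (metis linorder_not_less option.distinct(1) order_refl)
  then obtain v where v: "W p k \<omega> = Some v" by blast
  have "opt_val (W p k \<omega>) = g p k \<omega>" using G pk False unfolding good_def by force
  then show ?thesis using v False by (simp add: rW_def)
qed

lemma good_drive:
  assumes G: "good \<omega>"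
  shows "dr \<alpha> (rN, rW) s \<omega> = dr \<alpha> (prc C W) s \<omega>" "adr \<alpha> (rN, rW) s \<omega> = adr \<alpha> (prc C W) s \<omega>"
  by (rule drive_cong_gen(1); simp only: good_rN[OF G] good_rW[OF G])
     (rule drive_cong_gen(2); simp only: good_rN[OF G] good_rW[OF G])

lemma good_fin: "good \<omega> \<Longrightarrow> finite (times m (C m) \<omega> \<inter> {..T})"
  unfolding good_def eqn_upto_def by blast

lemma good_space: "good \<omega> \<Longrightarrow> \<omega> \<in> space M"
  using Om0_space by (simp add: good_def)

lemma good_points:
  assumes G: "good \<omega>" and S: "S \<subseteq> {t0..}"
  shows "npoints (rN m \<omega> \<inter> S) =
    (\<integral>\<^sup>+ (s, x). indicator {..intensity n \<phi> \<MM> (rN, rW) m \<omega> s} x \<partial>count_space (\<pi> m \<omega> \<inter> (S \<times> {0..})))"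
proof -
  define I where "I s = intensity n \<phi> \<MM> (rN, rW) m \<omega> s" for s
  define Y where "Y = {(s, x) \<in> \<pi> m \<omega>. s \<in> S \<and> x \<le> I s}"
  have w: "\<omega> \<in> space M" by (rule good_space[OF G])
  have o: "\<omega> \<in> Om0" and na: "\<And>x. (t0, x) \<notin> \<pi> m \<omega>" using G unfolding good_def by blast+
  have I: "I s = PhiM \<MM> m (dr (Inl m) (prc C W) s \<omega>)" for s
    unfolding I_def intensity_def good_drive[OF G] ..
  \<comment> \<open>\<open>S\<close> may contain \<open>t0\<close>, which \<open>pt\<close> leaves
    out; on a good path there is no atom at \<open>t0\<close>.\<close>
  have ptS: "(s, x) \<in> \<pi> m \<omega> \<and> s \<in> S \<longleftrightarrow> (s, x) \<in> pt m \<omega> \<and> s \<in> S" for s x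
  proof -
    have "t0 < s" if "(s, x) \<in> \<pi> m \<omega>" "s \<in> S"
      using that S na[of x] by (metis atLeast_iff order_le_less subsetD)
    then show ?thesis using o by (auto simp: pt_def)
  qed
  have CI: "(\<omega>, s, x) \<in> C m \<longleftrightarrow> x \<le> I s" if "(s, x) \<in> pt m \<omega>" for s x
  proof -
    have "eqn_upto s C W \<omega>" using G by (simp add: good_def)
    then show ?thesis using that unfolding eqn_upto_def I by blast
  qed
  have "rN m \<omega> \<inter> S = times m (C m) \<omega> \<inter> S"
    using CM_sub[OF w, of m] S o unfolding good_rN[OF G] NN_def CMt_def by fastforce
  also have "\<dots> = fst ` Y"
  proof (intro set_eqI iffI)
    fix s assume s: "s \<in> times m (C m) \<omega> \<inter> S"
    then obtain x where "(s, x) \<in> pt m \<omega>" "(\<omega>, s, x) \<in> C m" unfolding Int_iff times_iff by blast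
    then have "(s, x) \<in> Y" using s CI ptS by (auto simp: Y_def)
    then show "s \<in> fst ` Y" by force
  next
    fix s assume "s \<in> fst ` Y"
    then obtain x where x: "(s, x) \<in> Y" by force
    then have "(s, x) \<in> pt m \<omega>" "s \<in> S" "x \<le> I s" using ptS by (auto simp: Y_def)
    then show "s \<in> times m (C m) \<omega> \<inter> S" using CI unfolding Int_iff times_iff by blast
  qed
  also have "npoints \<dots> = npoints Y"
    by (intro npoints_image) (auto simp: inj_on_def Y_def dest: pi_uni[OF w])
  also have "\<dots> = (\<integral>\<^sup>+ y. indicator Y y \<partial>count_space UNIV)" by simp
  also have "\<dots> = (\<integral>\<^sup>+ (s, x). indicator {..I s} x \<partial>count_space (\<pi> m \<omega> \<inter> (S \<times> {0..})))"
    unfolding nn_integral_count_space_subset[of "\<pi> m \<omega> \<inter> (S \<times> {0..})"] using pi_pos[OF w, of m]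
    by (intro nn_integral_cong) (auto simp: Y_def indicator_def)
  finally show ?thesis by (simp add: I_def)
qed

text \<open>Truncation at the end of a window changes nothing within the window, and there the drive
  of the truncated process has a finite integral. Countably many windows cover all times.\<close>

lemma good_adr_finite_AE:
  assumes G: "good \<omega>"
  shows "AE t in lborel. t0 < t \<longrightarrow> adr (Inl m) (prc C W) t \<omega> < \<infinity>"
proof -
  have ic: "ic_good \<omega>" using G by (simp add: good_def)
  have "AE t in lborel. t0 < t \<longrightarrow> t \<le> t0 + real j \<longrightarrow> adr (Inl m) (prc C W) t \<omega> < \<infinity>" for j :: nat
  proof -
    let ?T = "t0 + real j"
    have fin: "(\<integral>\<^sup>+ s. adr (Inl m) (trunc ?T (prc C W)) s \<omega> * indicator {t0<..?T} s \<partial>lborel) < \<infinity>"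
      by (rule int_finite[OF ic good_fin[OF G] _ order_refl]) (use nice_WD(2)[OF W] in auto)
    have "(\<lambda>s. (\<omega>, s)) \<in> measurable borel (Fa ?T \<Otimes>\<^sub>M borel)"
      using good_space[OF G] by (intro measurable_Pair1') simp
    from measurable_compose[OF this drive_trunc_measurable(2)[OF nice_prc[OF C W], of ?T "Inl m"]]
    have "(\<lambda>s. adr (Inl m) (trunc ?T (prc C W)) s \<omega>) \<in> borel_measurable borel" by simp
    then have "(\<lambda>s. adr (Inl m) (trunc ?T (prc C W)) s \<omega> * indicator {t0<..?T} s) \<in> borel_measurable lborel" by measurable
    from nn_integral_PInf_AE[OF this] fin
    have "AE s in lborel. adr (Inl m) (trunc ?T (prc C W)) s \<omega> * indicator {t0<..?T} s \<noteq> \<infinity>" by simp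
    then show ?thesis
    proof eventually_elim
      case (elim s)
      show ?case
      proof (intro impI)
        assume s: "t0 < s" "s \<le> ?T"
        have "adr (Inl m) (trunc ?T (prc C W)) s \<omega> = adr (Inl m) (prc C W) s \<omega>"
          unfolding trunc_def prod.case using s by (intro drive_cong_gen(2)) auto
        then show "adr (Inl m) (prc C W) s \<omega> < \<infinity>" using elim s by (simp add: less_top)
      qed
    qed
  qed
  then have "AE t in lborel. \<forall>j::nat. t0 < t \<longrightarrow> t \<le> t0 + real j \<longrightarrow> adr (Inl m) (prc C W) t \<omega> < \<infinity>"
    by (rule AE_all_countable[THEN iffD2, OF allI])
  then show ?thesis
  proof eventually_elim
    case (elim t)
    obtain j :: nat where "t - t0 \<le> real j" using real_arch_simple by blast
    then show ?case using elim[THEN spec, of j] by simp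
  qed
qed

text \<open>To pass from almost every path and almost every time to the product measure, the
  exceptional set has to be measurable; this comes from the predictability of the absolute
  drive.\<close>

lemma adr_finite_AE_pair:
  assumes ae: "AE \<omega> in M. good \<omega>"
  shows "AE z in M \<Otimes>\<^sub>M lborel. t0 < snd z \<longrightarrow> adr (Inl m) (prc C W) (snd z) (fst z) < \<infinity>"
proof -
  interpret P: pair_sigma_finite M lborel ..
  let ?Q = "\<lambda>z. t0 < snd z \<longrightarrow> adr (Inl m) (prc C W) (snd z) (fst z) < \<infinity>"
  have m: "(\<lambda>(\<omega>, s, x). adr (Inl m) (prc C W) s \<omega>) \<in> borel_measurable (mpred t0 Fa)"
    by (rule drive_predictable(2)[OF nice_prc[OF C W]])
  have "{z \<in> space (mpred t0 Fa). (\<lambda>(\<omega>, s, x). adr (Inl m) (prc C W) s \<omega>) z = \<infinity>} \<in> sets (mpred t0 Fa)"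
    using m by measurable
  then have B: "{z \<in> space (mpred t0 Fa). (\<lambda>(\<omega>, s, x). adr (Inl m) (prc C W) s \<omega>) z = \<infinity>} \<in> sets (M \<Otimes>\<^sub>M borel)"
    by (rule au.mpred_subset)
  \<comment> \<open>The predictable space carries marks, on which the drive does not depend; the
    mark 0 is a dummy.\<close>
  have "(\<lambda>z. (fst z, snd z, 0::real)) \<in> measurable (M \<Otimes>\<^sub>M lborel) (M \<Otimes>\<^sub>M borel)"
    unfolding borel_prod[symmetric] by measurable
  from measurable_sets[OF this B]
  have "(\<lambda>z. (fst z, snd z, 0::real)) -` {z \<in> space (mpred t0 Fa). (\<lambda>(\<omega>, s, x). adr (Inl m) (prc C W) s \<omega>) z = \<infinity>} \<inter> space (M \<Otimes>\<^sub>M lborel) \<in> sets (M \<Otimes>\<^sub>M lborel)" .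
  from sets.compl_sets[OF this]
  have "{z \<in> space (M \<Otimes>\<^sub>M lborel). ?Q z} \<in> sets (M \<Otimes>\<^sub>M lborel)"
    by (rule back_subst[where P = "\<lambda>x. x \<in> sets _"]) (auto simp: space_pair_measure less_top[symmetric])
  moreover have "AE \<omega> in M. AE t in lborel. ?Q (\<omega>, t)"
    using ae by (rule eventually_mono) (unfold fst_conv snd_conv, rule good_adr_finite_AE)
  ultimately show ?thesis by (rule P.AE_pair_measure)
qed

lemma har_process_raw:
  assumes ae: "AE \<omega> in M. good \<omega>"
  shows "har_process M n \<phi> \<pi> \<MM> \<xi> t0 (CM, CP) (rN, rW)"
  unfolding har_process_def prod.case
proof (intro conjI allI ballI)
  show "mp_process M n \<phi> (rN, rW)"
    unfolding mp_process_def prod.case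
  proof (intro conjI allI ballI)
    fix z assume z: "z \<in> ar_index n \<phi>"
    obtain p k where pk: "z = (p, k)" by (cases z)
    have "rW p k \<in> measurable (Fr (max t0 k)) opt_borel" using z unfolding pk by (intro rW_meas) auto
    then show "case z of (p, k) \<Rightarrow> rW p k \<in> measurable M opt_borel"
      unfolding pk prod.case by (intro Fa_M Fr_Fa)
  qed (rule rN_meas rN_disjoint; assumption)+
  show "adapted_from M n \<phi> \<pi> \<xi> t0 (rN, rW)"
    unfolding adapted_from_def prod.case
  proof (intro conjI allI ballI impI)
    fix t z assume "t0 \<le> t" "z \<in> ar_index n \<phi>"
    then show "case z of (p, k) \<Rightarrow> k \<le> t \<longrightarrow> rW p k \<in> measurable (Fr t) opt_borel"
      using rW_meas by (auto simp: split_beta)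
  qed (rule rN_upto)
next
  fix \<omega> assume w: "\<omega> \<in> space M"
  show "rN m \<omega> \<inter> {..<t0} = CM m \<omega>" for m
    using CM_sub[OF w, of m] raw_sub[of m \<omega>] unfolding rN_def by fastforce
  fix z assume "z \<in> ar_index n \<phi>"
  show "case z of (p, k) \<Rightarrow> k < t0 \<longrightarrow> rW p k \<omega> = CP p k \<omega>" by (simp add: rW_def split_beta)
next
  fix m
  \<comment> \<open>The preceding result covers the times after \<open>t0\<close>, and the single
    time \<open>t0\<close> is Lebesgue null.\<close>
  have "AE z in M \<Otimes>\<^sub>M lborel. snd z \<noteq> t0"
  proof -
    interpret P: pair_sigma_finite M "lborel :: real measure" ..
    show ?thesis
    proof (rule P.AE_pair_measure)
      show "{z \<in> space (M \<Otimes>\<^sub>M lborel). snd z \<noteq> t0} \<in> sets (M \<Otimes>\<^sub>M lborel)" by measurable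
      show "AE \<omega> in M. AE t in lborel. snd (\<omega>, t) \<noteq> t0" by (simp add: AE_lborel_singleton)
    qed
  qed
  then have "AE z in M \<Otimes>\<^sub>M lborel. case z of (\<omega>, t) \<Rightarrow> t0 \<le> t \<longrightarrow> drive_converges n \<phi> \<MM> (Inl m) (rN, rW) t \<omega>"
    using adr_finite_AE_pair[OF ae, of m] AE_fst[OF ae lborel.sigma_finite_measure_axioms]
  proof eventually_elim
    case (elim z)
    then show ?case
      by (auto simp: split_beta drive_converges_iff good_drive[OF elim(3)] order_le_less)
  qed
  then show "AE (\<omega>, t) in M \<Otimes>\<^sub>M lborel. t0 \<le> t \<longrightarrow> drive_converges n \<phi> \<MM> (Inl m) (rN, rW) t \<omega>" .
next
  fix m
  show "AE \<omega> in M. \<forall>C\<in>sets borel. C \<subseteq> {t0..} \<longrightarrow> npoints (rN m \<omega> \<inter> C) =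
     (\<integral>\<^sup>+ (s, x). indicator {..intensity n \<phi> \<MM> (rN, rW) m \<omega> s} x \<partial>count_space (\<pi> m \<omega> \<inter> (C \<times> {0..})))"
    using ae by eventually_elim (blast intro: good_points)
next
  show "AE \<omega> in M. \<forall>(p, k)\<in>ar_index n \<phi>. t0 \<le> k \<longrightarrow>
        drive_converges n \<phi> \<MM> (Inr p) (rN, rW) k \<omega> \<and>
        rW p k \<omega> = Some (\<xi> p k \<omega> + PhiP \<MM> p (drive n \<phi> \<MM> (Inr p) (rN, rW) k \<omega>))"
    using ae
  proof eventually_elim
    case (elim \<omega>)
    have "drive_converges n \<phi> \<MM> (Inr p) (rN, rW) k \<omega> \<and>
        rW p k \<omega> = Some (\<xi> p k \<omega> + PhiP \<MM> p (drive n \<phi> \<MM> (Inr p) (rN, rW) k \<omega>))"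
      if pk: "(p, k) \<in> ar_index n \<phi>" "t0 \<le> k" for p k
    proof
      have ic: "ic_good \<omega>" and E: "eqn_upto k C W \<omega>" using elim by (simp_all add: good_def)
      have "adr (Inr p) (prc C W) k \<omega> < \<infinity>"
        by (rule adr_at_finite[OF ic good_fin[OF elim] _ pk(1)]) (use nice_WD(2)[OF W] in auto)
      then show "drive_converges n \<phi> \<MM> (Inr p) (rN, rW) k \<omega>"
        by (simp add: drive_converges_iff good_drive[OF elim])
      show "rW p k \<omega> = Some (\<xi> p k \<omega> + PhiP \<MM> p (drive n \<phi> \<MM> (Inr p) (rN, rW) k \<omega>))"
        using E pk unfolding good_rW[OF elim pk(1)] good_drive[OF elim] eqn_upto_def by blast
    qed
    then show ?case by auto
  qed
qed

lemma non_explosive_raw: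
  assumes ae: "AE \<omega> in M. good \<omega>"
  shows "non_explosive M n \<phi> (rN, rW)"
  unfolding non_explosive_def
  using ae
proof eventually_elim
  case (elim \<omega>)
  show ?case
  proof (intro ballI impI)
    fix B :: "real set" assume "bounded B"
    then obtain c where c: "\<And>x. x \<in> B \<Longrightarrow> \<bar>x\<bar> \<le> c" by (auto simp: bounded_iff)
    obtain i :: nat where i: "c \<le> real i" using real_arch_simple by blast
    have Bi: "B \<subseteq> {- real i..real i}" using c i by (force simp: abs_le_iff)
    have "npoints (rN m \<omega> \<inter> B) < \<infinity>" for m
    proof -
      have "rN m \<omega> \<inter> B \<subseteq> (CM m \<omega> \<inter> {- real i..real i}) \<union> (times m (C m) \<omega> \<inter> {..real i})"
        using Bi unfolding good_rN[OF elim] NN_def CMt_def by (auto split: if_splits)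
      moreover have "finite (CM m \<omega> \<inter> {- real i..real i})" using elim by (simp add: good_def Om0_CM)
      ultimately have "finite (rN m \<omega> \<inter> B)" using good_fin[OF elim] by (meson finite_UnI finite_subset)
      then show ?thesis by (simp only: npoints_less_top_iff)
    qed
    moreover have "(\<integral>\<^sup>+ k. ennreal (opt_abs (rW p k \<omega>)) \<partial>count_space (ar_times n \<phi> p \<inter> B)) < \<infinity>" for p
    proof (rule nn_integral_count_space_less_top_finite)
      show "finite (ar_times n \<phi> p \<inter> B)"
        by (rule finite_subset[OF _ finite_ar_times_bounded[of n p \<phi> "- real i" "real i", OF n1]]) (use Bi in auto)
    qed simp
    ultimately show "proc_mass n \<phi> (rN, rW) B \<omega> < \<infinity>"
      unfolding proc_mass_def prod.case by (simp add: less_top[symmetric])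
  qed
qed

end

lemma existence: "\<exists>X. har_process M n \<phi> \<pi> \<MM> \<xi> t0 (CM, CP) X \<and> non_explosive M n \<phi> X"
proof -
  obtain C W where C: "\<And>m. C m \<in> sets (mpred t0 Fa)" and W: "nice_W W" and sol: "AE \<omega> in M. \<forall>T. eqn_upto T C W \<omega>"
    using ex_solution by blast
  have "\<forall>m. \<exists>C'. C' \<in> sets (mpred t0 Fr) \<and> (AE \<omega> in M. \<forall>y. (\<omega>, y) \<in> C m \<longleftrightarrow> (\<omega>, y) \<in> C')"
    using raw.mpred_aug_version[OF C] unfolding Bex_def by (rule allI)
  from choice[OF this] obtain C' where "\<forall>m. C' m \<in> sets (mpred t0 Fr) \<and> (AE \<omega> in M. \<forall>y. (\<omega>, y) \<in> C m \<longleftrightarrow> (\<omega>, y) \<in> C' m)"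
    by (rule exE)
  then have C': "C' m \<in> sets (mpred t0 Fr)" and C'ae: "AE \<omega> in M. \<forall>y. (\<omega>, y) \<in> C m \<longleftrightarrow> (\<omega>, y) \<in> C' m" for m by blast+
  \<comment> \<open>A version is chosen for each term separately; there are countably many
    autoregressive times, so the null sets unite to a single one.\<close>
  define g where "g p k = (SOME h. h \<in> borel_measurable (Fr k) \<and> (AE \<omega> in M. opt_val (W p k \<omega>) = h \<omega>))" for p k
  have gs: "g p k \<in> borel_measurable (Fr k) \<and> (AE \<omega> in M. opt_val (W p k \<omega>) = g p k \<omega>)"
    if "(p, k) \<in> ar_index n \<phi>" "t0 \<le> k" for p k
  proof -
    have "W p k \<in> measurable (Fa k) opt_borel" using nice_WD(1)[OF W that(1)] that(2) by (simp add: max_absorb2)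
    then have "(\<lambda>\<omega>. opt_val (W p k \<omega>)) \<in> borel_measurable (Fa k)" by (rule measurable_compose[OF _ opt_val_measurable])
    from aug_version_real[OF filt_sub this]
    have "\<exists>h. h \<in> borel_measurable (Fr k) \<and> (AE \<omega> in M. opt_val (W p k \<omega>) = h \<omega>)" unfolding Bex_def .
    then show ?thesis unfolding g_def by (rule someI_ex)
  qed
  have gm: "g p k \<in> borel_measurable (Fr k)" if "(p, k) \<in> ar_index n \<phi>" "t0 \<le> k" for p k
    using gs[OF that] by (rule conjunct1)
  have "AE \<omega> in M. \<forall>m y. (\<omega>, y) \<in> C m \<longleftrightarrow> (\<omega>, y) \<in> C' m"
    using C'ae by (rule AE_all_countable[THEN iffD2, OF allI])
  moreover have "AE \<omega> in M. \<forall>z\<in>ar_index n \<phi>. t0 \<le> snd z \<longrightarrow> opt_val (W (fst z) (snd z) \<omega>) = g (fst z) (snd z) \<omega>"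
  proof (subst AE_ball_countable[OF countable_ar_index], intro ballI)
    fix z assume z: "z \<in> ar_index n \<phi>"
    show "AE \<omega> in M. t0 \<le> snd z \<longrightarrow> opt_val (W (fst z) (snd z) \<omega>) = g (fst z) (snd z) \<omega>"
    proof (cases "t0 \<le> snd z")
      case True
      then show ?thesis using gs[of "fst z" "snd z"] z by simp
    qed simp
  qed
  ultimately have ae: "AE \<omega> in M. good C C' W g \<omega>"
    using Om0_ae AE_ic_good sol AE_no_atom
  proof eventually_elim
    case (elim \<omega>)
    show ?case
      by (rule good_def[THEN iffD2, OF C W C']) (use gm elim in \<open>auto simp: split_beta\<close>)
  qed
  show ?thesis
    using har_process_raw[OF C W C' _ ae] non_explosive_raw[OF C W C' _ ae] gm by blast
qed

end

section \<open>Uniqueness and conclusion\<close>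

lemma non_explosive_finite_points:
  assumes "non_explosive M n \<phi> (N, W)"
  shows "AE \<omega> in M. \<forall>m T. finite (N m \<omega> \<inter> {t0..T})"
  using assms unfolding non_explosive_def
proof eventually_elim
  case (elim \<omega>)
  show ?case
  proof (intro allI)
    fix m T
    have "proc_mass n \<phi> (N, W) {t0..T} \<omega> < \<infinity>" using elim by auto
    moreover have "npoints (N m \<omega> \<inter> {t0..T}) \<le> (\<Sum>m\<in>UNIV. npoints (N m \<omega> \<inter> {t0..T}))"
      by (rule member_le_sum) auto
    moreover have "(\<Sum>m\<in>UNIV. npoints (N m \<omega> \<inter> {t0..T})) \<le> proc_mass n \<phi> (N, W) {t0..T} \<omega>"
      by (simp add: proc_mass_def)
    ultimately have "npoints (N m \<omega> \<inter> {t0..T}) < \<infinity>" by (meson le_less_trans)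
    then show "finite (N m \<omega> \<inter> {t0..T})" by (rule npoints_less_top_iff[THEN iffD1])
  qed
qed

lemma npoints_singleton_eq:
  assumes "npoints (A \<inter> {s}) = npoints (B \<inter> {s})"
  shows "s \<in> A \<longleftrightarrow> s \<in> B"
  using assms by (cases "s \<in> A"; cases "s \<in> B") auto

text \<open>At the first time at which two solutions differ they have the same strict past, hence the same
  drives, and so they do not differ there.\<close>

lemma har_process_unique:
  fixes n :: "'p::finite \<Rightarrow> nat" and \<MM> :: "('m::finite, 'p) har_params"
  assumes n1: "\<And>p. 1 \<le> n p"
    and X: "har_process M n \<phi> \<pi> \<MM> \<xi> t0 \<CC> X" "non_explosive M n \<phi> X"
    and Y: "har_process M n \<phi> \<pi> \<MM> \<xi> t0 \<CC> Y" "non_explosive M n \<phi> Y"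
  shows "modification M n \<phi> X Y"
proof -
  obtain CM CP where CC: "\<CC> = (CM, CP)" by (cases \<CC>)
  obtain N W where NW: "X = (N, W)" by (cases X)
  obtain N' W' where NW': "Y = (N', W')" by (cases Y)
  note hX = X(1)[unfolded har_process_def CC NW prod.case]
  note hY = Y(1)[unfolded har_process_def CC NW' prod.case]
  have points: "AE \<omega> in M. \<forall>m. \<forall>C\<in>sets borel. C \<subseteq> {t0..} \<longrightarrow> npoints (N m \<omega> \<inter> C) =
        (\<integral>\<^sup>+ (s, x). indicator {..intensity n \<phi> \<MM> (N, W) m \<omega> s} x \<partial>count_space (\<pi> m \<omega> \<inter> (C \<times> {0..})))"
    by (rule AE_all_countable[THEN iffD2, OF allI]) (use hX in blast)
  have points': "AE \<omega> in M. \<forall>m. \<forall>C\<in>sets borel. C \<subseteq> {t0..} \<longrightarrow> npoints (N' m \<omega> \<inter> C) =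
        (\<integral>\<^sup>+ (s, x). indicator {..intensity n \<phi> \<MM> (N', W') m \<omega> s} x \<partial>count_space (\<pi> m \<omega> \<inter> (C \<times> {0..})))"
    by (rule AE_all_countable[THEN iffD2, OF allI]) (use hY in blast)
  have series: "AE \<omega> in M. \<forall>(p, k)\<in>ar_index n \<phi>. t0 \<le> k \<longrightarrow>
        drive_converges n \<phi> \<MM> (Inr p) (N, W) k \<omega> \<and>
        W p k \<omega> = Some (\<xi> p k \<omega> + PhiP \<MM> p (drive n \<phi> \<MM> (Inr p) (N, W) k \<omega>))"
    using hX by blast
  have series': "AE \<omega> in M. \<forall>(p, k)\<in>ar_index n \<phi>. t0 \<le> k \<longrightarrow>
        drive_converges n \<phi> \<MM> (Inr p) (N', W') k \<omega> \<and>
        W' p k \<omega> = Some (\<xi> p k \<omega> + PhiP \<MM> p (drive n \<phi> \<MM> (Inr p) (N', W') k \<omega>))"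
    using hY by blast
  have before: "(\<forall>m. N m \<omega> \<inter> {..<t0} = N' m \<omega> \<inter> {..<t0}) \<and> (\<forall>(p, k)\<in>ar_index n \<phi>. k < t0 \<longrightarrow> W p k \<omega> = W' p k \<omega>)"
    if "\<omega> \<in> space M" for \<omega>
  proof -
    have "(\<forall>m. N m \<omega> \<inter> {..<t0} = CM m \<omega>) \<and> (\<forall>(p, k)\<in>ar_index n \<phi>. k < t0 \<longrightarrow> W p k \<omega> = CP p k \<omega>)"
      using hX that by blast
    moreover have "(\<forall>m. N' m \<omega> \<inter> {..<t0} = CM m \<omega>) \<and> (\<forall>(p, k)\<in>ar_index n \<phi>. k < t0 \<longrightarrow> W' p k \<omega> = CP p k \<omega>)"
      using hY that by blast
    ultimately show ?thesis by (simp add: case_prod_unfold)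
  qed
  have "AE \<omega> in M. (\<forall>m. N m \<omega> = N' m \<omega>) \<and> (\<forall>(p, k)\<in>ar_index n \<phi>. W p k \<omega> = W' p k \<omega>)"
    using points points' series series' non_explosive_finite_points[OF X(2)[unfolded NW], of t0]
      non_explosive_finite_points[OF Y(2)[unfolded NW'], of t0] AE_space
  proof eventually_elim
    case (elim \<omega>)
    define D where "D = {s. t0 \<le> s \<and> ((\<exists>m. (s \<in> N m \<omega>) \<noteq> (s \<in> N' m \<omega>)) \<or> (\<exists>p. (p, s) \<in> ar_index n \<phi> \<and> W p s \<omega> \<noteq> W' p s \<omega>))}"
    have "D = {}"
    proof (rule ccontr)
      assume "D \<noteq> {}"
      then obtain T where T: "T \<in> D" by blast
      \<comment> \<open>A time of difference is a point of one of the processes, of which there are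
        finitely many in bounded time by non-explosion, or an autoregressive time. So a first one
        exists.\<close>
      have "D \<inter> {..T} \<subseteq> (\<Union>m. N m \<omega> \<inter> {t0..T}) \<union> (\<Union>m. N' m \<omega> \<inter> {t0..T}) \<union> (\<Union>p. ar_times n \<phi> p \<inter> {t0..T})"
        unfolding D_def ar_index_def by auto
      moreover have "finite \<dots>"
        by (intro finite_UnI finite_UN_I finite_class.finite_UNIV finite_ar_times_bounded n1)
           (use elim(5,6) in auto)
      ultimately have fin: "finite (D \<inter> {..T})" by (rule finite_subset)
      define s where "s = Min (D \<inter> {..T})"
      have "s \<in> D \<inter> {..T}" unfolding s_def using fin T by (intro Min_in) auto
      then have sD: "s \<in> D" "s \<le> T" by auto
      have min: "s \<le> r" if "r \<in> D" for r
      proof (cases "r \<le> T")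
        case True
        then show ?thesis unfolding s_def using fin that by (intro Min_le) auto
      qed (use sD in auto)
      have ts: "t0 \<le> s" using sD by (simp add: D_def)
      have past: "(\<forall>m. r \<in> N m \<omega> \<longleftrightarrow> r \<in> N' m \<omega>) \<and> (\<forall>p. (p, r) \<in> ar_index n \<phi> \<longrightarrow> W p r \<omega> = W' p r \<omega>)" if r: "r < s" for r
      proof (cases "t0 \<le> r")
        case True
        then have "r \<notin> D" using min[of r] r by auto
        then show ?thesis using True unfolding D_def by blast
      next
        case False
        then have "r < t0" by simp
        then show ?thesis using before[OF elim(7)] unfolding set_eq_iff Int_iff lessThan_iff by blast
      qed
      \<comment> \<open>Both drives are sums of the same families, so they agree even where these
        diverge.\<close>
      have dr: "drive n \<phi> \<MM> \<alpha> (N, W) s \<omega> = drive n \<phi> \<MM> \<alpha> (N', W') s \<omega>" for \<alpha>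
        using past by (intro drive_cong_gen(1)) auto
      have "s \<in> N m \<omega> \<longleftrightarrow> s \<in> N' m \<omega>" for m
      proof (rule npoints_singleton_eq)
        \<comment> \<open>Tested with a single time, the thinning equation decides membership of
          \<open>s\<close> through the intensity at \<open>s\<close> alone.\<close>
        have "npoints (N m \<omega> \<inter> {s}) = (\<integral>\<^sup>+ (s, x). indicator {..intensity n \<phi> \<MM> (N, W) m \<omega> s} x \<partial>count_space (\<pi> m \<omega> \<inter> ({s} \<times> {0..})))"
          by (rule elim(1)[rule_format]) (use ts in auto)
        also have "\<dots> = (\<integral>\<^sup>+ (s, x). indicator {..intensity n \<phi> \<MM> (N', W') m \<omega> s} x \<partial>count_space (\<pi> m \<omega> \<inter> ({s} \<times> {0..})))"
          by (intro nn_integral_cong) (auto simp: intensity_def dr)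
        also have "\<dots> = npoints (N' m \<omega> \<inter> {s})"
          by (rule elim(2)[rule_format, symmetric]) (use ts in auto)
        finally show "npoints (N m \<omega> \<inter> {s}) = npoints (N' m \<omega> \<inter> {s})" .
      qed
      moreover have "W p s \<omega> = W' p s \<omega>" if "(p, s) \<in> ar_index n \<phi>" for p
        using elim(3,4) that ts dr by fastforce
      ultimately show False using sD unfolding D_def by blast
    qed
    show ?case
    proof (intro conjI allI ballI, clarify?)
      fix m
      show "N m \<omega> = N' m \<omega>"
      proof (rule set_eqI)
        fix r
        show "r \<in> N m \<omega> \<longleftrightarrow> r \<in> N' m \<omega>"
        proof (cases "t0 \<le> r")
          case True
          then show ?thesis using \<open>D = {}\<close> unfolding D_def by blast
        next
          case False
          then have "r < t0" by simp
          then show ?thesis using before[OF elim(7)] unfolding set_eq_iff Int_iff lessThan_iff by blast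
        qed
      qed
    next
      fix z assume z: "z \<in> ar_index n \<phi>"
      obtain p k where pk: "z = (p, k)" by (cases z)
      show "case z of (p, k) \<Rightarrow> W p k \<omega> = W' p k \<omega>"
      proof (cases "t0 \<le> k")
        case True
        then show ?thesis using \<open>D = {}\<close> z unfolding D_def pk by blast
      next
        case False
        then show ?thesis using before[OF elim(7)] z unfolding pk by auto
      qed
    qed
  qed
  then show ?thesis
    unfolding modification_def NW NW' prod.case by (auto elim: eventually_mono)
qed

section \<open>Local finiteness of the atoms, and conclusion\<close>

context har_noise begin

text \<open>Bounded boxes have a finite mean count, by \<open>pi_mean\<close> with the whole space
  as event of the past. Countably many boxes suffice, and negative marks do not occur.\<close>

lemma AE_loc_fin: "AE \<omega> in M. \<forall>m r. loc_fin t0 (\<pi> m \<omega>) r"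
proof -
  have "AE \<omega> in M. finite (\<pi> m \<omega> \<inter> ({t0<..t0 + real j} \<times> {..real i}))" for m and i j :: nat
  proof -
    define B where "B = {t0<..t0 + real j} \<times> {0..real i}"
    have B: "B \<in> sets borel" "B \<subseteq> {t0<..} \<times> {0..}" by (auto simp: B_def borel_Times_UNIV)
    have Bf: "emeasure lborel B < \<infinity>"
      unfolding B_def lborel_prod[symmetric] by (subst lborel.emeasure_pair_measure_Times) (auto simp: ennreal_mult_less_top)
    have "space M \<in> sets (Fr t0)" using sets.top[of "Fr t0"] by simp
    from pi_mean[OF B Bf this, of m]
    have "(\<integral>\<^sup>+ \<omega>. indicator (space M) \<omega> * npoints (\<pi> m \<omega> \<inter> B) \<partial>M) = emeasure lborel B" by (simp add: emeasure_space_1)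
    moreover have "(\<integral>\<^sup>+ \<omega>. indicator (space M) \<omega> * npoints (\<pi> m \<omega> \<inter> B) \<partial>M) = (\<integral>\<^sup>+ \<omega>. npoints (\<pi> m \<omega> \<inter> B) \<partial>M)"
      by (intro nn_integral_cong) simp
    ultimately have "AE \<omega> in M. npoints (\<pi> m \<omega> \<inter> B) \<noteq> \<infinity>"
      using Bf by (intro nn_integral_PInf_AE pi_count B) auto
    then show ?thesis using AE_space
    proof eventually_elim
      case (elim \<omega>)
      have "\<pi> m \<omega> \<inter> ({t0<..t0 + real j} \<times> {..real i}) = \<pi> m \<omega> \<inter> B"
        using pi_pos[OF elim(2), of m] by (auto simp: B_def)
      moreover have "finite (\<pi> m \<omega> \<inter> B)"
        using elim(1) npoints_less_top_iff[of "\<pi> m \<omega> \<inter> B"] by (simp add: less_top)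
      ultimately show ?case by simp
    qed
  qed
  then have "AE \<omega> in M. \<forall>m. \<forall>j i::nat. finite (\<pi> m \<omega> \<inter> ({t0<..t0 + real j} \<times> {..real i}))"
    by (simp add: AE_all_countable AE_finite_all)
  then show ?thesis
  proof eventually_elim
    case (elim \<omega>)
    show ?case
    proof (intro allI)
      fix m r
      obtain j :: nat where "r - t0 \<le> real j" using real_arch_simple by blast
      then have "r \<le> t0 + real j" by simp
      moreover have "loc_fin t0 (\<pi> m \<omega>) (t0 + real j)" using elim by (simp add: loc_fin_def)
      ultimately show "loc_fin t0 (\<pi> m \<omega>) r" by (rule loc_fin_mono[rotated])
    qed
  qed
qed

end

lemma (in har_ic) existence_ic: "\<exists>X. har_process M n \<phi> \<pi> \<MM> \<xi> t0 (CM, CP) X \<and> non_explosive M n \<phi> X"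
proof -
  have "AE \<omega> in M. (\<forall>m r. loc_fin t0 (\<pi> m \<omega>) r) \<and> (\<forall>m i. finite (CM m \<omega> \<inter> {- real i..real i}))"
    using AE_loc_fin AE_CM_fin by eventually_elim blast
  \<comment> \<open>The exceptional set itself need not be an event, so a measurable null set that
    covers it is removed; its complement then serves as \<open>Om0\<close>.\<close>
  then obtain S where S: "{\<omega> \<in> space M. \<not> ((\<forall>m r. loc_fin t0 (\<pi> m \<omega>) r) \<and> (\<forall>m i. finite (CM m \<omega> \<inter> {- real i..real i})))} \<subseteq> S"
    "emeasure M S = 0" "S \<in> sets M" by (rule AE_E)
  have ae: "AE \<omega> in M. \<omega> \<in> space M - S"
    by (rule AE_I'[of S]) (use S in auto)
  interpret F: har_full M n \<phi> \<pi> \<xi> t0 CM CP "space M - S" \<MM>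
  proof unfold_locales
    show "space M - S \<in> sets M" using S by auto
    show "AE \<omega> in M. \<omega> \<in> space M - S" by (rule ae)
    show "loc_fin t0 (\<pi> m \<omega>) r" if "\<omega> \<in> space M - S" for \<omega> m r using that S by blast
    show "finite (CM m \<omega> \<inter> {- real i..real i})" if "\<omega> \<in> space M - S" for \<omega> m i using that S by blast
  qed (fact ic0 param)+
  show ?thesis by (rule F.existence)
qed

theorem theorem3p4:
  fixes M :: "'w measure"
    and n :: "'p::finite \<Rightarrow> nat" and \<phi> :: "'p \<Rightarrow> real"
    and \<pi> :: "'m::finite \<Rightarrow> 'w \<Rightarrow> (real \<times> real) set"
    and \<xi> :: "'p \<Rightarrow> real \<Rightarrow> 'w \<Rightarrow> real"
    and \<MM> :: "('m, 'p) har_params"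
    and t0 :: real
    and \<CC> :: "('m, 'p, 'w) proc"
  assumes "prob_space M"
    and "ar_setting n \<phi>"
    and "random_points M \<pi>"
    and "random_drifts M n \<phi> \<pi> \<xi>"
    and "parameters \<MM>"
    and "initial_condition M n \<phi> \<pi> \<xi> t0 \<CC>"
    and "\<And>m. lipschitz_fun (PhiM \<MM> m)"
    and "\<And>\<alpha> m. in_L1 (hM \<MM> \<alpha> m)"
    and "\<And>m p. in_L1 (hP \<MM> (Inl m) p) \<and> in_L1 (bP \<MM> (Inl m) p)"
    and "\<And>p p'. in_L1inf (real (n p)) (hP \<MM> (Inr p') p) \<and> in_L1inf (real (n p)) (bP \<MM> (Inr p') p)"
    and "ic_integrable M n \<phi> t0 \<CC>"
  shows "(\<exists>X. har_process M n \<phi> \<pi> \<MM> \<xi> t0 \<CC> X \<and> non_explosive M n \<phi> X) \<and>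
         (\<forall>X Y. har_process M n \<phi> \<pi> \<MM> \<xi> t0 \<CC> X \<and> non_explosive M n \<phi> X \<and>
                har_process M n \<phi> \<pi> \<MM> \<xi> t0 \<CC> Y \<and> non_explosive M n \<phi> Y \<longrightarrow>
                modification M n \<phi> X Y)"
proof -
  obtain CM CP where CC: "\<CC> = (CM, CP)" by (cases \<CC>)
  have n1: "1 \<le> n p" for p using assms(2) by (auto simp: ar_setting_def)
  interpret prob_space M by fact
  interpret har_ic M n \<phi> \<pi> \<xi> t0 CM CP \<MM>
    by unfold_locales (use assms in \<open>auto simp: CC\<close>)
  show ?thesis
  proof (intro conjI allI impI)
    show "\<exists>X. har_process M n \<phi> \<pi> \<MM> \<xi> t0 \<CC> X \<and> non_explosive M n \<phi> X"
      unfolding CC by (rule existence_ic)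
    fix X Y
    assume "har_process M n \<phi> \<pi> \<MM> \<xi> t0 \<CC> X \<and> non_explosive M n \<phi> X \<and>
      har_process M n \<phi> \<pi> \<MM> \<xi> t0 \<CC> Y \<and> non_explosive M n \<phi> Y"
    then show "modification M n \<phi> X Y" using har_process_unique[of n, OF n1] by blast
  qed
qed

end
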